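(* Let $\Omega \subseteq \mathbb{R}^2$ be a bounded connected open set with Lipschitz boundary and let $\rho$ be a Hölder continuous probability density on $\Omega$ that is uniformly strictly positive and bounded from above. Let $(X_i, Y_i)_{i=1}^\infty$ be (jointly) i.i.d. random variables with common distribution $\rho$. Then $$\lim_{n \to \infty} \frac{1}{\log n}\, \mathbb{E}\left[ \min_{\sigma,\tau \in \mathcal{S}_n} \sum_{i=1}^{n} \left( |X_{\sigma(i)} - Y_{\tau(i)}|^2 + |Y_{\tau(i)} - X_{\sigma(i+1)}|^2 \right) \right] = \frac{|\Omega|}{\pi},$$ with the convention $\sigma(n+1) = \sigma(1)$ for $\sigma \in \mathcal{S}_n$.
   Context: All the variables $X_1,Y_1,X_2,Y_2,\dots$ are independent and each has law $\rho$ (the density $\rho$ being identified with the measure it defines with respect to Lebesgue measure). $\mathcal{S}_n$ denotes the group of permutations of $\{1,\dots,n\}$. $|\Omega|$ is the Lebesgue measure of $\Omega$ and $|\cdot|$ is the Euclidean norm on vectors. Hölder continuous means $\alpha$-Hölder continuous on $\Omega$ for some $\alpha\in(0,1]$ with respect to the Euclidean distance. *)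

theory Defs
  imports "HOL-Probability.Probability"
begin

definition hoelder_continuous_on :: "'a::metric_space set \<Rightarrow> ('a \<Rightarrow> 'b::metric_space) \<Rightarrow> bool" where
  "hoelder_continuous_on S f \<longleftrightarrow>
     (\<exists>\<alpha> C. 0 < \<alpha> \<and> \<alpha> \<le> 1 \<and> 0 \<le> C \<and>
        (\<forall>x\<in>S. \<forall>y\<in>S. dist (f x) (f y) \<le> C * dist x y powr \<alpha>))"

text \<open>
  Near every boundary point the set is, in suitable orthonormal coordinates, the part of a small
  ball lying strictly above the graph of a Lipschitz function of one variable. For any set of this
  form the boundary inside the ball is automatically the graph, and requiring \<open>g\<close> to be Lipschitz
  on the whole line is no restriction, since Lipschitz functions on an interval extend.
\<close>

definition lipschitz_boundary :: "(real^2) set \<Rightarrow> bool" where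
  "lipschitz_boundary \<Omega> \<longleftrightarrow>
     (\<forall>p\<in>frontier \<Omega>. \<exists>r>0. \<exists>T g L.
        orthogonal_transformation (T :: real^2 \<Rightarrow> real^2) \<and> L-lipschitz_on UNIV (g :: real \<Rightarrow> real) \<and>
        \<Omega> \<inter> ball p r = {x \<in> ball p r. g (T x $ 1) < T x $ 2})"

text \<open>Values of \<open>\<rho>\<close> outside \<open>\<Omega>\<close> are irrelevant; the law has density \<open>\<rho>\<close> on \<open>\<Omega>\<close> and \<open>0\<close> elsewhere.\<close>

definition has_law_on :: "'w measure \<Rightarrow> ('w \<Rightarrow> real^2) \<Rightarrow> (real^2) set \<Rightarrow> (real^2 \<Rightarrow> real) \<Rightarrow> bool" where
  "has_law_on M Z \<Omega> \<rho> \<longleftrightarrow>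
     distributed M lborel Z (\<lambda>x. ennreal (indicator \<Omega> x * \<rho> x))"

definition probability_density_on :: "(real^2) set \<Rightarrow> (real^2 \<Rightarrow> real) \<Rightarrow> bool" where
  "probability_density_on \<Omega> \<rho> \<longleftrightarrow>
     (\<forall>x\<in>\<Omega>. 0 \<le> \<rho> x) \<and> set_integrable lborel \<Omega> \<rho> \<and> set_lebesgue_integral lborel \<Omega> \<rho> = 1"

text \<open>
  The successor of the index \<open>i\<close> is taken cyclically in \<open>{1..n}\<close>, which encodes the convention
  \<open>\<sigma> (n + 1) = \<sigma> 1\<close> (a permutation of \<open>{1..n}\<close> in the sense of \<open>permutes\<close> fixes \<open>n + 1\<close>).
\<close>

definition bipartite_tour_cost ::
    "nat \<Rightarrow> (nat \<Rightarrow> real^2) \<Rightarrow> (nat \<Rightarrow> real^2) \<Rightarrow> (nat \<Rightarrow> nat) \<Rightarrow> (nat \<Rightarrow> nat) \<Rightarrow> real" where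
  "bipartite_tour_cost n x y \<sigma> \<tau> =
     (\<Sum>i\<in>{1..n}. (norm (x (\<sigma> i) - y (\<tau> i)))\<^sup>2 +
        (norm (y (\<tau> i) - x (\<sigma> (if i = n then 1 else i + 1))))\<^sup>2)"

definition bipartite_tsp :: "nat \<Rightarrow> (nat \<Rightarrow> real^2) \<Rightarrow> (nat \<Rightarrow> real^2) \<Rightarrow> real" where
  "bipartite_tsp n x y =
     Min {bipartite_tour_cost n x y \<sigma> \<tau> | \<sigma> \<tau>. \<sigma> permutes {1..n} \<and> \<tau> permutes {1..n}}"

end

(* A tour alternating between the X and the Y points consists of two perfect matchings, so it costs
   at least twice the optimal matching. Conversely the X points have a closed tour of bounded cost
   (bisect right isosceles triangles along the altitude), and following it along an optimal matching
   costs twice the matching up to a factor close to 1 and an additive constant. So it suffices to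
   show that the expected cost of the optimal matching is asymptotic to |Omega| / (2 pi) * log n.

   Upper bound. Cut Omega into cells of diameter of order n^(-(1 - delta) / 2). By duality and the
   Hopf-Lax semigroup the matching cost is at most about n * (integral of |b|^2 / rho) for a field b
   whose divergence is the difference of the empirical measures averaged over cells. Superpose fields
   that carry the mass of one cell to a fixed disc and look like x / (2 pi |x|^2) near the cell; by
   independence the energies add up, and each is ln(1 / eps) / (2 pi) to leading order. Going from
   the points to the cell averages only costs O(delta log n).

   Lower bound. Test the dual problem with the potential of the charges of the cells for the kernel
   -ln(|x|^2 + eps^2) / (4 pi). Since the counts of the two samples in every cell nearly agree with
   overwhelming probability, its Hessian is o(1), and a second order Taylor expansion bounds the
   matching cost from below by an explicit expression quadratic in the charges. *)

theory Submission
  imports Defs "HOL-Combinatorics.Combinatorics" "HOL-Real_Asymp.Real_Asymp"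
begin

section \<open>Closed tours through bounded sets\<close>

text \<open>The density disappears from the limit: the energy of a unit source near a cell is
  proportional to 1 / rho there, and the mass of the cell divided by rho is nearly its area. Cells
  have size n^(-1/2) up to a small power, so ln (1 / eps) is nearly half of log n, and the two
  samples double the variance. No differential equation is solved: fields are explicit and are
  tested only against potentials that satisfy the fundamental theorem of calculus along segments.
  Two obstacles shape the upper bound. A step of the Hopf-Lax evolution carries an error of order 1
  / t from semiconcavity, so the main field must not act near time 0. A short time is reserved for
  leaving the point masses with crude constants, and the main field is then applied in N small
  portions, which divides the error by N. Further, the energy is weighted by 1 / rho, so every field
  must vanish outside Omega. Discs therefore grow inside interior cones; near the boundary the
  constant is worse, but it is paid only on a layer of small area. In the lower bound segments
  between sample points may leave Omega, so the potential is controlled on a whole ball.\<close>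

fun path_cost :: "'a::real_inner => 'a list => 'a => real" where
 "path_cost a [] b = (norm (a - b))^2"
| "path_cost a (p # ps) b = (norm (a - p))^2 + path_cost p ps b"

lemma norm_sq_le_right_angle:
 fixes p q c :: "'a::real_inner"
 assumes "0 <= (p - c) \<bullet> (q - c)"
 shows "(norm (p - q))^2 <= (norm (p - c))^2 + (norm (c - q))^2"
proof -
 have "(norm (p - q))^2 = (norm (p - c))^2 + (norm (c - q))^2 - 2 * ((p - c) \<bullet> (q - c))"
  by (simp add: power2_norm_eq_inner inner_diff_left inner_diff_right inner_commute algebra_simps)
 then show ?thesis using assms by simp
qed

text \<open>Skipping the stop \<open>c\<close> merges two legs into one, which is no longer in
  squared length if the neighbours of the stop are seen from \<open>c\<close> at an angle of at most
  90 degrees. The hypothesis covers all points because the neighbours depend on the lists.\<close>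

lemma path_cost_join:
 assumes "\<And>p q. p \<in> insert a (set xs) ==> q \<in> insert b (set ys) ==> 0 <= (p - c) \<bullet> (q - c)"
 shows "path_cost a (xs @ ys) b <= path_cost a xs c + path_cost c ys b"
 using assms
proof (induction xs arbitrary: a)
 case Nil
 then show ?case
  by (cases ys) (auto intro!: norm_sq_le_right_angle)
next
 case (Cons x xs)
 then show ?case by simp
qed

lemma path_cost_replicate: "path_cost p (replicate k p) b = (norm (p - b))^2"
 by (induction k) auto

lemma sum_le_path_cost:
 "(\<Sum>i<length ps - 1. (norm (ps ! i - ps ! Suc i))^2) <= path_cost a ps b"
proof (induction ps arbitrary: a)
 case (Cons p ps)
 show ?case
 proof (cases ps)
  case (Cons q qs)
  have "(\<Sum>i<length ps. (norm ((p # ps) ! i - (p # ps) ! Suc i))^2)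
    = (norm (p - q))^2 + (\<Sum>i<length ps - 1. (norm (ps ! i - ps ! Suc i))^2)"
   unfolding Cons by (simp add: sum.lessThan_Suc_shift del: sum.lessThan_Suc)
  also have "... <= (norm (p - q))^2 + path_cost q qs b"
   using Cons.IH[of p] Cons
   by (smt (verit) path_cost.simps(2) Cons.IH[of q] diff_self norm_zero power_zero_numeral)
  also have "... <= path_cost a (p # ps) b" using Cons by simp
  finally show ?thesis by simp
 qed simp
qed simp

definition corner_triangle :: "'a::real_inner => 'a => 'a => 'a set" where
 "corner_triangle c a b = {c + s *\<^sub>R a + t *\<^sub>R b | s t. 0 <= s \<and> 0 <= t \<and> s + t <= 1}"

lemma corner_triangle_corners:
 "c + a \<in> corner_triangle c a b" "c + b \<in> corner_triangle c a b"
proof -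
 have "c + a = c + 1 *\<^sub>R a + 0 *\<^sub>R b" "c + b = c + 0 *\<^sub>R a + 1 *\<^sub>R b" by auto
 then show "c + a \<in> corner_triangle c a b" "c + b \<in> corner_triangle c a b"
  unfolding corner_triangle_def
  by (metis (mono_tags, lifting) add.right_neutral add.left_neutral mem_Collect_eq order_refl zero_le_one)+
qed

lemma corner_triangle_acute:
 assumes "p \<in> corner_triangle c a b" "q \<in> corner_triangle c a b" "a \<bullet> b = 0"
 shows "0 <= (p - c) \<bullet> (q - c)"
proof -
 obtain s t s' t' where *: "p = c + s *\<^sub>R a + t *\<^sub>R b" "q = c + s' *\<^sub>R a + t' *\<^sub>R b"
  "0 <= s" "0 <= t" "0 <= s'" "0 <= t'"
  using assms unfolding corner_triangle_def by auto
 have "(p - c) \<bullet> (q - c) = s * s' * (a \<bullet> a) + t * t' * (b \<bullet> b)"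
  using assms(3) unfolding * by (simp add: inner_left_distrib inner_right_distrib inner_commute)
 then show ?thesis using * by simp
qed

lemma norm_sq_orthogonal_comb:
 fixes a b :: "'a::real_inner"
 assumes "a \<bullet> b = 0" "norm a = norm b"
 shows "(norm (s *\<^sub>R a + t *\<^sub>R b))^2 = (s^2 + t^2) * (norm a)^2"
proof -
 have "b \<bullet> b = a \<bullet> a" using assms(2) by (metis norm_eq)
 moreover have "b \<bullet> a = 0" using assms(1) by (simp add: inner_commute)
 ultimately show ?thesis using assms(1)
  unfolding power2_norm_eq_inner inner_add_left inner_add_right
  by (simp add: power2_eq_square algebra_simps)
qed

text \<open>A right triangle lies in the disc over its hypotenuse, so \<open>p\<close> sees the
  hypotenuse at an angle of at least 90 degrees and the two squared legs add up to at most its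
  squared length.\<close>

lemma corner_triangle_obtuse:
 assumes "p \<in> corner_triangle c a b" "a \<bullet> b = 0" "norm a = norm b"
 shows "(norm (c + a - p))^2 + (norm (p - (c + b)))^2 <= 2 * (norm a)^2"
proof -
 obtain s t where *: "p = c + s *\<^sub>R a + t *\<^sub>R b" "0 <= s" "0 <= t" "s + t <= 1"
  using assms unfolding corner_triangle_def by auto
 have 1: "c + a - p = (1 - s) *\<^sub>R a + (- t) *\<^sub>R b" "p - (c + b) = s *\<^sub>R a + (- (1 - t)) *\<^sub>R b"
  unfolding * by (simp_all add: algebra_simps)
 have "(norm (c + a - p))^2 + (norm (p - (c + b)))^2
   = ((1 - s)^2 + t^2 + s^2 + (1 - t)^2) * (norm a)^2"
  unfolding 1 norm_sq_orthogonal_comb[OF assms(2,3)] by (simp add: algebra_simps power2_commute)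
 also have "... <= 2 * (norm a)^2"
 proof (rule mult_right_mono)
  have "s * s <= s" "t * t <= t" using * by (simp_all add: mult_left_le)
  then show "(1 - s)^2 + t^2 + s^2 + (1 - t)^2 <= 2"
   by (simp add: power2_eq_square algebra_simps)
 qed simp
 finally show ?thesis .
qed

lemma corner_triangle_diameter:
 assumes "p \<in> corner_triangle c a b" "q \<in> corner_triangle c a b" "a \<bullet> b = 0" "norm a = norm b"
 shows "(norm (p - q))^2 <= 2 * (norm a)^2"
proof -
 obtain s t s' t' where *: "p = c + s *\<^sub>R a + t *\<^sub>R b" "q = c + s' *\<^sub>R a + t' *\<^sub>R b"
  "0 <= s" "0 <= t" "s + t <= 1" "0 <= s'" "0 <= t'" "s' + t' <= 1"
  using assms unfolding corner_triangle_def by auto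
 have 1: "p - q = (s - s') *\<^sub>R a + (t - t') *\<^sub>R b" unfolding * by (simp add: algebra_simps)
 have "(norm (p - q))^2 = ((s - s')^2 + (t - t')^2) * (norm a)^2"
  unfolding 1 by (rule norm_sq_orthogonal_comb[OF assms(3,4)])
 also have "... <= 2 * (norm a)^2"
 proof (rule mult_right_mono)
  have "\<bar>s - s'\<bar> <= 1" "\<bar>t - t'\<bar> <= 1" using * by auto
  then show "(s - s')^2 + (t - t')^2 <= 2"
   by (smt (verit) abs_square_le_1[of "s - s'"] abs_square_le_1[of "t - t'"])
 qed simp
 finally show ?thesis .
qed

text \<open>The altitude splits an isosceles right triangle into two similar ones; the paths through the
 halves join at the old right angle, where the shortcut is no longer than the two legs in squared
 length.\<close>

lemma corner_triangle_path:
 fixes x :: "'i => 'a::real_inner"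
 assumes "finite S" "\<And>i. i \<in> S ==> x i \<in> corner_triangle c a b"
  and "a \<bullet> b = 0" "norm a = norm b"
  and "\<And>i j. i \<in> S ==> j \<in> S ==> x i \<noteq> x j ==> m <= (norm (x i - x j))^2"
  and "2 * (norm a)^2 < 2 ^ d * m"
 shows "\<exists>js. distinct js \<and> set js = S \<and> path_cost (c + a) (map x js) (c + b) <= 2 * (norm a)^2"
 using assms
proof (induction d arbitrary: S c a b)
 case 0
 obtain js where js: "set js = S" "distinct js"
  using finite_distinct_list[OF 0(1)] by auto
 show ?case
 proof (cases "S = {}")
  case True
  have "(norm (a - b))^2 = 2 * (norm a)^2"
   using 0(3,4) by (simp add: power2_norm_eq_inner inner_diff_left inner_diff_right inner_commute)
    (metis norm_eq)
  then show ?thesis using True by (intro exI[of _ "[]"]) auto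
 next
  case False
  then obtain i0 where i0: "i0 \<in> S" by auto
  \<comment> \<open>At depth 0 the squared diameter of the triangle is below the separation
    \<open>m\<close>, so all indices share one location, though there may be many of them.\<close>
  have eq: "x i = x i0" if "i \<in> S" for i
   using corner_triangle_diameter[OF 0(2)[OF that] 0(2)[OF i0] 0(3,4)] 0(5)[OF that i0] 0(6)
   by fastforce
  obtain i1 js1 where js1: "js = i1 # js1" using js False by (cases js) auto
  have m1: "map x js1 = replicate (length js1) (x i0)"
   using eq js js1 by (intro replicate_eqI) auto
  have "path_cost (c + a) (map x js) (c + b)
    = (norm (c + a - x i0))^2 + (norm (x i0 - (c + b)))^2"
   using js1 js eq[of i1] by (auto simp: m1 path_cost_replicate)
  also have "... <= 2 * (norm a)^2"
   by (rule corner_triangle_obtuse[OF 0(2)[OF i0] 0(3,4)])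
  finally show ?thesis using js by blast
 qed
next
 case (Suc d)
 define h where "h = a /\<^sub>R 2"
 define k where "k = b /\<^sub>R 2"
 have hk: "a = h + h" "b = k + k" unfolding h_def k_def scaleR_add_left[symmetric] by simp_all
 \<comment> \<open>The midpoint of the hypotenuse is the right angle of both halves; their
   hypotenuses are the old legs, from \<open>c + a\<close> to \<open>c\<close> and from
   \<open>c\<close> to \<open>c + b\<close>. The squared lengths of these add up to the bound for
   the whole triangle, so nothing is lost in the recursion, however deep.\<close>
 define e where "e = c + h + k"
 define u where "u = h - k"
 define v where "v = - h - k"
 have hk0: "h \<bullet> k = 0" "k \<bullet> h = 0" using Suc.prems(3) unfolding h_def k_def by (simp_all add: inner_commute)
 have kk: "k \<bullet> k = h \<bullet> h" using Suc.prems(4) unfolding h_def k_def norm_eq by simp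
 have ort: "u \<bullet> v = 0" "v \<bullet> (- u) = 0"
  unfolding u_def v_def by (simp_all add: inner_diff_left inner_diff_right hk0 kk)
 have aa: "a \<bullet> a = 4 * (h \<bullet> h)" unfolding hk by (simp add: inner_add_left inner_add_right)
 have uu: "u \<bullet> u = 2 * (h \<bullet> h)" and vv: "v \<bullet> v = 2 * (h \<bullet> h)"
  unfolding u_def v_def by (simp_all add: inner_diff_left inner_diff_right hk0 kk)
 have nn: "norm u = norm v" using uu vv by (simp add: norm_eq)
 have nu: "2 * (norm u)^2 = (norm a)^2" "2 * (norm v)^2 = (norm a)^2"
  unfolding power2_norm_eq_inner uu vv aa by simp_all
 have ca: "e + u = c + a" "e + v = c" "e + - u = c + b"
  unfolding e_def u_def v_def hk by simp_all
 have left: "c + s *\<^sub>R a + t *\<^sub>R b \<in> corner_triangle e u v"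
  if "0 <= s" "0 <= t" "s + t <= 1" "t <= s" for s t
 proof -
  have "c + s *\<^sub>R a + t *\<^sub>R b = e + (s - t) *\<^sub>R u + (1 - s - t) *\<^sub>R v"
   unfolding e_def u_def v_def hk by (simp add: algebra_simps)
  then show ?thesis unfolding corner_triangle_def using that
   by (intro CollectI exI[of _ "s - t"] exI[of _ "1 - s - t"]) auto
 qed
 have right: "c + s *\<^sub>R a + t *\<^sub>R b \<in> corner_triangle e v (- u)"
  if "0 <= s" "0 <= t" "s + t <= 1" "s <= t" for s t
 proof -
  have "c + s *\<^sub>R a + t *\<^sub>R b = e + (1 - s - t) *\<^sub>R v + (t - s) *\<^sub>R (- u)"
   unfolding e_def u_def v_def hk by (simp add: algebra_simps)
  then show ?thesis unfolding corner_triangle_def using that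
   by (intro CollectI exI[of _ "1 - s - t"] exI[of _ "t - s"]) auto
 qed
 define S1 where "S1 = {i \<in> S. x i \<in> corner_triangle e u v}"
 define S2 where "S2 = S - S1"
 have S2: "x i \<in> corner_triangle e v (- u)" if "i \<in> S2" for i
 proof -
  have "i \<in> S" "x i \<notin> corner_triangle e u v" using that unfolding S1_def S2_def by auto
  then show ?thesis using Suc.prems(2)[of i] left right
   unfolding corner_triangle_def[of c] by (smt (verit) mem_Collect_eq)
 qed
 have "\<exists>js. distinct js \<and> set js = S1 \<and> path_cost (e + u) (map x js) (e + v) <= 2 * (norm u)^2"
  using Suc.prems ort nn nu by (intro Suc.IH) (auto simp: S1_def)
 then obtain js1 where js1: "distinct js1" "set js1 = S1"
  "path_cost (c + a) (map x js1) c <= (norm a)^2" unfolding ca nu by auto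
 have "\<exists>js. distinct js \<and> set js = S2 \<and> path_cost (e + v) (map x js) (e + - u) <= 2 * (norm v)^2"
  using Suc.prems ort nn nu S2 by (intro Suc.IH) (auto simp: S2_def)
 then obtain js2 where js2: "distinct js2" "set js2 = S2"
  "path_cost c (map x js2) (c + b) <= (norm a)^2" unfolding ca nu by auto
 have "path_cost (c + a) (map x js1 @ map x js2) (c + b)
   <= path_cost (c + a) (map x js1) c + path_cost c (map x js2) (c + b)"
 proof (rule path_cost_join)
  fix p q assume "p \<in> insert (c + a) (set (map x js1))" "q \<in> insert (c + b) (set (map x js2))"
  then have "p \<in> corner_triangle c a b" "q \<in> corner_triangle c a b"
   using Suc.prems(2) js1(2) js2(2) corner_triangle_corners(1)[of c a b] corner_triangle_corners(2)[of c b a]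
   unfolding S1_def S2_def by auto
  then show "0 <= (p - c) \<bullet> (q - c)" using corner_triangle_acute Suc.prems(3) by blast
 qed
 then have "path_cost (c + a) (map x (js1 @ js2)) (c + b) <= 2 * (norm a)^2"
  using js1(3) js2(3) by simp
 moreover have "distinct (js1 @ js2)" "set (js1 @ js2) = S"
  using js1 js2 unfolding S2_def S1_def by auto
 ultimately show ?case by blast
qed

lemma ball_subset_corner_triangle:
 fixes p :: "real^2"
 assumes "norm p <= R" "0 < R"
 shows "p \<in> corner_triangle (vector [-R, -R]) (vector [4 * R, 0]) (vector [0, 4 * R])"
proof -
 have "\<bar>p $ 1\<bar> <= R" "\<bar>p $ 2\<bar> <= R" using component_le_norm_cart[of p] assms(1) order_trans by blast+
 then have "0 <= (p $ 1 + R) / (4 * R)" "0 <= (p $ 2 + R) / (4 * R)"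
  and "(p $ 1 + R) + (p $ 2 + R) <= 4 * R"
  using assms(2) by auto
 moreover have "(p $ 1 + R) / (4 * R) + (p $ 2 + R) / (4 * R) <= 1"
  using assms(2) calculation(3) by (subst add_divide_distrib[symmetric], subst divide_le_eq_1_pos) auto
 moreover have "p = vector [-R, -R] + ((p $ 1 + R) / (4 * R)) *\<^sub>R vector [4 * R, 0]
   + ((p $ 2 + R) / (4 * R)) *\<^sub>R vector [0, 4 * R]"
  using assms(2) unfolding vec_eq_iff forall_2 by (simp add: vector_2 nonzero_eq_divide_eq)
 ultimately show ?thesis unfolding corner_triangle_def by blast
qed

text \<open>A triangle with legs \<open>4 * R\<close> contains the disc, which gives a path of cost
  \<open>32 * R^2\<close>; the closing edge adds at most \<open>(2 * R)^2\<close>. The bound is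
  independent of \<open>n\<close>, so the tour is negligible against \<open>ln n\<close>. The depth
  of the bisection depends on the least distance of distinct points, but the bound does not.\<close>

lemma short_closed_tour:
 fixes x :: "nat => real^2"
 assumes "1 <= n" "0 < R" "\<And>i. i \<in> {1..n} ==> norm (x i) <= R"
 shows "\<exists>\<sigma>. \<sigma> permutes {1..n} \<and>
  (\<Sum>i\<in>{1..n}. (norm (x (\<sigma> i) - x (\<sigma> (if i = n then 1 else i + 1))))^2) <= 36 * R^2"
proof -
 let ?a = "vector [4 * R, 0] :: real^2" and ?b = "vector [0, 4 * R] :: real^2"
  and ?c = "vector [-R, -R] :: real^2"
 have na: "norm ?a = 4 * R" "norm ?b = 4 * R"
  using assms(2) by (simp_all add: norm_vec_def L2_set_def UNIV_2 real_sqrt_mult)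
 have ort: "?a \<bullet> ?b = 0" by (simp add: inner_vec_def UNIV_2)
 define D where "D = (%(i, j). (norm (x i - x j))^2) ` {(i, j) \<in> {1..n} \<times> {1..n}. x i \<noteq> x j}"
 have finD: "finite D" unfolding D_def
  by (rule finite_imageI, rule finite_subset[of _ "{1..n} \<times> {1..n}"]) auto
 obtain m where m: "0 < m" "\<And>z. z \<in> D ==> m <= z"
 proof (cases "D = {}")
  case False
  have "0 < Min D" using False finD by (auto simp: D_def)
  then show ?thesis using that[of "Min D"] finD by simp
 qed (use that[of 1] in auto)
 obtain d :: nat where d: "2 * (norm ?a)^2 / m < 2 ^ d"
  using real_arch_pow[of 2] by fastforce
 have "\<exists>js. distinct js \<and> set js = {1..n} \<and> path_cost (?c + ?a) (map x js) (?c + ?b) <= 2 * (norm ?a)^2"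
 proof (rule corner_triangle_path[where m = m and d = d])
  show "2 * (norm ?a)^2 < 2 ^ d * m" using d m(1) by (simp add: field_simps)
  show "m <= (norm (x i - x j))^2" if "i \<in> {1..n}" "j \<in> {1..n}" "x i \<noteq> x j" for i j
   using that by (intro m(2)) (force simp: D_def)
 qed (use assms ort na ball_subset_corner_triangle in auto)
 then obtain js where js: "distinct js" "set js = {1..n}"
  "path_cost (?c + ?a) (map x js) (?c + ?b) <= 32 * R^2"
  unfolding na by (auto simp: power2_eq_square)
 have len: "length js = n" using js distinct_card by fastforce
 define \<sigma> where "\<sigma> i = (if i \<in> {1..n} then js ! (i - 1) else i)" for i
 have "bij_betw (%i. js ! (i - 1)) {1..n} {1..n}"
 proof -
  have "bij_betw (%i. i - 1) {1..n} {..<n}"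
   by (rule bij_betw_byWitness[where f' = Suc]) auto
  moreover have "bij_betw ((!) js) {..<n} {1..n}" using bij_betw_nth[OF js(1)] js(2) len by auto
  ultimately show ?thesis using bij_betw_trans[of "%i. i - 1" "{1..n}" "{..<n}" "(!) js"] by (simp add: comp_def)
 qed
 then have "bij_betw \<sigma> {1..n} {1..n}" unfolding \<sigma>_def by (rule bij_betw_cong[THEN iffD1, rotated]) auto
 then have \<sigma>: "\<sigma> permutes {1..n}"
  by (rule bij_imp_permutes) (auto simp: \<sigma>_def)
 have "{1..n} = insert n {1..<n}" using assms(1) by auto
 then have "(\<Sum>i\<in>{1..n}. (norm (x (\<sigma> i) - x (\<sigma> (if i = n then 1 else i + 1))))^2)
   = (norm (x (\<sigma> n) - x (\<sigma> 1)))^2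
    + (\<Sum>i\<in>{1..<n}. (norm (x (\<sigma> i) - x (\<sigma> (i + 1))))^2)"
  by (simp add: sum.insert)
 also have "(\<Sum>i\<in>{1..<n}. (norm (x (\<sigma> i) - x (\<sigma> (i + 1))))^2)
   = (\<Sum>i<n - 1. (norm (map x js ! i - map x js ! Suc i))^2)"
  by (rule sum.reindex_bij_witness[of _ Suc "%i. i - 1"]) (auto simp: \<sigma>_def len)
 also have "... <= 32 * R^2" using sum_le_path_cost[of "map x js"] js(3) len
  by (metis (no_types, lifting) length_map order_trans)
 also have "(norm (x (\<sigma> n) - x (\<sigma> 1)))^2 <= (2 * R)^2"
 proof (rule power_mono)
  have "\<sigma> n \<in> {1..n}" "\<sigma> 1 \<in> {1..n}" using permutes_in_image[OF \<sigma>] assms(1) by auto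
  then show "norm (x (\<sigma> n) - x (\<sigma> 1)) <= 2 * R"
   using assms(3)[of "\<sigma> n"] assms(3)[of "\<sigma> 1"] norm_triangle_ineq4[of "x (\<sigma> n)" "x (\<sigma> 1)"]
   by linarith
 qed simp
 finally show ?thesis using \<sigma> by (intro exI[of _ \<sigma>]) (auto simp: power2_eq_square)
qed

section \<open>Duality for assignments and the Hopf-Lax semigroup\<close>

fun walk_cost :: "('a => 'a => real) => 'a list => real" where
 "walk_cost u (v # w # r) = u v w + walk_cost u (w # r)"
| "walk_cost u [v] = 0"
| "walk_cost u [] = 0"

lemma walk_cost_split: "walk_cost u (A @ i # B) = walk_cost u (A @ [i]) + walk_cost u (i # B)"
 by (induction u A rule: walk_cost.induct) auto

lemma walk_cost_closed:
 "walk_cost u (x # ys @ [z]) = sum_list (map2 u (x # ys) (ys @ [z]))"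
 by (induction ys arbitrary: x) auto

lemma map2_map_self: "map2 u xs (map f xs) = map (%v. u v (f v)) xs"
 by (induction xs) auto

lemma walk_cost_cycle:
 assumes "distinct (i # A)"
 shows "walk_cost u (i # A @ [i]) = (\<Sum>v\<in>set (i # A). u v (cycle_of_list (i # A) v))"
proof -
 have "map (cycle_of_list (i # A)) (i # A) = A @ [i]"
  using cyclic_rotation[OF assms, of 1] by simp
 then have "walk_cost u (i # A @ [i]) = sum_list (map2 u (i # A) (map (cycle_of_list (i # A)) (i # A)))"
  using walk_cost_closed by metis
 also have "map2 u (i # A) (map (cycle_of_list (i # A)) (i # A)) = map (%v. u v (cycle_of_list (i # A) v)) (i # A)"
  by (rule map2_map_self)
 finally show ?thesis
  using sum_list_distinct_conv_sum_set[OF assms] by metis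
qed

text \<open>The potential of a vertex is the least cost of a simple walk leaving it in the exchange graph
 of an optimal assignment, which has no negative cycles.\<close>

lemma assignment_duality:
 fixes c :: "'a => 'a => real"
 assumes S: "finite S" and p: "p permutes S"
  and opt: "\<And>q. q permutes S ==> (\<Sum>i\<in>S. c i (p i)) <= (\<Sum>i\<in>S. c i (q i))"
 obtains al \<beta> where "\<And>i j. i \<in> S ==> j \<in> S ==> al i + \<beta> j <= c i j"
  "(\<Sum>i\<in>S. al i) + (\<Sum>i\<in>S. \<beta> i) = (\<Sum>i\<in>S. c i (p i))"
proof -
 \<comment> \<open>The length of the edge from \<open>i\<close> to \<open>j\<close> in the exchange
   graph: \<open>i\<close> takes over the partner of \<open>j\<close>. Around a cycle these lengths
   add up to the change of the total cost.\<close>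
 define u where "u i j = c i (p j) - c j (p j)" for i j
 define W where "W i = walk_cost u ` {L. set L \<subseteq> S \<and> distinct L \<and> L \<noteq> [] \<and> hd L = i}" for i
 define al where "al i = Min (W i)" for i
 have finW: "finite (W i)" for i unfolding W_def
  using finite_subset_distinct[OF S] by (intro finite_imageI) (auto elim: rev_finite_subset)
 have neW: "walk_cost u [i] \<in> W i" if "i \<in> S" for i
  unfolding W_def using that by (intro imageI) auto
 have main: "al i <= al j + u i j" if ij: "i \<in> S" "j \<in> S" for i j
 proof -
  have "al j \<in> W j" unfolding al_def using finW neW[OF ij(2)] by (intro Min_in) auto
  then obtain L where L: "set L \<subseteq> S" "distinct L" "L \<noteq> []" "hd L = j" "al j = walk_cost u L"
   unfolding W_def by auto
  show ?thesis
  proof (cases "i \<in> set L")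
   case False
   have "walk_cost u (i # L) \<in> W i" unfolding W_def using L False ij by auto
   then have "al i <= walk_cost u (i # L)" unfolding al_def using finW by simp
   also have "... = al j + u i j" using L(3-5) by (cases L) auto
   finally show ?thesis .
  next
   \<comment> \<open>The best walk from \<open>j\<close> passes through \<open>i\<close>. Its tail
     from \<open>i\<close> competes for \<open>al i\<close>, and the part cut off, closed by the
     edge from \<open>i\<close> to \<open>j\<close>, is a simple cycle, whose length is nonnegative
     because \<open>p\<close> is optimal.\<close>
   case True
   then obtain A B where AB: "L = A @ i # B" by (meson split_list)
   define q where "q = cycle_of_list (i # A)"
   have dist: "distinct (i # A)" using L(2) AB by auto
   have "walk_cost u (i # B) \<in> W i" unfolding W_def using L AB ij by auto
   then have "al i <= walk_cost u (i # B)" unfolding al_def using finW by simp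
   moreover have "al j = walk_cost u (A @ [i]) + walk_cost u (i # B)"
    using L(5) unfolding AB by (metis walk_cost_split)
   moreover have "u i j + walk_cost u (A @ [i]) = walk_cost u (i # A @ [i])"
    using L(4) AB by (cases A) auto
   moreover have "0 <= walk_cost u (i # A @ [i])"
   proof -
    have qS: "q permutes S" unfolding q_def
     by (rule permutes_subset[OF cycle_permutes]) (use L AB in auto)
    have "walk_cost u (i # A @ [i]) = (\<Sum>v\<in>set (i # A). u v (q v))"
     unfolding q_def by (rule walk_cost_cycle[OF dist])
    also have "... = (\<Sum>v\<in>S. u v (q v))"
    proof (rule sum.mono_neutral_left)
     show "\<forall>v\<in>S - set (i # A). u v (q v) = 0"
      unfolding q_def u_def using id_outside_supp[of _ "i # A"] by (metis DiffE diff_self)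
    qed (use L AB S in auto)
    also have "... = (\<Sum>v\<in>S. c v (p (q v))) - (\<Sum>v\<in>S. c (q v) (p (q v)))"
     unfolding u_def by (simp add: sum_subtractf)
    also have "(\<Sum>v\<in>S. c (q v) (p (q v))) = (\<Sum>v\<in>S. c v (p v))"
     using sum.permute[OF qS, of "%v. c v (p v)"] by (simp add: comp_def)
    finally show ?thesis
     using opt[of "p \<circ> q"] permutes_compose[OF qS p] by (simp add: comp_def)
   qed
   ultimately show ?thesis by linarith
  qed
 qed
 \<comment> \<open>Complementary slackness: the dual constraint is made an equality on assigned
   pairs.\<close>
 define \<beta> where "\<beta> j = c (inv p j) j - al (inv p j)" for j
 show thesis
 proof
  show "al i + \<beta> j <= c i j" if "i \<in> S" "j \<in> S" for i j
  proof -
   have "inv p j \<in> S" using that(2) p by (meson permutes_in_image permutes_inv)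
   then have "al i <= al (inv p j) + u i (inv p j)" using main that(1) by blast
   then show ?thesis unfolding \<beta>_def u_def using permutes_inverses(1)[OF p, of j] by simp
  qed
  have "(\<Sum>i\<in>S. \<beta> i) = (\<Sum>i\<in>S. \<beta> (p i))"
   using sum.permute[OF p, of \<beta>] by (simp add: comp_def)
  also have "... = (\<Sum>i\<in>S. c i (p i) - al i)"
   unfolding \<beta>_def by (simp add: permutes_inverses(2)[OF p])
  finally show "(\<Sum>i\<in>S. al i) + (\<Sum>i\<in>S. \<beta> i) = (\<Sum>i\<in>S. c i (p i))"
   by (simp add: sum_subtractf)
 qed
qed

text \<open>Of the almost everywhere gradient of a locally Lipschitz function only the fundamental theorem of
 calculus along segments is needed.\<close>

definition weak_grad :: "('a::euclidean_space => real) => ('a => 'a) => bool" where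
 "weak_grad g \<xi> \<longleftrightarrow> continuous_on UNIV g \<and> \<xi> \<in> borel_measurable borel \<and>
   (\<forall>R. \<exists>C. \<forall>x. norm x <= R --> norm (\<xi> x) <= C) \<and>
   (\<forall>x v a b. a <= b -->
    ((%s. \<xi> (x + s *\<^sub>R v) \<bullet> v) has_integral g (x + b *\<^sub>R v) - g (x + a *\<^sub>R v)) {a..b})"

section \<open>The Hopf-Lax semigroup of finitely many data\<close>

definition hopf_lax :: "nat set => (nat => real) => (nat => 'a::euclidean_space) => real => 'a => real" where
 "hopf_lax I \<phi> p t x = Min ((%i. \<phi> i + (norm (x - p i))^2 / (2 * t)) ` I)"

text \<open>Taking the least index among the minimisers makes the choice measurable in
  \<open>x\<close>.\<close>

definition hl_sel :: "nat set => (nat => real) => (nat => 'a::euclidean_space) => real => 'a => nat" where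
 "hl_sel I \<phi> p t x = (LEAST i. i \<in> I \<and>
   (\<forall>j\<in>I. \<phi> i + (norm (x - p i))^2 / (2 * t) <= \<phi> j + (norm (x - p j))^2 / (2 * t)))"

definition hl_grad :: "nat set => (nat => real) => (nat => 'a::euclidean_space) => real => 'a => 'a" where
 "hl_grad I \<phi> p t x = (x - p (hl_sel I \<phi> p t x)) /\<^sub>R t"

lemma hopf_lax_le:
 assumes "finite I" "i \<in> I"
 shows "hopf_lax I \<phi> p t x <= \<phi> i + (norm (x - p i))^2 / (2 * t)"
 unfolding hopf_lax_def using assms by simp

lemma hl_sel_props:
 assumes "finite I" "I \<noteq> {}"
 shows "hl_sel I \<phi> p t x \<in> I"
  and "hopf_lax I \<phi> p t x = \<phi> (hl_sel I \<phi> p t x) + (norm (x - p (hl_sel I \<phi> p t x)))^2 / (2 * t)"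
proof -
 define f where "f i = \<phi> i + (norm (x - p i))^2 / (2 * t)" for i
 have "Min (f ` I) \<in> f ` I" using assms by (intro Min_in) auto
 then obtain i where "i \<in> I" "Min (f ` I) = f i" by auto
 then have i: "i \<in> I" "f i <= f j" if "j \<in> I" for j
  using assms(1) that Min_le[of "f ` I" "f j"] by auto
 have "hl_sel I \<phi> p t x \<in> I \<and> (\<forall>j\<in>I. f (hl_sel I \<phi> p t x) <= f j)"
  unfolding hl_sel_def f_def[symmetric]
  by (rule LeastI[of "%i. i \<in> I \<and> (\<forall>j\<in>I. f i <= f j)" i]) (use i assms(2) in auto)
 moreover from this have "Min (f ` I) = f (hl_sel I \<phi> p t x)"
  using assms by (intro Min_eqI) auto
 ultimately show "hl_sel I \<phi> p t x \<in> I"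
  "hopf_lax I \<phi> p t x = \<phi> (hl_sel I \<phi> p t x) + (norm (x - p (hl_sel I \<phi> p t x)))^2 / (2 * t)"
  unfolding hopf_lax_def f_def by auto
qed

lemma continuous_on_Min_image:
 fixes f :: "'i => 'a::topological_space => real"
 assumes "finite I" "I \<noteq> {}" "\<And>i. i \<in> I ==> continuous_on S (f i)"
 shows "continuous_on S (%x. Min ((%i. f i x) ` I))"
 using assms
proof (induction rule: finite_ne_induct)
 case (insert i F)
 have "(%x. Min ((%i. f i x) ` insert i F)) = (%x. min (f i x) (Min ((%i. f i x) ` F)))"
  using insert.hyps by (simp add: Min_insert)
 then show ?case using insert by (auto intro!: continuous_on_min)
qed auto

lemma hopf_lax_continuous:
 assumes "finite I" "I \<noteq> {}"
 shows "continuous_on UNIV (hopf_lax I \<phi> p t)"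
proof -
 have "continuous_on UNIV (%x. Min ((%i. \<phi> i + (norm (x - p i))^2 / (2 * t)) ` I))"
  by (rule continuous_on_Min_image[OF assms]) (cases "t = 0"; auto intro!: continuous_intros)
 then show ?thesis unfolding hopf_lax_def[abs_def] .
qed

lemma hl_sel_measurable:
 "hl_sel I \<phi> (p :: nat => 'a::euclidean_space) t \<in> measurable borel (count_space UNIV)" if "finite I"
proof -
 have [measurable]: "Measurable.pred borel (%x. \<forall>j\<in>I. \<phi> i + (norm (x - p i))^2 / (2 * t)
   <= \<phi> j + (norm (x - p j))^2 / (2 * t))" for i
  using that by (intro pred_intros_finite) auto
 show ?thesis unfolding hl_sel_def[abs_def] by measurable
qed

text \<open>The paraboloids share their quadratic part, so on a line the difference of two of them
  is affine: it is constant or vanishes at most once. Off a finite set of parameters the selected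
  paraboloid is therefore minimal in a whole neighbourhood, and the fundamental theorem with
  finitely many exceptions applies.\<close>

lemma hopf_lax_weak_grad:
 fixes p :: "nat => 'a::euclidean_space"
 assumes I: "finite I" "I \<noteq> {}" and t: "0 < t"
 shows "weak_grad (hopf_lax I \<phi> p t) (hl_grad I \<phi> p t)"
proof -
 let ?g = "hopf_lax I \<phi> p t" and ?\<xi> = "hl_grad I \<phi> p t" and ?k = "hl_sel I \<phi> p t"
 have [measurable]: "?k \<in> measurable borel (count_space UNIV)" using hl_sel_measurable[OF I(1)] .
 have meas: "?\<xi> \<in> borel_measurable borel" unfolding hl_grad_def[abs_def] by measurable
 have bdd: "\<exists>C. \<forall>x. norm x <= R --> norm (?\<xi> x) <= C" for R
 proof (intro exI allI impI)
  fix x :: 'a assume x: "norm x <= R"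
  have "norm (p (?k x)) <= (\<Sum>i\<in>I. norm (p i))"
   using hl_sel_props(1)[OF I, of \<phi> p t x] I(1) by (intro member_le_sum) auto
  then show "norm (?\<xi> x) <= (R + (\<Sum>i\<in>I. norm (p i))) / t"
   unfolding hl_grad_def using t x norm_triangle_ineq4[of x "p (?k x)"]
   by (simp add: divide_inverse mult.commute mult_right_mono)
 qed
 have int: "((%s. ?\<xi> (x + s *\<^sub>R v) \<bullet> v) has_integral ?g (x + b *\<^sub>R v) - ?g (x + a *\<^sub>R v)) {a..b}"
  if ab: "a <= b" for x v a b
 proof -
  define F where "F i s = \<phi> i + (norm (x + s *\<^sub>R v - p i))^2 / (2 * t)" for i and s :: real
  define B where "B i j = ((p j - p i) \<bullet> v) / t" for i j
  have Feq: "F i s - F j s = F i r - F j r + (s - r) * B i j" for i j s r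
  proof -
   have "F i s - F j s = \<phi> i - \<phi> j + ((norm (x - p i))^2 - (norm (x - p j))^2) / (2 * t) + s * B i j" for s
    using t unfolding F_def B_def power2_norm_eq_inner
    by (simp add: field_simps inner_diff_left inner_diff_right inner_add_left inner_add_right inner_commute)
   from this[of s] this[of r] show ?thesis by (simp add: algebra_simps)
  qed
  define K where "K = (\<Union>(i, j)\<in>{(i, j) \<in> I \<times> I. B i j \<noteq> 0}. {s. F i s = F j s})"
  have "finite {s. F i s = F j s}" if "B i j \<noteq> 0" for i j
  proof (cases "\<exists>r. F i r = F j r")
   case True
   then obtain r where "F i r = F j r" by auto
   then have "{s. F i s = F j s} \<subseteq> {r}"
   proof safe
    fix s assume "F i s = F j s"
    then have "(s - r) * B i j = 0" using Feq[of i s j r] \<open>F i r = F j r\<close> by simp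
    then show "s = r" using that by simp
   qed
   then show ?thesis using finite_subset by blast
  qed auto
  moreover have "finite {(i, j) \<in> I \<times> I. B i j \<noteq> 0}"
   by (rule finite_subset[of _ "I \<times> I"]) (use I in auto)
  ultimately have finK: "finite K" unfolding K_def by auto
  have deriv: "((%s. ?g (x + s *\<^sub>R v)) has_vector_derivative ?\<xi> (x + s *\<^sub>R v) \<bullet> v) (at s)"
   if s: "s \<notin> K" for s
  proof -
   define k where "k = ?k (x + s *\<^sub>R v)"
   have k: "k \<in> I" "\<And>j. j \<in> I ==> F k s <= F j s"
    using hl_sel_props[OF I, of \<phi> p t "x + s *\<^sub>R v"] hopf_lax_le[OF I(1), of _ \<phi> p t "x + s *\<^sub>R v"]
    unfolding k_def F_def by auto
   have contF: "isCont (F j) r" for j r unfolding F_def using t by (auto intro!: continuous_intros)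
   have ev: "\<forall>\<^sub>F r in nhds s. F k r <= F j r" if j: "j \<in> I" for j
   proof (cases "F k s = F j s")
    case True
    then have "B k j = 0" using s k j unfolding K_def by blast
    then show ?thesis using Feq[of k _ j s] True by (intro always_eventually) auto
   next
    case False
    then have "F k s < F j s" using k(2)[OF j] by simp
    moreover have "isCont (%r. F j r - F k r) s" using contF by (intro continuous_intros)
    ultimately have "\<forall>\<^sub>F r in nhds s. 0 < F j r - F k r"
     using order_tendstoD(1)[of "%r. F j r - F k r" "F j s - F k s" "nhds s" 0]
      tendsto_at_iff_tendsto_nhds[of "%r. F j r - F k r" s]
     unfolding isCont_def by auto
    then show ?thesis by eventually_elim simp
   qed
   have "\<forall>\<^sub>F r in nhds s. \<forall>j\<in>I. F k r <= F j r"
    using ev I(1) by (simp add: eventually_ball_finite_distrib)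
   then have "\<forall>\<^sub>F r in nhds s. ?g (x + r *\<^sub>R v) = F k r"
   proof eventually_elim
    case (elim r)
    then show ?case unfolding hopf_lax_def F_def[symmetric] using I k(1) by (intro Min_eqI) auto
   qed
   moreover have "(F k has_real_derivative ((x + s *\<^sub>R v - p k) /\<^sub>R t) \<bullet> v) (at s)"
   proof -
    have "F k = (%r. \<phi> k + ((x - p k) \<bullet> (x - p k) + 2 * r * ((x - p k) \<bullet> v) + r^2 * (v \<bullet> v)) / (2 * t))"
     unfolding F_def power2_norm_eq_inner
     by (simp add: inner_diff_left inner_diff_right inner_add_left inner_add_right inner_commute
       algebra_simps power2_eq_square fun_eq_iff)
    then show ?thesis using t
     by (auto intro!: derivative_eq_intros simp: field_simps inner_diff_left inner_add_left)
   qed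
   ultimately have "((%s. ?g (x + s *\<^sub>R v)) has_real_derivative ((x + s *\<^sub>R v - p k) /\<^sub>R t) \<bullet> v) (at s)"
    by (subst DERIV_cong_ev[OF refl _ refl]) auto
   then show ?thesis unfolding hl_grad_def k_def[symmetric] has_real_derivative_iff_has_vector_derivative .
  qed
  show ?thesis
  proof (rule fundamental_theorem_of_calculus_interior_strong[OF finK ab])
   show "continuous_on {a..b} (%s. ?g (x + s *\<^sub>R v))"
    by (rule continuous_on_compose2[OF hopf_lax_continuous[OF I]]) (auto intro!: continuous_intros)
  qed (use deriv in auto)
 qed
 show ?thesis unfolding weak_grad_def using hopf_lax_continuous[OF I] meas bdd int by blast
qed

text \<open>A discrete Hamilton-Jacobi inequality for mass that arrives at \<open>x\<close> with
  displacement \<open>w\<close> during time \<open>h\<close>. The term with \<open>h\<close> is the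
  cost of the displacement; the term with \<open>t\<close> is the semiconcavity of the potential at
  time \<open>t\<close>, an error that blows up as \<open>t\<close> tends to 0.\<close>

lemma hopf_lax_step:
 fixes p :: "nat => 'a::euclidean_space"
 assumes I: "finite I" "I \<noteq> {}" and t: "0 < t" "0 < h"
 shows "hopf_lax I \<phi> p (t + h) x
  <= hopf_lax I \<phi> p t x - hl_grad I \<phi> p t x \<bullet> w + (1 / (2 * t) + 1 / (2 * h)) * (norm w)^2"
proof -
 define i where "i = hl_sel I \<phi> p t x"
 have i: "i \<in> I" "hopf_lax I \<phi> p t x = \<phi> i + (norm (x - p i))^2 / (2 * t)"
  using hl_sel_props[OF I, of \<phi> p t x] unfolding i_def by auto
 define y where "y = x - p i"
 \<comment> \<open>Joint convexity of the squared norm divided by time, by completing the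
   square.\<close>
 have key: "(norm y)^2 / (t + h) <= (norm (y - w))^2 / t + (norm w)^2 / h"
 proof -
  have "0 <= (norm (h *\<^sub>R (y - w) - t *\<^sub>R w))^2" by simp
  also have "... = (t + h) * (h * (norm (y - w))^2 + t * (norm w)^2) - t * h * (norm y)^2"
   unfolding power2_norm_eq_inner
   by (simp add: inner_diff_left inner_diff_right inner_commute algebra_simps)
  finally show ?thesis using t by (simp add: field_simps)
 qed
 have "hopf_lax I \<phi> p (t + h) x <= \<phi> i + (norm y)^2 / (t + h) / 2"
  using hopf_lax_le[OF I(1) i(1), of \<phi> p "t + h" x] unfolding y_def by (simp add: mult.commute)
 also have "... <= \<phi> i + ((norm (y - w))^2 / t + (norm w)^2 / h) / 2"
  using key by (intro add_left_mono divide_right_mono) simp_all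
 also have "... = hopf_lax I \<phi> p t x - hl_grad I \<phi> p t x \<bullet> w + (1 / (2 * t) + 1 / (2 * h)) * (norm w)^2"
  using t unfolding i(2) hl_grad_def i_def[symmetric] y_def[symmetric] power2_norm_eq_inner
  by (simp add: field_simps inner_diff_left inner_diff_right inner_commute)
 finally show ?thesis .
qed

text \<open>The two potentials start at opposite ends and meet after total time 1. By convexity the
  squared distance of \<open>p i\<close> and \<open>q j\<close> is at most the sum of the squared
  distances from \<open>x\<close>, divided by \<open>t\<close> and \<open>s\<close>, so dual
  admissibility carries over to \<open>x\<close>.\<close>

lemma hopf_lax_add_nonneg:
 fixes p q :: "nat => 'a::euclidean_space"
 assumes I: "finite I" "I \<noteq> {}" and J: "finite J" "J \<noteq> {}" and t: "0 < t" "0 < s" "t + s = 1"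
  and dual: "\<And>i j. i \<in> I ==> j \<in> J ==> 0 <= \<phi> i + \<psi> j + (norm (p i - q j))^2 / 2"
 shows "0 <= hopf_lax I \<phi> p t x + hopf_lax J \<psi> q s x"
proof -
 define i where "i = hl_sel I \<phi> p t x"
 define j where "j = hl_sel J \<psi> q s x"
 have ij: "i \<in> I" "j \<in> J" "hopf_lax I \<phi> p t x = \<phi> i + (norm (x - p i))^2 / (2 * t)"
  "hopf_lax J \<psi> q s x = \<psi> j + (norm (x - q j))^2 / (2 * s)"
  using hl_sel_props[OF I, of \<phi> p t x] hl_sel_props[OF J, of \<psi> q s x] unfolding i_def j_def by auto
 define y z where "y = x - p i" and "z = x - q j"
 have "0 <= (norm (s *\<^sub>R y + t *\<^sub>R z))^2" by simp
 also have "... = s * (t + s) * (norm y)^2 + t * (t + s) * (norm z)^2 - t * s * (norm (z - y))^2"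
  unfolding power2_norm_eq_inner
  by (simp add: inner_diff_left inner_diff_right inner_add_left inner_add_right inner_commute algebra_simps)
 finally have "(norm (z - y))^2 <= (norm y)^2 / t + (norm z)^2 / s" using t(1,2) unfolding t(3) by (simp add: field_simps)
 moreover have "z - y = p i - q j" unfolding y_def z_def by simp
 ultimately show ?thesis using dual[OF ij(1,2)] unfolding ij(3,4) y_def[symmetric] z_def[symmetric]
  by (simp add: field_simps)
qed

section \<open>Fields carrying averages over discs\<close>

lemma nn_integral_lborel_translate:
 fixes c :: "'a::euclidean_space"
 assumes [measurable]: "f \<in> borel_measurable borel"
 shows "(\<integral>\<^sup>+x. f (x - c) \<partial>lborel) = (\<integral>\<^sup>+x. f x \<partial>lborel)"
proof -
 have "(\<integral>\<^sup>+x. f x \<partial>lborel) = (\<integral>\<^sup>+x. f x \<partial>distr lborel borel ((+) (- c)))"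
  by (simp add: lborel_distr_plus)
 also have "... = (\<integral>\<^sup>+x. f (- c + x) \<partial>lborel)" by (subst nn_integral_distr) auto
 finally show ?thesis by (simp add: algebra_simps)
qed

text \<open>Polar coordinates for radial integrands: on half-lines the two measures are compared
  through the area of a disc, and half-lines generate the Borel sets.\<close>

lemma distr_norm_plane:
 "distr lborel borel (norm :: real^2 => real) = density lborel (%r. ennreal (2 * pi * r) * indicator {0..} r)"
 (is "?M = ?N")
proof (rule measure_eqI_generator_eq[where E = "range (%a::real. {..a})" and \<Omega> = UNIV and A = "%i::nat. {..real i}"])
 show eq: "emeasure ?M X = emeasure ?N X" if X: "X \<in> range (%a::real. {..a})" for X
 proof -
  obtain a where a: "X = {..a}" using X by auto
  show ?thesis
  proof (cases "0 <= a")
   case True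
   have "emeasure ?M X = emeasure lborel (cball (0::real^2) a)"
    unfolding a by (subst emeasure_distr) (auto intro!: arg_cong[where f = "emeasure lborel"])
   also have "... = ennreal (pi * a^2)" using True by (simp add: emeasure_cball unit_ball_vol_2)
   also have "... = (\<integral>\<^sup>+r\<in>{0..a}. ennreal (2 * pi * r) \<partial>lborel)"
    by (subst nn_integral_FTC_Icc[where F = "%r. pi * r^2"])
     (use True in \<open>auto intro!: derivative_eq_intros\<close>)
   also have "... = emeasure ?N X" unfolding a
    by (subst emeasure_density) (auto intro!: nn_integral_cong simp: indicator_def)
   finally show ?thesis .
  next
   case False
   have "(norm :: real^2 => real) -` {..a} = {}" using False by (auto dest: order_trans[OF norm_ge_zero])
   then have "emeasure ?M X = emeasure lborel ({} :: (real^2) set)" unfolding a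
    by (subst emeasure_distr) auto
   moreover have "emeasure ?N X = 0" unfolding a
    by (subst emeasure_density) (use False in \<open>auto simp: indicator_def nn_integral_0_iff_AE\<close>)
   ultimately show ?thesis by simp
  qed
 qed
 show "sets ?M = sigma_sets UNIV (range (%a::real. {..a}))" "sets ?N = sigma_sets UNIV (range (%a::real. {..a}))"
  by (simp_all add: borel_eq_atMost)
 show "(\<Union>i::nat. {..real i}) = UNIV" by (auto intro: real_arch_simple)
 show "emeasure ?M {..real i} \<noteq> \<infinity>" for i
 proof -
  have "emeasure ?M {..real i} = emeasure lborel (cball (0::real^2) (real i))"
   by (subst emeasure_distr) (auto intro!: arg_cong[where f = "emeasure lborel"])
  then show ?thesis using emeasure_lborel_cball_finite[of "0::real^2" "real i"] by auto
 qed
qed (auto simp: Int_stable_def)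

lemma nn_integral_norm_plane:
 assumes [measurable]: "f \<in> borel_measurable borel"
 shows "(\<integral>\<^sup>+x. f (norm (x - c :: real^2)) \<partial>lborel) = (\<integral>\<^sup>+r\<in>{0..}. ennreal (2 * pi * r) * f r \<partial>lborel)"
proof -
 have "(\<integral>\<^sup>+x. f (norm (x - c)) \<partial>lborel) = (\<integral>\<^sup>+x. f (norm (x :: real^2)) \<partial>lborel)"
  by (rule nn_integral_lborel_translate) measurable
 also have "... = (\<integral>\<^sup>+r. f r \<partial>distr lborel borel (norm :: real^2 => real))"
  by (subst nn_integral_distr) auto
 also have "... = (\<integral>\<^sup>+r\<in>{0..}. ennreal (2 * pi * r) * f r \<partial>lborel)"
  unfolding distr_norm_plane by (subst nn_integral_density) (auto intro!: nn_integral_cong simp: ac_simps)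
 finally show ?thesis .
qed

lemma nn_integral_inverse_norm_plane:
 assumes "0 <= R"
 shows "(\<integral>\<^sup>+x\<in>cball c R. ennreal (1 / norm (x - c :: real^2)) \<partial>lborel) <= ennreal (2 * pi * R)"
proof -
 have "(\<integral>\<^sup>+x\<in>cball c R. ennreal (1 / norm (x - c :: real^2)) \<partial>lborel)
   = (\<integral>\<^sup>+x. ennreal (1 / norm (x - c)) * indicator {..R} (norm (x - c)) \<partial>lborel)"
  by (intro nn_integral_cong) (auto simp: indicator_def dist_norm norm_minus_commute)
 also have "... = (\<integral>\<^sup>+r\<in>{0..}. ennreal (2 * pi * r) * (ennreal (1 / r) * indicator {..R} r) \<partial>lborel)"
  by (rule nn_integral_norm_plane[of "%r. ennreal (1 / r) * indicator {..R} r"]) measurable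
 also have "... <= (\<integral>\<^sup>+r\<in>{0..R}. ennreal (2 * pi) \<partial>lborel)"
  by (intro nn_integral_mono) (auto simp: indicator_def simp flip: ennreal_mult'')
 also have "... = ennreal (2 * pi * R)"
  using assms by (simp add: nn_integral_cmult_indicator ennreal_mult'')
 finally show ?thesis .
qed

text \<open>The source of the logarithms in all energy estimates: up to a constant factor this is
  the energy of a point charge cut off at radius \<open>al\<close>. The inner disc contributes
  \<open>pi\<close> whatever its radius.\<close>

lemma nn_integral_inverse_square_plane:
 assumes "0 < al" "al <= R"
 shows "(\<integral>\<^sup>+x\<in>cball c R. ennreal (1 / (max al (norm (x - c :: real^2)))^2) \<partial>lborel)
  <= ennreal (pi + 2 * pi * ln (R / al))"
proof -
 have "(\<integral>\<^sup>+x\<in>cball c R. ennreal (1 / (max al (norm (x - c :: real^2)))^2) \<partial>lborel)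
   = (\<integral>\<^sup>+x. ennreal (1 / (max al (norm (x - c)))^2) * indicator {..R} (norm (x - c)) \<partial>lborel)"
  by (intro nn_integral_cong) (auto simp: indicator_def dist_norm norm_minus_commute)
 also have "... = (\<integral>\<^sup>+r\<in>{0..}. ennreal (2 * pi * r) * (ennreal (1 / (max al r)^2) * indicator {..R} r) \<partial>lborel)"
  by (rule nn_integral_norm_plane[of "%r. ennreal (1 / (max al r)^2) * indicator {..R} r"]) measurable
 also have "... <= (\<integral>\<^sup>+r. ennreal (2 * pi * r / al^2) * indicator {0..al} r + ennreal (2 * pi / r) * indicator {al..R} r \<partial>lborel)"
 proof (intro nn_integral_mono)
  fix r :: real
  show "ennreal (2 * pi * r) * (ennreal (1 / (max al r)^2) * indicator {..R} r) * indicator {0..} r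
   <= ennreal (2 * pi * r / al^2) * indicator {0..al} r + ennreal (2 * pi / r) * indicator {al..R} r"
   using assms by (cases "r <= al"; cases "r <= R"; cases "0 <= r")
    (auto simp: indicator_def power2_eq_square simp flip: ennreal_mult'')
 qed
 also have "... = (\<integral>\<^sup>+r\<in>{0..al}. ennreal (2 * pi * r / al^2) \<partial>lborel) + (\<integral>\<^sup>+r\<in>{al..R}. ennreal (2 * pi / r) \<partial>lborel)"
  by (rule nn_integral_add) auto
 also have "(\<integral>\<^sup>+r\<in>{0..al}. ennreal (2 * pi * r / al^2) \<partial>lborel) = ennreal pi"
  by (subst nn_integral_FTC_Icc[where F = "%r. pi * r^2 / al^2"])
   (use assms in \<open>auto intro!: derivative_eq_intros simp: power4_eq_xxxx power2_eq_square\<close>)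
 also have "(\<integral>\<^sup>+r\<in>{al..R}. ennreal (2 * pi / r) \<partial>lborel) = ennreal (2 * pi * ln (R / al))"
  by (subst nn_integral_FTC_Icc[where F = "%r. 2 * pi * ln r"])
   (use assms in \<open>auto intro!: derivative_eq_intros simp: ln_div algebra_simps\<close>)
 also have "ennreal pi + ennreal (2 * pi * ln (R / al)) = ennreal (pi + 2 * pi * ln (R / al))"
  using assms by (intro ennreal_plus[symmetric]) auto
 finally show ?thesis .
qed

section \<open>Disc averages and conic fields\<close>

lemma integral_lborel_affine_plane:
 fixes f :: "real^2 => real"
 assumes [measurable]: "f \<in> borel_measurable borel" and "s \<noteq> 0"
 shows "(LINT x|lborel. f x) = s^2 * (LINT u|lborel. f (t + s *\<^sub>R u))"
proof -
 have "(LINT x|lborel. f x) = (LINT x|density (distr lborel borel (%x::real^2. t + s *\<^sub>R x)) (%x. ennreal (\<bar>s\<bar> ^ DIM(real^2))). f x)"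
  using lborel_affine[OF assms(2), of t] by simp
 also have "... = (LINT x|distr lborel borel (%x::real^2. t + s *\<^sub>R x). s^2 * f x)"
  by (subst integral_density) (auto simp: power2_eq_square)
 also have "... = (LINT u|lborel. s^2 * f (t + s *\<^sub>R u))"
  by (subst integral_distr) auto
 finally show ?thesis by simp
qed

text \<open>Parametrising by the unit disc gives radius 0 the meaning of evaluation at the centre,
  so point masses and discs are treated alike.\<close>

definition disc_avg :: "real^2 => real => (real^2 => real) => real" where
 "disc_avg c r g = (LINT u:ball 0 1|lborel. g (c + r *\<^sub>R u)) / pi"

text \<open>The disc of radius \<open>s\<close> around \<open>c + s v\<close> grows with velocity \<open>(x - c) / s\<close> at the point \<open>x\<close>; the field
 is the integral over \<open>s\<close> of this velocity times the uniform density on the disc.\<close>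

definition conic_weight :: "real^2 => real^2 => real => real => real^2 => real" where
 "conic_weight c v al \<beta> x =
   (LINT s:{al..\<beta>}|lborel. indicator {s. norm (x - c - s *\<^sub>R v) < s} s / (pi * s^3))"

definition conic_field :: "real^2 => real^2 => real => real => real^2 => real^2" where
 "conic_field c v al \<beta> x = conic_weight c v al \<beta> x *\<^sub>R (x - c)"

lemma conic_weight_measurable [measurable]:
 assumes [measurable]: "c \<in> borel_measurable M" "v \<in> borel_measurable M" "x \<in> borel_measurable M"
 shows "(%w. conic_weight (c w) (v w) al \<beta> (x w)) \<in> borel_measurable M"
 unfolding conic_weight_def set_lebesgue_integral_def
proof (rule lborel.borel_measurable_lebesgue_integral)
 have [measurable]: "Measurable.pred (M \<Otimes>\<^sub>M lborel) (%p. norm (x (fst p) - c (fst p) - snd p *\<^sub>R v (fst p)) < snd p)"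
  by measurable
 have "(%p. indicat_real {al..\<beta>} (snd p) *\<^sub>R (indicat_real {s. norm (x (fst p) - c (fst p) - s *\<^sub>R v (fst p)) < s} (snd p) / (pi * snd p ^ 3)))
  = (%p. indicat_real {al..\<beta>} (snd p) *\<^sub>R ((if norm (x (fst p) - c (fst p) - snd p *\<^sub>R v (fst p)) < snd p then 1 else 0) / (pi * snd p ^ 3)))"
  by (auto simp: indicator_def fun_eq_iff)
 also have "... \<in> borel_measurable (M \<Otimes>\<^sub>M lborel)" by measurable
 finally show "(%(w, s). indicat_real {al..\<beta>} s *\<^sub>R (indicat_real {s. norm (x w - c w - s *\<^sub>R v w) < s} s / (pi * s ^ 3)))
  \<in> borel_measurable (M \<Otimes>\<^sub>M lborel)" by (simp add: case_prod_beta')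
qed

lemma conic_field_measurable [measurable]:
 assumes [measurable]: "c \<in> borel_measurable M" "v \<in> borel_measurable M" "x \<in> borel_measurable M"
 shows "(%w. conic_field (c w) (v w) al \<beta> (x w)) \<in> borel_measurable M"
 unfolding conic_field_def by measurable

lemma norm_in_cone_less:
 fixes x c v :: "'a::real_normed_vector"
 assumes "norm (x - c - s *\<^sub>R v) < s"
 shows "0 < s" "norm (x - c) < s * (1 + norm v)"
proof -
 show "0 < s" using assms norm_ge_zero less_le_trans le_less_trans by metis
 then show "norm (x - c) < s * (1 + norm v)"
  using norm_triangle_ineq[of "x - c - s *\<^sub>R v" "s *\<^sub>R v"] assms by (simp add: algebra_simps)
qed

lemma conic_weight_nonneg: "0 <= al ==> 0 <= conic_weight c v al \<beta> x"
 unfolding conic_weight_def set_lebesgue_integral_def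
 by (intro Bochner_Integration.integral_nonneg) (auto simp: indicator_def)

lemma conic_field_eq_0:
 assumes "\<beta> * (1 + norm v) <= norm (x - c)"
 shows "conic_field c v al \<beta> x = 0"
proof -
 have "indicat_real {al..\<beta>} s *\<^sub>R (indicat_real {s. norm (x - c - s *\<^sub>R v) < s} s / (pi * s ^ 3)) = 0" for s
  using norm_in_cone_less[of x c s v] assms mult_right_mono[of s \<beta> "1 + norm v"]
  by (auto simp: indicator_def)
 then show ?thesis unfolding conic_field_def conic_weight_def set_lebesgue_integral_def by (simp only:) simp
qed

lemma conic_field_eq_0':
 assumes "0 <= al" "\<And>s. al <= s ==> s <= \<beta> ==> s <= norm (x - (c + s *\<^sub>R v))"
 shows "conic_field c v al \<beta> x = 0"
proof -
 have "indicat_real {al..\<beta>} s *\<^sub>R (indicat_real {s. norm (x - c - s *\<^sub>R v) < s} s / (pi * s ^ 3)) = 0" for s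
  using assms(2)[of s] by (auto simp: indicator_def algebra_simps)
 then show ?thesis unfolding conic_field_def conic_weight_def set_lebesgue_integral_def by (simp only:) simp
qed

text \<open>If the disc of radius \<open>s\<close> contains \<open>x\<close>, then \<open>s\<close>
  exceeds \<open>norm (x - c) / (1 + norm v)\<close>. So only \<open>s\<close> in
  \<open>{m..}\<close> contribute, and there \<open>1 / (pi * s^3)\<close> integrates to the bound.
  For \<open>v = 0\<close> the resulting field has the sharp size of the field of a unit point
  charge.\<close>

lemma conic_weight_le:
 assumes m: "0 < m" "m <= max al (norm (x - c) / (1 + norm v))" and al: "0 <= al"
 shows "conic_weight c v al \<beta> x <= 1 / (2 * pi * m^2)"
proof -
 let ?f = "%s. indicat_real {al..\<beta>} s *\<^sub>R (indicat_real {s. norm (x - c - s *\<^sub>R v) < s} s / (pi * s ^ 3))"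
 have mea: "?f \<in> borel_measurable lborel"
 proof -
  have "?f = (%s. indicat_real {al..\<beta>} s *\<^sub>R ((if norm (x - c - s *\<^sub>R v) < s then 1 else 0) / (pi * s ^ 3)))"
   by (auto simp: indicator_def fun_eq_iff)
  also have "... \<in> borel_measurable lborel" by measurable
  finally show ?thesis .
 qed
 have "(\<integral>\<^sup>+s. ennreal (?f s) \<partial>lborel) <= (\<integral>\<^sup>+s\<in>{m..}. ennreal (1 / (pi * s^3)) \<partial>lborel)"
 proof (intro nn_integral_mono)
  fix s
  have "m <= s" if "al <= s" "norm (x - c - s *\<^sub>R v) < s"
  proof -
   have "norm (x - c) / (1 + norm v) < s"
    using norm_in_cone_less(2)[OF that(2)] norm_ge_zero[of v] by (subst pos_divide_less_eq) (auto simp: add_pos_nonneg)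
   then show ?thesis using that(1) m(2) by linarith
  qed
  then show "ennreal (?f s) <= ennreal (1 / (pi * s^3)) * indicator {m..} s"
   by (auto simp: indicator_def)
 qed
 also have "... = ennreal (0 - (- (1 / (2 * pi * m^2))))"
 proof (rule nn_integral_FTC_atLeast)
  show "((%s. - (1 / (2 * pi * s^2))) has_real_derivative 1 / (pi * s ^ 3)) (at s)" if "m <= s" for s
   using that m(1) by (auto intro!: derivative_eq_intros simp: field_simps power2_eq_square power3_eq_cube)
  show "((%s. - (1 / (2 * pi * s^2))) \<longlongrightarrow> 0) at_top"
   by (rule tendsto_eq_intros real_tendsto_divide_at_top filterlim_tendsto_pos_mult_at_top[where c = "2 * pi"] filterlim_pow_at_top filterlim_ident | simp)+
  show "0 <= 1 / (pi * s ^ 3)" if "m <= s" for s using that m(1) by simp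
 qed measurable
 finally have "enn2real (\<integral>\<^sup>+s. ennreal (?f s) \<partial>lborel) <= 1 / (2 * pi * m^2)"
  by (intro enn2real_leI) auto
 moreover have "conic_weight c v al \<beta> x = enn2real (\<integral>\<^sup>+s. ennreal (?f s) \<partial>lborel)"
  unfolding conic_weight_def set_lebesgue_integral_def
  by (rule integral_eq_nn_integral[OF mea]) (use al in \<open>auto simp: indicator_def\<close>)
 ultimately show ?thesis by simp
qed

lemma conic_field_le:
 assumes "0 <= al"
 shows "norm (conic_field c v al \<beta> x) <= (1 + norm v) / (2 * pi * max al (norm (x - c) / (1 + norm v)))"
proof -
 define m where "m = max al (norm (x - c) / (1 + norm v))"
 have v: "0 < 1 + norm v" by (simp add: add_pos_nonneg)
 have m0: "0 <= m" unfolding m_def using v by (auto simp: le_max_iff_disj)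
 have mx: "norm (x - c) <= (1 + norm v) * m" unfolding m_def using v
  by (metis max.cobounded2 mult.commute pos_divide_le_eq)
 show ?thesis
 proof (cases "m = 0")
  case True
  then have "x = c" using mx by simp
  then show ?thesis unfolding conic_field_def using assms v by (simp add: le_max_iff_disj)
 next
  case False
  then have "conic_weight c v al \<beta> x <= 1 / (2 * pi * m^2)"
   using assms m0 by (intro conic_weight_le) (auto simp: m_def)
  then have "norm (conic_field c v al \<beta> x) <= 1 / (2 * pi * m^2) * ((1 + norm v) * m)"
   unfolding conic_field_def norm_scaleR abs_of_nonneg[OF conic_weight_nonneg[OF assms]]
   using mx by (intro mult_mono) auto
  also have "... = (1 + norm v) / (2 * pi * m)" using False by (simp add: power2_eq_square)
  finally show ?thesis unfolding m_def .
 qed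
qed

text \<open>In distributional terms: the divergence of \<open>b\<close> is \<open>A - B\<close>.\<close>

definition flow :: "((real^2 => real) => real) => ((real^2 => real) => real) => (real^2 => real^2) => bool" where
 "flow A B b \<longleftrightarrow> b \<in> borel_measurable borel \<and>
   (\<forall>g \<xi>. weak_grad g \<xi> --> integrable lborel (%x. \<xi> x \<bullet> b x) \<and> B g - A g = (LINT x|lborel. \<xi> x \<bullet> b x))"

lemma weak_gradD:
 assumes "weak_grad g \<xi>"
 shows "continuous_on UNIV g" "\<xi> \<in> borel_measurable borel" "g \<in> borel_measurable borel"
  "\<And>R. \<exists>C. \<forall>x. norm x <= R --> norm (\<xi> x) <= C"
  "\<And>x v a b. a <= b ==>
    ((%s. \<xi> (x + s *\<^sub>R v) \<bullet> v) has_integral g (x + b *\<^sub>R v) - g (x + a *\<^sub>R v)) {a..b}"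
 using assms unfolding weak_grad_def by (auto intro: borel_measurable_continuous_onI)

lemma set_integrable_bounded:
 fixes f :: "'a::euclidean_space => 'b::{banach,second_countable_topology}"
 assumes "f \<in> borel_measurable borel" "bounded S" "S \<in> sets borel" "\<And>x. x \<in> S ==> norm (f x) <= C"
 shows "set_integrable lborel S f"
proof (rule set_integrable_bound[where f = "%_. C"])
 have "emeasure lborel S < \<infinity>" using assms(2) by (rule emeasure_bounded_finite)
 then show "set_integrable lborel S (%_. C)"
  unfolding set_integrable_def using assms(3) by (intro integrable_scaleR_left integrable_real_indicator) auto
qed (use assms in \<open>auto simp: set_borel_measurable_def intro!: AE_I2 order_trans[OF _ abs_ge_self]\<close>)

text \<open>In the coordinates \<open>x = c + s *\<^sub>R (v + u)\<close> with \<open>u\<close> in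
  the unit disc, the fundamental theorem along the ray from \<open>c\<close> in direction
  \<open>v + u\<close> gives the difference of the two averages after integration over
  \<open>u\<close>. Passing from \<open>u\<close> to \<open>x\<close> brings the Jacobian
  \<open>s^2\<close>, and \<open>v + u\<close> becomes \<open>(x - c) / s\<close>; together they
  produce the \<open>s^3\<close> in the weight.\<close>

lemma flow_conic_field:
 assumes "0 <= al" "al <= \<beta>"
 shows "flow (disc_avg (c + al *\<^sub>R v) al) (disc_avg (c + \<beta> *\<^sub>R v) \<beta>) (conic_field c v al \<beta>)"
 unfolding flow_def
proof (intro conjI allI impI)
 show "conic_field c v al \<beta> \<in> borel_measurable borel" by measurable
 fix g :: "real^2 => real" and \<xi> assume wg: "weak_grad g \<xi>"
 note [measurable] = weak_gradD(2,3)[OF wg]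
 define M where "M = norm c + \<beta> * (norm v + 1)"
 obtain C0 where C0: "\<And>x. norm x <= M ==> norm (\<xi> x) <= C0" using weak_gradD(4)[OF wg] by blast
 define C where "C = max C0 0"
 have C: "0 <= C" "\<And>x. norm x <= M ==> norm (\<xi> x) <= C" using C0 unfolding C_def by (auto simp: le_max_iff_disj)
 have inM: "norm (c + s *\<^sub>R (v + u)) <= M" if "0 <= s" "s <= \<beta>" "norm u <= 1" for s u
 proof -
  have "norm (c + s *\<^sub>R (v + u)) <= norm c + norm (s *\<^sub>R (v + u))" by (rule norm_triangle_ineq)
  also have "norm (s *\<^sub>R (v + u)) <= \<beta> * (norm v + 1)"
   using that norm_triangle_ineq[of v u] by (auto intro!: mult_mono)
  finally show ?thesis unfolding M_def by simp
 qed
 define F where "F = (%(u :: real^2, s :: real). indicat_real (ball 0 1) u * (indicat_real {al..\<beta>} s * (\<xi> (c + s *\<^sub>R (v + u)) \<bullet> (v + u))))"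
 define D where "D = C * (norm v + 1)"
 have Fb: "\<bar>F (u, s)\<bar> <= D" "norm (F (u, s)) <= D * (indicat_real (ball 0 1) u * indicat_real {al..\<beta>} s)" for u s
 proof -
  show "norm (F (u, s)) <= D * (indicat_real (ball 0 1) u * indicat_real {al..\<beta>} s)"
  proof (cases "u \<in> ball 0 1 \<and> s \<in> {al..\<beta>}")
   case True
   then have "norm u <= 1" "0 <= s" "s <= \<beta>" using assms by auto
   then have "\<bar>\<xi> (c + s *\<^sub>R (v + u)) \<bullet> (v + u)\<bar> <= C * (norm v + 1)"
    using C inM norm_triangle_ineq[of v u]
    by (intro order_trans[OF Cauchy_Schwarz_ineq2] mult_mono) auto
   then show ?thesis using True unfolding F_def D_def by simp
  qed (auto simp: F_def indicator_def)
  also have "... <= D" using C unfolding D_def by (auto simp: indicator_def)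
  finally show "\<bar>F (u, s)\<bar> <= D" by simp
 qed
 have Fm: "F \<in> borel_measurable (lborel \<Otimes>\<^sub>M lborel)"
 proof -
  have "F = (%p. (if norm (fst p) < 1 then 1 else 0) * (indicat_real {al..\<beta>} (snd p) *
    (\<xi> (c + snd p *\<^sub>R (v + fst p)) \<bullet> (v + fst p))))"
   unfolding F_def by (auto simp: indicator_def fun_eq_iff)
  also have "... \<in> borel_measurable (lborel \<Otimes>\<^sub>M lborel)" by measurable
  finally show ?thesis .
 qed
 have Fint: "integrable (lborel \<Otimes>\<^sub>M lborel) F"
 proof (rule Bochner_Integration.integrable_bound)
  have "emeasure lborel (ball (0::real^2) 1) < \<infinity>" by (rule emeasure_lborel_ball_finite)
  moreover have "emeasure lborel {al..\<beta>} < \<infinity>" by (rule emeasure_bounded_finite) simp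
  ultimately have "integrable (lborel \<Otimes>\<^sub>M lborel) (%p. indicat_real (ball (0::real^2) 1 \<times> {al..\<beta>}) p)"
   by (intro integrable_real_indicator) (auto simp: lborel.emeasure_pair_measure_Times ennreal_mult_less_top)
  then show "integrable (lborel \<Otimes>\<^sub>M lborel) (%p. D * indicat_real (ball (0::real^2) 1 \<times> {al..\<beta>}) p)"
   by simp
  show "AE p in lborel \<Otimes>\<^sub>M lborel. norm (F p) <= norm (D * indicat_real (ball (0::real^2) 1 \<times> {al..\<beta>}) p)"
   using Fb(2) by (intro AE_I2) (auto simp: indicator_times split: prod.split intro: order_trans[OF _ abs_ge_self])
 qed (use Fm in auto)
 have ray: "g (c + \<beta> *\<^sub>R (v + u)) - g (c + al *\<^sub>R (v + u)) = (LINT s:{al..\<beta>}|lborel. \<xi> (c + s *\<^sub>R (v + u)) \<bullet> (v + u))"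
  if u: "u \<in> ball 0 1" for u
 proof -
  have "set_integrable lborel {al..\<beta>} (%s. \<xi> (c + s *\<^sub>R (v + u)) \<bullet> (v + u))"
  proof (rule set_integrable_bounded[where C = D])
   show "norm (\<xi> (c + s *\<^sub>R (v + u)) \<bullet> (v + u)) <= D" if "s \<in> {al..\<beta>}" for s
    using Fb(1)[of u s] u that unfolding F_def by simp
  qed auto
  then show ?thesis using weak_gradD(5)[OF wg assms(2), of c "v + u"]
   by (simp add: set_borel_integral_eq_integral(2) integral_unique)
 qed
 have gint: "set_integrable lborel (ball 0 1) (%u. g (c + r *\<^sub>R (v + u)))" for r
 proof -
  have "compact ((%u. g (c + r *\<^sub>R (v + u))) ` cball 0 1)"
   by (intro compact_continuous_image continuous_on_compose2[OF weak_gradD(1)[OF wg]] continuous_intros) auto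
  then obtain B where "\<And>u. u \<in> cball 0 1 ==> norm (g (c + r *\<^sub>R (v + u))) <= B"
   using compact_imp_bounded bounded_iff by (metis (no_types, lifting) imageI)
  then show ?thesis by (intro set_integrable_bounded[where C = B]) auto
 qed
 have "pi * (disc_avg (c + \<beta> *\<^sub>R v) \<beta> g - disc_avg (c + al *\<^sub>R v) al g)
   = (LINT u:ball 0 1|lborel. g (c + \<beta> *\<^sub>R (v + u))) - (LINT u:ball 0 1|lborel. g (c + al *\<^sub>R (v + u)))"
  unfolding disc_avg_def by (simp add: algebra_simps)
 also have "... = (LINT u:ball 0 1|lborel. g (c + \<beta> *\<^sub>R (v + u)) - g (c + al *\<^sub>R (v + u)))"
  using set_integral_diff(2)[OF gint gint] by simp
 also have "... = (LINT u:ball 0 1|lborel. (LINT s:{al..\<beta>}|lborel. \<xi> (c + s *\<^sub>R (v + u)) \<bullet> (v + u)))"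
  by (rule set_lebesgue_integral_cong) (use ray in auto)
 also have "... = (LINT u|lborel. (LINT s|lborel. F (u, s)))"
  unfolding set_lebesgue_integral_def F_def by simp
 also have "... = (LINT s|lborel. (LINT u|lborel. F (u, s)))"
  using lborel_pair.Fubini_integral[of "%s u. F (u, s)"] lborel_pair.integrable_product_swap[OF Fint]
  by (simp add: case_prod_beta')
 finally have 1: "pi * (disc_avg (c + \<beta> *\<^sub>R v) \<beta> g - disc_avg (c + al *\<^sub>R v) al g)
   = (LINT s|lborel. (LINT u|lborel. F (u, s)))" .
 define G where "G = (%(s :: real, x :: real^2). indicat_real {al..\<beta>} s * (indicat_real {x. norm (x - c - s *\<^sub>R v) < s} x * (\<xi> x \<bullet> (x - c)) / s^3))"
 have Gm: "G \<in> borel_measurable (lborel \<Otimes>\<^sub>M lborel)"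
 proof -
  have "G = (%p. indicat_real {al..\<beta>} (fst p) * ((if norm (snd p - c - fst p *\<^sub>R v) < fst p then 1 else 0) * (\<xi> (snd p) \<bullet> (snd p - c)) / fst p^3))"
   unfolding G_def by (auto simp: indicator_def fun_eq_iff)
  also have "... \<in> borel_measurable (lborel \<Otimes>\<^sub>M lborel)" by measurable
  finally show ?thesis .
 qed
 have sub: "(LINT x|lborel. h (G (s, x))) = (LINT u|lborel. s^2 * h (F (u, s) / s^2))"
  if s: "0 < s" and [measurable]: "h \<in> borel_measurable borel" for s and h :: "real => real"
 proof -
  have [measurable]: "(%x. G (s, x)) \<in> borel_measurable borel"
   using measurable_compose[OF measurable_Pair1'[of s lborel lborel] Gm] by simp
  have "(LINT x|lborel. h (G (s, x))) = s^2 * (LINT u|lborel. h (G (s, (c + s *\<^sub>R v) + s *\<^sub>R u)))"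
   using s by (intro integral_lborel_affine_plane) auto
  also have "(LINT u|lborel. h (G (s, (c + s *\<^sub>R v) + s *\<^sub>R u))) = (LINT u|lborel. h (F (u, s) / s^2))"
  proof (intro Bochner_Integration.integral_cong refl arg_cong[where f = h])
   fix u
   have e: "c + s *\<^sub>R v + s *\<^sub>R u = c + s *\<^sub>R (v + u)" by (simp add: algebra_simps)
   have "c + s *\<^sub>R (v + u) - c - s *\<^sub>R v = s *\<^sub>R u" by (simp add: algebra_simps)
   then have "indicat_real {x. norm (x - c - s *\<^sub>R v) < s} (c + s *\<^sub>R (v + u)) = indicat_real (ball 0 1) u"
    using s by (simp add: indicator_def)
   then show "G (s, (c + s *\<^sub>R v) + s *\<^sub>R u) = F (u, s) / s^2"
    using s unfolding G_def F_def e by (simp add: power2_eq_square power3_eq_cube)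
  qed
  finally show ?thesis by simp
 qed
 have Gint: "integrable (lborel \<Otimes>\<^sub>M lborel) G"
 proof (rule lborel_pair.Fubini_integrable[OF Gm])
  have bound: "(LINT x|lborel. norm (G (s, x))) <= indicat_real {al..\<beta>} s * (D * pi)" if "s \<noteq> 0" for s
  proof (cases "s \<in> {al..\<beta>}")
   case True
   then have s: "0 < s" using that assms by auto
   have "(LINT x|lborel. norm (G (s, x))) = (LINT u|lborel. s^2 * norm (F (u, s) / s^2))"
    using sub[OF s, of norm] by simp
   also have "... = (LINT u|lborel. norm (F (u, s)))"
    using s by (intro Bochner_Integration.integral_cong) auto
   also have "... <= (LINT u|lborel. D * indicat_real (ball (0::real^2) 1) u)"
   proof (rule integral_mono')
    show "integrable lborel (%u. D * indicat_real (ball (0::real^2) 1) u)"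
     using emeasure_lborel_ball_finite[of "0::real^2" 1] by (intro integrable_mult_right integrable_real_indicator) auto
    show "norm (F (u, s)) <= D * indicat_real (ball 0 1) u" for u
     using Fb(2)[of u s] True by simp
   qed (use C D_def in auto)
   also have "... = D * pi" by (simp add: content_ball unit_ball_vol_2)
   finally show ?thesis using True by simp
  next
   case False
   then show ?thesis unfolding G_def by simp
  qed
  show "integrable lborel (%s. LINT x|lborel. norm (G (s, x)))"
  proof (rule Bochner_Integration.integrable_bound)
   show "integrable lborel (%s. indicat_real {al..\<beta>} s * (D * pi))"
    by (intro integrable_mult_left integrable_real_indicator emeasure_bounded_finite) auto
   show "(%s. LINT x|lborel. norm (G (s, x))) \<in> borel_measurable lborel"
    using Gm by (intro lborel.borel_measurable_lebesgue_integral) (simp add: case_prod_beta')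
   have "AE s in lborel. s \<noteq> (0::real)" by (rule AE_lborel_singleton)
   then show "AE s in lborel. norm (LINT x|lborel. norm (G (s, x))) <= norm (indicat_real {al..\<beta>} s * (D * pi))"
   proof eventually_elim
    case (elim s)
    have "0 <= (LINT x|lborel. norm (G (s, x)))" by (intro Bochner_Integration.integral_nonneg) auto
    then show ?case using bound[OF elim] by simp
   qed
  qed
  show "AE s in lborel. integrable lborel (%x. G (s, x))"
  proof (intro AE_I2)
   fix s :: real
   show "integrable lborel (%x. G (s, x))"
   proof (cases "s \<in> {al..\<beta>}")
    case True
    have "integrable lborel (%x. indicat_real (ball (c + s *\<^sub>R v) s) x *\<^sub>R ((\<xi> x \<bullet> (x - c)) / s^3))"
    proof (rule set_integrable_bounded[where C = "C * (\<beta> * (1 + norm v)) / s^3", unfolded set_integrable_def])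
     fix x assume "x \<in> ball (c + s *\<^sub>R v) s"
     then have x: "norm (x - c - s *\<^sub>R v) < s" by (simp add: dist_norm norm_minus_commute algebra_simps)
     have s: "0 < s" using norm_in_cone_less(1)[OF x] .
     have "norm (x - c) <= \<beta> * (1 + norm v)"
      using norm_in_cone_less(2)[OF x] True mult_right_mono[of s \<beta> "1 + norm v"] by auto
     moreover from this have "norm x <= M" unfolding M_def using norm_triangle_ineq[of c "x - c"] by (simp add: algebra_simps)
     ultimately have "\<bar>\<xi> x \<bullet> (x - c)\<bar> <= C * (\<beta> * (1 + norm v))"
      using C by (intro order_trans[OF Cauchy_Schwarz_ineq2] mult_mono) auto
     then show "norm ((\<xi> x \<bullet> (x - c)) / s^3) <= C * (\<beta> * (1 + norm v)) / s^3"
      using s by (simp add: divide_right_mono)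
    qed auto
    also have "(%x. indicat_real (ball (c + s *\<^sub>R v) s) x *\<^sub>R ((\<xi> x \<bullet> (x - c)) / s^3)) = (%x. G (s, x))"
     using True unfolding G_def
     by (auto simp: fun_eq_iff indicator_def dist_norm norm_minus_commute algebra_simps)
    finally show ?thesis .
   qed (simp add: G_def)
  qed
 qed
 \<comment> \<open>At \<open>s = 0\<close>, which occurs for \<open>al = 0\<close>, the substitution
   degenerates; this is a null set.\<close>
 have "AE s in lborel. s \<noteq> (0::real)" by (rule AE_lborel_singleton)
 then have "(LINT s|lborel. (LINT u|lborel. F (u, s))) = (LINT s|lborel. (LINT x|lborel. G (s, x)))"
 proof (intro integral_cong_AE)
  show "AE s in lborel. (LINT u|lborel. F (u, s)) = (LINT x|lborel. G (s, x))"
   using \<open>AE s in lborel. s \<noteq> 0\<close>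
  proof eventually_elim
   case (elim s)
   show ?case
   proof (cases "s \<in> {al..\<beta>}")
    case True
    then have "0 < s" using elim assms by auto
    then show ?thesis using sub[of s "%x. x"] by simp
   qed (auto simp: F_def G_def)
  qed
  show "(%s. LINT u|lborel. F (u, s)) \<in> borel_measurable lborel"
   using measurable_compose[OF measurable_pair_swap' Fm]
   by (intro lborel.borel_measurable_lebesgue_integral) (simp add: case_prod_beta')
  show "(%s. LINT x|lborel. G (s, x)) \<in> borel_measurable lborel"
   using Gm by (intro lborel.borel_measurable_lebesgue_integral) (simp add: case_prod_beta')
 qed
 also have "... = (LINT x|lborel. (LINT s|lborel. G (s, x)))"
  using lborel_pair.Fubini_integral[of "%x s. G (s, x)"] lborel_pair.integrable_product_swap[OF Gint]
  by (simp add: case_prod_beta')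
 finally have 2: "(LINT s|lborel. (LINT u|lborel. F (u, s))) = (LINT x|lborel. (LINT s|lborel. G (s, x)))" .
 have inner: "(LINT s|lborel. G (s, x)) = pi * (\<xi> x \<bullet> conic_field c v al \<beta> x)" for x
 proof -
  have "(LINT s|lborel. G (s, x)) = (LINT s|lborel. (pi * (\<xi> x \<bullet> (x - c))) *
    (indicat_real {al..\<beta>} s *\<^sub>R (indicat_real {s. norm (x - c - s *\<^sub>R v) < s} s / (pi * s ^ 3))))"
   unfolding G_def by (intro Bochner_Integration.integral_cong) (auto simp: indicator_def)
  also have "... = (pi * (\<xi> x \<bullet> (x - c))) * conic_weight c v al \<beta> x"
   unfolding conic_weight_def set_lebesgue_integral_def by (rule integral_mult_right_zero)
  finally show ?thesis unfolding conic_field_def by simp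
 qed
 have "integrable lborel (%x. LINT s|lborel. G (s, x))"
  using lborel_pair.integrable_snd[of "%s x. G (s, x)"] Gint by (simp add: case_prod_beta')
 then show "integrable lborel (%x. \<xi> x \<bullet> conic_field c v al \<beta> x)" unfolding inner by simp
 show "disc_avg (c + \<beta> *\<^sub>R v) \<beta> g - disc_avg (c + al *\<^sub>R v) al g = (LINT x|lborel. \<xi> x \<bullet> conic_field c v al \<beta> x)"
  using 1 unfolding 2 inner by simp
qed

section \<open>Matching cost and energy\<close>

definition density_integral :: "(real^2 => real) => (real^2 => real) => real" where
 "density_integral u g = (LINT x|lborel. g x * u x)"

definition compact_density :: "(real^2 => real) => bool" where
 "compact_density u \<longleftrightarrow> integrable lborel u \<and> (\<forall>x. 0 <= u x) \<and> (\<exists>R. \<forall>x. R < norm x --> u x = 0)"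

text \<open>The kinetic energy of a momentum field over a density, as in the dynamic formulation of
  optimal transport. Division by 0 gives 0, so the transport estimates assume that \<open>b\<close>
  vanishes wherever \<open>l\<close> does.\<close>

definition energy :: "(real^2 => real) => (real^2 => real^2) => real" where
 "energy l b = (LINT x|lborel. (norm (b x))^2 / l x)"

lemma continuous_bounded_on_cball:
 fixes g :: "real^2 => real"
 assumes "continuous_on UNIV g"
 obtains C where "0 <= C" "\<And>x. norm x <= R ==> \<bar>g x\<bar> <= C"
proof -
 have "compact (g ` cball 0 R)"
  by (intro compact_continuous_image continuous_on_subset[OF assms]) auto
 then obtain C where C: "\<And>y. y \<in> g ` cball 0 R ==> norm y <= C"
  using compact_imp_bounded bounded_iff by metis
 have "\<bar>g x\<bar> <= max C 0" if "norm x <= R" for x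
  using C[of "g x"] that by (simp add: le_max_iff_disj)
 then show thesis using that[of "max C 0"] by auto
qed

lemma integrable_continuous_compact_density:
 assumes u: "compact_density u" and g: "continuous_on UNIV g"
 shows "integrable lborel (%x. g x * u x)"
proof -
 obtain R where R: "\<And>x. R < norm x ==> u x = 0" using u unfolding compact_density_def by auto
 obtain C where C: "0 <= C" "\<And>x. norm x <= R ==> \<bar>g x\<bar> <= C" using continuous_bounded_on_cball[OF g] by blast
 have [measurable]: "u \<in> borel_measurable borel" "g \<in> borel_measurable borel"
  using u g unfolding compact_density_def by (auto intro: borel_measurable_continuous_onI)
 show ?thesis
 proof (rule Bochner_Integration.integrable_bound)
  show "integrable lborel (%x. C * u x)" using u unfolding compact_density_def by simp
  show "AE x in lborel. norm (g x * u x) <= norm (C * u x)"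
  proof (intro AE_I2)
   fix x
   show "norm (g x * u x) <= norm (C * u x)"
    using C R[of x] by (cases "norm x <= R") (auto simp: abs_mult intro!: mult_right_mono)
  qed
 qed measurable
qed

section \<open>Hopf-Lax potentials along a flow\<close>

lemma integral_diff_add_mult:
 fixes f g h :: "real^2 => real"
 assumes "integrable lborel f" "integrable lborel g" "integrable lborel h"
 shows "(LINT x|lborel. f x - g x + K * h x) = (LINT x|lborel. f x) - (LINT x|lborel. g x) + K * (LINT x|lborel. h x)"
 using assms by simp

text \<open>Pointwise this is \<open>hopf_lax_step\<close> with displacement \<open>b / u\<close>,
  multiplied by the density \<open>u\<close> of arrival. After integration the linear term exchanges
  \<open>u\<close> for \<open>A\<close> by the definition of a flow. Replacing \<open>u\<close> by a
  lower bound \<open>l\<close> in the energy will allow a weight that does not depend on the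
  sample.\<close>

lemma flow_step:
 assumes I: "finite I" "I \<noteq> {}" and t: "0 < t" "0 < h"
  and fl: "flow A (density_integral u) b" and u: "compact_density u"
  and l: "\<And>x. 0 <= l x" "\<And>x. l x <= u x" "\<And>x. l x = 0 ==> b x = 0"
  and E: "integrable lborel (%x. (norm (b x))^2 / l x)"
 shows "density_integral u (hopf_lax I \<phi> p (t + h))
  <= A (hopf_lax I \<phi> p t) + (1 / (2 * t) + 1 / (2 * h)) * energy l b"
proof -
 let ?H = "hopf_lax I \<phi> p t" and ?\<xi> = "hl_grad I \<phi> p t" and ?K = "1 / (2 * t) + 1 / (2 * h)"
 have wg: "weak_grad ?H ?\<xi>" by (rule hopf_lax_weak_grad[OF I t(1)])
 have fl': "integrable lborel (%x. ?\<xi> x \<bullet> b x)"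
  "density_integral u ?H - A ?H = (LINT x|lborel. ?\<xi> x \<bullet> b x)"
  using fl wg unfolding flow_def by auto
 have i1: "integrable lborel (%x. ?H x * u x)" for t
  by (intro integrable_continuous_compact_density u hopf_lax_continuous I)
 have i2: "integrable lborel (%x. hopf_lax I \<phi> p (t + h) x * u x)"
  by (intro integrable_continuous_compact_density u hopf_lax_continuous I)
 have K: "0 <= ?K" using t by simp
 have pw: "hopf_lax I \<phi> p (t + h) x * u x <= ?H x * u x - ?\<xi> x \<bullet> b x + ?K * ((norm (b x))^2 / l x)" for x
 proof (cases "l x = 0")
  case True
  have u0: "0 <= u x" using l(1,2)[of x] by linarith
  have "hopf_lax I \<phi> p (t + h) x <= ?H x" using hopf_lax_step[OF I t, of \<phi> p x 0] by simp
  then show ?thesis using l(3)[OF True] u0 by (simp add: mult_right_mono)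
 next
  case False
  then have l0: "0 < l x" "0 < u x" using l(1,2)[of x] by auto
  have "hopf_lax I \<phi> p (t + h) x * u x
    <= (?H x - ?\<xi> x \<bullet> (b x /\<^sub>R u x) + ?K * (norm (b x /\<^sub>R u x))^2) * u x"
   using hopf_lax_step[OF I t, of \<phi> p x "b x /\<^sub>R u x"] l0 by (intro mult_right_mono) auto
  also have "... = ?H x * u x - ?\<xi> x \<bullet> b x + ?K * ((norm (b x))^2 / u x)"
  proof -
   have "(norm (b x /\<^sub>R u x))^2 * u x = (norm (b x))^2 / u x"
    using l0 by (simp add: power_mult_distrib power2_eq_square field_simps)
   then show ?thesis using l0 by (simp add: algebra_simps)
  qed
  also have "(norm (b x))^2 / u x <= (norm (b x))^2 / l x"
   using l0 l(2)[of x] by (intro divide_left_mono) auto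
  then have "?H x * u x - ?\<xi> x \<bullet> b x + ?K * ((norm (b x))^2 / u x)
    <= ?H x * u x - ?\<xi> x \<bullet> b x + ?K * ((norm (b x))^2 / l x)"
   using K by (intro add_left_mono mult_left_mono) auto
  finally show ?thesis .
 qed
 have "density_integral u (hopf_lax I \<phi> p (t + h))
   <= (LINT x|lborel. ?H x * u x - ?\<xi> x \<bullet> b x + ?K * ((norm (b x))^2 / l x))"
  unfolding density_integral_def using i1 i2 fl'(1) E pw
  by (intro integral_mono Bochner_Integration.integrable_add Bochner_Integration.integrable_diff
    integrable_mult_right) auto
 also have "... = density_integral u ?H - (LINT x|lborel. ?\<xi> x \<bullet> b x) + ?K * energy l b"
  unfolding density_integral_def energy_def by (rule integral_diff_add_mult[OF i1 fl'(1) E])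
 finally show ?thesis using fl'(2) by simp
qed

lemma compact_density_convex:
 assumes "compact_density u" "compact_density v" "0 <= s" "0 <= r"
 shows "compact_density (%x. s * u x + r * v x)"
proof -
 obtain R R' where "\<And>x. R < norm x ==> u x = 0" "\<And>x. R' < norm x ==> v x = 0"
  using assms(1,2) unfolding compact_density_def by auto
 then have "\<And>x. max R R' < norm x ==> s * u x + r * v x = 0" by auto
 then have "\<exists>R. \<forall>x. R < norm x --> s * u x + r * v x = 0" by blast
 then show ?thesis using assms unfolding compact_density_def by simp
qed

lemma density_integral_add:
 assumes "compact_density u" "compact_density v" "continuous_on UNIV g"
 shows "density_integral (%x. s * u x + r * v x) g = s * density_integral u g + r * density_integral v g"
proof -
 have "density_integral (%x. s * u x + r * v x) g = (LINT x|lborel. s * (g x * u x) + r * (g x * v x))"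
  unfolding density_integral_def by (simp add: algebra_simps)
 also have "... = s * density_integral u g + r * density_integral v g"
  unfolding density_integral_def
  using integrable_continuous_compact_density[OF assms(1,3)] integrable_continuous_compact_density[OF assms(2,3)]
  by simp
 finally show ?thesis .
qed

lemma flow_scaleR:
 assumes "flow A B b" "\<And>g. continuous_on UNIV g ==> B' g - A' g = k * (B g - A g)"
 shows "flow A' B' (%x. k *\<^sub>R b x)"
 using assms unfolding flow_def by (auto simp: weak_gradD(1))

text \<open>The linear interpolation from \<open>u\<close> to \<open>v\<close> is run in
  \<open>N\<close> steps of time \<open>h / N\<close> with field \<open>b / N\<close>. One step
  costs \<open>(1 / (2 * t) + N / (2 * h)) / N^2\<close> times the energy, so the sum keeps the main
  term and divides the semiconcavity error by \<open>N\<close>. All interpolated densities stay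
  above \<open>l\<close>.\<close>

lemma flow_multi_step:
 assumes I: "finite I" "I \<noteq> {}" and t: "0 < t" "0 < h" and N: "0 < N"
  and fl: "flow (density_integral u) (density_integral v) b"
  and u: "compact_density u" "compact_density v"
  and l: "\<And>x. 0 <= l x" "\<And>x. l x <= u x" "\<And>x. l x <= v x" "\<And>x. l x = 0 ==> b x = 0"
  and E: "integrable lborel (%x. (norm (b x))^2 / l x)"
 shows "density_integral v (hopf_lax I \<phi> p (t + h))
  <= density_integral u (hopf_lax I \<phi> p t) + (1 / (2 * t * real N) + 1 / (2 * h)) * energy l b"
proof -
 define w where "w k = (%x. (1 - real k / real N) * u x + real k / real N * v x)" for k
 define T where "T k = t + real k * (h / real N)" for k
 have E0: "0 <= energy l b" unfolding energy_def using l(1) by (intro Bochner_Integration.integral_nonneg) auto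
 have wd: "compact_density (w k)" if "k <= N" for k
  unfolding w_def using that N by (intro compact_density_convex u) auto
 have en: "energy l (%x. (1 / real N) *\<^sub>R b x) = energy l b / (real N)^2"
 proof -
  have "(norm ((1 / real N) *\<^sub>R b x))^2 / l x = 1 / (real N)^2 * ((norm (b x))^2 / l x)" for x
   by (simp add: power_mult_distrib power_divide)
  then show ?thesis unfolding energy_def by (simp only: integral_mult_right_zero) simp
 qed
 have main: "k <= N ==> density_integral (w k) (hopf_lax I \<phi> p (T k))
  <= density_integral u (hopf_lax I \<phi> p t) + real k * ((1 / (2 * t) + real N / (2 * h)) * (energy l b / (real N)^2))" for k
 proof (induction k)
  case 0
  then show ?case by (simp add: w_def T_def)
 next
  case (Suc k)
  have T0: "t <= T k" unfolding T_def using t N by simp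
  have "flow (density_integral (w k)) (density_integral (w (Suc k))) (%x. (1 / real N) *\<^sub>R b x)"
  proof (rule flow_scaleR[OF fl])
   fix g :: "real^2 => real" assume g: "continuous_on UNIV g"
   show "density_integral (w (Suc k)) g - density_integral (w k) g = 1 / real N * (density_integral v g - density_integral u g)"
    unfolding w_def density_integral_add[OF u g] using N by (simp add: field_simps)
  qed
  moreover have "l x <= w (Suc k) x" for x
  proof -
   have "l x = (1 - real (Suc k) / real N) * l x + real (Suc k) / real N * l x" by (simp add: algebra_simps)
   also have "... <= w (Suc k) x" unfolding w_def using l(2,3)[of x] Suc.prems N
    by (intro add_mono mult_left_mono) auto
   finally show ?thesis .
  qed
  moreover have "integrable lborel (%x. (norm ((1 / real N) *\<^sub>R b x))^2 / l x)"
   using integrable_mult_right[OF E, of "1 / (real N)^2"] by (simp add: power_mult_distrib power_divide)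
  ultimately have "density_integral (w (Suc k)) (hopf_lax I \<phi> p (T k + h / real N))
   <= density_integral (w k) (hopf_lax I \<phi> p (T k)) + (1 / (2 * T k) + 1 / (2 * (h / real N))) * energy l (%x. (1 / real N) *\<^sub>R b x)"
   using t T0 N Suc.prems l(1,4) by (intro flow_step I wd) auto
  also have "(1 / (2 * T k) + 1 / (2 * (h / real N))) * energy l (%x. (1 / real N) *\<^sub>R b x)
   <= (1 / (2 * t) + real N / (2 * h)) * (energy l b / (real N)^2)"
   unfolding en using T0 t E0 by (intro mult_right_mono add_mono) (auto simp: frac_le)
  finally show ?case using Suc by (simp add: T_def algebra_simps add_divide_distrib)
 qed
 have wN: "w N = v" "T N = t + h" unfolding w_def T_def using N by auto
 have "real N * ((1 / (2 * t) + real N / (2 * h)) * (energy l b / (real N)^2))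
   = (1 / (2 * t * real N) + 1 / (2 * h)) * energy l b"
  using N t by (simp add: field_simps power2_eq_square)
 then show ?thesis using main[of N] unfolding wN by simp
qed

lemma disc_avg_le:
 assumes "continuous_on UNIV g" "\<And>u. u \<in> ball 0 1 ==> g (c + r *\<^sub>R u) <= K"
 shows "disc_avg c r g <= K"
proof -
 have [measurable]: "g \<in> borel_measurable borel" using assms(1) by (intro borel_measurable_continuous_onI)
 obtain C where C: "\<And>x. norm x <= norm c + \<bar>r\<bar> ==> \<bar>g x\<bar> <= C" using continuous_bounded_on_cball[OF assms(1)] by blast
 have "(LINT u:ball 0 1|lborel. g (c + r *\<^sub>R u)) <= (LINT u:ball (0::real^2) 1|lborel. K)"
 proof (rule set_integral_mono)
  have "norm (c + r *\<^sub>R u) <= norm c + \<bar>r\<bar>" if "u \<in> ball 0 1" for u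
   using that norm_triangle_ineq[of c "r *\<^sub>R u"] mult_left_le[of "norm u" "\<bar>r\<bar>"] by simp
  then show "set_integrable lborel (ball 0 1) (%u. g (c + r *\<^sub>R u))"
   using C by (intro set_integrable_bounded[where C = C]) auto
 qed (use assms(2) in \<open>auto intro!: set_integrable_bounded\<close>)
 also have "... = pi * K" unfolding set_lebesgue_integral_def by (simp add: content_ball unit_ball_vol_2)
 finally show ?thesis unfolding disc_avg_def by (simp add: divide_le_eq mult.commute)
qed

text \<open>Half of the time budget is spent on the way from the point masses to the common density \<open>w\<close>:
 first the discs, then one rough step to \<open>u\<close>, then \<open>N\<close> fine steps.\<close>

lemma one_sided_bound:
 fixes p c :: "nat => real^2"
 assumes n: "1 <= n" and \<theta>: "0 < \<theta>" "\<theta> < 1 / 4" and N: "0 < N"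
  and near: "\<And>i u. i \<in> {1..n} ==> u \<in> ball 0 1 ==> norm (c i + r *\<^sub>R u - p i) <= kap"
  and fl: "flow (%g. (\<Sum>i\<in>{1..n}. disc_avg (c i) r g) / real n) (density_integral u) b1"
   "flow (density_integral u) (density_integral w) bm"
  and u: "compact_density u" "compact_density w"
  and l: "\<And>x. 0 <= l x" "\<And>x. l x <= u x" "\<And>x. l x <= w x"
   "\<And>x. l x = 0 ==> b1 x = 0" "\<And>x. l x = 0 ==> bm x = 0"
  and E: "integrable lborel (%x. (norm (b1 x))^2 / l x)" "integrable lborel (%x. (norm (bm x))^2 / l x)"
 shows "density_integral w (hopf_lax {1..n} \<phi> p (1 / 2))
  <= (\<Sum>i\<in>{1..n}. \<phi> i) / real n + kap^2 / (2 * \<theta>) + energy l b1 / \<theta>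
   + (1 / (4 * \<theta> * real N) + 1 / (1 - 4 * \<theta>)) * energy l bm"
proof -
 have I: "finite {1..n}" "{1..n} \<noteq> {}" using n by auto
 have "disc_avg (c i) r (hopf_lax {1..n} \<phi> p \<theta>) <= \<phi> i + kap^2 / (2 * \<theta>)" if i: "i \<in> {1..n}" for i
 proof (rule disc_avg_le[OF hopf_lax_continuous[OF I]])
  fix v :: "real^2" assume v: "v \<in> ball 0 1"
  have "hopf_lax {1..n} \<phi> p \<theta> (c i + r *\<^sub>R v) <= \<phi> i + (norm (c i + r *\<^sub>R v - p i))^2 / (2 * \<theta>)"
   by (rule hopf_lax_le[OF I(1) i])
  also have "(norm (c i + r *\<^sub>R v - p i))^2 / (2 * \<theta>) <= kap^2 / (2 * \<theta>)"
   using near[OF i v] \<theta> by (intro divide_right_mono power_mono) auto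
  finally show "hopf_lax {1..n} \<phi> p \<theta> (c i + r *\<^sub>R v) <= \<phi> i + kap^2 / (2 * \<theta>)" by simp
 qed
 then have "(\<Sum>i\<in>{1..n}. disc_avg (c i) r (hopf_lax {1..n} \<phi> p \<theta>)) <= (\<Sum>i\<in>{1..n}. \<phi> i + kap^2 / (2 * \<theta>))"
  by (rule sum_mono)
 also have "... = (\<Sum>i\<in>{1..n}. \<phi> i) + real n * (kap^2 / (2 * \<theta>))" by (simp add: sum.distrib)
 finally have 1: "(\<Sum>i\<in>{1..n}. disc_avg (c i) r (hopf_lax {1..n} \<phi> p \<theta>)) / real n <= (\<Sum>i\<in>{1..n}. \<phi> i) / real n + kap^2 / (2 * \<theta>)"
  using n by (simp add: field_simps)
 have "density_integral u (hopf_lax {1..n} \<phi> p (\<theta> + \<theta>))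
  <= (\<Sum>i\<in>{1..n}. disc_avg (c i) r (hopf_lax {1..n} \<phi> p \<theta>)) / real n + (1 / (2 * \<theta>) + 1 / (2 * \<theta>)) * energy l b1"
  using \<theta> l E by (intro flow_step[OF I _ _ fl(1)] u) auto
 then have 2: "density_integral u (hopf_lax {1..n} \<phi> p (2 * \<theta>))
  <= (\<Sum>i\<in>{1..n}. disc_avg (c i) r (hopf_lax {1..n} \<phi> p \<theta>)) / real n + energy l b1 / \<theta>"
  by (simp add: mult_2[symmetric])
 have "density_integral w (hopf_lax {1..n} \<phi> p (2 * \<theta> + (1 / 2 - 2 * \<theta>)))
  <= density_integral u (hopf_lax {1..n} \<phi> p (2 * \<theta>)) + (1 / (2 * (2 * \<theta>) * real N) + 1 / (2 * (1 / 2 - 2 * \<theta>))) * energy l bm"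
  using \<theta> l E N by (intro flow_multi_step[OF I _ _ _ fl(2)] u) auto
 moreover have "2 * (1 / 2 - 2 * \<theta>) = 1 - 4 * \<theta>" "2 * (2 * \<theta>) = 4 * \<theta>" "2 * \<theta> + (1 / 2 - 2 * \<theta>) = 1 / 2" by auto
 ultimately show ?thesis using 1 2 by simp
qed

section \<open>The optimal matching cost and its bound by energies\<close>

definition match_cost :: "nat => (nat => real^2) => (nat => real^2) => real" where
 "match_cost n x y = Min ((%\<sigma>. \<Sum>i\<in>{1..n}. (norm (x i - y (\<sigma> i)))^2) ` {\<sigma>. \<sigma> permutes {1..n}})"

lemma match_cost_attained:
 obtains \<sigma> where "\<sigma> permutes {1..n}" "match_cost n x y = (\<Sum>i\<in>{1..n}. (norm (x i - y (\<sigma> i)))^2)"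
proof -
 have "match_cost n x y \<in> (%\<sigma>. \<Sum>i\<in>{1..n}. (norm (x i - y (\<sigma> i)))^2) ` {\<sigma>. \<sigma> permutes {1..n}}"
  unfolding match_cost_def using permutes_id[of "{1..n}"]
  by (intro Min_in finite_imageI finite_permutations) blast+
 then show thesis using that by auto
qed

lemma match_cost_le:
 "\<sigma> permutes {1..n} ==> match_cost n x y <= (\<Sum>i\<in>{1..n}. (norm (x i - y (\<sigma> i)))^2)"
 unfolding match_cost_def by (intro Min_le) (auto intro: finite_permutations)

text \<open>Both dual potentials evolve for time 1/2 towards a common density, where their sum is
  nonnegative. With half of the field on each side the main term is the energy of \<open>b\<close>
  with a factor that tends to 1 as \<open>\<theta>\<close> tends to 0 and
  \<open>\<theta> * N\<close> to infinity; everything before the averaged densities is multiplied by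
  \<open>1 / \<theta>\<close> and must be small by itself.\<close>

lemma match_cost_upper:
 fixes x y cx cy :: "nat => real^2"
 assumes n: "1 <= n" and \<theta>: "0 < \<theta>" "\<theta> < 1 / 4" and N: "0 < N"
  and near: "\<And>i a. i \<in> {1..n} ==> a \<in> ball 0 1 ==> norm (cx i + r *\<^sub>R a - x i) <= kap"
   "\<And>i a. i \<in> {1..n} ==> a \<in> ball 0 1 ==> norm (cy i + r *\<^sub>R a - y i) <= kap"
  and fl: "flow (%g. (\<Sum>i\<in>{1..n}. disc_avg (cx i) r g) / real n) (density_integral u) bx"
   "flow (%g. (\<Sum>i\<in>{1..n}. disc_avg (cy i) r g) / real n) (density_integral v) by"
   "flow (density_integral u) (density_integral v) b"
  and u: "compact_density u" "compact_density v"
  and l: "\<And>x. 0 <= l x" "\<And>x. l x <= u x" "\<And>x. l x <= v x"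
   "\<And>x. l x = 0 ==> bx x = 0" "\<And>x. l x = 0 ==> by x = 0" "\<And>x. l x = 0 ==> b x = 0"
  and E: "integrable lborel (%x. (norm (bx x))^2 / l x)" "integrable lborel (%x. (norm (by x))^2 / l x)"
   "integrable lborel (%x. (norm (b x))^2 / l x)"
 shows "match_cost n x y / real n <= 2 * kap^2 / \<theta> + 2 / \<theta> * (energy l bx + energy l by)
   + (1 / (4 * \<theta> * real N) + 1 / (1 - 4 * \<theta>)) * energy l b"
proof -
 obtain \<pi> where \<pi>: "\<pi> permutes {1..n}" "match_cost n x y = (\<Sum>i\<in>{1..n}. (norm (x i - y (\<pi> i)))^2)"
  using match_cost_attained .
 \<comment> \<open>Half the squared distance is the cost generated by the Hopf-Lax formula at time
   1.\<close>
 define cc where "cc i j = (norm (x i - y j))^2 / 2" for i j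
 have "(\<Sum>i\<in>{1..n}. cc i (\<pi> i)) <= (\<Sum>i\<in>{1..n}. cc i (q i))" if "q permutes {1..n}" for q
  using match_cost_le[OF that, of x y] \<pi>(2) unfolding cc_def by (simp flip: sum_divide_distrib)
 then obtain al \<beta> where ab: "\<And>i j. i \<in> {1..n} ==> j \<in> {1..n} ==> al i + \<beta> j <= cc i j"
  "(\<Sum>i\<in>{1..n}. al i) + (\<Sum>i\<in>{1..n}. \<beta> i) = (\<Sum>i\<in>{1..n}. cc i (\<pi> i))"
  using assignment_duality[of "{1..n}" \<pi> cc] \<pi>(1) by auto
 define \<phi> where "\<phi> i = - al i" for i
 define \<psi> where "\<psi> i = - \<beta> i" for i
 \<comment> \<open>The meeting density is the mean of \<open>u\<close> and \<open>v\<close>, so each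
   side uses half of the field and a quarter of the energy.\<close>
 define w where "w = (%x. 1 / 2 * u x + 1 / 2 * v x)"
 have w: "compact_density w" unfolding w_def by (intro compact_density_convex u) auto
 have lw: "l x <= w x" for x using l(2,3)[of x] unfolding w_def by simp
 have eh: "energy l (%x. k *\<^sub>R b x) = energy l b / 4" "integrable lborel (%x. (norm (k *\<^sub>R b x))^2 / l x)"
  if "k = 1 / 2 \<or> k = - (1 / 2)" for k
 proof -
  have "k^2 = 1 / 4" using that by (elim disjE; hypsubst; simp add: power2_eq_square)
  then have e: "(norm (k *\<^sub>R b x))^2 / l x = 1 / 4 * ((norm (b x))^2 / l x)" for x
   by (simp only: norm_scaleR power_mult_distrib power2_abs)
  show "energy l (%x. k *\<^sub>R b x) = energy l b / 4"
   unfolding energy_def e by (simp only: integral_mult_right_zero)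
  show "integrable lborel (%x. (norm (k *\<^sub>R b x))^2 / l x)" unfolding e by (rule integrable_mult_right, rule E(3))
 qed
 have hw: "density_integral w g = 1 / 2 * density_integral u g + 1 / 2 * density_integral v g"
  if "continuous_on UNIV g" for g
  unfolding w_def by (rule density_integral_add[OF u that])
 have fx: "flow (density_integral u) (density_integral w) (%x. (1 / 2) *\<^sub>R b x)"
  by (rule flow_scaleR[OF fl(3)]) (simp add: hw field_simps)
 have fy: "flow (density_integral v) (density_integral w) (%x. (- (1 / 2)) *\<^sub>R b x)"
  by (rule flow_scaleR[OF fl(3)]) (simp add: hw field_simps)
 let ?K = "1 / (4 * \<theta> * real N) + 1 / (1 - 4 * \<theta>)"
 have 1: "density_integral w (hopf_lax {1..n} \<phi> x (1 / 2))
  <= (\<Sum>i\<in>{1..n}. \<phi> i) / real n + kap^2 / (2 * \<theta>) + energy l bx / \<theta> + ?K * energy l (%x. (1 / 2) *\<^sub>R b x)"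
  by (intro one_sided_bound[OF n \<theta> N near(1) fl(1) fx] u w E eh(2)) (use l lw in auto)
 have 2: "density_integral w (hopf_lax {1..n} \<psi> y (1 / 2))
  <= (\<Sum>i\<in>{1..n}. \<psi> i) / real n + kap^2 / (2 * \<theta>) + energy l by / \<theta> + ?K * energy l (%x. (- (1 / 2)) *\<^sub>R b x)"
  by (intro one_sided_bound[OF n \<theta> N near(2) fl(2) fy] u w E eh(2)) (use l lw in auto)
 have "0 <= (LINT z|lborel. (hopf_lax {1..n} \<phi> x (1 / 2) z + hopf_lax {1..n} \<psi> y (1 / 2) z) * w z)"
 proof (intro Bochner_Integration.integral_nonneg mult_nonneg_nonneg)
  fix z
  show "0 <= hopf_lax {1..n} \<phi> x (1 / 2) z + hopf_lax {1..n} \<psi> y (1 / 2) z"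
  proof (rule hopf_lax_add_nonneg)
   show "0 <= \<phi> i + \<psi> j + (norm (x i - y j))^2 / 2" if "i \<in> {1..n}" "j \<in> {1..n}" for i j
    using ab(1)[OF that] unfolding cc_def \<phi>_def \<psi>_def by simp
  qed (use n in auto)
  show "0 <= w z" using w unfolding compact_density_def by auto
 qed
 also have "... = density_integral w (hopf_lax {1..n} \<phi> x (1 / 2)) + density_integral w (hopf_lax {1..n} \<psi> y (1 / 2))"
  unfolding density_integral_def distrib_right
  using n by (intro Bochner_Integration.integral_add integrable_continuous_compact_density w hopf_lax_continuous) auto
 finally have 3: "0 <= density_integral w (hopf_lax {1..n} \<phi> x (1 / 2)) + density_integral w (hopf_lax {1..n} \<psi> y (1 / 2))" .
 have 4: "(\<Sum>i\<in>{1..n}. \<phi> i) / real n + (\<Sum>i\<in>{1..n}. \<psi> i) / real n = - (match_cost n x y / real n / 2)"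
 proof -
  have "(\<Sum>i\<in>{1..n}. \<phi> i) + (\<Sum>i\<in>{1..n}. \<psi> i) = - ((\<Sum>i\<in>{1..n}. al i) + (\<Sum>i\<in>{1..n}. \<beta> i))"
   unfolding \<phi>_def \<psi>_def by (simp add: sum_negf)
  also have "... = - (match_cost n x y / 2)"
   unfolding ab(2) \<pi>(2) cc_def by (simp add: sum_divide_distrib)
  finally show ?thesis by (simp flip: add_divide_distrib)
 qed
 have e: "energy l (%x. (1 / 2) *\<^sub>R b x) = energy l b / 4" "energy l (%x. (- (1 / 2)) *\<^sub>R b x) = energy l b / 4"
  by (rule eh(1), simp)+
 define Q where "Q = ?K * energy l b"
 have f: "kap^2 / (2 * \<theta>) = kap^2 / \<theta> / 2" "?K * (energy l b / 4) = Q / 4"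
  "2 * kap^2 / \<theta> = 2 * (kap^2 / \<theta>)"
  "2 / \<theta> * (energy l bx + energy l by) = 2 * (energy l bx / \<theta>) + 2 * (energy l by / \<theta>)"
  unfolding Q_def by (simp_all add: distrib_left)
 have arith: "m <= 2 * k + (2 * ex + 2 * ey) + q"
  if "d1 <= s1 + k / 2 + ex + q / 4" "d2 <= s2 + k / 2 + ey + q / 4" "0 <= d1 + d2" "s1 + s2 = - (m / 2)"
  for m k ex ey q d1 d2 s1 s2 :: real
  using that by linarith
 show ?thesis using 1 2 3 4 unfolding e f Q_def[symmetric] by (rule arith)
qed

section \<open>Cells in Lipschitz domains\<close>

text \<open>The interior cone condition, with one axis for all points near \<open>p\<close>. At a
  boundary point the axis is the vertical direction of the chart; at an interior point any direction
  works.\<close>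

lemma lipschitz_boundary_cone:
 assumes lip: "lipschitz_boundary Om" and op: "open Om" and p: "p \<in> closure Om"
 shows "\<exists>r>0. \<exists>lam>0. \<exists>e. lam <= 1 \<and> norm e = 1 \<and>
  (\<forall>z\<in>Om \<inter> ball p r. \<forall>s. 0 <= s \<and> s <= r --> ball (z + s *\<^sub>R e) (lam * s) \<subseteq> Om)"
proof (cases "p \<in> Om")
 case True
 then obtain d where d: "0 < d" "ball p d \<subseteq> Om" using op open_contains_ball by blast
 define e :: "real^2" where "e = axis 1 1"
 have e: "norm e = 1" unfolding e_def by simp
 have "ball (z + s *\<^sub>R e) (1 * s) \<subseteq> Om" if "z \<in> ball p (d / 3)" "0 <= s" "s <= d / 3" for z s
 proof
  fix w assume w: "w \<in> ball (z + s *\<^sub>R e) (1 * s)"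
  have "dist p w <= dist p z + dist z (z + s *\<^sub>R e) + dist (z + s *\<^sub>R e) w" by metric
  moreover have "dist z (z + s *\<^sub>R e) = s" using e that by (simp add: dist_norm)
  ultimately have "dist p w < d" using that w by simp
  then show "w \<in> Om" using d by auto
 qed
 then show ?thesis using d e by (intro exI[of _ "d / 3"] conjI exI[of _ 1] exI[of _ e]) auto
next
 case False
 then have "p \<in> frontier Om" using p op by (simp add: frontier_def interior_open)
 then obtain r T g L where r: "0 < r" and T: "orthogonal_transformation (T :: real^2 => real^2)"
  and g: "L-lipschitz_on UNIV (g :: real => real)"
  and eq: "Om \<inter> ball p r = {x \<in> ball p r. g (T x $ 1) < T x $ 2}"
  using lip unfolding lipschitz_boundary_def by blast
 have L: "0 <= L" using g lipschitz_on_nonneg by blast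
 have linT: "linear T" using T by (rule orthogonal_transformation_linear)
 have normT: "norm (T x) = norm x" for x using T by (rule orthogonal_transformation_norm)
 obtain e where e: "T e = axis 2 1" using orthogonal_transformation_surj[OF T] by (metis surjD)
 have ne: "norm e = 1" using normT[of e] e by simp
 \<comment> \<open>Moving up by \<open>s\<close> and then anywhere by less than
   \<open>lam * s\<close> gains more than \<open>s - lam * s\<close> in height, while the graph
   rises by at most \<open>L * lam * s\<close>. For this \<open>lam\<close> the two quantities
   agree.\<close>
 define lam where "lam = 1 / (1 + L)"
 have lam: "0 < lam" "lam <= 1" "(1 + L) * lam = 1" unfolding lam_def using L by auto
 have "ball (z + s *\<^sub>R e) (lam * s) \<subseteq> Om" if z: "z \<in> Om" "z \<in> ball p (r / 3)" and s: "0 <= s" "s <= r / 3" for z s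
 proof
  fix w assume w: "w \<in> ball (z + s *\<^sub>R e) (lam * s)"
  define d where "d = w - z - s *\<^sub>R e"
  have d: "norm d < lam * s" using w unfolding d_def by (simp add: dist_norm norm_minus_commute algebra_simps)
  have wz: "w = z + s *\<^sub>R e + d" unfolding d_def by simp
  have "lam * s <= s" using lam s by (simp add: mult_left_le_one_le)
  have "dist p w <= dist p z + dist z (z + s *\<^sub>R e) + dist (z + s *\<^sub>R e) w" by metric
  moreover have "dist z (z + s *\<^sub>R e) = s" using ne s by (simp add: dist_norm)
  ultimately have pw: "w \<in> ball p r" using z s w \<open>lam * s <= s\<close> by simp
  have Tw: "T w = T z + s *\<^sub>R axis 2 1 + T d" unfolding wz linear_add[OF linT] linear_scale[OF linT] e ..
  have cd: "\<bar>T d $ 1\<bar> < lam * s" "\<bar>T d $ 2\<bar> < lam * s"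
   using component_le_norm_cart[of "T d" 1] component_le_norm_cart[of "T d" 2] d normT[of d] by linarith+
  have "\<bar>g (T w $ 1) - g (T z $ 1)\<bar> <= L * \<bar>T w $ 1 - T z $ 1\<bar>"
   using lipschitz_onD[OF g, of "T w $ 1" "T z $ 1"] by (simp add: dist_real_def)
  also have "T w $ 1 - T z $ 1 = T d $ 1" unfolding Tw by (simp add: axis_def)
  also have "L * \<bar>T d $ 1\<bar> <= L * (lam * s)" using cd L by (intro mult_left_mono) auto
  finally have "g (T w $ 1) <= g (T z $ 1) + L * lam * s" by (simp add: mult.assoc)
  moreover have "g (T z $ 1) < T z $ 2"
  proof -
   have "z \<in> Om \<inter> ball p r" using z r by auto
   then show ?thesis unfolding eq by simp
  qed
  moreover have "T w $ 2 = T z $ 2 + s + T d $ 2" unfolding Tw by (simp add: axis_def)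
  moreover have "L * lam * s = s - lam * s"
  proof -
   have "s = ((1 + L) * lam) * s" using lam(3) by simp
   then show ?thesis by (simp add: algebra_simps)
  qed
  ultimately have "g (T w $ 1) < T w $ 2" using cd by linarith
  then show "w \<in> Om" using pw eq by blast
 qed
 then show ?thesis using r lam ne
  by (intro exI[of _ "r / 3"] conjI exI[of _ lam] exI[of _ e]) auto
qed

text \<open>The axis may depend on \<open>y\<close> but is shared by all points of the domain near
  \<open>y\<close>, so that a whole grid square can be moved along a single axis.\<close>

definition uniform_cone :: "(real^2) set => real => real => real => bool" where
 "uniform_cone Om h lam R \<longleftrightarrow> 0 < h \<and> 0 < lam \<and> lam <= 1 \<and> 0 < R \<and>
  (\<forall>y\<in>Om. \<exists>e. norm e = 1 \<and> (\<forall>z\<in>Om \<inter> ball y R. \<forall>s. 0 <= s \<and> s <= h --> ball (z + s *\<^sub>R e) (lam * s) \<subseteq> Om))"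

text \<open>A finite cover of the compact closure by half-radius balls: a point close to
  \<open>y\<close> is still in the full ball of the cover that serves \<open>y\<close>, and minima
  over the cover give common constants.\<close>

lemma uniform_cone_exists:
 assumes "lipschitz_boundary Om" "open Om" "bounded Om"
 shows "\<exists>h lam R. uniform_cone Om h lam R"
proof -
 have "\<forall>p\<in>closure Om. \<exists>r lam e. 0 < r \<and> 0 < lam \<and> lam <= 1 \<and> norm e = 1 \<and>
  (\<forall>z\<in>Om \<inter> ball p r. \<forall>s. 0 <= s \<and> s <= r --> ball (z + s *\<^sub>R e) (lam * s) \<subseteq> Om)"
  using lipschitz_boundary_cone[OF assms(1,2)] by blast
 then obtain r lam e where rl: "\<And>p. p \<in> closure Om ==> 0 < r p \<and> 0 < lam p \<and> lam p <= 1 \<and> norm (e p) = (1::real) \<and>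
  (\<forall>z\<in>Om \<inter> ball p (r p). \<forall>s. 0 <= s \<and> s <= r p --> ball (z + s *\<^sub>R e p) (lam p * s) \<subseteq> Om)"
  by metis
 have "compact (closure Om)" using assms(3) by (simp add: compact_closure)
 then obtain P where P: "P \<subseteq> closure Om" "finite P" "closure Om \<subseteq> (\<Union>p\<in>P. ball p (r p / 2))"
  by (rule compactE_image[of "closure Om" "closure Om" "%p. ball p (r p / 2)"])
   (use rl in \<open>auto intro: centre_in_ball[THEN iffD2]\<close>)
 define h where "h = Min (insert 1 (r ` P))"
 define l where "l = Min (insert 1 (lam ` P))"
 have hl: "0 < h" "0 < l" "l <= 1" unfolding h_def l_def using P rl by (auto simp: subset_iff)
 have hl': "h <= r p" "l <= lam p" if "p \<in> P" for p unfolding h_def l_def using P(2) that by auto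
 have "\<exists>e. norm e = 1 \<and> (\<forall>z\<in>Om \<inter> ball y (h / 2). \<forall>s. 0 <= s \<and> s <= h --> ball (z + s *\<^sub>R e) (l * s) \<subseteq> Om)"
  if y: "y \<in> Om" for y
 proof -
  obtain p where p: "p \<in> P" "y \<in> ball p (r p / 2)" using y P(3) closure_subset[of Om] by blast
  have pc: "p \<in> closure Om" using p P by auto
  have "ball (z + s *\<^sub>R e p) (l * s) \<subseteq> Om" if z: "z \<in> Om" "z \<in> ball y (h / 2)" and s: "0 <= s" "s <= h" for z s
  proof -
   have "dist p z <= dist p y + dist y z" by metric
   then have "z \<in> ball p (r p)" using z p(2) hl'(1)[OF p(1)] by simp
   then have "ball (z + s *\<^sub>R e p) (lam p * s) \<subseteq> Om" using rl[OF pc] z(1) s hl'(1)[OF p(1)] by auto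
   moreover have "l * s <= lam p * s" using hl'(2)[OF p(1)] s by (simp add: mult_right_mono)
   ultimately show ?thesis by auto
  qed
  then show ?thesis using rl[OF pc] by (intro exI[of _ "e p"]) auto
 qed
 then have "uniform_cone Om h l (h / 2)" unfolding uniform_cone_def using hl by auto
 then show ?thesis by blast
qed

section \<open>Square grids and cells\<close>

lemma norm_plane_less:
 fixes x :: "real^2"
 assumes "\<bar>x $ 1\<bar> <= k" "\<bar>x $ 2\<bar> <= k" "0 < k"
 shows "norm x < 3 / 2 * k"
proof (rule power2_less_imp_less)
 have "(x $ 1)^2 <= k^2" "(x $ 2)^2 <= k^2" using assms by (simp_all flip: abs_le_square_iff)
 then have "(norm x)^2 <= 2 * k^2" by (simp add: norm_vec_def L2_set_def UNIV_2)
 also have "... < (3 / 2 * k)^2" using assms(3) by (simp add: power2_eq_square)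
 finally show "(norm x)^2 < (3 / 2 * k)^2" .
qed (use assms in simp)

definition grid_index :: "real => real^2 => int \<times> int" where
 "grid_index eps z = (\<lfloor>z $ 1 / eps\<rfloor>, \<lfloor>z $ 2 / eps\<rfloor>)"

definition grid_center :: "real => int \<times> int => real^2" where
 "grid_center eps k = vector [eps * (real_of_int (fst k) + 1 / 2), eps * (real_of_int (snd k) + 1 / 2)]"

lemma grid_index_eq_iff:
 assumes "0 < eps"
 shows "grid_index eps z = k \<longleftrightarrow> eps * real_of_int (fst k) <= z $ 1 \<and> z $ 1 < eps * (real_of_int (fst k) + 1) \<and> eps * real_of_int (snd k) <= z $ 2 \<and> z $ 2 < eps * (real_of_int (snd k) + 1)"
 using assms unfolding grid_index_def by (auto simp: prod_eq_iff floor_eq_iff field_simps)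

lemma grid_center_components:
 "grid_center eps k $ 1 = eps * (real_of_int (fst k) + 1 / 2)" "grid_center eps k $ 2 = eps * (real_of_int (snd k) + 1 / 2)"
 unfolding grid_center_def by simp_all

lemma ball_grid_center:
 assumes "0 < eps" "w \<in> ball (grid_center eps k) (eps / 2)"
 shows "grid_index eps w = k"
proof -
 have "norm (w - grid_center eps k) < eps / 2" using assms(2) by (simp add: dist_norm norm_minus_commute)
 then have "\<bar>(w - grid_center eps k) $ 1\<bar> < eps / 2" "\<bar>(w - grid_center eps k) $ 2\<bar> < eps / 2"
  using component_le_norm_cart le_less_trans by blast+
 then have "\<bar>w $ 1 - eps * (real_of_int (fst k) + 1 / 2)\<bar> < eps / 2" "\<bar>w $ 2 - eps * (real_of_int (snd k) + 1 / 2)\<bar> < eps / 2"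
  by (simp_all add: grid_center_components)
 then show ?thesis unfolding grid_index_eq_iff[OF assms(1)] by (simp add: algebra_simps abs_less_iff) argo
qed

lemma grid_index_dist:
 assumes "0 < eps"
 shows "grid_index eps z = grid_index eps w ==> norm (z - w) < 3 / 2 * eps"
  and "norm (z - grid_center eps (grid_index eps z)) < 3 / 4 * eps"
proof -
 note g = grid_index_eq_iff[OF assms, of _ "grid_index eps z"]
 note z = g[of z, simplified]
 show "norm (z - w) < 3 / 2 * eps" if "grid_index eps z = grid_index eps w"
  using z g[of w] that by (intro norm_plane_less assms) (auto simp: algebra_simps abs_le_iff)
 have "norm (z - grid_center eps (grid_index eps z)) < 3 / 2 * (eps / 2)"
 proof (rule norm_plane_less)
  show "\<bar>(z - grid_center eps (grid_index eps z)) $ 1\<bar> <= eps / 2"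
   "\<bar>(z - grid_center eps (grid_index eps z)) $ 2\<bar> <= eps / 2"
   using z unfolding abs_le_iff
   by (simp_all add: grid_center_components distrib_left)
 qed (use assms in simp)
 then show "norm (z - grid_center eps (grid_index eps z)) < 3 / 4 * eps" by simp
qed

lemma grid_index_convex:
 assumes "0 < eps" "grid_index eps z = k" "grid_index eps w = k" "0 <= s" "s <= 1"
 shows "grid_index eps ((1 - s) *\<^sub>R z + s *\<^sub>R w) = k"
proof -
 have aux: "a <= (1 - s) * x + s * y \<and> (1 - s) * x + s * y < b" if "a <= x" "x < b" "a <= y" "y < b" for a b x y :: real
 proof -
  have "x \<in> {a..<b}" "y \<in> {a..<b}" using that by auto
  then have "(1 - s) *\<^sub>R x + s *\<^sub>R y \<in> {a..<b}"
   using assms(4,5) convex_real_interval(5)[of a b] by (intro convexD) auto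
  then show ?thesis by auto
 qed
 show ?thesis using assms(2,3) unfolding grid_index_eq_iff[OF assms(1)] by (auto intro!: aux[THEN conjunct1] aux[THEN conjunct2])
qed

lemma grid_index_measurable: "grid_index eps \<in> measurable borel (count_space UNIV)"
proof -
 have "grid_index eps -` {k} = {z. \<lfloor>z $ 1 / eps\<rfloor> = fst k} \<inter> {z. \<lfloor>z $ 2 / eps\<rfloor> = snd k}" for k
  unfolding grid_index_def by (auto simp: prod_eq_iff)
 moreover have "{z :: real^2. \<lfloor>z $ i / eps\<rfloor> = m} \<in> sets borel" for i m by measurable
 ultimately show ?thesis
  by (subst measurable_count_space_eq2_countable) auto
qed

lemma finite_grid_index:
 assumes "bounded S" "0 < eps"
 shows "finite (grid_index eps ` S)"
proof -
 obtain B where B: "\<And>z. z \<in> S ==> norm z <= B" using assms(1) bounded_iff by blast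
 have "grid_index eps ` S \<subseteq> {\<lfloor>- B / eps\<rfloor>..\<lfloor>B / eps\<rfloor>} \<times> {\<lfloor>- B / eps\<rfloor>..\<lfloor>B / eps\<rfloor>}"
 proof
  fix k assume "k \<in> grid_index eps ` S"
  then obtain z where z: "z \<in> S" "k = grid_index eps z" by auto
  have "\<bar>z $ i\<bar> <= B" for i using B[OF z(1)] component_le_norm_cart[of z i] by linarith
  then have "- B <= z $ i" "z $ i <= B" for i by (simp_all add: abs_le_iff minus_le_iff)
  then have "- B / eps <= z $ i / eps" "z $ i / eps <= B / eps" for i
   using assms(2) by (simp_all only: divide_right_mono less_imp_le)
  then show "k \<in> {\<lfloor>- B / eps\<rfloor>..\<lfloor>B / eps\<rfloor>} \<times> {\<lfloor>- B / eps\<rfloor>..\<lfloor>B / eps\<rfloor>}"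
   unfolding z(2) grid_index_def by (auto intro: floor_mono)
 qed
 then show ?thesis by (rule finite_subset) auto
qed

text \<open>Cells are the fibres of \<open>kap\<close> in the domain, and each contains the disc of
  radius \<open>eps / 2\<close> around its centre. The last clause keeps inside the domain the discs
  that grow linearly from the point \<open>z\<close> to the disc of its cell; it makes the
  corresponding conic field vanish outside.\<close>

definition cell_structure :: "(real^2) set => real => real => (real^2 => int \<times> int) => (int \<times> int => real^2) => bool" where
 "cell_structure Om C eps kap ctr \<longleftrightarrow> kap \<in> measurable borel (count_space UNIV) \<and> finite (kap ` Om) \<and>
   (\<forall>z\<in>Om. ball (ctr (kap z)) (eps / 2) \<subseteq> Om \<and> (\<forall>w\<in>ball (ctr (kap z)) (eps / 2). kap w = kap z) \<and>
    dist z (ctr (kap z)) <= C * eps \<and>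
    (\<forall>s. 0 <= s \<and> s <= 1 --> ball ((1 - s) *\<^sub>R z + s *\<^sub>R ctr (kap z)) (s * (eps / 2)) \<subseteq> Om))"

text \<open>Grid squares inside the domain are cells of their own; every other square is merged into a
 square of the domain that lies in the interior cone of one of its points.\<close>

lemma cell_structure_exists:
 assumes uc: "uniform_cone Om h lam R" and bd: "bounded Om"
  and eps: "0 < eps" "3 / lam * eps <= h" "3 / 2 * eps < R"
 shows "\<exists>kap. cell_structure Om (3 / lam + 3) eps kap (grid_center eps)"
proof -
 have lam: "0 < lam" "lam <= 1" using uc unfolding uniform_cone_def by auto
 obtain e where e: "\<And>y. y \<in> Om ==> norm (e y) = 1"
  "\<And>y z s. y \<in> Om ==> z \<in> Om ==> z \<in> ball y R ==> 0 <= s ==> s <= h ==> ball (z + s *\<^sub>R e y) (lam * s) \<subseteq> Om"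
  using uc unfolding uniform_cone_def by (metis IntI)
 \<comment> \<open>At distance \<open>K * eps\<close> along the axis the cone contains a ball of
   radius \<open>3 * eps\<close>. That is more than the diameter of a square, and also more than the
   accumulated displacement \<open>(1 / 2 + 3 / 2 + 3 / 4) * eps\<close> that occurs when the cone
   is based at another point of the square and aimed at a point of the disc of the new cell.\<close>
 define K where "K = 3 / lam"
 have K: "0 < K" "lam * (K * eps) = 3 * eps" "K * eps <= h" unfolding K_def using lam eps by auto
 define full where "full k \<longleftrightarrow> (\<forall>z. grid_index eps z = k --> z \<in> Om)" for k
 define y where "y k = (SOME y. y \<in> Om \<and> grid_index eps y = k)" for k
 define c where "c k = y k + (K * eps) *\<^sub>R e (y k)" for k
 define \<pi> where "\<pi> k = (if full k then k else grid_index eps (c k))" for k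
 define kap where "kap z = \<pi> (grid_index eps z)" for z
 have y: "y (grid_index eps z) \<in> Om" "grid_index eps (y (grid_index eps z)) = grid_index eps z" if "z \<in> Om" for z
  using someI[of "%y. y \<in> Om \<and> grid_index eps y = grid_index eps z" z] that unfolding y_def by auto
 have fullc: "full (grid_index eps (c (grid_index eps z)))" if z: "z \<in> Om" for z
  unfolding full_def
 proof (intro allI impI)
  fix w assume "grid_index eps w = grid_index eps (c (grid_index eps z))"
  then have "norm (w - c (grid_index eps z)) < 3 * eps" using grid_index_dist(1)[OF eps(1)] eps(1) by fastforce
  then have "w \<in> ball (y (grid_index eps z) + (K * eps) *\<^sub>R e (y (grid_index eps z))) (lam * (K * eps))"
   unfolding K(2) c_def by (simp add: dist_norm norm_minus_commute)
  moreover have "ball (y (grid_index eps z) + (K * eps) *\<^sub>R e (y (grid_index eps z))) (lam * (K * eps)) \<subseteq> Om"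
   by (rule e(2)[OF y(1)[OF z] y(1)[OF z]]) (use K eps in auto)
  ultimately show "w \<in> Om" by blast
 qed
 have fullk: "full (kap z)" if "z \<in> Om" for z unfolding kap_def \<pi>_def using fullc[OF that] by auto
 have "kap \<in> measurable borel (count_space UNIV)"
  unfolding kap_def[abs_def] using grid_index_measurable by (rule measurable_compose) simp
 moreover have "finite (kap ` Om)"
  using finite_grid_index[OF bd eps(1)] unfolding kap_def by (metis finite_imageI image_image)
 moreover have "ball (grid_center eps (kap z)) (eps / 2) \<subseteq> Om \<and> (\<forall>w\<in>ball (grid_center eps (kap z)) (eps / 2). kap w = kap z) \<and>
    dist z (grid_center eps (kap z)) <= (3 / lam + 3) * eps \<and>
    (\<forall>s. 0 <= s \<and> s <= 1 --> ball ((1 - s) *\<^sub>R z + s *\<^sub>R grid_center eps (kap z)) (s * (eps / 2)) \<subseteq> Om)"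
  if z: "z \<in> Om" for z
 proof (intro conjI)
  show b1: "ball (grid_center eps (kap z)) (eps / 2) \<subseteq> Om"
   using ball_grid_center[OF eps(1)] fullk[OF z] unfolding full_def by blast
  show "\<forall>w\<in>ball (grid_center eps (kap z)) (eps / 2). kap w = kap z"
  proof
   fix w assume "w \<in> ball (grid_center eps (kap z)) (eps / 2)"
   then have "grid_index eps w = kap z" by (rule ball_grid_center[OF eps(1)])
   then show "kap w = kap z" unfolding kap_def[of w] \<pi>_def using fullk[OF z] by simp
  qed
  show "dist z (grid_center eps (kap z)) <= (3 / lam + 3) * eps"
  proof (cases "full (grid_index eps z)")
   case True
   then have "dist z (grid_center eps (kap z)) <= 3 * eps"
    using grid_index_dist(2)[OF eps(1), of z] eps(1) unfolding kap_def \<pi>_def by (simp add: dist_norm)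
   also have "... <= (3 / lam + 3) * eps" using lam eps(1) by (intro mult_right_mono) auto
   finally show ?thesis .
  next
   case False
   let ?y = "y (grid_index eps z)" and ?c = "c (grid_index eps z)"
   have "dist z (grid_center eps (kap z)) <= dist z ?y + dist ?y ?c + dist ?c (grid_center eps (kap z))" by metric
   moreover have "dist z ?y < 3 / 2 * eps" using grid_index_dist(1)[OF eps(1), of z ?y] y(2)[OF z] by (simp add: dist_norm)
   moreover have "dist ?y ?c = K * eps" unfolding c_def using e(1)[OF y(1)[OF z]] K eps by (simp add: dist_norm)
   moreover have "dist ?c (grid_center eps (kap z)) < 3 / 4 * eps"
    using grid_index_dist(2)[OF eps(1), of ?c] False unfolding kap_def \<pi>_def by (simp add: dist_norm)
   ultimately have "dist z (grid_center eps (kap z)) <= K * eps + 3 * eps" using eps(1) by linarith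
   then show ?thesis unfolding K_def by (simp add: algebra_simps)
  qed
  show "\<forall>s. 0 <= s \<and> s <= 1 --> ball ((1 - s) *\<^sub>R z + s *\<^sub>R grid_center eps (kap z)) (s * (eps / 2)) \<subseteq> Om"
  proof (intro allI impI subsetI)
   fix s w assume s: "0 <= s \<and> s <= 1" and w: "w \<in> ball ((1 - s) *\<^sub>R z + s *\<^sub>R grid_center eps (kap z)) (s * (eps / 2))"
   have s0: "0 < s" using w s eps(1) by (cases "s = 0") auto
   define g where "g = grid_center eps (kap z)"
   define u where "u = (w - ((1 - s) *\<^sub>R z + s *\<^sub>R g)) /\<^sub>R s"
   have "norm (w - ((1 - s) *\<^sub>R z + s *\<^sub>R g)) < s * (eps / 2)"
    using w unfolding g_def by (simp add: dist_norm norm_minus_commute)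
   then have "norm (w - ((1 - s) *\<^sub>R z + s *\<^sub>R g)) / s < eps / 2" using s0 by (simp add: divide_less_eq mult.commute)
   then have u: "norm u < eps / 2" 
    unfolding u_def norm_scaleR abs_inverse using s0 by (simp only: divide_inverse_commute abs_of_pos)
   have wu: "w = (1 - s) *\<^sub>R z + s *\<^sub>R (g + u)" unfolding u_def using s0 by (simp add: algebra_simps)
   have gu: "grid_index eps (g + u) = kap z"
   proof (rule ball_grid_center[OF eps(1)])
    have "dist g (g + u) = norm u" by (simp add: dist_norm)
    then show "g + u \<in> ball (grid_center eps (kap z)) (eps / 2)" using u unfolding g_def[symmetric] by simp
   qed
   show "w \<in> Om"
   proof (cases "full (grid_index eps z)")
    case True
    then have "kap z = grid_index eps z" unfolding kap_def \<pi>_def by simp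
    then have "grid_index eps w = grid_index eps z"
     unfolding wu using gu s grid_index_convex[OF eps(1) refl, where z = z and w = "g + u" and s = s] by simp
    then show ?thesis using True unfolding full_def by blast
   next
    \<comment> \<open>The axis belongs to the representative \<open>?y\<close> of the square, but
      the cone is based at \<open>z\<close>; at height \<open>s * (K * eps)\<close> its ball
      contains \<open>w\<close>.\<close>
    case False
    let ?y = "y (grid_index eps z)" and ?c = "c (grid_index eps z)"
    have 1: "norm (z - ?y) < 3 / 2 * eps" using grid_index_dist(1)[OF eps(1), of z ?y] y(2)[OF z] by simp
    have 2: "norm (?c - g) < 3 / 4 * eps"
     using grid_index_dist(2)[OF eps(1), of ?c] False unfolding g_def kap_def \<pi>_def by simp
    have eq: "g + u - z - (K * eps) *\<^sub>R e ?y = (u - (z - ?y)) - (?c - g)" unfolding c_def by (simp add: algebra_simps)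
    have "norm (g + u - z - (K * eps) *\<^sub>R e ?y) <= norm u + norm (z - ?y) + norm (?c - g)"
     unfolding eq using norm_triangle_ineq4[of "u - (z - ?y)" "?c - g"] norm_triangle_ineq4[of u "z - ?y"] by linarith
    then have 3: "norm (g + u - z - (K * eps) *\<^sub>R e ?y) < 3 * eps" using 1 2 u eps(1) by linarith
    have "w - (z + (s * (K * eps)) *\<^sub>R e ?y) = s *\<^sub>R (g + u - z - (K * eps) *\<^sub>R e ?y)"
     unfolding wu by (simp add: algebra_simps)
    then have "norm (w - (z + (s * (K * eps)) *\<^sub>R e ?y)) = s * norm (g + u - z - (K * eps) *\<^sub>R e ?y)"
     using s0 by simp
    also have "... < s * (3 * eps)" using 3 s0 by (rule mult_strict_left_mono)
    also have "... = lam * (s * (K * eps))" unfolding K(2)[symmetric] by (simp only: mult.left_commute)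
    finally have "w \<in> ball (z + (s * (K * eps)) *\<^sub>R e ?y) (lam * (s * (K * eps)))"
     by (simp add: dist_norm norm_minus_commute)
    moreover have "ball (z + (s * (K * eps)) *\<^sub>R e ?y) (lam * (s * (K * eps))) \<subseteq> Om"
    proof (rule e(2)[OF y(1)[OF z] z])
     show "z \<in> ball ?y R" using 1 eps(3) by (simp add: dist_norm norm_minus_commute)
     show "0 <= s * (K * eps)" using s K eps by simp
     show "s * (K * eps) <= h" 
     proof -
      have "s * (K * eps) <= 1 * (K * eps)" by (rule mult_right_mono) (use s K(1) eps(1) in auto)
      then show ?thesis using K(3) by linarith
     qed
    qed
    ultimately show ?thesis by blast
   qed
  qed
 qed
 ultimately show ?thesis unfolding cell_structure_def by blast
qed

section \<open>Bounded flows from discs in the domain to a fixed disc\<close>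

lemma flow_trans:
 assumes "flow A B b" "flow B C b'"
 shows "flow A C (%x. b x + b' x)"
 using assms unfolding flow_def by (fastforce simp: inner_add_right)

lemma flow_reverse:
 assumes "flow A B b"
 shows "flow B A (%x. - b x)"
 using flow_scaleR[OF assms, of A B "-1"] by simp

lemma radial_flow:
 assumes "0 < r" "0 < r'" "ball c (max r r') \<subseteq> Om"
 shows "\<exists>b. flow (disc_avg c r) (disc_avg c r') b \<and> (\<forall>x. norm (b x) <= 1 / (2 * pi * min r r')) \<and>
  (\<forall>x. x \<notin> Om --> b x = 0)"
proof -
 have *: "flow (disc_avg c r) (disc_avg c r') (conic_field c 0 r r') \<and>
   (\<forall>x. norm (conic_field c 0 r r' x) <= 1 / (2 * pi * r)) \<and> (\<forall>x. x \<notin> Om --> conic_field c 0 r r' x = 0)"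
  if r: "0 < r" "r <= r'" "ball c r' \<subseteq> Om" for r r'
 proof (intro conjI allI impI)
  show "flow (disc_avg c r) (disc_avg c r') (conic_field c 0 r r')"
   using flow_conic_field[of r r' c 0] r by simp
  fix x
  have "norm (conic_field c 0 r r' x) <= 1 / (2 * pi * max r (norm (x - c)))"
   using conic_field_le[of r c 0 r' x] r by simp
  also have "... <= 1 / (2 * pi * r)" using r by (intro divide_left_mono) auto
  finally show "norm (conic_field c 0 r r' x) <= 1 / (2 * pi * r)" .
  assume "x \<notin> Om"
  then have "r' <= norm (x - c)" using r(3) by (auto simp: dist_norm norm_minus_commute subset_iff not_less)
  then show "conic_field c 0 r r' x = 0" using r by (intro conic_field_eq_0') auto
 qed
 show ?thesis
 proof (cases "r <= r'")
  case True
  then show ?thesis using *[of r r'] assms by (auto simp: max_def min_def)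
 next
  case False
  then have "flow (disc_avg c r') (disc_avg c r) (conic_field c 0 r' r) \<and>
   (\<forall>x. norm (conic_field c 0 r' r x) <= 1 / (2 * pi * r')) \<and> (\<forall>x. x \<notin> Om --> conic_field c 0 r' r x = 0)"
   using assms by (intro *) (auto simp: max_def)
  then show ?thesis using False flow_reverse
   by (intro exI[of _ "%x. - conic_field c 0 r' r x"]) (auto simp: min_def)
 qed
qed

text \<open>Translation realised by a conic field: the velocity is such that the centre travels from
  \<open>c\<close> to \<open>c'\<close> while the radius doubles, and the apex \<open>c0\<close>
  extrapolates this motion back to radius 0. The change of radius is undone by
  \<open>radial_flow\<close>.\<close>

lemma move_flow:
 assumes d: "0 < d" "ball a d \<subseteq> Om" and c: "c \<in> ball a (d / 4)" "c' \<in> ball a (d / 4)"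
 shows "\<exists>b. flow (disc_avg c (d / 16)) (disc_avg c' (d / 8)) b \<and> (\<forall>x. norm (b x) <= 9 / (2 * pi * (d / 16))) \<and>
  (\<forall>x. x \<notin> Om --> b x = 0)"
proof -
 define v where "v = (16 / d) *\<^sub>R (c' - c)"
 define c0 where "c0 = c - (d / 16) *\<^sub>R v"
 define b where "b = conic_field c0 v (d / 16) (d / 8)"
 have e: "c0 + (d / 16) *\<^sub>R v = c" "c0 + (d / 8) *\<^sub>R v = c'"
 proof -
  show "c0 + (d / 16) *\<^sub>R v = c" unfolding c0_def by simp
  have "c0 + (d / 8) *\<^sub>R v = c0 + (d / 16) *\<^sub>R v + (d / 16) *\<^sub>R v"
   by (simp add: add.assoc flip: scaleR_add_left)
  also have "... = c + (c' - c)" unfolding c0_def v_def using d(1) by simp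
  finally show "c0 + (d / 8) *\<^sub>R v = c'" by simp
 qed
 have "dist c' c <= dist a c' + dist a c" by metric
 then have "norm (c' - c) <= d / 2" using c by (simp add: dist_norm)
 then have "16 / d * norm (c' - c) <= 16 / d * (d / 2)" using d(1) by (intro mult_left_mono) auto
 moreover have "norm v = 16 / d * norm (c' - c)" unfolding v_def norm_scaleR using d(1) by simp
 ultimately have v: "norm v <= 8" using d(1) by simp
 have "flow (disc_avg c (d / 16)) (disc_avg c' (d / 8)) b"
  using flow_conic_field[of "d / 16" "d / 8" c0 v] d(1) unfolding e b_def by simp
 moreover have "norm (b x) <= 9 / (2 * pi * (d / 16))" for x
 proof -
  have "norm (b x) <= (1 + norm v) / (2 * pi * max (d / 16) (norm (x - c0) / (1 + norm v)))"
   unfolding b_def using d(1) by (intro conic_field_le) auto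
  also have "... <= 9 / (2 * pi * (d / 16))" using d(1) v by (intro frac_le mult_left_mono) auto
  finally show ?thesis .
 qed
 moreover have "b x = 0" if x: "x \<notin> Om" for x
  unfolding b_def
 proof (rule conic_field_eq_0')
  fix s assume s: "d / 16 <= s" "s <= d / 8"
  define t where "t = (s - d / 16) * (16 / d)"
  have t: "0 <= t" "t <= 1" unfolding t_def using s d(1) by (auto simp: field_simps)
  have "c0 + s *\<^sub>R v = c + (s - d / 16) *\<^sub>R v" unfolding c0_def by (simp add: algebra_simps)
  also have "... = (1 - t) *\<^sub>R c + t *\<^sub>R c'" unfolding t_def v_def by (simp add: algebra_simps)
  also have "... \<in> ball a (d / 4)" by (rule convexD[OF convex_ball c]) (use t in auto)
  finally have "dist a (c0 + s *\<^sub>R v) < d / 4" by simp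
  moreover have "d <= dist a x" using x d(2) by (auto simp: subset_iff not_less)
  moreover have "dist a x <= dist a (c0 + s *\<^sub>R v) + dist x (c0 + s *\<^sub>R v)" by metric
  ultimately show "s <= norm (x - (c0 + s *\<^sub>R v))" using s d(1) by (simp add: dist_norm)
 qed (use d in auto)
 ultimately show ?thesis by blast
qed

lemma flow_bounded_trans:
 assumes "\<exists>b. flow A B b \<and> (\<forall>x. norm (b x) <= C) \<and> (\<forall>x. x \<notin> Om --> b x = 0)"
  "\<exists>b. flow B D b \<and> (\<forall>x. norm (b x) <= C') \<and> (\<forall>x. x \<notin> Om --> b x = 0)"
 shows "\<exists>b. flow A D b \<and> (\<forall>x. norm (b x) <= C + C') \<and> (\<forall>x. x \<notin> Om --> b x = 0)"
proof -
 obtain b b' where b: "flow A B b" "\<And>x. norm (b x) <= C" "\<And>x. x \<notin> Om ==> b x = 0"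
  and b': "flow B D b'" "\<And>x. norm (b' x) <= C'" "\<And>x. x \<notin> Om ==> b' x = 0"
  using assms by blast
 show ?thesis using flow_trans[OF b(1) b'(1)] b b'
  by (intro exI[of _ "%x. b x + b' x"]) (auto intro!: norm_triangle_mono)
qed

definition reachable :: "(real^2) set => ((real^2 => real) => real) => real^2 => bool" where
 "reachable Om W c \<longleftrightarrow> (\<exists>r>0. ball c r \<subseteq> Om \<and>
  (\<exists>C b. flow (disc_avg c r) W b \<and> (\<forall>x. norm (b x) <= C) \<and> (\<forall>x. x \<notin> Om --> b x = 0)))"

text \<open>Move to \<open>c1\<close>, adjust the radius, continue from there. The bounds of the
  first two fields depend only on \<open>d\<close> and \<open>r\<close>, so one constant serves all
  \<open>c\<close> of the ball.\<close>

lemma reachable_near: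
 assumes d: "0 < d" "ball a d \<subseteq> Om" and c1: "c1 \<in> ball a (d / 4)" "reachable Om W c1"
 shows "\<exists>C. \<forall>c\<in>ball a (d / 4). \<exists>b. flow (disc_avg c (d / 16)) W b \<and> (\<forall>x. norm (b x) <= C) \<and> (\<forall>x. x \<notin> Om --> b x = 0)"
proof -
 obtain r C where r: "0 < r" "ball c1 r \<subseteq> Om"
  "\<exists>b. flow (disc_avg c1 r) W b \<and> (\<forall>x. norm (b x) <= C) \<and> (\<forall>x. x \<notin> Om --> b x = 0)"
  using c1(2) unfolding reachable_def by blast
 have "ball c1 (d / 8) \<subseteq> ball a d" using c1(1) d(1) by (intro ball_subset_ball_iff[THEN iffD2]) (simp add: dist_commute)
 then have "ball c1 (max (d / 8) r) \<subseteq> Om" using r(2) d(2) by (auto simp: max_def)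
 then have 2: "\<exists>b. flow (disc_avg c1 (d / 8)) (disc_avg c1 r) b \<and> (\<forall>x. norm (b x) <= 1 / (2 * pi * min (d / 8) r)) \<and> (\<forall>x. x \<notin> Om --> b x = 0)"
  using d(1) r(1) by (intro radial_flow) auto
 show ?thesis
  using flow_bounded_trans[OF move_flow[OF d _ c1(1)] flow_bounded_trans[OF 2 r(3)]] by blast
qed

text \<open>The centres that can be joined to the target form an open subset of \<open>Om\<close>
  with open complement in \<open>Om\<close>, so connectedness gives all of \<open>Om\<close>. The
  admissible centres for radius \<open>R\<close> form a compact set, and a finite cover makes the
  bound independent of \<open>c\<close>. Since the target disc is the same for every cell, the
  fields of different cells can later be subtracted.\<close>

lemma macro_flow:
 assumes op: "open Om" and con: "connected Om" and bd: "bounded Om" and w: "0 < rw" "ball cw rw \<subseteq> Om" and R: "0 < R"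
 shows "\<exists>C. \<forall>c. ball c R \<subseteq> Om --> (\<exists>b. flow (disc_avg c R) (disc_avg cw rw) b \<and> (\<forall>x. norm (b x) <= C) \<and> (\<forall>x. x \<notin> Om --> b x = 0))"
proof -
 let ?W = "disc_avg cw rw"
 have base: "reachable Om ?W cw"
  unfolding reachable_def using w radial_flow[of rw rw cw Om] by auto
 obtain d where d: "\<And>a. a \<in> Om ==> 0 < d a" "\<And>a. a \<in> Om ==> ball a (d a) \<subseteq> Om"
  using op open_contains_ball by metis
 have near: "reachable Om ?W c" if a: "a \<in> Om" and c1: "c1 \<in> ball a (d a / 4)" "reachable Om ?W c1" and c: "c \<in> ball a (d a / 4)" for a c c1
 proof -
  have "ball c (d a / 16) \<subseteq> ball a (d a)" using c d(1)[OF a]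
   by (intro ball_subset_ball_iff[THEN iffD2]) (simp add: dist_commute)
  moreover obtain C where "\<forall>c\<in>ball a (d a / 4). \<exists>b. flow (disc_avg c (d a / 16)) ?W b \<and>
    (\<forall>x. norm (b x) <= C) \<and> (\<forall>x. x \<notin> Om --> b x = 0)"
   using reachable_near[OF d(1)[OF a] d(2)[OF a] c1] by blast
  then have "\<exists>C b. flow (disc_avg c (d a / 16)) ?W b \<and> (\<forall>x. norm (b x) <= C) \<and> (\<forall>x. x \<notin> Om --> b x = 0)"
   using c by blast
  ultimately show ?thesis using d[OF a] unfolding reachable_def
   by (intro exI[of _ "d a / 16"]) auto
 qed
 define S where "S = {c \<in> Om. reachable Om ?W c}"
 have opS: "open S"
 proof (rule openI)
  fix a assume a: "a \<in> S"
  have "ball a (d a / 4) \<subseteq> S"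
   using near[of a a] a d[of a] unfolding S_def by fastforce
  then show "\<exists>e>0. ball a e \<subseteq> S" using d(1)[of a] a unfolding S_def by (intro exI[of _ "d a / 4"]) auto
 qed
 have opC: "open (Om - S)"
 proof (rule openI)
  fix a assume a: "a \<in> Om - S"
  have "c \<in> Om - S" if c: "c \<in> ball a (d a / 4)" for c
  proof -
   have "c \<in> Om" using c d[of a] a by (auto simp: subset_iff)
   moreover have "\<not> reachable Om ?W c" using near[of a c a] c a d(1)[of a] unfolding S_def by auto
   ultimately show ?thesis unfolding S_def by auto
  qed
  then have "ball a (d a / 4) \<subseteq> Om - S" by blast
  then show "\<exists>e>0. ball a e \<subseteq> Om - S" using d(1)[of a] a by (intro exI[of _ "d a / 4"]) auto
 qed
 have "cw \<in> S" using base w unfolding S_def by (auto simp: subset_iff)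
 then have "Om - S = {}" using connectedD[OF con opS opC] unfolding S_def by auto
 then have all: "reachable Om ?W c" if "c \<in> Om" for c using that unfolding S_def by auto
 define K where "K = {c. ball c R \<subseteq> Om}"
 have KO: "K \<subseteq> Om" unfolding K_def using R centre_in_ball by blast
 have "- K = (\<Union>x\<in>- Om. ball x R)" unfolding K_def by (auto simp: dist_commute)
 then have "closed K" unfolding closed_def by auto
 moreover have "bounded K" using KO bd bounded_subset by blast
 ultimately have "compact K" using compact_eq_bounded_closed by blast
 moreover have "K \<subseteq> (\<Union>p\<in>K. ball p (d p / 4))"
 proof
  fix x assume "x \<in> K"
  then show "x \<in> (\<Union>p\<in>K. ball p (d p / 4))" using d(1)[of x] KO by (intro UN_I[of x]) auto
 qed
 ultimately have "\<exists>P\<subseteq>K. finite P \<and> K \<subseteq> (\<Union>p\<in>P. ball p (d p / 4))"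
  by (elim compactE_image) auto
 then obtain P where P: "P \<subseteq> K" "finite P" "K \<subseteq> (\<Union>p\<in>P. ball p (d p / 4))"
  by blast
 have "\<exists>C. \<forall>c\<in>ball p (d p / 4) \<inter> K. \<exists>b. flow (disc_avg c R) ?W b \<and> (\<forall>x. norm (b x) <= C) \<and> (\<forall>x. x \<notin> Om --> b x = 0)"
  if p: "p \<in> Om" for p
 proof -
  obtain C where C: "\<forall>c\<in>ball p (d p / 4). \<exists>b. flow (disc_avg c (d p / 16)) ?W b \<and> (\<forall>x. norm (b x) <= C) \<and> (\<forall>x. x \<notin> Om --> b x = 0)"
   using reachable_near[OF d[OF p] _ all[OF p]] d(1)[OF p] by auto
  have "\<exists>b. flow (disc_avg c R) ?W b \<and> (\<forall>x. norm (b x) <= 1 / (2 * pi * min R (d p / 16)) + C) \<and> (\<forall>x. x \<notin> Om --> b x = 0)"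
   if c: "c \<in> ball p (d p / 4) \<inter> K" for c
  proof -
   have "ball c (d p / 16) \<subseteq> ball p (d p)" using c d(1)[OF p]
    by (intro ball_subset_ball_iff[THEN iffD2]) (simp add: dist_commute)
   then have "ball c (max R (d p / 16)) \<subseteq> Om" using c d(2)[OF p] unfolding K_def by (auto simp: max_def)
   then show ?thesis using flow_bounded_trans[OF radial_flow[OF R] C[THEN bspec]] c d(1)[OF p] by simp
  qed
  then show ?thesis by blast
 qed
 then obtain C where C: "\<And>p c. p \<in> Om ==> c \<in> ball p (d p / 4) \<inter> K ==>
   \<exists>b. flow (disc_avg c R) ?W b \<and> (\<forall>x. norm (b x) <= C p) \<and> (\<forall>x. x \<notin> Om --> b x = 0)"
  by metis
 show ?thesis
 proof (rule exI[of _ "\<Sum>p\<in>P. \<bar>C p\<bar>"], intro allI impI)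
  fix c assume "ball c R \<subseteq> Om"
  then have cK: "c \<in> K" unfolding K_def by auto
  then obtain p where p: "p \<in> P" "c \<in> ball p (d p / 4)" using P(3) by auto
  then obtain b where b: "flow (disc_avg c R) ?W b" "\<And>x. norm (b x) <= C p" "\<And>x. x \<notin> Om ==> b x = 0"
   using C[of p c] cK P(1) KO by auto
  have "C p <= (\<Sum>p\<in>P. \<bar>C p\<bar>)" using p(1) P(2) member_le_sum[of p P "%p. \<bar>C p\<bar>"] by auto
  then show "\<exists>b. flow (disc_avg c R) ?W b \<and> (\<forall>x. norm (b x) <= (\<Sum>p\<in>P. \<bar>C p\<bar>)) \<and> (\<forall>x. x \<notin> Om --> b x = 0)"
   using b by (meson order_trans)
 qed
qed

text \<open>The layers have finite measure and decrease to the empty set, because every point of an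
  open set has some ball inside it.\<close>

lemma boundary_layer_small:
 fixes Om :: "'a::euclidean_space set"
 assumes op: "open Om" and bd: "bounded Om" and e: "0 < e"
 shows "\<exists>R>0. {z \<in> Om. \<not> ball z R \<subseteq> Om} \<in> sets borel \<and> measure lborel {z \<in> Om. \<not> ball z R \<subseteq> Om} < e"
proof -
 define A where "A R = {z \<in> Om. \<not> ball z R \<subseteq> Om}" for R
 have mA: "A R \<in> sets borel" for R
 proof -
  have "A R = Om \<inter> (\<Union>x\<in>- Om. ball x R)" unfolding A_def by (auto simp: dist_commute)
  then show ?thesis using op by (auto intro!: borel_open open_Int open_UN)
 qed
 have "(%k::nat. measure lborel (A (1 / (real k + 1)))) \<longlonglongrightarrow> measure lborel (\<Inter>k::nat. A (1 / (real k + 1)))"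
 proof (rule Lim_measure_decseq)
  show "range (%k::nat. A (1 / (real k + 1))) \<subseteq> sets lborel" using mA by auto
  have "A (1 / (real k + 1)) \<subseteq> A (1 / (real m + 1))" if "m <= k" for m k :: nat
  proof -
   have "1 / (real k + 1) <= 1 / (real m + 1)" using that by (intro divide_left_mono) auto
   then show ?thesis unfolding A_def by (auto dest: subset_ball)
  qed
  then show "decseq (%k::nat. A (1 / (real k + 1)))" by (auto simp: decseq_def)
  have "bounded (A (1 / (real k + 1)))" for k :: nat using bd by (rule bounded_subset) (auto simp: A_def)
  then show "emeasure lborel (A (1 / (real k + 1))) \<noteq> \<infinity>" for k :: nat
   using emeasure_bounded_finite by (metis less_irrefl infinity_ennreal_def)
 qed
 moreover have "(\<Inter>k::nat. A (1 / (real k + 1))) = {}"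
 proof -
  have False if z: "\<And>k::nat. z \<in> A (1 / (real k + 1))" for z
  proof -
   obtain d where d: "0 < d" "ball z d \<subseteq> Om" using z[of 0] op open_contains_ball unfolding A_def by blast
   obtain k :: nat where "1 / (real k + 1) < d" using d(1) reals_Archimedean[of d] by (auto simp: field_simps)
   then have "ball z (1 / (real k + 1)) \<subseteq> Om" using d(2) by auto
   then show False using z[of k] unfolding A_def by auto
  qed
  then show ?thesis by blast
 qed
 ultimately have "(%k::nat. measure lborel (A (1 / (real k + 1)))) \<longlonglongrightarrow> 0" by simp
 then have "\<forall>\<^sub>F k in sequentially. measure lborel (A (1 / (real k + 1))) < e" using e by (rule order_tendstoD)
 then obtain k :: nat where "measure lborel (A (1 / (real k + 1))) < e" by (auto simp: eventually_sequentially)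
 then show ?thesis using mA unfolding A_def by (intro exI[of _ "1 / (real k + 1)"]) auto
qed

section \<open>Sums of independent variables\<close>

lemma prob_space_PiM_const: "prob_space D ==> prob_space (PiM K (%_. D))"
 by (intro prob_space_PiM)

lemma product_sigma_finite_const: "prob_space D ==> product_sigma_finite (%_. D)"
 by (simp add: product_sigma_finite_def prob_space_imp_sigma_finite)

lemma PiM_component_integral:
 fixes F :: "'a => real"
 assumes "prob_space D" "k \<in> K" "F \<in> borel_measurable D"
 shows "(LINT om|PiM K (%_. D). F (om k)) = (LINT x|D. F x)"
proof -
 have "(LINT x|D. F x) = (LINT x|distr (PiM K (%_. D)) D (%om. om k). F x)"
  using distr_PiM_component[of K "%_. D" k] assms(1,2) by simp
 also have "... = (LINT om|PiM K (%_. D). F (om k))"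
  using assms by (intro integral_distr measurable_component_singleton) auto
 finally show ?thesis by simp
qed

lemma PiM_pair_integral:
 fixes G :: "'a => 'a => real"
 assumes D: "prob_space D" and K: "finite K" "k \<in> K" "l \<in> K" "k \<noteq> l"
  and G[measurable]: "case_prod G \<in> borel_measurable (D \<Otimes>\<^sub>M D)" and B: "\<And>x y. \<bar>G x y\<bar> <= B"
 shows "(LINT om|PiM K (%_. D). G (om k) (om l)) = (LINT z|D. LINT y|D. G y z)"
proof -
 interpret D: prob_space D by fact
 interpret product_sigma_finite "%_. D" by (rule product_sigma_finite_const[OF D])
 interpret P: prob_space "PiM K (%_. D)" by (rule prob_space_PiM_const[OF D])
 have KI: "K = insert k (K - {k})" using K by auto
 have "(%om. case_prod G (om k, om l)) \<in> borel_measurable (PiM K (%_. D))"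
  by (rule measurable_compose[OF _ G]) (use K in measurable)
 then have "integrable (PiM K (%_. D)) (%om. G (om k) (om l))"
  using B by (intro P.integrable_const_bound[where B = B]) auto
 then have "(LINT om|PiM K (%_. D). G (om k) (om l)) = (LINT om|PiM (K - {k}) (%_. D). LINT y|D. G y (om l))"
  using product_integral_insert[of "K - {k}" k "%om. G (om k) (om l)"] KI K by simp
 also have "... = (LINT z|D. LINT y|D. G y z)"
 proof (rule PiM_component_integral[OF D])
  have "(%(z, y). G y z) \<in> borel_measurable (D \<Otimes>\<^sub>M D)"
   using measurable_compose[OF measurable_pair_swap' G] by (simp add: case_prod_beta')
  then show "(%z. LINT y|D. G y z) \<in> borel_measurable D" by (rule D.borel_measurable_lebesgue_integral)
 qed (use K in auto)
 finally show ?thesis .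
qed

text \<open>Independence leaves only two expectations, one for equal and one for distinct indices.
  The identity is applied to inner products of fields and, in the lower bound, to the interaction
  potential. If the weights sum to 0, only the excess of the diagonal mean over the off-diagonal
  mean remains.\<close>

lemma signed_pair_sum_integral:
 fixes G :: "'a => 'a => real"
 assumes D: "prob_space D" and K: "finite K"
  and G[measurable]: "case_prod G \<in> borel_measurable (D \<Otimes>\<^sub>M D)" and B: "\<And>x y. \<bar>G x y\<bar> <= B"
 shows "(LINT om|PiM K (%_. D). (\<Sum>k\<in>K. \<Sum>l\<in>K. s k * s l * G (om k) (om l)))
  = (\<Sum>k\<in>K. (s k)^2) * (LINT x|D. G x x) + ((\<Sum>k\<in>K. s k)^2 - (\<Sum>k\<in>K. (s k)^2)) * (LINT z|D. LINT y|D. G y z)"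
proof -
 interpret P: prob_space "PiM K (%_. D)" by (rule prob_space_PiM_const[OF D])
 define d where "d = (LINT x|D. G x x)"
 define e where "e = (LINT z|D. LINT y|D. G y z)"
 have mea: "(%om. G (om k) (om l)) \<in> borel_measurable (PiM K (%_. D))" if "k \<in> K" "l \<in> K" for k l
 proof -
  have "(%om. case_prod G (om k, om l)) \<in> borel_measurable (PiM K (%_. D))"
   by (rule measurable_compose[OF _ G]) (use that in measurable)
  then show ?thesis by simp
 qed
 have int: "integrable (PiM K (%_. D)) (%om. G (om k) (om l))" if "k \<in> K" "l \<in> K" for k l
  using B mea[OF that] by (intro P.integrable_const_bound[where B = B]) auto
 have val: "(LINT om|PiM K (%_. D). G (om k) (om l)) = (if k = l then d else e)" if "k \<in> K" "l \<in> K" for k l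
 proof (cases "k = l")
  case True
  have "(%x. case_prod G (x, x)) \<in> borel_measurable D" by (rule measurable_compose[OF _ G]) measurable
  then show ?thesis using PiM_component_integral[OF D that(1), of "%x. G x x"] True unfolding d_def by simp
 next
  case False
  then show ?thesis using PiM_pair_integral[OF D K that False G B] unfolding e_def by simp
 qed
 have "(LINT om|PiM K (%_. D). (\<Sum>k\<in>K. \<Sum>l\<in>K. s k * s l * G (om k) (om l)))
   = (\<Sum>k\<in>K. \<Sum>l\<in>K. s k * s l * (if k = l then d else e))"
  using int val by (simp add: Bochner_Integration.integral_sum)
 also have "... = (\<Sum>k\<in>K. \<Sum>l\<in>K. s k * s l * e + (if k = l then s k * s l * (d - e) else 0))"
  by (intro sum.cong) (auto simp: algebra_simps)
 also have "... = (\<Sum>k\<in>K. s k)^2 * e + (\<Sum>k\<in>K. (s k)^2) * (d - e)"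
 proof -
  have "(\<Sum>k\<in>K. \<Sum>l\<in>K. s k * s l * e) = (\<Sum>k\<in>K. s k)^2 * e"
  proof -
   have "(\<Sum>l\<in>K. s k * s l * e) = s k * ((\<Sum>l\<in>K. s l) * e)" for k
    by (simp only: sum_distrib_left sum_distrib_right mult.assoc)
   then show ?thesis by (simp only: power2_eq_square mult.assoc sum_distrib_right[symmetric])
  qed
  then show ?thesis using K by (simp add: sum.distrib sum_distrib_right power2_eq_square)
 qed
 finally show ?thesis unfolding d_def e_def by (simp add: algebra_simps)
qed

lemma vector_second_moment:
 fixes V :: "'a => real^2"
 assumes D: "prob_space D" and J: "finite J" and V[measurable]: "V \<in> borel_measurable D" and Bd: "\<And>x. norm (V x) <= Bd"
 shows "(\<integral>\<^sup>+om. ennreal ((norm (\<Sum>k\<in>J. s k *\<^sub>R V (om k)))^2) \<partial>PiM J (%_. D))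
  <= ennreal ((\<Sum>k\<in>J. (s k)^2) * (LINT x|D. (norm (V x))^2) + (\<Sum>k\<in>J. s k)^2 * (norm (LINT x|D. V x))^2)"
proof -
 interpret D: prob_space D by fact
 interpret P: prob_space "PiM J (%_. D)" by (rule prob_space_PiM_const[OF D])
 have i1: "integrable D V" using Bd by (intro D.integrable_const_bound[where B = Bd]) auto
 have sq: "(norm (\<Sum>k\<in>J. s k *\<^sub>R V (om k)))^2 = (\<Sum>k\<in>J. \<Sum>l\<in>J. s k * s l * (V (om k) \<bullet> V (om l)))" for om
  unfolding power2_norm_eq_inner inner_sum_left inner_sum_right by (intro sum.cong refl) (simp add: inner_commute)
 have b: "norm (\<Sum>k\<in>J. s k *\<^sub>R V (om k)) <= (\<Sum>k\<in>J. \<bar>s k\<bar> * Bd)" for om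
  by (rule sum_norm_le) (simp add: Bd mult_left_mono)
 have "(\<integral>\<^sup>+om. ennreal ((norm (\<Sum>k\<in>J. s k *\<^sub>R V (om k)))^2) \<partial>PiM J (%_. D)) = ennreal (LINT om|PiM J (%_. D). (norm (\<Sum>k\<in>J. s k *\<^sub>R V (om k)))^2)"
  using power_mono[OF b norm_ge_zero, where n = 2] by (intro nn_integral_eq_integral P.integrable_const_bound[OF AE_I2]) auto
 also have "(LINT om|PiM J (%_. D). (norm (\<Sum>k\<in>J. s k *\<^sub>R V (om k)))^2)
  = (\<Sum>k\<in>J. (s k)^2) * (LINT x|D. V x \<bullet> V x) + ((\<Sum>k\<in>J. s k)^2 - (\<Sum>k\<in>J. (s k)^2)) * (LINT z|D. LINT y|D. V y \<bullet> V z)"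
  unfolding sq
 proof (rule signed_pair_sum_integral[OF D J])
  show "\<bar>V x \<bullet> V y\<bar> <= Bd * Bd" for x y
   using Bd[of x] by (intro order_trans[OF Cauchy_Schwarz_ineq2] mult_mono Bd) (auto intro: order_trans[OF norm_ge_zero])
 qed measurable
 also have "(LINT z|D. LINT y|D. V y \<bullet> V z) = (norm (LINT x|D. V x))^2"
  using i1 by (simp add: power2_norm_eq_inner)
 also have "(\<Sum>k\<in>J. (s k)^2) * (LINT x|D. V x \<bullet> V x) + ((\<Sum>k\<in>J. s k)^2 - (\<Sum>k\<in>J. (s k)^2)) * (norm (LINT x|D. V x))^2
  <= (\<Sum>k\<in>J. (s k)^2) * (LINT x|D. (norm (V x))^2) + (\<Sum>k\<in>J. s k)^2 * (norm (LINT x|D. V x))^2"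
  unfolding power2_norm_eq_inner[of "V _"] by (intro add_left_mono mult_right_mono) (auto simp: sum_nonneg)
 finally show ?thesis by (simp add: ennreal_leI)
qed

text \<open>Given coordinate \<open>i\<close>, the other summands are independent and the second
  moment splits into squares and the squared mean; the latter is bounded by the mean square through
  Jensen's inequality.\<close>

lemma leave_one_out_second_moment:
 fixes g :: "'a => 'a => real^2"
 assumes D: "prob_space D" and K: "finite K" "i \<in> K"
  and g[measurable]: "case_prod g \<in> borel_measurable (D \<Otimes>\<^sub>M D)" and B: "\<And>x y. norm (g x y) <= B"
 shows "(\<integral>\<^sup>+om. ennreal ((norm (\<Sum>k\<in>K - {i}. s k *\<^sub>R g (om i) (om k)))^2) \<partial>PiM K (%_. D))
  <= ennreal ((\<Sum>k\<in>K - {i}. (s k)^2) + (\<Sum>k\<in>K - {i}. s k)^2) * (\<integral>\<^sup>+x. \<integral>\<^sup>+z. ennreal ((norm (g x z))^2) \<partial>D \<partial>D)"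
proof -
 interpret D: prob_space D by fact
 interpret product_sigma_finite "%_. D" by (rule product_sigma_finite_const[OF D])
 define S2 where "S2 = (\<Sum>k\<in>K - {i}. (s k)^2)"
 define S1 where "S1 = (\<Sum>k\<in>K - {i}. s k)^2"
 have S: "0 <= S2" "0 <= S1" unfolding S1_def S2_def by (auto simp: sum_nonneg)
 have Kins: "K = insert i (K - {i})" using K by auto
 have "(%om. g (om i) (om k)) \<in> borel_measurable (PiM K (%_. D))" if "k \<in> K" for k
  using measurable_compose[OF measurable_Pair[OF measurable_component_singleton[OF K(2)] measurable_component_singleton[OF that]] g] by simp
 then have m: "(%om. ennreal ((norm (\<Sum>k\<in>K - {i}. s k *\<^sub>R g (om i) (om k)))^2)) \<in> borel_measurable (PiM (insert i (K - {i})) (%_. D))"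
  unfolding Kins[symmetric] by measurable
 have "(\<integral>\<^sup>+om. ennreal ((norm (\<Sum>k\<in>K - {i}. s k *\<^sub>R g (om i) (om k)))^2) \<partial>PiM K (%_. D))
  = (\<integral>\<^sup>+x. \<integral>\<^sup>+om. ennreal ((norm (\<Sum>k\<in>K - {i}. s k *\<^sub>R g x (om k)))^2) \<partial>PiM (K - {i}) (%_. D) \<partial>D)"
 proof -
  have "(\<Sum>k\<in>K - {i}. s k *\<^sub>R g ((fun_upd om i x) i) ((fun_upd om i x) k)) = (\<Sum>k\<in>K - {i}. s k *\<^sub>R g x (om k))" for om x
   by (intro sum.cong) auto
  then show ?thesis using product_nn_integral_insert_rev[OF _ _ m] K unfolding Kins[symmetric] by simp
 qed
 also have "... <= (\<integral>\<^sup>+x. ennreal (S2 + S1) * (\<integral>\<^sup>+z. ennreal ((norm (g x z))^2) \<partial>D) \<partial>D)"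
 proof (rule nn_integral_mono)
  fix x assume x: "x \<in> space D"
  have gx[measurable]: "g x \<in> borel_measurable D" using measurable_compose[OF measurable_Pair1'[OF x] g] by simp
  have b: "norm ((norm (g x z))^2) <= B^2" for z using power_mono[OF B norm_ge_zero, where n = 2] by simp
  have i2: "integrable D (%z. (norm (g x z))^2)" using b by (intro D.integrable_const_bound[OF AE_I2]) auto
  have i1: "integrable D (%z. norm (g x z))" using B by (intro D.integrable_const_bound[OF AE_I2]) auto
  have "(norm (LINT z|D. g x z))^2 <= (LINT z|D. norm (g x z))^2" by (intro power_mono integral_norm_bound) auto
  also have "... <= (LINT z|D. (norm (g x z))^2)"
   using D.variance_positive[of "%z. norm (g x z)"] D.variance_eq[OF i1 i2] by simp
  finally have c: "(norm (LINT z|D. g x z))^2 <= (LINT z|D. (norm (g x z))^2)" .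
  have "(\<integral>\<^sup>+om. ennreal ((norm (\<Sum>k\<in>K - {i}. s k *\<^sub>R g x (om k)))^2) \<partial>PiM (K - {i}) (%_. D))
   <= ennreal (S2 * (LINT z|D. (norm (g x z))^2) + S1 * (norm (LINT z|D. g x z))^2)"
   unfolding S1_def S2_def using K B by (intro vector_second_moment[OF D]) auto
  also have "... <= ennreal ((S2 + S1) * (LINT z|D. (norm (g x z))^2))"
   using mult_left_mono[OF c S(2)] by (intro ennreal_leI) (simp add: distrib_right)
  also have "... = ennreal (S2 + S1) * (\<integral>\<^sup>+z. ennreal ((norm (g x z))^2) \<partial>D)"
   using nn_integral_eq_integral[OF i2] S by (simp add: ennreal_mult')
  finally show "(\<integral>\<^sup>+om. ennreal ((norm (\<Sum>k\<in>K - {i}. s k *\<^sub>R g x (om k)))^2) \<partial>PiM (K - {i}) (%_. D))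
   <= ennreal (S2 + S1) * (\<integral>\<^sup>+z. ennreal ((norm (g x z))^2) \<partial>D)" .
 qed
 also have "... = ennreal (S2 + S1) * (\<integral>\<^sup>+x. \<integral>\<^sup>+z. ennreal ((norm (g x z))^2) \<partial>D \<partial>D)"
  by (rule nn_integral_cmult) measurable
 finally show ?thesis unfolding S1_def S2_def .
qed

section \<open>Elementary inequalities and deviations of counts\<close>

lemma power2_sum_le_weighted:
 fixes u v e :: real
 assumes "0 < e"
 shows "(u + v)^2 <= (1 + e) * u^2 + (1 + 1 / e) * v^2"
proof -
 have "0 <= (e * u - v)^2 / e" using assms by simp
 also have "... = e * u^2 + 1 / e * v^2 - 2 * u * v" using assms by (simp add: power2_eq_square field_simps)
 finally show ?thesis by (simp add: power2_sum algebra_simps)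
qed

lemma exp_le_quadratic:
 fixes u :: real
 assumes "\<bar>u\<bar> <= 1"
 shows "exp u <= 1 + u + u^2"
proof (cases "0 <= u")
 case True
 then show ?thesis using exp_bound[of u] assms by simp
next
 case False
 define v where "v = - u"
 have v: "0 <= v" "v <= 1" using False assms unfolding v_def by auto
 have "exp u * (1 + v) <= exp u * exp v" using exp_ge_add_one_self[of v] by (intro mult_left_mono) auto
 also have "... = 1" unfolding v_def by (simp flip: exp_add)
 also have "... <= (1 - v + v^2) * (1 + v)"
 proof -
  have "(1 - v + v^2) * (1 + v) = 1 + v^3" by (simp add: algebra_simps power2_eq_square power3_eq_cube)
  moreover have "0 <= v^3" using v by simp
  ultimately show ?thesis by linarith
 qed
 finally have "exp u <= 1 - v + v^2" by (rule mult_right_le_imp_le) (use v in simp)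
 then show ?thesis unfolding v_def by simp
qed

text \<open>The exponential Markov inequality. The quadratic bound of the exponential restricts
  \<open>t\<close> to at most 1, and the variance of an indicator is at most its mean. Weights -1, 0
  and 1 cover a deficit in one of two samples as well as the difference of both.\<close>

lemma chernoff_counts:
 fixes s :: "'k => real"
 assumes D: "prob_space D" and K: "finite K" and Q: "Q \<in> sets D"
  and s: "\<And>k. k \<in> K ==> s k = -1 \<or> s k = 0 \<or> s k = 1" and t: "0 <= t" "t <= 1"
 shows "measure (PiM K (%_. D)) {om \<in> space (PiM K (%_. D)). T <= (\<Sum>k\<in>K. s k * (indicator Q (om k) - measure D Q))}
  <= exp (t^2 * real (card K) * measure D Q - t * T)"
proof -
 interpret D: prob_space D by fact
 interpret product_sigma_finite "%_. D" by (rule product_sigma_finite_const[OF D])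
 interpret P: prob_space "PiM K (%_. D)" by (rule prob_space_PiM_const[OF D])
 define p where "p = measure D Q"
 have p: "0 <= p" "p <= 1" unfolding p_def by auto
 define F where "F x = indicator Q x - p" for x
 have [measurable]: "F \<in> borel_measurable D" unfolding F_def[abs_def] using Q by measurable
 have F1: "\<bar>F x\<bar> <= 1" for x unfolding F_def using p by (auto simp: indicator_def)
 have iI: "integrable D (indicat_real Q)" using Q by (intro integrable_real_indicator) (auto simp: D.emeasure_eq_measure)
 have F0: "(LINT x|D. F x) = 0"
  unfolding F_def using iI Q by (simp add: p_def D.prob_space)
 have F2: "(LINT x|D. (F x)^2) <= p"
 proof -
  have "(F x)^2 = (1 - 2 * p) * indicator Q x + p^2" for x
   unfolding F_def by (auto simp: indicator_def power2_eq_square algebra_simps)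
  then have "(LINT x|D. (F x)^2) = (1 - 2 * p) * p + p^2"
   using iI Q by (simp add: D.prob_space p_def)
  moreover have "(1 - 2 * p) * p + p^2 = p - p^2" by (simp add: power2_eq_square algebra_simps)
  ultimately show ?thesis by simp
 qed
 define E where "E k = (LINT x|D. exp (t * (s k * F x)))" for k
 have ib: "integrable D (%x. exp (t * (s k * F x)))" if k: "k \<in> K" for k
 proof (rule D.integrable_const_bound[where B = "exp 1"])
  have "t * (s k * F x) <= 1" for x
  proof -
   have "\<bar>s k\<bar> <= 1" using s[OF k] by auto
   then have "\<bar>t * (s k * F x)\<bar> <= 1"
    unfolding abs_mult using t F1[of x] by (simp add: mult_le_one)
   then show ?thesis by (rule abs_le_D1)
  qed
  then show "AE x in D. norm (exp (t * (s k * F x))) <= exp 1" by (intro AE_I2) simp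
 qed measurable
 have Ek: "E k <= exp (t^2 * p)" "0 <= E k" if k: "k \<in> K" for k
 proof -
  have sq: "(s k)^2 <= 1" "\<bar>s k\<bar> <= 1" using s[OF k] by auto
  have "\<bar>t * (s k * F x)\<bar> <= 1" for x
   unfolding abs_mult using t sq F1[of x] by (simp add: mult_le_one)
  then have pw: "exp (t * (s k * F x)) <= 1 + t * (s k * F x) + (t * (s k * F x))^2" for x
   by (rule exp_le_quadratic)
  have iF: "integrable D F" by (rule D.integrable_const_bound[where B = 1]) (use F1 in auto)
  have iF2: "integrable D (%x. (F x)^2)"
   by (rule D.integrable_const_bound[where B = 1]) (use F1 in \<open>auto simp: abs_square_le_1\<close>)
  have "E k <= (LINT x|D. 1 + (t * s k) * F x + (t^2 * (s k)^2) * (F x)^2)"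
   unfolding E_def using ib[OF k] iF iF2 pw
   by (intro integral_mono) (auto simp: power_mult_distrib mult.assoc)
  also have "... = 1 + (t^2 * (s k)^2) * (LINT x|D. (F x)^2)"
   using iF iF2 F0 by (simp add: D.prob_space)
  also have "... <= 1 + t^2 * p"
   using F2 sq p t by (auto intro!: mult_mono simp: mult_left_le)
  also have "... <= exp (t^2 * p)" by (rule exp_ge_add_one_self)
  finally show "E k <= exp (t^2 * p)" .
  show "0 <= E k" unfolding E_def by (intro Bochner_Integration.integral_nonneg) auto
 qed
 define S where "S om = (\<Sum>k\<in>K. s k * F (om k))" for om
 have eS: "exp (t * S om) = (\<Prod>k\<in>K. exp (t * (s k * F (om k))))" for om
  unfolding S_def sum_distrib_left by (rule exp_sum[OF K])
 have int: "integrable (PiM K (%_. D)) (%om. exp (t * S om))"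
  unfolding eS by (rule product_integrable_prod[OF K]) (rule ib)
 have "(LINT om|PiM K (%_. D). exp (t * S om)) = (\<Prod>k\<in>K. E k)"
  unfolding eS E_def by (rule product_integral_prod[OF K]) (rule ib)
 also have "... <= (\<Prod>k\<in>K. exp (t^2 * p))" by (intro prod_mono) (use Ek in auto)
 also have "... = exp (t^2 * real (card K) * p)" by (simp add: exp_of_nat_mult[symmetric] algebra_simps)
 finally have E: "(LINT om|PiM K (%_. D). exp (t * S om)) <= exp (t^2 * real (card K) * p)" .
 let ?A = "{om \<in> space (PiM K (%_. D)). T <= S om}"
 have "measure (PiM K (%_. D)) ?A <= measure (PiM K (%_. D)) {om \<in> space (PiM K (%_. D)). exp (t * T) <= exp (t * S om)}"
 proof (rule P.finite_measure_mono)
  show "?A \<subseteq> {om \<in> space (PiM K (%_. D)). exp (t * T) <= exp (t * S om)}" using t(1) by (auto intro: mult_left_mono)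
  show "{om \<in> space (PiM K (%_. D)). exp (t * T) <= exp (t * S om)} \<in> sets (PiM K (%_. D))"
   using int by measurable
 qed
 also have "... <= (LINT om|PiM K (%_. D). exp (t * S om)) / exp (t * T)"
  by (rule integral_Markov_inequality_measure[where A = "{}"]) (use int in auto)
 also have "... <= exp (t^2 * real (card K) * p) / exp (t * T)" using E by (intro divide_right_mono) auto
 also have "... = exp (t^2 * real (card K) * p - t * T)" by (simp add: exp_diff)
 finally show ?thesis unfolding S_def F_def p_def .
qed

section \<open>Superposition and splitting of conic fields\<close>

lemma disc_avg_0: "disc_avg z 0 g = g z"
 unfolding disc_avg_def set_lebesgue_integral_def by (simp add: content_ball unit_ball_vol_2)

text \<open>The flows from the points \<open>z\<close> are superposed with weights
  \<open>q z\<close>. The singularity \<open>1 / norm (x - z)\<close> is integrable in the plane,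
  which justifies exchanging the integrals.\<close>

lemma flow_average:
 fixes f :: "real^2 => real^2 => real^2"
 assumes q: "compact_density q" "(LINT z|lborel. q z) = 1"
  and fm: "case_prod f \<in> borel_measurable (lborel \<Otimes>\<^sub>M lborel)"
  and fl: "\<And>z. q z \<noteq> 0 ==> flow (disc_avg z 0) A (f z)"
  and C: "0 <= C" "\<And>z x. q z \<noteq> 0 ==> norm (f z x) <= C / norm (x - z)"
  and R: "\<And>z x. q z \<noteq> 0 ==> R < norm x ==> f z x = 0"
 shows "flow (density_integral q) A (%x. LINT z|lborel. q z *\<^sub>R f z x)"
 unfolding flow_def
proof (intro conjI allI impI)
 have qm[measurable]: "q \<in> borel_measurable borel" and q0: "\<And>z. 0 <= q z" and qi: "integrable lborel q"
  using q unfolding compact_density_def by auto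
 obtain R1 where R1: "\<And>z. R1 < norm z ==> q z = 0" using q unfolding compact_density_def by auto
 define R' where "R' = max 0 (R + R1)"
 define P where "P = (%(z, x). q z *\<^sub>R f z x)"
 have [measurable]: "(%p. f (fst p) (snd p)) \<in> borel_measurable (lborel \<Otimes>\<^sub>M lborel)"
  using fm by (simp add: case_prod_beta')
 have fz[measurable]: "f z \<in> borel_measurable borel" for z
  using measurable_compose[OF measurable_Pair1' fm, of z] by simp
 have Pm: "P \<in> borel_measurable (lborel \<Otimes>\<^sub>M lborel)" unfolding P_def case_prod_beta' by measurable
 show "(%x. LINT z|lborel. q z *\<^sub>R f z x) \<in> borel_measurable borel"
 proof -
  have "(%(x, z). q z *\<^sub>R f z x) \<in> borel_measurable (lborel \<Otimes>\<^sub>M lborel)"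
   using measurable_compose[OF measurable_pair_swap' Pm] by (simp add: case_prod_beta' P_def)
  then show ?thesis by (rule lborel.borel_measurable_lebesgue_integral[of _ lborel, simplified])
 qed
 have nnf: "(\<integral>\<^sup>+x. ennreal (norm (f z x)) \<partial>lborel) <= ennreal (C * (2 * pi * R'))" if z: "q z \<noteq> 0" for z
 proof -
  have [measurable]: "cball z R' \<in> sets borel" by simp
  have "(\<integral>\<^sup>+x. ennreal (norm (f z x)) \<partial>lborel) <= (\<integral>\<^sup>+x. ennreal C * (ennreal (1 / norm (x - z)) * indicator (cball z R') x) \<partial>lborel)"
  proof (intro nn_integral_mono)
   fix x :: "real^2"
   show "ennreal (norm (f z x)) <= ennreal C * (ennreal (1 / norm (x - z)) * indicator (cball z R') x)"
   proof (cases "norm x <= R")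
    case True
    have "norm z <= R1" using R1[of z] z by force
    then have "norm (x - z) <= R'" using True norm_triangle_ineq4[of x z] unfolding R'_def by simp
    then have "x \<in> cball z R'" by (simp add: dist_norm norm_minus_commute)
    then show ?thesis using C(2)[OF z, of x] C(1) by (simp add: ennreal_mult''[symmetric])
   qed (use R[OF z, of x] in simp)
  qed
  also have "... = ennreal C * (\<integral>\<^sup>+x\<in>cball z R'. ennreal (1 / norm (x - z)) \<partial>lborel)"
   by (rule nn_integral_cmult) measurable
  also have "... <= ennreal C * ennreal (2 * pi * R')"
   by (intro mult_left_mono nn_integral_inverse_norm_plane) (auto simp: R'_def)
  finally show ?thesis unfolding ennreal_mult'[OF C(1)] .
 qed
 have fint: "integrable lborel (f z)" if "q z \<noteq> 0" for z
  using nnf[OF that] by (intro integrableI_bounded) (auto intro: le_less_trans)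
 have nf: "(LINT x|lborel. norm (f z x)) <= C * (2 * pi * R')" if "q z \<noteq> 0" for z
 proof -
  have "ennreal (LINT x|lborel. norm (f z x)) <= ennreal (C * (2 * pi * R'))"
   using nnf[OF that] fint[OF that] by (subst nn_integral_eq_integral[symmetric]) auto
  then show ?thesis using C(1) by (subst (asm) ennreal_le_iff) (auto simp: R'_def)
 qed
 have Pi: "integrable (lborel \<Otimes>\<^sub>M lborel) P"
 proof (rule lborel_pair.Fubini_integrable[OF Pm])
  have e: "(LINT x|lborel. norm (P (z, x))) = q z * (LINT x|lborel. norm (f z x))" for z
   unfolding P_def using q0 by simp
  show "integrable lborel (%z. LINT x|lborel. norm (P (z, x)))"
  proof (rule Bochner_Integration.integrable_bound)
   show "integrable lborel (%z. q z * (C * (2 * pi * R')))" using qi by simp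
   show "(%z. LINT x|lborel. norm (P (z, x))) \<in> borel_measurable lborel"
    using Pm by (intro lborel.borel_measurable_lebesgue_integral) (simp add: case_prod_beta')
   show "AE z in lborel. norm (LINT x|lborel. norm (P (z, x))) <= norm (q z * (C * (2 * pi * R')))"
   proof (intro AE_I2)
    fix z
    have "0 <= (LINT x|lborel. norm (f z x))" by (intro Bochner_Integration.integral_nonneg) auto
    then show "norm (LINT x|lborel. norm (P (z, x))) <= norm (q z * (C * (2 * pi * R')))"
     unfolding e using nf[of z] q0[of z] C(1)
     by (cases "q z = 0") (auto simp: abs_mult R'_def intro!: mult_left_mono)
   qed
  qed
  show "AE z in lborel. integrable lborel (%x. P (z, x))"
   unfolding P_def by (intro AE_I2) (auto intro!: fint)
 qed
 fix g :: "real^2 => real" and \<xi> assume wg: "weak_grad g \<xi>"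
 note [measurable] = weak_gradD(2)[OF wg]
 obtain C\<xi>0 where "\<And>x. norm x <= R ==> norm (\<xi> x) <= C\<xi>0" using weak_gradD(4)[OF wg] by blast
 then obtain C\<xi> where C\<xi>: "0 <= C\<xi>" "\<And>x. norm x <= R ==> norm (\<xi> x) <= C\<xi>"
  by (metis linorder_linear max.absorb1 max.cobounded1 max.cobounded2 order_trans)
 have Gi: "integrable (lborel \<Otimes>\<^sub>M lborel) (%(z, x). \<xi> x \<bullet> P (z, x))"
 proof (rule Bochner_Integration.integrable_bound)
  show "integrable (lborel \<Otimes>\<^sub>M lborel) (%p. C\<xi> * norm (P p))" using Pi by simp
  show "(%(z, x). \<xi> x \<bullet> P (z, x)) \<in> borel_measurable (lborel \<Otimes>\<^sub>M lborel)"
   using Pm unfolding case_prod_beta' by simp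
  show "AE p in lborel \<Otimes>\<^sub>M lborel. norm (case p of (z, x) => \<xi> x \<bullet> P (z, x)) <= norm (C\<xi> * norm (P p))"
  proof (intro AE_I2, clarify)
   fix z x
   show "norm (\<xi> x \<bullet> P (z, x)) <= norm (C\<xi> * norm (P (z, x)))"
   proof (cases "norm x <= R")
    case True
    then show ?thesis using C\<xi>(1) C\<xi>(2)[OF True]
     by (auto intro!: order_trans[OF Cauchy_Schwarz_ineq2] mult_right_mono)
   next
    case False
    then show ?thesis using R[of z x] by (cases "q z = 0") (auto simp: P_def)
   qed
  qed
 qed
 have "AE x in lborel. integrable lborel (%z. P (z, x))"
  using lborel_pair.AE_integrable_snd[of "%z x. P (z, x)"] Pi by (simp add: case_prod_beta')
 then have AE1: "AE x in lborel. (LINT z|lborel. \<xi> x \<bullet> P (z, x)) = \<xi> x \<bullet> (LINT z|lborel. q z *\<^sub>R f z x)"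
  by eventually_elim (simp add: P_def del: inner_scaleR_right)
 have m1: "(%x. LINT z|lborel. \<xi> x \<bullet> P (z, x)) \<in> borel_measurable lborel"
  using lborel_pair.integrable_snd[OF Gi] by simp
 have m2: "(%x. \<xi> x \<bullet> (LINT z|lborel. q z *\<^sub>R f z x)) \<in> borel_measurable lborel"
  using \<open>(%x. LINT z|lborel. q z *\<^sub>R f z x) \<in> borel_measurable borel\<close> by simp
 show "integrable lborel (%x. \<xi> x \<bullet> (LINT z|lborel. q z *\<^sub>R f z x))"
  using lborel_pair.integrable_snd[OF Gi] AE1 m1 m2 by (subst integrable_cong_AE[symmetric]) auto
 have "(LINT x|lborel. \<xi> x \<bullet> (LINT z|lborel. q z *\<^sub>R f z x)) = (LINT x|lborel. LINT z|lborel. \<xi> x \<bullet> P (z, x))"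
  using AE1 m1 m2 by (intro integral_cong_AE) auto
 also have "... = (LINT z|lborel. LINT x|lborel. \<xi> x \<bullet> P (z, x))"
  by (rule lborel_pair.Fubini_integral[OF Gi])
 also have "... = (LINT z|lborel. A g * q z - g z * q z)"
 proof (rule Bochner_Integration.integral_cong[OF refl])
  fix z
  show "(LINT x|lborel. \<xi> x \<bullet> P (z, x)) = A g * q z - g z * q z"
  proof (cases "q z = 0")
   case False
   have "A g - g z = (LINT x|lborel. \<xi> x \<bullet> f z x)"
    using fl[OF False] wg unfolding flow_def by (simp add: disc_avg_0)
   then show ?thesis unfolding P_def by (simp add: algebra_simps flip: left_diff_distrib)
  qed (simp add: P_def)
 qed
 also have "... = A g - density_integral q g"
  using qi q(2) integrable_continuous_compact_density[OF q(1) weak_gradD(1)[OF wg]]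
  by (simp add: density_integral_def)
 finally show "A g - density_integral q g = (LINT x|lborel. \<xi> x \<bullet> (LINT z|lborel. q z *\<^sub>R f z x))" by simp
qed

text \<open>The point \<open>x = c\<close> is excluded: with \<open>al = 0\<close> the integral can
  diverge there, its default value is then 0, and additivity would fail.\<close>

lemma conic_weight_split:
 assumes "0 <= al" "al <= \<beta>" "\<beta> <= \<gamma>" "x \<noteq> c"
 shows "conic_weight c v al \<gamma> x = conic_weight c v al \<beta> x + conic_weight c v \<beta> \<gamma> x"
proof -
 let ?f = "%s. indicat_real {s. norm (x - c - s *\<^sub>R v) < s} s / (pi * s ^ 3)"
 define m where "m = norm (x - c) / (1 + norm v)"
 have v: "0 < 1 + norm v" by (simp add: add_pos_nonneg)
 have m0: "0 < m" unfolding m_def using assms(4) v by simp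
 have mea: "?f \<in> borel_measurable borel"
 proof -
  have "?f = (%s. (if norm (x - c - s *\<^sub>R v) < s then 1 else 0) / (pi * s ^ 3))"
   by (auto simp: indicator_def fun_eq_iff)
  also have "... \<in> borel_measurable borel" by measurable
  finally show ?thesis .
 qed
 have bd: "norm (?f s) <= 1 / (pi * m^3)" for s
 proof (cases "norm (x - c - s *\<^sub>R v) < s")
  case True
  then have "m <= s" using norm_in_cone_less(2)[OF True] v unfolding m_def by (simp add: pos_divide_le_eq)
  then have "1 / (pi * s^3) <= 1 / (pi * m^3)" using m0 by (intro divide_left_mono mult_left_mono power_mono) auto
  then show ?thesis using True m0 \<open>m <= s\<close> by simp
 qed (use m0 in simp)
 have int: "set_integrable lborel {p..q} ?f" for p q
  by (rule set_integrable_bounded[OF mea _ _ bd]) auto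
 have "conic_weight c v al \<gamma> x = (LINT s:{al..\<beta>} \<union> {\<beta><..\<gamma>}|lborel. ?f s)"
  unfolding conic_weight_def using assms by (simp add: ivl_disj_un_two_touch(4) ivl_disj_un(7) ivl_disj_un)
 also have "... = conic_weight c v al \<beta> x + (LINT s:{\<beta><..\<gamma>}|lborel. ?f s)"
  unfolding conic_weight_def using int by (intro set_integral_Un) (auto intro: set_integrable_subset[OF int[of \<beta> \<gamma>]])
 also have "(LINT s:{\<beta><..\<gamma>}|lborel. ?f s) = conic_weight c v \<beta> \<gamma> x"
  unfolding conic_weight_def set_lebesgue_integral_def
 proof (rule integral_cong_AE)
  have "AE s in lborel. s \<noteq> \<beta>" by (rule AE_lborel_singleton)
  then show "AE s in lborel. indicat_real {\<beta><..\<gamma>} s *\<^sub>R ?f s = indicat_real {\<beta>..\<gamma>} s *\<^sub>R ?f s"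
   by eventually_elim (auto simp: indicator_def)
 qed (use mea in measurable)
 finally show ?thesis .
qed

section \<open>Fields attached to cells\<close>

lemma norm_integral_le_nn_integral:
 fixes f :: "'a => 'b::{banach,second_countable_topology}"
 shows "ennreal (norm (LINT x|M. f x)) <= (\<integral>\<^sup>+x. ennreal (norm (f x)) \<partial>M)"
 by (cases "integrable M f") (simp_all add: integral_norm_bound_ennreal not_integrable_integral_eq)

text \<open>Here \<open>r\<close> is the density extended by 0, so that integrals run over the whole
  plane; Hoelder continuity enters as the uniform continuity \<open>uc\<close> on the
  domain.\<close>

locale planar_density =
 fixes Om :: "(real^2) set" and r :: "real^2 => real" and a b :: real
 assumes op: "open Om" and bd: "bounded Om" and con: "connected Om" and lip: "lipschitz_boundary Om"
  and rm[measurable]: "r \<in> borel_measurable borel"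
  and r_out: "\<And>x. x \<notin> Om ==> r x = 0"
  and a: "0 < a" and ra: "\<And>x. x \<in> Om ==> a <= r x" and rb: "\<And>x. r x <= b"
  and ri: "integrable lborel r" and r1: "(LINT x|lborel. r x) = 1"
  and uc: "\<And>e. 0 < e ==> \<exists>d>0. \<forall>x\<in>Om. \<forall>y\<in>Om. dist x y < d --> \<bar>r x - r y\<bar> < e"
begin

definition D :: "(real^2) measure" where "D = density lborel (%x. ennreal (r x))"

lemma r0: "0 <= r x" using a ra[of x] r_out[of x] by (cases "x \<in> Om") auto

lemma b0: "0 < b"
proof -
 have "Om \<noteq> {}"
 proof
  assume "Om = {}"
  then have "r = (%x. 0)" using r_out by auto
  then show False using r1 by simp
 qed
 then show ?thesis using a ra rb by (metis all_not_in_conv order_less_le_trans)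
qed

lemma Om_ne: "Om \<noteq> {}"
proof
 assume "Om = {}"
 then have "r = (%x. 0)" using r_out by auto
 then show False using r1 by simp
qed

lemma Om_borel[measurable]: "Om \<in> sets borel" using op by simp

lemma sets_D[measurable_cong, simp]: "sets D = sets borel" unfolding D_def by simp

lemma space_D[simp]: "space D = UNIV" unfolding D_def by simp

lemma prob_D: "prob_space D"
proof
 have "emeasure D (space D) = (\<integral>\<^sup>+x. ennreal (r x) \<partial>lborel)"
  unfolding D_def by (simp add: emeasure_density)
 also have "... = 1" using r1 r0 ri by (subst nn_integral_eq_integral) auto
 finally show "emeasure D (space D) = 1" .
qed

lemma integral_D:
 fixes f :: "real^2 => 'c::{banach,second_countable_topology}"
 assumes "f \<in> borel_measurable borel"
 shows "(LINT x|D. f x) = (LINT x|lborel. r x *\<^sub>R f x)"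
 unfolding D_def using assms r0 by (intro integral_density) auto

lemma nn_integral_D:
 assumes "f \<in> borel_measurable borel"
 shows "(\<integral>\<^sup>+x. f x \<partial>D) = (\<integral>\<^sup>+x. ennreal (r x) * f x \<partial>lborel)"
 unfolding D_def using assms by (intro nn_integral_density) auto

lemma AE_D: "AE x in D. x \<in> Om"
proof -
 have "x \<in> Om" if "0 < ennreal (r x)" for x using that r_out[of x] by (cases "x \<in> Om") auto
 then show ?thesis unfolding D_def by (simp add: AE_density)
qed

lemma Om_finite: "emeasure lborel Om < \<infinity>" using bd by (rule emeasure_bounded_finite)

lemma compact_density_indicator:
 assumes "Q \<in> sets borel" "0 <= k"
 shows "compact_density (%x. indicator Q x * r x / k)"
proof -
 obtain R where R: "\<And>x. x \<in> Om ==> norm x <= R" using bd bounded_iff by blast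
 have "indicator Q x * r x / k = 0" if "R < norm x" for x
  using R[of x] r_out[of x] that by (cases "x \<in> Om") auto
 moreover have "integrable lborel (%x. indicat_real Q x * r x)"
  using ri assms(1) integrable_mult_indicator[of Q lborel r] by simp
 ultimately show ?thesis unfolding compact_density_def using r0 assms(2) by auto
qed

end

section \<open>Cells of a given size and the fields inside them\<close>

locale planar_cells = planar_density +
 fixes C0 eps :: real and kap :: "real^2 => int \<times> int" and ctr :: "int \<times> int => real^2"
 assumes cs: "cell_structure Om C0 eps kap ctr" and eps: "0 < eps" and C0: "1 <= C0"
begin

definition cell :: "int \<times> int => (real^2) set" where "cell i = {z \<in> Om. kap z = i}"

definition mass :: "int \<times> int => real" where "mass i = (LINT x|lborel. indicator (cell i) x * r x)"

definition q :: "int \<times> int => real^2 => real" where "q i x = indicator (cell i) x * r x / mass i"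

definition I :: "(int \<times> int) set" where "I = kap ` Om"

lemma kapm[measurable]: "kap \<in> measurable borel (count_space UNIV)"
 using cs unfolding cell_structure_def by auto

lemma finI: "finite I" using cs unfolding cell_structure_def I_def by auto

lemma cell_borel[measurable]: "cell i \<in> sets borel"
proof -
 have "cell i = Om \<inter> (kap -` {i} \<inter> space borel)" unfolding cell_def by auto
 also have "... \<in> sets borel" by (intro sets.Int Om_borel measurable_sets[OF kapm]) auto
 finally show ?thesis .
qed

lemma cell_props:
 assumes "z \<in> Om"
 shows "ball (ctr (kap z)) (eps / 2) \<subseteq> cell (kap z)" "dist z (ctr (kap z)) <= C0 * eps"
  "\<And>s. 0 <= s ==> s <= 1 ==> ball ((1 - s) *\<^sub>R z + s *\<^sub>R ctr (kap z)) (s * (eps / 2)) \<subseteq> Om"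
 using cs assms unfolding cell_structure_def cell_def by auto

lemma cell_subset: "cell i \<subseteq> Om" "cell i \<subseteq> cball (ctr i) (C0 * eps)"
 using cell_props(2) unfolding cell_def by (auto simp: dist_commute)

lemma ctr_ball: "i \<in> I ==> ball (ctr i) (eps / 2) \<subseteq> cell i"
 using cell_props(1) unfolding I_def by auto

lemma ctr_in: "i \<in> I ==> ctr i \<in> Om"
 using ctr_ball[of i] cell_subset(1)[of i] eps by (auto simp: subset_iff)

lemma cell_finite: "emeasure lborel (cell i) < \<infinity>"
 using bounded_subset[OF bd cell_subset(1)] by (rule emeasure_bounded_finite)

lemma mass_measure: "measure D (cell i) = mass i"
proof -
 have "measure D (cell i) = (LINT x|D. indicator (cell i) x)" by simp
 also have "... = mass i" unfolding mass_def by (subst integral_D) (auto simp: mult.commute)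
 finally show ?thesis .
qed

lemma mass_ge:
 assumes "i \<in> I"
 shows "a * (pi * (eps / 2)^2) <= mass i"
proof -
 have "a * (pi * (eps / 2)^2) = (LINT x|lborel. a * indicator (ball (ctr i) (eps / 2)) x)"
  using eps by (simp add: content_ball unit_ball_vol_2)
 also have "... <= mass i"
  unfolding mass_def
 proof (rule integral_mono)
  show "integrable lborel (%x. a * indicat_real (ball (ctr i) (eps / 2)) x)"
   using emeasure_lborel_ball_finite[of "ctr i" "eps / 2"] by (intro integrable_mult_right integrable_real_indicator) auto
  show "integrable lborel (%x. indicat_real (cell i) x * r x)"
   using ri integrable_mult_indicator[of "cell i" lborel r] by simp
  show "a * indicat_real (ball (ctr i) (eps / 2)) x <= indicat_real (cell i) x * r x" for x
   using ctr_ball[OF assms] cell_subset(1)[of i] ra[of x] r0[of x] by (auto simp: indicator_def)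
 qed
 finally show ?thesis .
qed

lemma mass_pos: "i \<in> I ==> 0 < mass i"
 using mass_ge[of i] a eps by (intro order_less_le_trans[OF _ mass_ge]) auto

lemma mass_le:
 assumes "\<And>x. x \<in> cell i ==> r x <= K"
 shows "mass i <= K * measure lborel (cell i)"
proof -
 have "mass i <= (LINT x|lborel. K * indicator (cell i) x)"
  unfolding mass_def
 proof (rule integral_mono)
  show "integrable lborel (%x. K * indicat_real (cell i) x)"
   using cell_finite[of i] by (intro integrable_mult_right integrable_real_indicator) auto
  show "integrable lborel (%x. indicat_real (cell i) x * r x)"
   using ri integrable_mult_indicator[of "cell i" lborel r] by simp
  show "indicat_real (cell i) x * r x <= K * indicat_real (cell i) x" for x
   using assms[of x] by (auto simp: indicator_def)
 qed
 then show ?thesis by simp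
qed

lemma area_le: "measure lborel (cell i) <= pi * (C0 * eps)^2"
proof -
 have "measure lborel (cell i) <= measure lborel (cball (ctr i) (C0 * eps))"
  by (rule measure_mono_fmeasurable) (use cell_subset(2) emeasure_lborel_cball_finite in \<open>auto simp: fmeasurable_def\<close>)
 then show ?thesis using C0 eps by (simp add: content_cball unit_ball_vol_2)
qed

lemma sum_indicator_cells: "(\<Sum>i\<in>I. indicator (cell i) x) = (indicator Om x :: real)"
proof (cases "x \<in> Om")
 case True
 have "(\<Sum>i\<in>I. indicator (cell i) x :: real) = (\<Sum>i\<in>I. if i = kap x then 1 else 0)"
  using True by (intro sum.cong) (auto simp: cell_def)
 also have "... = 1" using finI True unfolding I_def by simp
 finally show ?thesis using True by simp
qed (auto simp: cell_def)

lemma cell_sum: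
 fixes h :: "int \<times> int => 'v::real_vector"
 assumes "z \<in> Om"
 shows "(\<Sum>i\<in>I. indicator (cell i) z *\<^sub>R h i) = h (kap z)"
proof -
 have "(\<Sum>i\<in>I. indicat_real (cell i) z *\<^sub>R h i) = (\<Sum>i\<in>I. if i = kap z then h i else 0)"
  using assms by (intro sum.cong) (auto simp: cell_def)
 also have "... = h (kap z)" using finI assms unfolding I_def by simp
 finally show ?thesis .
qed

lemma cell_area_sum:
 fixes h :: "int \<times> int => real"
 shows "(\<Sum>i\<in>I. measure lborel (cell i) * h i) = (LINT x|lborel. indicator Om x * h (kap x))"
proof -
 have "(\<Sum>i\<in>I. measure lborel (cell i) * h i) = (LINT x|lborel. (\<Sum>i\<in>I. indicator (cell i) x * h i))"
  using cell_finite by (subst Bochner_Integration.integral_sum) (auto intro!: integrable_mult_left integrable_real_indicator)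
 also have "... = (LINT x|lborel. indicator Om x * h (kap x))"
 proof (intro Bochner_Integration.integral_cong refl)
  show "(\<Sum>i\<in>I. indicator (cell i) x * h i) = indicator Om x * h (kap x)" for x
   using cell_sum[of x h] by (cases "x \<in> Om") (auto simp: cell_def)
 qed
 finally show ?thesis .
qed

lemma sum_area: "(\<Sum>i\<in>I. measure lborel (cell i)) = measure lborel Om"
 using cell_area_sum[of "%_. 1"] by simp

lemma sum_mass: "(\<Sum>i\<in>I. mass i) = 1"
proof -
 have "(\<Sum>i\<in>I. mass i) = (LINT x|lborel. (\<Sum>i\<in>I. indicator (cell i) x * r x))"
  unfolding mass_def using integrable_mult_indicator[of _ lborel r] ri
  by (intro Bochner_Integration.integral_sum[symmetric]) auto
 also have "... = (LINT x|lborel. indicator Om x * r x)"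
  by (simp add: sum_indicator_cells flip: sum_distrib_right)
 also have "... = (LINT x|lborel. r x)"
  by (intro Bochner_Integration.integral_cong) (use r_out in \<open>auto simp: indicator_def\<close>)
 finally show ?thesis using r1 by simp
qed

lemma compact_q: "i \<in> I ==> compact_density (q i)"
 unfolding q_def[abs_def] using mass_pos[of i] by (intro compact_density_indicator) auto

lemma integral_q: "i \<in> I ==> (LINT x|lborel. q i x) = 1"
 unfolding q_def using mass_pos[of i] by (simp add: mass_def)

lemma q_measurable[measurable]: "q i \<in> borel_measurable borel"
 unfolding q_def[abs_def] by measurable

lemma q_nonneg: "0 <= q i x"
proof -
 have "0 <= mass i" unfolding mass_def using r0 by (intro Bochner_Integration.integral_nonneg) auto
 then show ?thesis unfolding q_def using r0 by auto
qed

lemma q_cell: "q i z \<noteq> 0 ==> z \<in> cell i" unfolding q_def by (auto simp: indicator_def split: if_splits)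

text \<open>With this velocity a disc that starts at \<open>z\<close> with radius 0 has reached the
  disc of its cell when its radius is \<open>eps / 2\<close>.\<close>

definition vel :: "real^2 => real^2" where "vel z = (2 / eps) *\<^sub>R (ctr (kap z) - z)"

definition B :: "real => real^2 => real^2 => real^2" where
 "B s z x = conic_field z (vel z) s (eps / 2) x"

definition K :: real where "K = 1 + 2 * C0"

lemma K: "3 <= K" unfolding K_def using C0 by simp

lemma vel_measurable[measurable]: "vel \<in> borel_measurable borel"
proof -
 have "(%z. ctr (kap z)) \<in> borel_measurable borel" by measurable
 then show ?thesis unfolding vel_def[abs_def] by measurable
qed

lemma norm_vel: "z \<in> Om ==> 1 + norm (vel z) <= K"
proof -
 assume "z \<in> Om"
 then have "norm (ctr (kap z) - z) <= C0 * eps" using cell_props(2) by (simp add: dist_norm norm_minus_commute)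
 then have "2 / eps * norm (ctr (kap z) - z) <= 2 / eps * (C0 * eps)" using eps by (intro mult_left_mono) auto
 then show ?thesis unfolding vel_def K_def norm_scaleR using eps by simp
qed

lemma B_flow:
 assumes "z \<in> Om" "0 <= s" "s <= eps / 2"
 shows "flow (disc_avg (z + s *\<^sub>R vel z) s) (disc_avg (ctr (kap z)) (eps / 2)) (B s z)"
proof -
 have "z + (eps / 2) *\<^sub>R vel z = ctr (kap z)" unfolding vel_def using eps by simp
 then show ?thesis using flow_conic_field[of s "eps / 2" z "vel z"] assms unfolding B_def by simp
qed

lemma B_outside:
 assumes "z \<in> Om" "x \<notin> Om" "0 <= s"
 shows "B s z x = 0"
 unfolding B_def
proof (rule conic_field_eq_0'[OF assms(3)])
 fix t assume t: "s <= t" "t <= eps / 2"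
 define u where "u = t * (2 / eps)"
 have u: "0 <= u" "u <= 1" "u * (eps / 2) = t" unfolding u_def using t assms(3) eps by (auto simp: field_simps)
 have "z + t *\<^sub>R vel z = (1 - u) *\<^sub>R z + u *\<^sub>R ctr (kap z)" unfolding vel_def u_def by (simp add: algebra_simps)
 then have "x \<notin> ball (z + t *\<^sub>R vel z) t" using cell_props(3)[OF assms(1) u(1,2)] assms(2) u(3) by auto
 then show "t <= norm (x - (z + t *\<^sub>R vel z))" by (simp add: dist_norm norm_minus_commute)
qed

lemma conic_field_le':
 assumes "1 + norm v <= k" "0 <= al"
 shows "norm (conic_field c v al \<beta> x) <= k^2 / (2 * pi * max al (norm (x - c)))"
proof (cases "max al (norm (x - c)) = 0")
 case True
 then have "x = c" using assms(2) by (simp add: max_def split: if_splits)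
 then show ?thesis unfolding conic_field_def using assms(2) by (auto simp: le_max_iff_disj)
next
 case False
 have v: "0 < 1 + norm v" by (simp add: add_pos_nonneg)
 then have k: "1 <= k" using assms(1) norm_ge_zero[of v] by linarith
 have m: "0 < max al (norm (x - c))" using False assms(2) by (simp add: less_max_iff_disj max_def split: if_splits)
 have "max al (norm (x - c)) / k <= max al (norm (x - c) / (1 + norm v))"
 proof -
  have "al / k <= al" using k assms(2) by (simp add: divide_le_eq mult_left_le_one_le mult_le_cancel_left1)
  moreover have "norm (x - c) / k <= norm (x - c) / (1 + norm v)" using assms(1) v k by (intro divide_left_mono) auto
  ultimately show ?thesis by (auto simp: max_def)
 qed
 moreover have "0 < max al (norm (x - c)) / k" using m k by simp
 ultimately have "(1 + norm v) / (2 * pi * max al (norm (x - c) / (1 + norm v))) <= k / (2 * pi * (max al (norm (x - c)) / k))"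
  using assms(1) k m by (intro frac_le mult_left_mono) auto
 also have "... = k^2 / (2 * pi * max al (norm (x - c)))" by (simp add: power2_eq_square)
 finally show ?thesis using conic_field_le[OF assms(2), of c v \<beta> x] by linarith
qed

lemma B_bound: "z \<in> Om ==> 0 <= s ==> norm (B s z x) <= K^2 / (2 * pi * max s (norm (x - z)))"
 unfolding B_def by (rule conic_field_le'[OF norm_vel])

lemma B_far:
 assumes "z \<in> Om" "K * eps / 2 <= norm (x - z)"
 shows "B s z x = 0"
 unfolding B_def
proof (rule conic_field_eq_0)
 have "eps / 2 * (1 + norm (vel z)) <= eps / 2 * K" using norm_vel[OF assms(1)] eps by (intro mult_left_mono) auto
 then show "eps / 2 * (1 + norm (vel z)) <= norm (x - z)" using assms(2) by (simp add: mult.commute)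
qed

lemma B_measurable[measurable]:
 assumes [measurable]: "z \<in> borel_measurable N" "x \<in> borel_measurable N"
 shows "(%w. B s (z w) (x w)) \<in> borel_measurable N"
 unfolding B_def by measurable

definition Bbar :: "int \<times> int => real^2 => real^2" where
 "Bbar i x = (LINT z|lborel. q i z *\<^sub>R B 0 z x)"

lemma Bbar_measurable[measurable]: "Bbar i \<in> borel_measurable borel"
proof -
 have "(%(x, z). q i z *\<^sub>R B 0 z x) \<in> borel_measurable (borel \<Otimes>\<^sub>M lborel)"
  unfolding case_prod_beta' by measurable
 then show ?thesis unfolding Bbar_def[abs_def] by (rule lborel.borel_measurable_lebesgue_integral)
qed

lemma Bbar_flow:
 assumes i: "i \<in> I"
 shows "flow (density_integral (q i)) (disc_avg (ctr i) (eps / 2)) (Bbar i)"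
proof -
 obtain R where R: "\<And>x. x \<in> Om ==> norm x <= R" using bd bounded_iff by blast
 show ?thesis unfolding Bbar_def[abs_def]
 proof (rule flow_average[OF compact_q[OF i] integral_q[OF i]])
  show "case_prod (B 0) \<in> borel_measurable (lborel \<Otimes>\<^sub>M lborel)" unfolding case_prod_beta' by measurable
  fix z assume "q i z \<noteq> 0"
  then have z: "z \<in> Om" "kap z = i" using q_cell[of i z] unfolding cell_def by auto
  show "flow (disc_avg z 0) (disc_avg (ctr i) (eps / 2)) (B 0 z)"
   using B_flow[OF z(1), of 0] eps z(2) by simp
  show "norm (B 0 z x) <= (K^2 / (2 * pi)) / norm (x - z)" for x
   using B_bound[OF z(1), of 0 x] by simp
  show "B 0 z x = 0" if "R < norm x" for x
   using R[of x] that by (intro B_outside z) auto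
 qed (use K in simp)
qed

lemma Bbar_outside: "x \<notin> Om ==> Bbar i x = 0"
proof -
 assume x: "x \<notin> Om"
 have "q i z *\<^sub>R B 0 z x = 0" for z
  using q_cell[of i z] B_outside[of z x 0] x unfolding cell_def by (cases "q i z = 0") auto
 then show ?thesis unfolding Bbar_def by (simp only:) simp
qed

lemma Bbar_far:
 assumes "(C0 + K) * eps < norm (x - ctr i)"
 shows "Bbar i x = 0"
proof -
 have "q i z *\<^sub>R B 0 z x = 0" for z
 proof (cases "q i z = 0")
  case False
  then have z: "z \<in> Om" "dist (ctr i) z <= C0 * eps" using q_cell[of i z] cell_subset[of i] by (auto simp: subset_iff)
  have "norm (x - ctr i) <= norm (x - z) + norm (z - ctr i)" using norm_triangle_ineq[of "x - z" "z - ctr i"] by simp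
  then have "K * eps <= norm (x - z)" using assms z(2) by (simp add: dist_norm norm_minus_commute algebra_simps)
  then have "K * eps / 2 <= norm (x - z)" using K eps by (smt (verit) field_sum_of_halves mult_pos_pos)
  then show ?thesis using B_far[OF z(1)] by simp
 qed simp
 then show ?thesis unfolding Bbar_def by (simp only:) simp
qed

lemma nn_integral_norm_inverse_ball:
 assumes "0 <= R"
 shows "(\<integral>\<^sup>+z\<in>cball x R. ennreal (1 / norm (x - z :: real^2)) \<partial>lborel) <= ennreal (2 * pi * R)"
 using nn_integral_inverse_norm_plane[OF assms, of x] by (simp add: norm_minus_commute)

text \<open>The density \<open>q i\<close> is at most of order \<open>1 / eps^2\<close>, and the
  kernel \<open>1 / norm (x - z)\<close> integrates to order \<open>eps\<close> over the disc of
  radius \<open>K * eps / 2\<close> outside which the fields vanish.\<close>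

lemma norm_Bbar_le:
 assumes i: "i \<in> I"
 shows "norm (Bbar i x) <= 2 * b * K^3 / (a * pi) / eps"
proof -
 let ?k = "b / mass i * (K^2 / (2 * pi))"
 have k0: "0 <= ?k" using b0 mass_pos[OF i] by simp
 have [measurable]: "cball x (K * eps / 2) \<in> sets borel" by simp
 have "ennreal (norm (Bbar i x)) <= (\<integral>\<^sup>+z. ennreal (norm (q i z *\<^sub>R B 0 z x)) \<partial>lborel)"
  unfolding Bbar_def by (rule norm_integral_le_nn_integral)
 also have "... <= (\<integral>\<^sup>+z. ennreal ?k * (ennreal (1 / norm (x - z)) * indicator (cball x (K * eps / 2)) z) \<partial>lborel)"
 proof (intro nn_integral_mono)
  fix z
  show "ennreal (norm (q i z *\<^sub>R B 0 z x)) <= ennreal ?k * (ennreal (1 / norm (x - z)) * indicator (cball x (K * eps / 2)) z)"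
  proof (cases "q i z \<noteq> 0 \<and> norm (x - z) <= K * eps / 2")
   case True
   then have z: "z \<in> Om" using q_cell[of i z] cell_subset[of i] by auto
   have "q i z <= b / mass i" unfolding q_def using rb[of z] r0[of z] b0 mass_pos[OF i]
    by (intro divide_right_mono) (auto simp: indicator_def)
   moreover have "norm (B 0 z x) <= K^2 / (2 * pi) * (1 / norm (x - z))" using B_bound[OF z, of 0 x] by simp
   ultimately have "norm (q i z *\<^sub>R B 0 z x) <= (b / mass i) * (K^2 / (2 * pi) * (1 / norm (x - z)))"
    unfolding norm_scaleR using q_nonneg[of i z] b0 mass_pos[OF i] by (intro mult_mono) auto
   also have "... = ?k * (1 / norm (x - z))" by simp
   finally have n: "norm (q i z *\<^sub>R B 0 z x) <= ?k * (1 / norm (x - z))" .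
   have "z \<in> cball x (K * eps / 2)" using True by (simp add: dist_norm)
   then show ?thesis using ennreal_leI[OF n] unfolding ennreal_mult'[OF k0] by simp
  next
   case False
   then have "q i z *\<^sub>R B 0 z x = 0"
    using B_far[of z x 0] q_cell[of i z] cell_subset[of i] by (cases "q i z = 0") auto
   then show ?thesis by (simp only: norm_zero ennreal_0 zero_le)
  qed
 qed
 also have "... = ennreal ?k * (\<integral>\<^sup>+z\<in>cball x (K * eps / 2). ennreal (1 / norm (x - z)) \<partial>lborel)"
  by (rule nn_integral_cmult) measurable
 also have "... <= ennreal ?k * ennreal (2 * pi * (K * eps / 2))"
  using K eps by (intro mult_left_mono nn_integral_norm_inverse_ball) auto
 also have "... = ennreal (?k * (2 * pi * (K * eps / 2)))" by (rule ennreal_mult'[OF k0, symmetric])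
 finally have "norm (Bbar i x) <= ?k * (2 * pi * (K * eps / 2))"
  by (subst (asm) ennreal_le_iff, intro mult_nonneg_nonneg k0) (use K eps in auto)
 also have "... = b * K^3 * eps / 2 / mass i" by (simp add: power2_eq_square power3_eq_cube)
 also have "... <= b * K^3 * eps / 2 / (a * (pi * (eps / 2)^2))"
  using mass_ge[OF i] mass_pos[OF i] a b0 K eps by (intro divide_left_mono) auto
 also have "... = 2 * b * K^3 / (a * pi) / eps" using eps by (simp add: power2_eq_square)
 finally show ?thesis .
qed

end

lemma nn_integral_square_bound_ball:
 fixes f :: "real^2 => real^2"
 assumes "\<And>x. norm (f x) <= k" "\<And>x. R < norm (x - c) ==> f x = 0" "0 <= R"
 shows "(\<integral>\<^sup>+x. ennreal ((norm (f x))^2) \<partial>lborel) <= ennreal (k^2 * (pi * R^2))"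
proof -
 have "(\<integral>\<^sup>+x. ennreal ((norm (f x))^2) \<partial>lborel) <= (\<integral>\<^sup>+x. ennreal (k^2) * indicator (cball c R) x \<partial>lborel)"
 proof (intro nn_integral_mono)
  fix x
  show "ennreal ((norm (f x))^2) <= ennreal (k^2) * indicator (cball c R) x"
   using assms(1)[of x] assms(2)[of x]
   by (cases "norm (x - c) <= R") (auto simp: dist_norm norm_minus_commute intro!: ennreal_leI power_mono)
 qed
 also have "... = ennreal (k^2) * emeasure lborel (cball c R)" by (intro nn_integral_cmult_indicator) simp
 also have "... = ennreal (k^2 * (pi * R^2))"
  using assms(3) by (simp add: emeasure_cball unit_ball_vol_2 ennreal_mult')
 finally show ?thesis .
qed

lemma nn_integral_inverse_bound:
 fixes A :: "real^2 => real^2"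
 assumes A: "\<And>x. norm (A x) <= k / max al (norm (x - c))" "\<And>x. R < norm (x - c) ==> A x = 0"
  and al: "0 < al" "al <= R"
 shows "(\<integral>\<^sup>+x. ennreal ((norm (A x))^2) \<partial>lborel) <= ennreal (k^2 * (pi + 2 * pi * ln (R / al)))"
proof -
 have [measurable]: "cball c R \<in> sets borel" by simp
 have "(\<integral>\<^sup>+x. ennreal ((norm (A x))^2) \<partial>lborel)
  <= (\<integral>\<^sup>+x. ennreal (k^2) * (ennreal (1 / (max al (norm (x - c)))^2) * indicator (cball c R) x) \<partial>lborel)"
 proof (intro nn_integral_mono)
  fix x
  show "ennreal ((norm (A x))^2) <= ennreal (k^2) * (ennreal (1 / (max al (norm (x - c)))^2) * indicator (cball c R) x)"
  proof (cases "norm (x - c) <= R")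
   case True
   have "(norm (A x))^2 <= (k / max al (norm (x - c)))^2" using A(1)[of x] by (intro power_mono) auto
   also have "... = k^2 * (1 / (max al (norm (x - c)))^2)" by (simp add: power_divide)
   finally have "ennreal ((norm (A x))^2) <= ennreal (k^2 * (1 / (max al (norm (x - c)))^2))" by (rule ennreal_leI)
   also have "... = ennreal (k^2) * ennreal (1 / (max al (norm (x - c)))^2)" by (rule ennreal_mult') simp
   finally show ?thesis using True by (simp add: dist_norm norm_minus_commute)
  qed (use A(2)[of x] in simp)
 qed
 also have "... = ennreal (k^2) * (\<integral>\<^sup>+x\<in>cball c R. ennreal (1 / (max al (norm (x - c)))^2) \<partial>lborel)"
  by (rule nn_integral_cmult) measurable
 also have "... <= ennreal (k^2) * ennreal (pi + 2 * pi * ln (R / al))"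
  by (intro mult_left_mono nn_integral_inverse_square_plane al) auto
 also have "... = ennreal (k^2 * (pi + 2 * pi * ln (R / al)))" by (rule ennreal_mult'[symmetric]) simp
 finally show ?thesis .
qed

context planar_cells
begin

definition CB :: real where "CB = 2 * b * K^3 / (a * pi)"

text \<open>A field of height of order \<open>1 / eps\<close> on a disc of radius of order
  \<open>eps\<close>: in the plane its energy is bounded independently of
  \<open>eps\<close>.\<close>

lemma Bbar_square:
 assumes "i \<in> I"
 shows "(\<integral>\<^sup>+x. ennreal ((norm (Bbar i x))^2) \<partial>lborel) <= ennreal (CB^2 * (pi * (C0 + K)^2))"
proof -
 have "(\<integral>\<^sup>+x. ennreal ((norm (Bbar i x))^2) \<partial>lborel) <= ennreal ((CB / eps)^2 * (pi * ((C0 + K) * eps)^2))"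
  using norm_Bbar_le[OF assms] Bbar_far C0 K eps
  by (intro nn_integral_square_bound_ball[where c = "ctr i"]) (auto simp: CB_def)
 also have "(CB / eps)^2 * (pi * ((C0 + K) * eps)^2) = CB^2 * (pi * (C0 + K)^2)"
  using eps by (simp add: power_mult_distrib power_divide)
 finally show ?thesis .
qed

text \<open>The averaging field inside the cell, a middle field \<open>A\<close> and a bounded
  macroscopic field are concatenated. Only \<open>A\<close> may have logarithmic energy; for the
  other two the bound is free of \<open>eps\<close>.\<close>

lemma cell_to_center_flow:
 assumes i: "i \<in> I"
  and M: "\<exists>f. flow (disc_avg c2 \<beta>) W f \<and> (\<forall>x. norm (f x) <= M) \<and> (\<forall>x. x \<notin> Om --> f x = 0)"
  and A: "flow (disc_avg (ctr i) (eps / 2)) (disc_avg c2 \<beta>) A" "\<And>x. x \<notin> Om ==> A x = 0" "\<And>x. norm (A x) <= k"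
 shows "\<exists>F. flow (density_integral (q i)) W F \<and> (\<forall>x. x \<notin> Om --> F x = 0) \<and> (\<exists>Bd. \<forall>x. norm (F x) <= Bd) \<and>
  (\<integral>\<^sup>+x. ennreal ((norm (F x - A x))^2) \<partial>lborel) <= ennreal (2 * (CB^2 * (pi * (C0 + K)^2)) + 2 * (M^2 * measure lborel Om))"
proof -
 obtain f where f: "flow (disc_avg c2 \<beta>) W f" "\<And>x. norm (f x) <= M" "\<And>x. x \<notin> Om ==> f x = 0" using M by blast
 define F where "F x = (Bbar i x + A x) + f x" for x
 have [measurable]: "f \<in> borel_measurable borel" using f(1) unfolding flow_def by auto
 have "flow (density_integral (q i)) W F"
  unfolding F_def[abs_def] by (rule flow_trans[OF flow_trans[OF Bbar_flow[OF i] A(1)] f(1)])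
 moreover have "F x = 0" if "x \<notin> Om" for x unfolding F_def using that A(2) f(3) Bbar_outside by simp
 moreover have "norm (F x) <= CB / eps + k + M" for x
  unfolding F_def using norm_Bbar_le[OF i, of x] A(3)[of x] f(2)[of x]
  by (intro norm_triangle_mono) (auto simp: CB_def)
 moreover have "(\<integral>\<^sup>+x. ennreal ((norm (F x - A x))^2) \<partial>lborel) <= ennreal (2 * (CB^2 * (pi * (C0 + K)^2)) + 2 * (M^2 * measure lborel Om))"
 proof -
  have M0: "0 <= M" using f(2)[of 0] norm_ge_zero order_trans by blast
  have "(\<integral>\<^sup>+x. ennreal ((norm (F x - A x))^2) \<partial>lborel)
   <= (\<integral>\<^sup>+x. ennreal 2 * ennreal ((norm (Bbar i x))^2) + ennreal (2 * M^2) * indicator Om x \<partial>lborel)"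
  proof (intro nn_integral_mono)
   fix x
   have "F x - A x = Bbar i x + f x" unfolding F_def by simp
   then have "(norm (F x - A x))^2 <= (norm (Bbar i x) + norm (f x))^2"
    using norm_triangle_ineq[of "Bbar i x" "f x"] by (intro power_mono) auto
   also have "... <= 2 * (norm (Bbar i x))^2 + 2 * (norm (f x))^2"
    using sum_squares_bound[of "norm (Bbar i x)" "norm (f x)"] by (simp add: power2_sum)
   also have "2 * (norm (f x))^2 <= 2 * M^2 * indicator Om x"
    using f(2)[of x] f(3)[of x] by (cases "x \<in> Om") (auto intro!: power_mono)
   finally have "(norm (F x - A x))^2 <= 2 * (norm (Bbar i x))^2 + 2 * M^2 * indicator Om x" by simp
   then have "ennreal ((norm (F x - A x))^2) <= ennreal (2 * (norm (Bbar i x))^2 + 2 * M^2 * indicator Om x)" by (rule ennreal_leI)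
   also have "... = ennreal 2 * ennreal ((norm (Bbar i x))^2) + ennreal (2 * M^2) * indicator Om x"
    by (subst ennreal_plus) (auto simp: ennreal_mult' indicator_def)
   finally show "ennreal ((norm (F x - A x))^2) <= ennreal 2 * ennreal ((norm (Bbar i x))^2) + ennreal (2 * M^2) * indicator Om x" .
  qed
  also have "... = ennreal 2 * (\<integral>\<^sup>+x. ennreal ((norm (Bbar i x))^2) \<partial>lborel) + ennreal (2 * M^2) * emeasure lborel Om"
   by (subst nn_integral_add) (auto simp: nn_integral_cmult nn_integral_cmult_indicator)
  also have "... <= ennreal 2 * ennreal (CB^2 * (pi * (C0 + K)^2)) + ennreal (2 * M^2) * ennreal (measure lborel Om)"
   using Bbar_square[OF i] Om_finite by (intro add_mono mult_left_mono) (auto simp: emeasure_eq_ennreal_measure)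
  also have "... = ennreal (2 * (CB^2 * (pi * (C0 + K)^2)) + 2 * (M^2 * measure lborel Om))"
  proof -
   have "ennreal 2 * ennreal X = ennreal (2 * X)" "ennreal (2 * M^2) * ennreal Y = ennreal (2 * (M^2 * Y))" for X Y
    by (simp_all only: ennreal_mult'[symmetric] mult.assoc zero_le_numeral mult_nonneg_nonneg zero_le_power2)
   then show ?thesis by (simp add: ennreal_plus[symmetric] del: ennreal_plus)
  qed
  finally show ?thesis .
 qed
 ultimately show ?thesis by blast
qed

text \<open>With room up to radius \<open>R\<close> the disc grows without moving, which gives the
  sharp constant \<open>1 / (2 * pi)\<close> of the point charge.\<close>

lemma interior_flow:
 assumes i: "i \<in> I" and R: "eps <= 2 * R" "ball (ctr i) R \<subseteq> Om"
  and M: "\<And>c. ball c R \<subseteq> Om ==> \<exists>f. flow (disc_avg c R) W f \<and> (\<forall>x. norm (f x) <= M) \<and> (\<forall>x. x \<notin> Om --> f x = 0)"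
 shows "\<exists>F A. flow (density_integral (q i)) W F \<and> (\<forall>x. x \<notin> Om --> F x = 0) \<and> (\<exists>Bd. \<forall>x. norm (F x) <= Bd) \<and>
  (\<integral>\<^sup>+x. ennreal ((norm (F x - A x))^2) \<partial>lborel) <= ennreal (2 * (CB^2 * (pi * (C0 + K)^2)) + 2 * (M^2 * measure lborel Om)) \<and>
  A \<in> borel_measurable borel \<and>
  (\<forall>x. norm (A x) <= 1 / (2 * pi * max (eps / 2) (norm (x - ctr i)))) \<and> (\<forall>x. R <= norm (x - ctr i) --> A x = 0)"
proof -
 define A where "A = conic_field (ctr i) 0 (eps / 2) R"
 have A1: "norm (A x) <= 1 / (2 * pi * max (eps / 2) (norm (x - ctr i)))" for x
  using conic_field_le[of "eps / 2" "ctr i" 0 R x] eps unfolding A_def by simp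
 have A2: "A x = 0" if "R <= norm (x - ctr i)" for x
  unfolding A_def using that by (intro conic_field_eq_0) simp
 have A3: "A x = 0" if "x \<notin> Om" for x
  using R(2) that by (intro A2) (auto simp: subset_iff dist_norm norm_minus_commute not_less)
 have fl: "flow (disc_avg (ctr i) (eps / 2)) (disc_avg (ctr i) R) A"
  using flow_conic_field[of "eps / 2" R "ctr i" 0] R(1) eps unfolding A_def by simp
 have A4: "norm (A x) <= 1 / (2 * pi * (eps / 2))" for x
  using eps by (intro order_trans[OF A1] divide_left_mono mult_left_mono) auto
 have "A \<in> borel_measurable borel" unfolding A_def by measurable
 then show ?thesis using cell_to_center_flow[OF i M[OF R(2)] fl A3 A4] A1 A2 by blast
qed

text \<open>Near the boundary the disc moves along the axis of the cone while it grows. The energy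
  is still logarithmic, with a constant that depends on \<open>lam\<close>; this is affordable
  because such cells have small total area.\<close>

lemma boundary_flow:
 assumes i: "i \<in> I" and uc: "uniform_cone Om h lam R0" and small: "eps / 2 <= lam * h" "eps / 2 <= R0"
  and M: "\<And>c. ball c (lam * h) \<subseteq> Om ==> \<exists>f. flow (disc_avg c (lam * h)) W f \<and> (\<forall>x. norm (f x) <= M) \<and> (\<forall>x. x \<notin> Om --> f x = 0)"
 shows "\<exists>F A. flow (density_integral (q i)) W F \<and> (\<forall>x. x \<notin> Om --> F x = 0) \<and> (\<exists>Bd. \<forall>x. norm (F x) <= Bd) \<and>
  (\<integral>\<^sup>+x. ennreal ((norm (F x - A x))^2) \<partial>lborel) <= ennreal (2 * (CB^2 * (pi * (C0 + K)^2)) + 2 * (M^2 * measure lborel Om)) \<and>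
  A \<in> borel_measurable borel \<and>
  (\<integral>\<^sup>+x. ennreal ((norm (A x))^2) \<partial>lborel)
   <= ennreal (((1 + 1 / lam)^2 / (2 * pi))^2 * (pi + 2 * pi * ln ((1 + 1 / lam) * (lam * h) / (eps / 2))))"
proof -
 have lam: "0 < lam" "lam <= 1" "0 < h" using uc unfolding uniform_cone_def by auto
 have "\<exists>e. norm e = 1 \<and> (\<forall>z\<in>Om \<inter> ball (ctr i) R0. \<forall>s. 0 <= s \<and> s <= h --> ball (z + s *\<^sub>R e) (lam * s) \<subseteq> Om)"
  using uc ctr_in[OF i] unfolding uniform_cone_def by (elim conjE) (rule bspec)
 then obtain e where e1: "norm e = 1"
  and e2: "\<forall>z\<in>Om \<inter> ball (ctr i) R0. \<forall>s. 0 <= s \<and> s <= h --> ball (z + s *\<^sub>R e) (lam * s) \<subseteq> Om"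
  by (elim exE conjE)
 note e = e1 e2[rule_format, OF IntI conjI]
 \<comment> \<open>The speed is \<open>1 / lam\<close>, so the centre advances by \<open>t\<close>
   while the radius grows by \<open>lam * t\<close>, which is the opening of the cone.\<close>
 define v where "v = (1 / lam) *\<^sub>R e"
 define c where "c = ctr i - (eps / 2) *\<^sub>R v"
 define \<beta> where "\<beta> = lam * h"
 define A where "A = conic_field c v (eps / 2) \<beta>"
 have nv: "1 + norm v = 1 + 1 / lam" unfolding v_def using e(1) lam by simp
 have ctri: "ball (ctr i) (eps / 2) \<subseteq> Om" using ctr_ball[OF i] cell_subset(1)[of i] by blast
 have inO: "ball (c + s *\<^sub>R v) s \<subseteq> Om" if s: "eps / 2 <= s" "s <= \<beta>" for s
 proof
  fix x assume x: "x \<in> ball (c + s *\<^sub>R v) s"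
  define t where "t = (s - eps / 2) / lam"
  have "t <= (\<beta> - eps / 2) / lam" unfolding t_def using s lam by (intro divide_right_mono) auto
  also have "... <= \<beta> / lam" using eps lam by (intro divide_right_mono) auto
  finally have t: "0 <= t" "t <= h" "lam * t = s - eps / 2" unfolding t_def \<beta>_def using s lam by auto
  have s0: "0 < s" using s eps by linarith
  define p where "p = x - ctr i - t *\<^sub>R e"
  have ce: "c + s *\<^sub>R v = ctr i + t *\<^sub>R e" unfolding c_def v_def t_def by (simp add: algebra_simps diff_divide_distrib)
  have p: "norm p < s" using x unfolding p_def ce by (simp add: dist_norm norm_minus_commute algebra_simps)
  \<comment> \<open>The radius is \<open>s = eps / 2 + lam * t\<close>. Splitting \<open>p\<close>
    in this proportion writes the point as a point of the disc in the cell, moved by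
    \<open>t\<close> along the axis and then by less than \<open>lam * t\<close>.\<close>
  define u where "u = (eps / 2 / s) *\<^sub>R p"
  define w where "w = (lam * t / s) *\<^sub>R p"
  have "eps / 2 / s + lam * t / s = 1" using s0 t(3) by (simp add: field_simps)
  then have "u + w = p" unfolding u_def w_def by (simp flip: scaleR_add_left)
  then have xe: "x = (ctr i + u) + t *\<^sub>R e + w" unfolding p_def by (simp add: algebra_simps)
  have nu: "norm u < eps / 2"
  proof -
   have "norm u = (eps / 2 / s) * norm p" unfolding u_def norm_scaleR using eps s0 by simp
   also have "... < (eps / 2 / s) * s" using p eps s0 by (intro mult_strict_left_mono) auto
   finally show ?thesis using s0 by simp
  qed
  have z: "ctr i + u \<in> Om" "ctr i + u \<in> ball (ctr i) R0"
   using nu ctri small(2) by (auto simp: dist_norm subset_iff)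
  show "x \<in> Om"
  proof (cases "t = 0")
   case True
   then have "w = 0" unfolding w_def by simp
   then show ?thesis using z(1) xe True by simp
  next
   case False
   have "0 <= lam * t / s" using lam t(1) s0 by (intro divide_nonneg_pos mult_nonneg_nonneg) auto
   then have "norm w = (lam * t / s) * norm p" unfolding w_def norm_scaleR by (simp only: abs_of_nonneg)
   also have "... < (lam * t / s) * s"
   proof (rule mult_strict_left_mono[OF p])
    show "0 < lam * t / s" using lam(1) t(1) s0 False by (intro divide_pos_pos mult_pos_pos) auto
   qed
   finally have "norm w < lam * t" using s0 by simp
   then have "x \<in> ball (ctr i + u + t *\<^sub>R e) (lam * t)" unfolding xe by (simp add: dist_norm)
   then show ?thesis using e(2)[OF z t(1,2)] by blast
  qed
 qed
 have be: "eps / 2 <= \<beta>" using small(1) unfolding \<beta>_def .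
 have fl: "flow (disc_avg (ctr i) (eps / 2)) (disc_avg (c + \<beta> *\<^sub>R v) \<beta>) A"
 proof -
  have "c + (eps / 2) *\<^sub>R v = ctr i" unfolding c_def by simp
  then show ?thesis using flow_conic_field[of "eps / 2" \<beta> c v] be eps unfolding A_def by simp
 qed
 have Aout: "A x = 0" if "x \<notin> Om" for x
  unfolding A_def
 proof (rule conic_field_eq_0')
  show "s <= norm (x - (c + s *\<^sub>R v))" if s: "eps / 2 <= s" "s <= \<beta>" for s
   using inO[OF s] \<open>x \<notin> Om\<close> by (auto simp: subset_iff dist_norm norm_minus_commute not_less)
 qed (use eps in simp)
 let ?k = "(1 + 1 / lam)^2 / (2 * pi)"
 have A1: "norm (A x) <= ?k / max (eps / 2) (norm (x - c))" for x
  using conic_field_le'[of v "1 + 1 / lam" "eps / 2" c \<beta> x] nv eps unfolding A_def by simp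
 have A2: "norm (A x) <= ?k / (eps / 2)" for x
  using eps by (intro order_trans[OF A1] divide_left_mono) auto
 have M': "\<exists>f. flow (disc_avg (c + \<beta> *\<^sub>R v) \<beta>) W f \<and> (\<forall>x. norm (f x) <= M) \<and> (\<forall>x. x \<notin> Om --> f x = 0)"
  using M[of "c + \<beta> *\<^sub>R v"] inO[OF be] unfolding \<beta>_def by simp
 have "(\<integral>\<^sup>+x. ennreal ((norm (A x))^2) \<partial>lborel) <= ennreal (?k^2 * (pi + 2 * pi * ln ((1 + 1 / lam) * (lam * h) / (eps / 2))))"
 proof (rule nn_integral_inverse_bound[OF A1])
  show "A x = 0" if "(1 + 1 / lam) * (lam * h) < norm (x - c)" for x
   unfolding A_def using that nv by (intro conic_field_eq_0) (simp add: \<beta>_def mult.commute)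
  have "1 * (lam * h) <= (1 + 1 / lam) * (lam * h)" using lam by (intro mult_right_mono) auto
  then have "lam * h <= (1 + 1 / lam) * (lam * h)" by (simp only: mult_1_left)
  then show "eps / 2 <= (1 + 1 / lam) * (lam * h)" by (rule order_trans[OF small(1)])
 qed (use eps in simp)
 moreover have "A \<in> borel_measurable borel" unfolding A_def by measurable
 ultimately show ?thesis using cell_to_center_flow[OF i M' fl Aout A2] by blast
qed

end

section \<open>Upper bound for the matching cost\<close>

lemma flow_cong:
 assumes "flow A B b" "\<And>g. continuous_on UNIV g ==> A' g = A g" "\<And>g. continuous_on UNIV g ==> B' g = B g"
 shows "flow A' B' b"
 using flow_scaleR[OF assms(1), of B' A' 1] assms(2,3) by simp

lemma flow_sum:
 assumes "finite S" "\<And>i. i \<in> S ==> flow (A i) (B i) (b i)"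
 shows "flow (%g. (\<Sum>i\<in>S. A i g) / k) (%g. (\<Sum>i\<in>S. B i g) / k) (%x. (1 / k) *\<^sub>R (\<Sum>i\<in>S. b i x))"
proof -
 have "flow (%g. \<Sum>i\<in>S. A i g) (%g. \<Sum>i\<in>S. B i g) (%x. \<Sum>i\<in>S. b i x)"
  unfolding flow_def
 proof (intro conjI allI impI)
  show "(%x. \<Sum>i\<in>S. b i x) \<in> borel_measurable borel"
   using assms(2) unfolding flow_def by (intro borel_measurable_sum) auto
  fix g :: "real^2 => real" and \<xi> assume "weak_grad g \<xi>"
  then have *: "integrable lborel (%x. \<xi> x \<bullet> b i x)" "B i g - A i g = (LINT x|lborel. \<xi> x \<bullet> b i x)" if "i \<in> S" for i
   using assms(2)[OF that] unfolding flow_def by auto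
  show "integrable lborel (%x. \<xi> x \<bullet> (\<Sum>i\<in>S. b i x))"
   unfolding inner_sum_right using * by (intro Bochner_Integration.integrable_sum)
  show "(\<Sum>i\<in>S. B i g) - (\<Sum>i\<in>S. A i g) = (LINT x|lborel. \<xi> x \<bullet> (\<Sum>i\<in>S. b i x))"
   unfolding inner_sum_right using * by (simp add: Bochner_Integration.integral_sum sum_subtractf[symmetric])
 qed
 then show ?thesis by (rule flow_scaleR) (simp add: diff_divide_distrib)
qed

context planar_density
begin

lemma integrable_energy:
 fixes f :: "real^2 => real^2"
 assumes [measurable]: "f \<in> borel_measurable borel" and "\<And>x. norm (f x) <= Bd" "\<And>x. x \<notin> Om ==> f x = 0"
 shows "integrable lborel (%x. (norm (f x))^2 / r x)"
proof (rule Bochner_Integration.integrable_bound)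
 show "integrable lborel (%x. (Bd^2 / a) * indicat_real Om x)"
  using Om_finite by (intro integrable_mult_right integrable_real_indicator) auto
 show "AE x in lborel. norm ((norm (f x))^2 / r x) <= norm ((Bd^2 / a) * indicat_real Om x)"
 proof (intro AE_I2)
  fix x
  show "norm ((norm (f x))^2 / r x) <= norm ((Bd^2 / a) * indicat_real Om x)"
  proof (cases "x \<in> Om")
   case True
   have "(norm (f x))^2 / r x <= Bd^2 / a"
    using assms(2)[of x] ra[OF True] a by (intro frac_le power_mono) auto
   then show ?thesis using True a r0[of x] by simp
  qed (use assms(3) in simp)
 qed
qed measurable

lemma energy_scale:
 assumes "0 < k"
 shows "energy (%x. k * r x) f = energy r f / k"
proof -
 have "energy (%x. k * r x) f = (LINT x|lborel. (1 / k) * ((norm (f x))^2 / r x))" unfolding energy_def by simp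
 also have "... = (1 / k) * energy r f" unfolding energy_def by (rule integral_mult_right_zero)
 finally show ?thesis by simp
qed

end

section \<open>The empirical measures averaged over cells\<close>

context planar_cells
begin

definition smoothed :: "nat => (nat => real^2) => real^2 => real" where
 "smoothed n x z = (\<Sum>i\<in>{1..n}. q (kap (x i)) z) / real n"

text \<open>It starts from discs of radius \<open>s\<close> close to the sample points and not from
  the points themselves, because the field of a point mass has infinite energy.\<close>

definition local_field :: "real => nat => (nat => real^2) => real^2 => real^2" where
 "local_field s n x z = (1 / real n) *\<^sub>R (\<Sum>i\<in>{1..n}. B s (x i) z - Bbar (kap (x i)) z)"

definition global_field :: "(int \<times> int => real^2 => real^2) => nat => (nat => real^2) => (nat => real^2) => real^2 => real^2" where
 "global_field F n x y z = (1 / real n) *\<^sub>R (\<Sum>i\<in>{1..n}. F (kap (x i)) z - F (kap (y i)) z)"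

lemma kap_in: "x \<in> Om ==> kap x \<in> I" unfolding I_def by auto

lemma compact_smoothed:
 assumes "\<And>i. i \<in> {1..n} ==> x i \<in> Om"
 shows "compact_density (smoothed n x)"
proof -
 have c: "compact_density (q (kap (x i)))" if "i \<in> {1..n}" for i using compact_q kap_in assms that by auto
 obtain R where R: "\<And>z. z \<in> Om ==> norm z <= R" using bd bounded_iff by blast
 have "q k z = 0" if "R < norm z" for k z
  using q_cell[of k z] cell_subset(1)[of k] R[of z] that by force
 then have "\<forall>z. R < norm z --> smoothed n x z = 0" unfolding smoothed_def by simp
 moreover have "integrable lborel (smoothed n x)"
  unfolding smoothed_def[abs_def] using c unfolding compact_density_def
  by (intro Bochner_Integration.integrable_divide Bochner_Integration.integrable_sum) auto
 moreover have "0 <= smoothed n x z" for z unfolding smoothed_def using q_nonneg by (intro divide_nonneg_nonneg sum_nonneg) auto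
 ultimately show ?thesis unfolding compact_density_def by blast
qed

lemma density_integral_smoothed:
 assumes "\<And>i. i \<in> {1..n} ==> x i \<in> Om" "continuous_on UNIV g"
 shows "density_integral (smoothed n x) g = (\<Sum>i\<in>{1..n}. density_integral (q (kap (x i))) g) / real n"
proof -
 have i: "integrable lborel (%z. g z * q (kap (x i)) z)" if "i \<in> {1..n}" for i
  using that assms by (intro integrable_continuous_compact_density compact_q kap_in) auto
 have "density_integral (smoothed n x) g = (LINT z|lborel. (\<Sum>i\<in>{1..n}. g z * q (kap (x i)) z) / real n)"
  unfolding density_integral_def smoothed_def by (simp add: sum_distrib_left)
 also have "... = (LINT z|lborel. (\<Sum>i\<in>{1..n}. g z * q (kap (x i)) z)) / real n" by (rule integral_divide_zero)
 also have "... = (\<Sum>i\<in>{1..n}. density_integral (q (kap (x i))) g) / real n"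
  unfolding density_integral_def using i by (subst Bochner_Integration.integral_sum) auto
 finally show ?thesis .
qed

lemma local_flow:
 assumes x: "\<And>i. i \<in> {1..n} ==> x i \<in> Om" and s: "0 <= s" "s <= eps / 2"
 shows "flow (%g. (\<Sum>i\<in>{1..n}. disc_avg (x i + s *\<^sub>R vel (x i)) s g) / real n) (density_integral (smoothed n x)) (local_field s n x)"
proof -
 have "flow (disc_avg (x i + s *\<^sub>R vel (x i)) s) (density_integral (q (kap (x i)))) (%z. B s (x i) z + - Bbar (kap (x i)) z)"
  if "i \<in> {1..n}" for i
  using x[OF that] s kap_in by (intro flow_trans[OF B_flow flow_reverse[OF Bbar_flow]]) auto
 then have "flow (%g. (\<Sum>i\<in>{1..n}. disc_avg (x i + s *\<^sub>R vel (x i)) s g) / real n)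
   (%g. (\<Sum>i\<in>{1..n}. density_integral (q (kap (x i))) g) / real n)
   (%z. (1 / real n) *\<^sub>R (\<Sum>i\<in>{1..n}. B s (x i) z + - Bbar (kap (x i)) z))"
  by (intro flow_sum) auto
 then show ?thesis unfolding local_field_def[abs_def] add_uminus_conv_diff
  by (rule flow_cong) (use density_integral_smoothed[OF x] in auto)
qed

lemma global_flow:
 assumes x: "\<And>i. i \<in> {1..n} ==> x i \<in> Om" and y: "\<And>i. i \<in> {1..n} ==> y i \<in> Om"
  and F: "\<And>i. i \<in> I ==> flow (density_integral (q i)) W (F i)"
 shows "flow (density_integral (smoothed n x)) (density_integral (smoothed n y)) (global_field F n x y)"
proof -
 have "flow (density_integral (q (kap (x i)))) (density_integral (q (kap (y i)))) (%z. F (kap (x i)) z + - F (kap (y i)) z)"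
  if "i \<in> {1..n}" for i
  using x[OF that] y[OF that] by (intro flow_trans[OF F flow_reverse[OF F]] kap_in) auto
 then have "flow (%g. (\<Sum>i\<in>{1..n}. density_integral (q (kap (x i))) g) / real n)
   (%g. (\<Sum>i\<in>{1..n}. density_integral (q (kap (y i))) g) / real n)
   (%z. (1 / real n) *\<^sub>R (\<Sum>i\<in>{1..n}. F (kap (x i)) z + - F (kap (y i)) z))"
  by (intro flow_sum) auto
 then show ?thesis unfolding global_field_def[abs_def] add_uminus_conv_diff
  by (rule flow_cong) (use density_integral_smoothed[OF x] density_integral_smoothed[OF y] in auto)
qed

lemma smoothed_eq:
 assumes "z \<in> Om"
 shows "smoothed n x z = r z / mass (kap z) * (\<Sum>i\<in>{1..n}. indicator {w. kap w = kap z} (x i)) / real n"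
proof -
 have "q (kap (x i)) z = r z / mass (kap z) * indicator {w. kap w = kap z} (x i)" for i
  using assms unfolding q_def cell_def by (auto simp: indicator_def)
 then show ?thesis unfolding smoothed_def by (simp add: sum_distrib_left)
qed

text \<open>If no cell is short of points, then \<open>(1 - et) * r\<close> lies below the averaged
  density. This provides a weight for the energies that does not depend on the sample, so that their
  expectations can be computed.\<close>

lemma smoothed_ge:
 assumes n: "1 <= n" and cnt: "\<And>k. k \<in> I ==> (1 - et) * (real n * mass k) <= (\<Sum>i\<in>{1..n}. indicator {w. kap w = k} (x i))"
 shows "(1 - et) * r z <= smoothed n x z"
proof (cases "z \<in> Om")
 case True
 have m: "0 < mass (kap z)" using mass_pos kap_in True by auto
 have "(1 - et) * r z = r z / mass (kap z) * ((1 - et) * (real n * mass (kap z))) / real n"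
  using m n by simp
 also have "... <= smoothed n x z"
  unfolding smoothed_eq[OF True] using cnt[OF kap_in[OF True]] r0[of z] m
  by (intro divide_right_mono mult_left_mono) auto
 finally show ?thesis .
next
 case False
 then show ?thesis using r_out[of z] q_nonneg unfolding smoothed_def by (simp add: sum_nonneg)
qed

lemma local_field_bounds:
 assumes x: "\<And>i. i \<in> {1..n} ==> x i \<in> Om" and s: "0 < s"
 shows "norm (local_field s n x z) <= K^2 / (2 * pi * s) + CB / eps" "z \<notin> Om ==> local_field s n x z = 0"
  "local_field s n x \<in> borel_measurable borel"
proof -
 have "norm (B s (x i) z - Bbar (kap (x i)) z) <= K^2 / (2 * pi * s) + CB / eps" if "i \<in> {1..n}" for i
 proof -
  have "norm (B s (x i) z) <= K^2 / (2 * pi * max s (norm (z - x i)))" using x[OF that] s by (intro B_bound) auto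
  also have "... <= K^2 / (2 * pi * s)" using s by (intro divide_left_mono mult_left_mono) auto
  finally show ?thesis
   using norm_Bbar_le[OF kap_in[OF x[OF that]], of z] norm_triangle_ineq4[of "B s (x i) z" "Bbar (kap (x i)) z"]
   unfolding CB_def by linarith
 qed
 then have "norm (\<Sum>i\<in>{1..n}. B s (x i) z - Bbar (kap (x i)) z) <= real (card {1..n}) * (K^2 / (2 * pi * s) + CB / eps)"
  by (rule sum_norm_bound)
 moreover have "0 <= K^2 / (2 * pi * s) + CB / eps" using s eps a b0 K unfolding CB_def by (intro add_nonneg_nonneg divide_nonneg_nonneg mult_nonneg_nonneg) auto
 ultimately show "norm (local_field s n x z) <= K^2 / (2 * pi * s) + CB / eps"
  unfolding local_field_def by (cases "n = 0") (auto simp: divide_le_eq mult.commute)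
 show "local_field s n x z = 0" if "z \<notin> Om"
  unfolding local_field_def using that x s by (simp add: B_outside Bbar_outside)
 show "local_field s n x \<in> borel_measurable borel" unfolding local_field_def[abs_def] by measurable
qed

lemma global_field_bounds:
 assumes F: "\<And>i z. norm (F i z) <= Bd" "\<And>i z. z \<notin> Om ==> F i z = 0" "\<And>i. F i \<in> borel_measurable borel"
 shows "norm (global_field F n x y z) <= 2 * Bd" "z \<notin> Om ==> global_field F n x y z = 0"
  "global_field F n x y \<in> borel_measurable borel"
proof -
 note [measurable] = F(3)
 have B0: "0 <= Bd" using F(1)[of undefined 0] norm_ge_zero order_trans by blast
 have "norm (F (kap (x i)) z - F (kap (y i)) z) <= 2 * Bd" for i
  using F(1)[of "kap (x i)" z] F(1)[of "kap (y i)" z] norm_triangle_ineq4[of "F (kap (x i)) z" "F (kap (y i)) z"] by linarith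
 then have "norm (\<Sum>i\<in>{1..n}. F (kap (x i)) z - F (kap (y i)) z) <= real (card {1..n}) * (2 * Bd)"
  by (rule sum_norm_bound)
 then show "norm (global_field F n x y z) <= 2 * Bd"
  unfolding global_field_def using B0 by (cases "n = 0") (auto simp: divide_le_eq mult.commute)
 show "global_field F n x y z = 0" if "z \<notin> Om" unfolding global_field_def using that F(2) by simp
 show "global_field F n x y \<in> borel_measurable borel" unfolding global_field_def[abs_def] by measurable
qed

lemma match_cost_good:
 assumes n: "1 <= n" and \<theta>: "0 < \<theta>" "\<theta> < 1 / 4" and N: "0 < N" and et: "0 < et" "et < 1"
  and x: "\<And>i. i \<in> {1..n} ==> x i \<in> Om" and y: "\<And>i. i \<in> {1..n} ==> y i \<in> Om"
  and s: "0 < s" "s <= eps / 2"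
  and F: "\<And>i. i \<in> I ==> flow (density_integral (q i)) W (F i)"
   "\<And>i z. norm (F i z) <= Bd" "\<And>i z. z \<notin> Om ==> F i z = 0" "\<And>i. F i \<in> borel_measurable borel"
  and cnt: "\<And>k. k \<in> I ==> (1 - et) * (real n * mass k) <= (\<Sum>i\<in>{1..n}. indicator {w. kap w = k} (x i))"
   "\<And>k. k \<in> I ==> (1 - et) * (real n * mass k) <= (\<Sum>i\<in>{1..n}. indicator {w. kap w = k} (y i))"
 shows "match_cost n x y / real n <= 2 * (K * s)^2 / \<theta>
   + 2 / \<theta> * (energy r (local_field s n x) + energy r (local_field s n y)) / (1 - et)
   + (1 / (4 * \<theta> * real N) + 1 / (1 - 4 * \<theta>)) * energy r (global_field F n x y) / (1 - et)"
proof -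
 have near: "norm (p + s *\<^sub>R vel p + s *\<^sub>R u - p) <= K * s" if "p \<in> Om" "u \<in> ball 0 1" for p u
 proof -
  have "norm (p + s *\<^sub>R vel p + s *\<^sub>R u - p) = norm (s *\<^sub>R (vel p + u))" by (simp add: algebra_simps)
  also have "... = s * norm (vel p + u)" using s by simp
  also have "... <= s * K" using norm_vel[OF that(1)] norm_triangle_ineq[of "vel p" u] that(2) s
   by (intro mult_left_mono) auto
  finally show ?thesis by (simp add: mult.commute)
 qed
 have l0: "f z = 0" if "(1 - et) * r z = 0" "\<And>z. z \<notin> Om ==> f z = 0" for f :: "real^2 => real^2" and z
  using that et ra[of z] a by force
 have en: "integrable lborel (%z. (norm (f z))^2 / ((1 - et) * r z))"
  if "integrable lborel (%z. (norm (f z))^2 / r z)" for f :: "real^2 => real^2"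
 proof -
  have "(norm (f z))^2 / ((1 - et) * r z) = 1 / (1 - et) * ((norm (f z))^2 / r z)" for z by simp
  then show ?thesis using integrable_mult_right[of "1 / (1 - et)", OF that] by (simp only:)
 qed
 note gb = global_field_bounds[OF F(2-4)]
 have "match_cost n x y / real n <= 2 * (K * s)^2 / \<theta>
   + 2 / \<theta> * (energy (%z. (1 - et) * r z) (local_field s n x) + energy (%z. (1 - et) * r z) (local_field s n y))
   + (1 / (4 * \<theta> * real N) + 1 / (1 - 4 * \<theta>)) * energy (%z. (1 - et) * r z) (global_field F n x y)"
 proof (rule match_cost_upper[OF n \<theta> N _ _ local_flow[OF x] local_flow[OF y] global_flow[OF x y F(1)]
    compact_smoothed[OF x] compact_smoothed[OF y]])
  show "0 <= (1 - et) * r z" for z using et r0[of z] by simp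
  show "(1 - et) * r z <= smoothed n x z" for z by (rule smoothed_ge[OF n cnt(1)])
  show "(1 - et) * r z <= smoothed n y z" for z by (rule smoothed_ge[OF n cnt(2)])
  show "local_field s n x z = 0" if "(1 - et) * r z = 0" for z by (rule l0[OF that local_field_bounds(2)[OF x s(1)]])
  show "local_field s n y z = 0" if "(1 - et) * r z = 0" for z by (rule l0[OF that local_field_bounds(2)[OF y s(1)]])
  show "global_field F n x y z = 0" if "(1 - et) * r z = 0" for z by (rule l0[OF that gb(2)])
  show "integrable lborel (%z. (norm (local_field s n x z))^2 / ((1 - et) * r z))"
   by (rule en, rule integrable_energy[OF local_field_bounds(3,1,2)[OF x s(1)]])
  show "integrable lborel (%z. (norm (local_field s n y z))^2 / ((1 - et) * r z))"
   by (rule en, rule integrable_energy[OF local_field_bounds(3,1,2)[OF y s(1)]])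
  show "integrable lborel (%z. (norm (global_field F n x y z))^2 / ((1 - et) * r z))"
   by (rule en, rule integrable_energy[OF gb(3,1,2)])
 qed (use near x y s in auto)
 then show ?thesis using et by (simp add: energy_scale add_divide_distrib distrib_left)
qed

end

section \<open>Expected energies of superposed fields\<close>

context planar_density
begin

lemma energy_expectation:
 fixes V :: "real^2 => real^2 => real^2"
 assumes J: "finite J" and V[measurable]: "case_prod V \<in> borel_measurable (borel \<Otimes>\<^sub>M borel)"
  and Bd: "\<And>y z. norm (V y z) <= Bd" and out: "\<And>y z. z \<notin> Om ==> V y z = 0"
 shows "(\<integral>\<^sup>+om. ennreal (energy r (%z. \<Sum>k\<in>J. s k *\<^sub>R V (om k) z)) \<partial>PiM J (%_. D))
  <= (\<integral>\<^sup>+z. ennreal (((\<Sum>k\<in>J. (s k)^2) * (LINT y|D. (norm (V y z))^2) + (\<Sum>k\<in>J. s k)^2 * (norm (LINT y|D. V y z))^2) / r z) \<partial>lborel)"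
  (is "?L <= ?R")
  and "(%om. energy r (%z. \<Sum>k\<in>J. s k *\<^sub>R V (om k) z)) \<in> borel_measurable (PiM J (%_. D))"
proof -
 interpret P: prob_space "PiM J (%_. D)" by (rule prob_space_PiM_const[OF prob_D])
 interpret PL: pair_sigma_finite "PiM J (%_. D)" "lborel :: (real^2) measure" ..
 have Vm: "(%w. V (f w) (h w)) \<in> borel_measurable N" if "f \<in> measurable N borel" "h \<in> measurable N borel" for f h and N :: "'m measure"
  using measurable_compose[OF measurable_Pair[OF that] V] by simp
 have Vm2: "(%p. V (fst p k) (snd p)) \<in> borel_measurable (PiM J (%_. D) \<Otimes>\<^sub>M lborel)" if "k \<in> J" for k
  using measurable_compose[OF measurable_Pair[OF _ _] V, of "%p. fst p k" _ snd] that by auto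
 define S where "S om z = (\<Sum>k\<in>J. s k *\<^sub>R V (om k) z)" for om z
 have Sm: "(%p. S (fst p) (snd p)) \<in> borel_measurable (PiM J (%_. D) \<Otimes>\<^sub>M lborel)"
  unfolding S_def using Vm2 by (intro borel_measurable_sum borel_measurable_scaleR) auto
 have Sz[measurable]: "S om \<in> borel_measurable borel" for om
  unfolding S_def[abs_def]
 proof (intro borel_measurable_sum borel_measurable_scaleR borel_measurable_const)
  show "V (om k) \<in> borel_measurable borel" for k
   using measurable_compose[OF measurable_Pair1' V, of "om k"] by simp
 qed
 have Sb: "norm (S om z) <= (\<Sum>k\<in>J. \<bar>s k\<bar> * Bd)" for om z
  unfolding S_def by (intro sum_norm_le) (auto intro!: mult_left_mono Bd)
 have S0: "S om z = 0" if "z \<notin> Om" for om z unfolding S_def using out[OF that] by simp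
 have m2: "(%p. (norm (S (fst p) (snd p)))^2 / r (snd p)) \<in> borel_measurable (PiM J (%_. D) \<Otimes>\<^sub>M lborel)"
  using Sm by measurable
 show "(%om. energy r (%z. \<Sum>k\<in>J. s k *\<^sub>R V (om k) z)) \<in> borel_measurable (PiM J (%_. D))"
  unfolding energy_def S_def[symmetric] using m2
  by (intro lborel.borel_measurable_lebesgue_integral) (simp add: case_prod_beta')
 have "?L = (\<integral>\<^sup>+om. \<integral>\<^sup>+z. ennreal ((norm (S om z))^2 / r z) \<partial>lborel \<partial>PiM J (%_. D))"
 proof (intro nn_integral_cong)
  fix om
  have "ennreal (energy r (S om)) = (\<integral>\<^sup>+z. ennreal ((norm (S om z))^2 / r z) \<partial>lborel)"
   unfolding energy_def using r0 by (intro nn_integral_eq_integral[symmetric] integrable_energy[OF Sz Sb S0]) auto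
  then show "ennreal (energy r (%z. \<Sum>k\<in>J. s k *\<^sub>R V (om k) z)) = (\<integral>\<^sup>+z. ennreal ((norm (S om z))^2 / r z) \<partial>lborel)"
   unfolding S_def by simp
 qed
 also have "... = (\<integral>\<^sup>+z. \<integral>\<^sup>+om. ennreal ((norm (S om z))^2 / r z) \<partial>PiM J (%_. D) \<partial>lborel)"
  using m2 by (intro PL.Fubini'[symmetric]) (simp add: case_prod_beta')
 also have "... <= ?R"
 proof (intro nn_integral_mono)
  fix z
  have Vz: "(%y. V y z) \<in> borel_measurable D" using measurable_compose[OF measurable_Pair2' V, of z] by simp
  have "(%om. V (om k) z) \<in> borel_measurable (PiM J (%_. D))" if "k \<in> J" for k
   using measurable_compose[OF measurable_component_singleton[OF that] Vz] .
  then have Swm: "(%om. S om z) \<in> borel_measurable (PiM J (%_. D))"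
   unfolding S_def by (intro borel_measurable_sum borel_measurable_scaleR) auto
  have "(\<integral>\<^sup>+om. ennreal ((norm (S om z))^2 / r z) \<partial>PiM J (%_. D))
    = (\<integral>\<^sup>+om. ennreal (1 / r z) * ennreal ((norm (S om z))^2) \<partial>PiM J (%_. D))"
   using r0 by (intro nn_integral_cong) (simp flip: ennreal_mult')
  also have "... = ennreal (1 / r z) * (\<integral>\<^sup>+om. ennreal ((norm (S om z))^2) \<partial>PiM J (%_. D))"
   by (intro nn_integral_cmult measurable_compose[OF _ measurable_ennreal] borel_measurable_power
     measurable_compose[OF Swm borel_measurable_norm])
  also have "... <= ennreal (1 / r z) * ennreal ((\<Sum>k\<in>J. (s k)^2) * (LINT y|D. (norm (V y z))^2) + (\<Sum>k\<in>J. s k)^2 * (norm (LINT y|D. V y z))^2)"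
   unfolding S_def by (intro mult_left_mono vector_second_moment[OF prob_D J Vz Bd]) auto
  also have "... = ennreal (((\<Sum>k\<in>J. (s k)^2) * (LINT y|D. (norm (V y z))^2) + (\<Sum>k\<in>J. s k)^2 * (norm (LINT y|D. V y z))^2) / r z)"
   using r0 by (subst ennreal_mult'[symmetric]) auto
  finally show "(\<integral>\<^sup>+om. ennreal ((norm (S om z))^2 / r z) \<partial>PiM J (%_. D))
   <= ennreal (((\<Sum>k\<in>J. (s k)^2) * (LINT y|D. (norm (V y z))^2) + (\<Sum>k\<in>J. s k)^2 * (norm (LINT y|D. V y z))^2) / r z)" .
 qed
 finally show "?L <= ?R" .
qed

end

text \<open>Both samples form one i.i.d. family, so product measures and moments need a single index
  set.\<close>

definition labels :: "nat => (nat + nat) set" where "labels n = {1..n} <+> {1..n}"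

lemma finite_labels: "finite (labels n)" unfolding labels_def by simp

lemma sum_labels: "(\<Sum>k\<in>labels n. f k) = (\<Sum>i\<in>{1..n}. f (Inl i)) + (\<Sum>i\<in>{1..n}. f (Inr i))"
 unfolding labels_def by (simp add: sum.Plus)

context planar_cells
begin

lemma mass_nonneg: "0 <= mass i"
 unfolding mass_def using r0 by (intro Bochner_Integration.integral_nonneg) auto

lemma cell_integral:
 fixes h :: "int \<times> int => real"
 shows "(LINT y|D. h (kap y)) = (\<Sum>i\<in>I. mass i * h i)"
proof -
 have m: "(%y. h (kap y)) \<in> borel_measurable borel" by measurable
 have "(LINT y|D. h (kap y)) = (LINT y|lborel. r y * h (kap y))" using integral_D[OF m] by simp
 also have "... = (LINT y|lborel. (\<Sum>i\<in>I. h i * (indicator (cell i) y * r y)))"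
 proof (intro Bochner_Integration.integral_cong refl)
  fix y
  show "r y * h (kap y) = (\<Sum>i\<in>I. h i * (indicator (cell i) y * r y))"
  proof (cases "y \<in> Om")
   case True
   have "(\<Sum>i\<in>I. h i * (indicator (cell i) y * r y)) = (\<Sum>i\<in>I. if i = kap y then h i * r y else 0)"
    using True by (intro sum.cong) (auto simp: cell_def indicator_def)
   then show ?thesis using True finI unfolding I_def by simp
  qed (use r_out in simp)
 qed
 also have "... = (\<Sum>i\<in>I. h i * mass i)"
  unfolding mass_def using integrable_mult_indicator[of _ lborel r] ri
  by (subst Bochner_Integration.integral_sum) auto
 finally show ?thesis by (simp add: mult.commute)
qed

text \<open>The weights \<open>1 / n\<close> and \<open>- (1 / n)\<close> sum to 0, so the mean
  field drops out and no cross terms between cells survive; the squares of the weights sum to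
  \<open>2 / n\<close>.\<close>

lemma global_energy_expectation:
 assumes n: "1 <= n" and F: "\<And>i z. norm (F i z) <= Bd" "\<And>i z. z \<notin> Om ==> F i z = 0" "\<And>i. F i \<in> borel_measurable borel"
 shows "(\<integral>\<^sup>+om. ennreal (energy r (global_field F n (%i. om (Inl i)) (%i. om (Inr i)))) \<partial>PiM (labels n) (%_. D))
  <= (\<Sum>i\<in>I. ennreal (2 / real n * mass i) * (\<integral>\<^sup>+z. ennreal ((norm (F i z))^2 / r z) \<partial>lborel))"
  and "(%om. energy r (global_field F n (%i. om (Inl i)) (%i. om (Inr i)))) \<in> borel_measurable (PiM (labels n) (%_. D))"
proof -
 note [measurable] = F(3)
 define s :: "nat + nat => real" where "s k = (case k of Inl _ => 1 / real n | Inr _ => - (1 / real n))" for k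
 have gf: "global_field F n (%i. om (Inl i)) (%i. om (Inr i)) = (%z. \<Sum>k\<in>labels n. s k *\<^sub>R F (kap (om k)) z)" for om
  unfolding global_field_def[abs_def] sum_labels s_def
  by (simp add: sum_subtractf sum_negf scaleR_diff_right flip: scaleR_sum_right)
 have Vm: "(%(y, z). F (kap y) z) \<in> borel_measurable (borel \<Otimes>\<^sub>M borel)"
  unfolding case_prod_beta'
  by (rule measurable_compose_countable[where g = "%p. kap (fst p)"]) measurable
 have s1: "(\<Sum>k\<in>labels n. (s k)^2) = 2 / real n" "(\<Sum>k\<in>labels n. s k) = 0"
  unfolding sum_labels s_def using n by (simp_all add: power2_eq_square)
 note ee = energy_expectation[OF finite_labels[of n] Vm F(1) F(2), where s = s, unfolded gf[symmetric] s1]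
 show "(%om. energy r (global_field F n (%i. om (Inl i)) (%i. om (Inr i)))) \<in> borel_measurable (PiM (labels n) (%_. D))"
  by (rule ee(2))
 have "(\<integral>\<^sup>+om. ennreal (energy r (global_field F n (%i. om (Inl i)) (%i. om (Inr i)))) \<partial>PiM (labels n) (%_. D))
  <= (\<integral>\<^sup>+z. ennreal ((2 / real n * (LINT y|D. (norm (F (kap y) z))^2)) / r z) \<partial>lborel)"
  using ee(1) by simp
 also have "... = (\<integral>\<^sup>+z. (\<Sum>i\<in>I. ennreal (2 / real n * mass i) * ennreal ((norm (F i z))^2 / r z)) \<partial>lborel)"
 proof (intro nn_integral_cong)
  fix z
  have "(2 / real n * (LINT y|D. (norm (F (kap y) z))^2)) / r z = (\<Sum>i\<in>I. (2 / real n * mass i) * ((norm (F i z))^2 / r z))"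
   unfolding cell_integral[of "%i. (norm (F i z))^2"] by (simp add: sum_distrib_left sum_divide_distrib mult.assoc)
  also have "ennreal ... = (\<Sum>i\<in>I. ennreal ((2 / real n * mass i) * ((norm (F i z))^2 / r z)))"
   using r0[of z] by (intro sum_ennreal[symmetric] mult_nonneg_nonneg divide_nonneg_nonneg mass_nonneg) auto
  also have "... = (\<Sum>i\<in>I. ennreal (2 / real n * mass i) * ennreal ((norm (F i z))^2 / r z))"
   by (intro sum.cong refl ennreal_mult' mult_nonneg_nonneg mass_nonneg) auto
  finally show "ennreal ((2 / real n * (LINT y|D. (norm (F (kap y) z))^2)) / r z)
   = (\<Sum>i\<in>I. ennreal (2 / real n * mass i) * ennreal ((norm (F i z))^2 / r z))" .
 qed
 also have "... = (\<Sum>i\<in>I. ennreal (2 / real n * mass i) * (\<integral>\<^sup>+z. ennreal ((norm (F i z))^2 / r z) \<partial>lborel))"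
  by (subst nn_integral_sum) (auto intro!: sum.cong nn_integral_cmult)
 finally show "(\<integral>\<^sup>+om. ennreal (energy r (global_field F n (%i. om (Inl i)) (%i. om (Inr i)))) \<partial>PiM (labels n) (%_. D))
  <= (\<Sum>i\<in>I. ennreal (2 / real n * mass i) * (\<integral>\<^sup>+z. ennreal ((norm (F i z))^2 / r z) \<partial>lborel))" .
qed

end

section \<open>From small discs to cell averages\<close>

context planar_cells
begin

text \<open>The indicator makes the pointwise bounds hold for every \<open>y\<close>; almost surely
  it is 1 on the sample.\<close>

definition Vloc :: "real => real^2 => real^2 => real^2" where
 "Vloc s y z = indicator Om y *\<^sub>R (B s y z - Bbar (kap y) z)"

lemma Vloc_measurable: "case_prod (Vloc s) \<in> borel_measurable (borel \<Otimes>\<^sub>M borel)"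
proof -
 have [measurable]: "(%p. Bbar (kap (fst p)) (snd p)) \<in> borel_measurable (borel \<Otimes>\<^sub>M borel)"
  by (rule measurable_compose_countable[where g = "%p. kap (fst p)"]) measurable
 show ?thesis unfolding Vloc_def case_prod_beta' by measurable
qed

lemma Vloc_bound:
 assumes "0 < s"
 shows "norm (Vloc s y z) <= K^2 / (2 * pi * s) + CB / eps"
proof (cases "y \<in> Om")
 case True
 have "norm (B s y z) <= K^2 / (2 * pi * max s (norm (z - y)))" using True assms by (intro B_bound) auto
 also have "... <= K^2 / (2 * pi * s)" using assms by (intro divide_left_mono mult_left_mono) auto
 finally show ?thesis
  using norm_Bbar_le[OF kap_in[OF True], of z] norm_triangle_ineq4[of "B s y z" "Bbar (kap y) z"] True
  unfolding CB_def Vloc_def by simp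
next
 case False
 moreover have "0 <= K^2 / (2 * pi * s) + CB / eps"
  using assms eps a b0 K unfolding CB_def by (intro add_nonneg_nonneg divide_nonneg_nonneg mult_nonneg_nonneg) auto
 ultimately show ?thesis unfolding Vloc_def by simp
qed

lemma Vloc_out: "0 <= s ==> z \<notin> Om ==> Vloc s y z = 0"
 unfolding Vloc_def by (cases "y \<in> Om") (auto simp: B_outside Bbar_outside)

lemma local_field_eq:
 assumes "\<And>i. i \<in> {1..n} ==> x i \<in> Om"
 shows "local_field s n x = (%z. \<Sum>i\<in>{1..n}. (1 / real n) *\<^sub>R Vloc s (x i) z)"
proof
 fix z
 show "local_field s n x z = (\<Sum>i\<in>{1..n}. (1 / real n) *\<^sub>R Vloc s (x i) z)"
  unfolding local_field_def Vloc_def scaleR_sum_right using assms by (intro sum.cong) auto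
qed

lemma nn_integral_conic_at:
 assumes C: "0 <= C" "\<And>y. y \<in> Om ==> norm (f y) <= C / norm (z - y)" "\<And>y. y \<in> Om ==> R < norm (z - y) ==> f y = 0" "0 <= R"
 shows "(\<integral>\<^sup>+y. ennreal (norm (r y *\<^sub>R (f y :: real^2))) \<partial>lborel) <= ennreal (b * C * (2 * pi * R))"
proof -
 have [measurable]: "cball z R \<in> sets borel" by simp
 have bC: "0 <= b * C" using b0 C(1) by simp
 have "(\<integral>\<^sup>+y. ennreal (norm (r y *\<^sub>R f y)) \<partial>lborel)
  <= (\<integral>\<^sup>+y. ennreal (b * C) * (ennreal (1 / norm (z - y)) * indicator (cball z R) y) \<partial>lborel)"
 proof (intro nn_integral_mono)
  fix y
  show "ennreal (norm (r y *\<^sub>R f y)) <= ennreal (b * C) * (ennreal (1 / norm (z - y)) * indicator (cball z R) y)"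
  proof (cases "y \<in> Om \<and> norm (z - y) <= R")
   case True
   have "norm (r y *\<^sub>R f y) <= b * (C / norm (z - y))"
    unfolding norm_scaleR using C(2)[of y] True r0[of y] rb[of y] b0 by (intro mult_mono) auto
   then have "ennreal (norm (r y *\<^sub>R f y)) <= ennreal (b * C * (1 / norm (z - y)))" by (intro ennreal_leI) simp
   also have "... = ennreal (b * C) * ennreal (1 / norm (z - y))" by (rule ennreal_mult'[OF bC])
   finally show ?thesis using True by (simp add: dist_norm)
  next
   case False
   then have "r y *\<^sub>R f y = 0" using r_out[of y] C(3)[of y] by (cases "y \<in> Om") auto
   then show ?thesis by (simp only: norm_zero ennreal_0 zero_le)
  qed
 qed
 also have "... = ennreal (b * C) * (\<integral>\<^sup>+y\<in>cball z R. ennreal (1 / norm (z - y)) \<partial>lborel)"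
  by (rule nn_integral_cmult) measurable
 also have "... <= ennreal (b * C) * ennreal (2 * pi * R)"
  using C(4) by (intro mult_left_mono nn_integral_norm_inverse_ball) auto
 also have "... = ennreal (b * C * (2 * pi * R))" by (rule ennreal_mult'[OF bC, symmetric])
 finally show ?thesis .
qed

lemma integrable_B:
 assumes "0 <= s"
 shows "integrable lborel (%y. r y *\<^sub>R B s y z)"
proof (rule integrableI_bounded)
 show "(%y. r y *\<^sub>R B s y z) \<in> borel_measurable lborel" by measurable
 have "(\<integral>\<^sup>+y. ennreal (norm (r y *\<^sub>R B s y z)) \<partial>lborel) <= ennreal (b * (K^2 / (2 * pi)) * (2 * pi * (K * eps / 2)))"
 proof (rule nn_integral_conic_at)
  fix y assume y: "y \<in> Om"
  show "B s y z = 0" if "K * eps / 2 < norm (z - y)" using B_far[OF y] that by simp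
  show "norm (B s y z) <= K^2 / (2 * pi) / norm (z - y)"
  proof (cases "z = y")
   case True
   then show ?thesis unfolding B_def conic_field_def by simp
  next
   case False
   have "norm (B s y z) <= K^2 / (2 * pi * max s (norm (z - y)))" by (rule B_bound[OF y assms])
   also have "... <= K^2 / (2 * pi * norm (z - y))" using False
    by (intro divide_left_mono mult_left_mono mult_pos_pos) (auto simp: less_max_iff_disj)
   finally show ?thesis by simp
  qed
 qed (use K eps in auto)
 then show "(\<integral>\<^sup>+y. ennreal (norm (r y *\<^sub>R B s y z)) \<partial>lborel) < \<infinity>" by (rule le_less_trans) simp
qed

lemma mass_Bbar: "i \<in> I ==> mass i *\<^sub>R Bbar i z = (LINT y|lborel. indicator (cell i) y *\<^sub>R (r y *\<^sub>R B 0 y z))"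
proof -
 assume i: "i \<in> I"
 have "mass i *\<^sub>R Bbar i z = (LINT y|lborel. mass i *\<^sub>R (q i y *\<^sub>R B 0 y z))"
  unfolding Bbar_def by (rule integral_scaleR_right[symmetric])
 also have "... = (LINT y|lborel. indicator (cell i) y *\<^sub>R (r y *\<^sub>R B 0 y z))"
  using mass_pos[OF i] by (intro Bochner_Integration.integral_cong) (auto simp: q_def)
 finally show ?thesis .
qed

text \<open>\<open>Bbar\<close> is the mean of \<open>B 0\<close> over a cell, so
  \<open>B 0 - Bbar\<close> averages to 0 and only the part of the cones with radius below
  \<open>s\<close> remains. It is bounded by a multiple of \<open>1 / norm (z - y)\<close> on a disc
  of radius \<open>K * s\<close>, whose integral has order \<open>s\<close>.\<close>

lemma Vloc_mean:
 assumes s: "0 < s" "s <= eps / 2"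
 shows "norm (LINT y|D. Vloc s y z) <= b * K^3 * s"
proof -
 have vm: "(%y. Vloc s y z) \<in> borel_measurable borel"
  using measurable_compose[OF measurable_Pair2' Vloc_measurable, of z] by simp
 have iB0: "integrable lborel (%y. r y *\<^sub>R B 0 y z)" and iBs: "integrable lborel (%y. r y *\<^sub>R B s y z)"
  using s by (auto intro: integrable_B)
 have ii: "integrable lborel (%y. (indicat_real (cell i) y * r y) *\<^sub>R Bbar i z)" for i
  using integrable_mult_indicator[of "cell i" lborel r] ri by (intro integrable_scaleR_left) auto
 have ind: "r y *\<^sub>R Bbar (kap y) z = (\<Sum>i\<in>I. (indicat_real (cell i) y * r y) *\<^sub>R Bbar i z)" for y
 proof (cases "y \<in> Om")
  case True
  have "(\<Sum>i\<in>I. (indicat_real (cell i) y * r y) *\<^sub>R Bbar i z) = (\<Sum>i\<in>I. if i = kap y then r y *\<^sub>R Bbar i z else 0)"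
   using True by (intro sum.cong) (auto simp: cell_def indicator_def)
  then show ?thesis using True finI unfolding I_def by simp
 qed (use r_out in simp)
 have indB: "r y *\<^sub>R B 0 y z = (\<Sum>i\<in>I. indicat_real (cell i) y *\<^sub>R (r y *\<^sub>R B 0 y z))" for y
 proof (cases "y \<in> Om")
  case True
  have "(\<Sum>i\<in>I. indicat_real (cell i) y *\<^sub>R (r y *\<^sub>R B 0 y z)) = (\<Sum>i\<in>I. indicat_real (cell i) y) *\<^sub>R (r y *\<^sub>R B 0 y z)"
   by (rule scaleR_sum_left[symmetric])
  then show ?thesis using True by (simp add: sum_indicator_cells)
 qed (use r_out in simp)
 have "(LINT y|lborel. r y *\<^sub>R Bbar (kap y) z) = (\<Sum>i\<in>I. mass i *\<^sub>R Bbar i z)"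
  unfolding ind using ii integrable_mult_indicator[of _ lborel r] ri
  by (subst Bochner_Integration.integral_sum) (auto simp: mass_def intro!: sum.cong integral_scaleR_left)
 also have "... = (\<Sum>i\<in>I. LINT y|lborel. indicator (cell i) y *\<^sub>R (r y *\<^sub>R B 0 y z))"
  by (intro sum.cong refl mass_Bbar)
 also have "... = (LINT y|lborel. (\<Sum>i\<in>I. indicator (cell i) y *\<^sub>R (r y *\<^sub>R B 0 y z)))"
  using iB0 by (intro Bochner_Integration.integral_sum[symmetric] integrable_mult_indicator) auto
 finally have e1: "(LINT y|lborel. r y *\<^sub>R Bbar (kap y) z) = (LINT y|lborel. r y *\<^sub>R B 0 y z)"
  unfolding indB[symmetric] .
 have iBb: "integrable lborel (%y. r y *\<^sub>R Bbar (kap y) z)" unfolding ind using ii by (intro Bochner_Integration.integrable_sum)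
 have "(LINT y|D. Vloc s y z) = (LINT y|lborel. r y *\<^sub>R B s y z - r y *\<^sub>R Bbar (kap y) z)"
  unfolding integral_D[OF vm]
  by (intro Bochner_Integration.integral_cong refl) (use r_out in \<open>auto simp: Vloc_def indicator_def scaleR_diff_right\<close>)
 also have "... = (LINT y|lborel. r y *\<^sub>R B s y z) - (LINT y|lborel. r y *\<^sub>R B 0 y z)"
  using iBs iBb e1 by simp
 also have "... = (LINT y|lborel. r y *\<^sub>R (- conic_field y (vel y) 0 s z))"
 proof -
  have "AE y in lborel. y \<noteq> z" by (rule AE_lborel_singleton)
  then have "AE y in lborel. r y *\<^sub>R B s y z - r y *\<^sub>R B 0 y z = r y *\<^sub>R (- conic_field y (vel y) 0 s z)"
  proof eventually_elim
   case (elim y)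
   have "conic_weight y (vel y) 0 (eps / 2) z = conic_weight y (vel y) 0 s z + conic_weight y (vel y) s (eps / 2) z"
    using s elim by (intro conic_weight_split) auto
   then have "B 0 y z = conic_field y (vel y) 0 s z + B s y z"
    unfolding B_def conic_field_def by (simp add: scaleR_add_left)
   then show ?case by (simp add: algebra_simps)
  qed
  then have "(LINT y|lborel. r y *\<^sub>R B s y z - r y *\<^sub>R B 0 y z) = (LINT y|lborel. r y *\<^sub>R (- conic_field y (vel y) 0 s z))"
   by (intro integral_cong_AE) auto
  then show ?thesis using iBs iB0 by simp
 qed
 finally have eq: "(LINT y|D. Vloc s y z) = (LINT y|lborel. r y *\<^sub>R (- conic_field y (vel y) 0 s z))" .
 have "ennreal (norm (LINT y|D. Vloc s y z)) <= (\<integral>\<^sup>+y. ennreal (norm (r y *\<^sub>R (- conic_field y (vel y) 0 s z))) \<partial>lborel)"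
  unfolding eq by (rule norm_integral_le_nn_integral)
 also have "... <= ennreal (b * (K^2 / (2 * pi)) * (2 * pi * (K * s)))"
 proof (rule nn_integral_conic_at)
  fix y assume y: "y \<in> Om"
  show "norm (- conic_field y (vel y) 0 s z) <= K^2 / (2 * pi) / norm (z - y)"
   using conic_field_le'[OF norm_vel[OF y], of 0 y s z] by simp
  show "- conic_field y (vel y) 0 s z = 0" if "K * s < norm (z - y)"
  proof -
   have "s * (1 + norm (vel y)) <= s * K" using norm_vel[OF y] s by (intro mult_left_mono) auto
   then show ?thesis using that by (subst conic_field_eq_0) (auto simp: mult.commute)
  qed
 qed (use K s in auto)
 finally have "norm (LINT y|D. Vloc s y z) <= b * (K^2 / (2 * pi)) * (2 * pi * (K * s))"
  using b0 K s by (subst (asm) ennreal_le_iff) auto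
 also have "... = b * K^3 * s" by (simp add: power2_eq_square power3_eq_cube)
 finally show ?thesis .
qed

text \<open>The bound for the energy of one local field. Its logarithm compares the cell size with
  the radius \<open>s\<close> of the initial disc; the last summand is the energy of
  \<open>Bbar\<close>.\<close>

definition CL :: "real => real" where
 "CL s = 2 * ((K^2 / (2 * pi))^2 * (pi + 2 * pi * ln (K * eps / 2 / s))) + 2 * (CB^2 * (pi * (C0 + K)^2))"

lemma CL_nonneg:
 assumes s: "0 < s" "s <= eps / 2"
 shows "0 <= CL s"
proof -
 have "1 <= K * eps / 2 / s"
 proof -
  have "s <= 1 * (eps / 2)" using s by simp
  also have "... <= K * (eps / 2)" using K eps by (intro mult_right_mono) auto
  finally show ?thesis using s by simp
 qed
 then show ?thesis unfolding CL_def
  by (intro add_nonneg_nonneg mult_nonneg_nonneg) auto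
qed

lemma Vloc_square:
 assumes s: "0 < s" "s <= eps / 2"
 shows "(\<integral>\<^sup>+z. ennreal ((norm (Vloc s y z))^2) \<partial>lborel) <= ennreal (CL s)"
proof (cases "y \<in> Om")
 case True
 have sK: "s <= K * eps / 2"
 proof -
  have "s <= 1 * (eps / 2)" using s by simp
  also have "... <= K * (eps / 2)" using K eps by (intro mult_right_mono) auto
  finally show ?thesis by simp
 qed
 have "(\<integral>\<^sup>+z. ennreal ((norm (Vloc s y z))^2) \<partial>lborel)
  <= (\<integral>\<^sup>+z. ennreal 2 * ennreal ((norm (B s y z))^2) + ennreal 2 * ennreal ((norm (Bbar (kap y) z))^2) \<partial>lborel)"
 proof (intro nn_integral_mono)
  fix z
  have "(norm (Vloc s y z))^2 <= (norm (B s y z) + norm (Bbar (kap y) z))^2"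
   unfolding Vloc_def using True norm_triangle_ineq4[of "B s y z" "Bbar (kap y) z"] by (intro power_mono) auto
  also have "... <= 2 * (norm (B s y z))^2 + 2 * (norm (Bbar (kap y) z))^2"
   using sum_squares_bound[of "norm (B s y z)" "norm (Bbar (kap y) z)"] by (simp add: power2_sum)
  finally have "ennreal ((norm (Vloc s y z))^2) <= ennreal (2 * (norm (B s y z))^2 + 2 * (norm (Bbar (kap y) z))^2)" by (rule ennreal_leI)
  also have "... = ennreal 2 * ennreal ((norm (B s y z))^2) + ennreal 2 * ennreal ((norm (Bbar (kap y) z))^2)"
   by (subst ennreal_plus) (auto simp: ennreal_mult')
  finally show "ennreal ((norm (Vloc s y z))^2) <= ennreal 2 * ennreal ((norm (B s y z))^2) + ennreal 2 * ennreal ((norm (Bbar (kap y) z))^2)" .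
 qed
 also have "... = ennreal 2 * (\<integral>\<^sup>+z. ennreal ((norm (B s y z))^2) \<partial>lborel) + ennreal 2 * (\<integral>\<^sup>+z. ennreal ((norm (Bbar (kap y) z))^2) \<partial>lborel)"
  by (subst nn_integral_add) (auto simp: nn_integral_cmult)
 also have "... <= ennreal 2 * ennreal ((K^2 / (2 * pi))^2 * (pi + 2 * pi * ln (K * eps / 2 / s))) + ennreal 2 * ennreal (CB^2 * (pi * (C0 + K)^2))"
 proof (intro add_mono mult_left_mono Bbar_square kap_in True)
  show "(\<integral>\<^sup>+z. ennreal ((norm (B s y z))^2) \<partial>lborel) <= ennreal ((K^2 / (2 * pi))^2 * (pi + 2 * pi * ln (K * eps / 2 / s)))"
   using B_bound[OF True, of s] B_far[OF True, of _ s] s sK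
   by (intro nn_integral_inverse_bound[where c = y]) auto
 qed auto
 also have "... = ennreal (CL s)"
 proof -
  have "0 <= ln (K * eps / 2 / s)" using sK s by simp
  then have n: "0 <= (K^2 / (2 * pi))^2 * (pi + 2 * pi * ln (K * eps / 2 / s))" by (intro mult_nonneg_nonneg add_nonneg_nonneg) auto
  have "ennreal 2 * ennreal X + ennreal 2 * ennreal Y = ennreal (2 * X + 2 * Y)" if "0 <= X" "0 <= Y" for X Y
   using that by (simp add: ennreal_mult' ennreal_plus)
  from this[OF n] show ?thesis unfolding CL_def by simp
 qed
 finally show ?thesis .
qed (simp add: Vloc_def)

text \<open>The weights \<open>1 / n\<close> of a single sample have square sum \<open>1 / n\<close>
  but sum 1, so in addition to the variance the squared mean appears; \<open>Vloc_mean\<close> makes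
  it of order \<open>s^2\<close>.\<close>

lemma local_energy_expectation:
 fixes inj :: "nat => nat + nat"
 assumes n: "1 <= n" and s: "0 < s" "s <= eps / 2" and inj: "inj = Inl \<or> inj = Inr"
 shows "(\<integral>\<^sup>+om. ennreal (energy r (%z. \<Sum>i\<in>{1..n}. (1 / real n) *\<^sub>R Vloc s (om (inj i)) z)) \<partial>PiM (labels n) (%_. D))
  <= ennreal ((CL s / real n + (b * K^3 * s)^2 * measure lborel Om) / a)"
  and "(%om. energy r (%z. \<Sum>i\<in>{1..n}. (1 / real n) *\<^sub>R Vloc s (om (inj i)) z)) \<in> borel_measurable (PiM (labels n) (%_. D))"
proof -
 interpret DD: prob_space D by (rule prob_D)
 interpret PL: pair_sigma_finite D "lborel :: (real^2) measure" ..
 define w :: "nat + nat => real" where "w k = (if k \<in> range inj then 1 / real n else 0)" for k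
 have we: "(%z. \<Sum>i\<in>{1..n}. (1 / real n) *\<^sub>R Vloc s (om (inj i)) z) = (%z. \<Sum>k\<in>labels n. w k *\<^sub>R Vloc s (om k) z)" for om
  unfolding sum_labels w_def using inj by (intro ext) (auto intro!: sum.neutral)
 have w1: "(\<Sum>k\<in>labels n. (w k)^2) = 1 / real n" "(\<Sum>k\<in>labels n. w k) = 1"
  unfolding sum_labels w_def using n inj by (auto simp: power2_eq_square intro!: sum.neutral)
 note ee = energy_expectation[OF finite_labels[of n] Vloc_measurable Vloc_bound[OF s(1)] Vloc_out[OF less_imp_le[OF s(1)]],
   where s = w, unfolded we[symmetric] w1]
 show "(%om. energy r (%z. \<Sum>i\<in>{1..n}. (1 / real n) *\<^sub>R Vloc s (om (inj i)) z)) \<in> borel_measurable (PiM (labels n) (%_. D))"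
  by (rule ee(2))
 define M where "M = (b * K^3 * s)^2"
 have M0: "0 <= M" unfolding M_def by simp
 have Vm: "(%p. ennreal ((norm (Vloc s (fst p) (snd p)))^2)) \<in> borel_measurable (D \<Otimes>\<^sub>M lborel)"
 proof -
  have "(%p. Vloc s (fst p) (snd p)) \<in> borel_measurable (D \<Otimes>\<^sub>M lborel)"
  proof -
   have "fst \<in> measurable (D \<Otimes>\<^sub>M lborel) borel" "snd \<in> measurable (D \<Otimes>\<^sub>M lborel) borel" by measurable
   from measurable_compose[OF measurable_Pair[OF this] Vloc_measurable] show ?thesis by simp
  qed
  then show ?thesis by measurable
 qed
 have "(\<integral>\<^sup>+om. ennreal (energy r (%z. \<Sum>i\<in>{1..n}. (1 / real n) *\<^sub>R Vloc s (om (inj i)) z)) \<partial>PiM (labels n) (%_. D))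
  <= (\<integral>\<^sup>+z. ennreal ((1 / real n * (LINT y|D. (norm (Vloc s y z))^2) + 1^2 * (norm (LINT y|D. Vloc s y z))^2) / r z) \<partial>lborel)"
  using ee(1) .
 also have "... <= (\<integral>\<^sup>+z. ennreal (1 / (real n * a)) * (\<integral>\<^sup>+y. ennreal ((norm (Vloc s y z))^2) \<partial>D) + ennreal (M / a) * indicator Om z \<partial>lborel)"
 proof (intro nn_integral_mono)
  fix z
  have vm: "(%y. Vloc s y z) \<in> borel_measurable borel"
   using measurable_compose[OF measurable_Pair2' Vloc_measurable, of z] by simp
  have vi: "integrable D (%y. (norm (Vloc s y z))^2)"
  proof (rule DD.integrable_const_bound[where B = "(K^2 / (2 * pi * s) + CB / eps)^2"])
   show "AE y in D. norm ((norm (Vloc s y z))^2) <= (K^2 / (2 * pi * s) + CB / eps)^2"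
    using Vloc_bound[OF s(1)] by (intro AE_I2) (auto intro!: power_mono)
  qed (use vm in measurable)
  define L where "L = (LINT y|D. (norm (Vloc s y z))^2)"
  have L0: "0 <= L" unfolding L_def by (intro Bochner_Integration.integral_nonneg) auto
  have L: "ennreal L = (\<integral>\<^sup>+y. ennreal ((norm (Vloc s y z))^2) \<partial>D)"
   unfolding L_def using vi by (intro nn_integral_eq_integral[symmetric]) auto
  show "ennreal ((1 / real n * (LINT y|D. (norm (Vloc s y z))^2) + 1^2 * (norm (LINT y|D. Vloc s y z))^2) / r z)
   <= ennreal (1 / (real n * a)) * (\<integral>\<^sup>+y. ennreal ((norm (Vloc s y z))^2) \<partial>D) + ennreal (M / a) * indicator Om z"
  proof (cases "z \<in> Om")
   case True
   have "(norm (LINT y|D. Vloc s y z))^2 <= M" unfolding M_def using Vloc_mean[OF s] by (intro power_mono) auto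
   then have "(1 / real n * L + 1^2 * (norm (LINT y|D. Vloc s y z))^2) / r z <= (1 / real n * L + M) / a"
    using ra[OF True] a L0 M0 by (intro frac_le add_mono) auto
   also have "... = 1 / (real n * a) * L + M / a" by (simp add: add_divide_distrib)
   finally have "ennreal ((1 / real n * L + 1^2 * (norm (LINT y|D. Vloc s y z))^2) / r z) <= ennreal (1 / (real n * a) * L + M / a)"
    by (rule ennreal_leI)
   also have "... = ennreal (1 / (real n * a)) * ennreal L + ennreal (M / a)"
    using L0 a by (subst ennreal_plus) (auto simp: M_def ennreal_mult'[symmetric])
   finally show ?thesis using True unfolding L_def[symmetric] L[symmetric] by simp
  qed (use r_out in simp)
 qed
 also have "... = ennreal (1 / (real n * a)) * (\<integral>\<^sup>+z. \<integral>\<^sup>+y. ennreal ((norm (Vloc s y z))^2) \<partial>D \<partial>lborel) + ennreal (M / a) * emeasure lborel Om"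
 proof -
  have "(%(z, y). ennreal ((norm (Vloc s y z))^2)) \<in> borel_measurable (lborel \<Otimes>\<^sub>M D)"
   using measurable_compose[OF measurable_pair_swap' Vm] by (simp add: case_prod_beta')
  then have [measurable]: "(%z. \<integral>\<^sup>+y. ennreal ((norm (Vloc s y z))^2) \<partial>D) \<in> borel_measurable lborel"
   by (rule DD.borel_measurable_nn_integral)
  show ?thesis by (subst nn_integral_add) (auto simp: nn_integral_cmult nn_integral_cmult_indicator)
 qed
 also have "... <= ennreal (1 / (real n * a)) * ennreal (CL s) + ennreal (M / a) * emeasure lborel Om"
 proof (intro add_right_mono mult_left_mono)
  have "(\<integral>\<^sup>+z. \<integral>\<^sup>+y. ennreal ((norm (Vloc s y z))^2) \<partial>D \<partial>lborel) = (\<integral>\<^sup>+y. \<integral>\<^sup>+z. ennreal ((norm (Vloc s y z))^2) \<partial>lborel \<partial>D)"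
   using Vm by (intro PL.Fubini') (simp add: case_prod_beta')
  also have "... <= (\<integral>\<^sup>+y. ennreal (CL s) \<partial>D)" by (intro nn_integral_mono Vloc_square s)
  also have "... = ennreal (CL s)" using DD.emeasure_space_1 by simp
  finally show "(\<integral>\<^sup>+z. \<integral>\<^sup>+y. ennreal ((norm (Vloc s y z))^2) \<partial>D \<partial>lborel) <= ennreal (CL s)" .
 qed simp
 also have "... = ennreal ((CL s / real n + M * measure lborel Om) / a)"
 proof -
  have "ennreal (1 / (real n * a)) * ennreal (CL s) = ennreal (CL s / real n / a)"
   using a by (subst ennreal_mult'[symmetric]) auto
  moreover have "ennreal (M / a) * emeasure lborel Om = ennreal (M * measure lborel Om / a)"
   using a Om_finite by (subst emeasure_eq_ennreal_measure) (auto simp: M_def ennreal_mult'[symmetric])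
  moreover have "0 <= CL s / real n / a" using CL_nonneg[OF s] a by simp
  moreover have "0 <= M * measure lborel Om / a" using a unfolding M_def by simp
  ultimately show ?thesis by (simp add: ennreal_plus[symmetric] add_divide_distrib del: ennreal_plus)
 qed
 finally show "(\<integral>\<^sup>+om. ennreal (energy r (%z. \<Sum>i\<in>{1..n}. (1 / real n) *\<^sub>R Vloc s (om (inj i)) z)) \<partial>PiM (labels n) (%_. D))
  <= ennreal ((CL s / real n + (b * K^3 * s)^2 * measure lborel Om) / a)"
  unfolding M_def .
qed

end

lemma match_cost_nonneg: "0 <= match_cost n x y"
proof -
 obtain \<sigma> where "match_cost n x y = (\<Sum>i\<in>{1..n}. (norm (x i - y (\<sigma> i)))^2)" using match_cost_attained by blast
 then show ?thesis by (simp add: sum_nonneg)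
qed

lemma match_cost_le_diameter:
 assumes "\<And>i. i \<in> {1..n} ==> norm (x i) <= R \<and> norm (y i) <= R"
 shows "match_cost n x y <= real n * (2 * R)^2"
proof -
 have "match_cost n x y <= (\<Sum>i\<in>{1..n}. (norm (x i - y (id i)))^2)" by (rule match_cost_le[OF permutes_id])
 also have "... <= (\<Sum>i\<in>{1..n}. (2 * R)^2)"
  using assms norm_triangle_ineq4 by (intro sum_mono power_mono) (fastforce intro: order_trans)+
 finally show ?thesis by simp
qed

section \<open>Cells with too few points and the expected matching cost\<close>

context planar_density
begin

lemma AE_sample: "AE om in PiM (labels n) (%_. D). \<forall>k\<in>labels n. om k \<in> Om"
 using AE_PiM_component[of "labels n" "%_. D", OF prob_D _ AE_D] finite_labels
 by (intro AE_finite_allI) auto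

end

context planar_cells
begin

definition shortage :: "real => nat => (nat => nat + nat) => int \<times> int => (nat + nat => real^2) set" where
 "shortage et n emb k = {om \<in> space (PiM (labels n) (%_. D)).
   (\<Sum>i\<in>{1..n}. indicator (cell k) (om (emb i))) <= (1 - et) * (real n * mass k)}"

lemma shortage_prob:
 assumes emb: "emb = Inl \<or> emb = Inr" and et: "0 < et" "et < 1" and k: "k \<in> I"
 shows "shortage et n emb k \<in> sets (PiM (labels n) (%_. D))"
  "measure (PiM (labels n) (%_. D)) (shortage et n emb k) <= exp (- (real n * a * pi * eps^2 * et^2 / 32))"
proof -
 have inm: "emb i \<in> labels n" if "i \<in> {1..n}" for i using that emb unfolding labels_def by auto
 have "(%om. indicat_real (cell k) (om (emb i))) \<in> borel_measurable (PiM (labels n) (%_. D))" if "i \<in> {1..n}" for i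
  by (rule measurable_compose[OF measurable_component_singleton[OF inm[OF that]]]) simp
 then have [measurable]: "(%om. \<Sum>i\<in>{1..n}. indicat_real (cell k) (om (emb i))) \<in> borel_measurable (PiM (labels n) (%_. D))"
  by (intro borel_measurable_sum)
 show "shortage et n emb k \<in> sets (PiM (labels n) (%_. D))"
  unfolding shortage_def by measurable
 define s :: "nat + nat => real" where "s j = (if j \<in> range emb then -1 else 0)" for j
 have eq: "(\<Sum>j\<in>labels n. s j * (indicator (cell k) (om j) - measure D (cell k)))
  = real n * mass k - (\<Sum>i\<in>{1..n}. indicator (cell k) (om (emb i)))" for om
  unfolding sum_labels s_def mass_measure using emb by (auto simp: sum_subtractf sum_negf intro!: sum.neutral)
 have cardl: "card (labels n) = 2 * n" unfolding labels_def by (simp add: card_Plus)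
 have "measure (PiM (labels n) (%_. D)) (shortage et n emb k)
  = measure (PiM (labels n) (%_. D)) {om \<in> space (PiM (labels n) (%_. D)).
   et * (real n * mass k) <= (\<Sum>j\<in>labels n. s j * (indicator (cell k) (om j) - measure D (cell k)))}"
  unfolding shortage_def eq by (intro arg_cong[where f = "measure _"]) (auto simp: algebra_simps)
 \<comment> \<open>With \<open>2 * n\<close> labels the exponent is \<open>2 * t^2 - et * t\<close>
   times \<open>real n * mass k\<close>, which is least at \<open>t = et / 4\<close>.\<close>
 also have "... <= exp ((et / 4)^2 * real (card (labels n)) * measure D (cell k) - et / 4 * (et * (real n * mass k)))"
  using et by (intro chernoff_counts prob_D finite_labels) (auto simp: s_def)
 also have "... = exp (- (et^2 / 8 * real n * mass k))"
  unfolding mass_measure cardl by (simp add: power2_eq_square algebra_simps)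
 also have "... <= exp (- (et^2 / 8 * real n * (a * (pi * (eps / 2)^2))))"
  using mass_ge[OF k] by (simp add: mult_left_mono)
 also have "et^2 / 8 * real n * (a * (pi * (eps / 2)^2)) = real n * a * pi * eps^2 * et^2 / 32"
  by (simp add: power2_eq_square)
 finally show "measure (PiM (labels n) (%_. D)) (shortage et n emb k) <= exp (- (real n * a * pi * eps^2 * et^2 / 32))" .
qed

lemma card_I_le: "real (card I) <= 4 / (a * pi * eps^2)"
proof -
 have "real (card I) * (a * (pi * (eps / 2)^2)) <= (\<Sum>i\<in>I. mass i)"
  using mass_ge by (intro sum_bounded_below) auto
 then have "real (card I) * (a * pi * eps^2) <= 4" using sum_mass by (simp add: power2_eq_square)
 then show ?thesis using a eps by (simp add: pos_le_divide_eq)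
qed

definition shortages :: "real => nat => (nat + nat => real^2) set" where
 "shortages et n = (\<Union>k\<in>I. shortage et n Inl k \<union> shortage et n Inr k)"

lemma shortages_prob:
 assumes et: "0 < et" "et < 1"
 shows "shortages et n \<in> sets (PiM (labels n) (%_. D))"
  "measure (PiM (labels n) (%_. D)) (shortages et n) <= 8 / (a * pi * eps^2) * exp (- (real n * a * pi * eps^2 * et^2 / 32))"
proof -
 interpret P: prob_space "PiM (labels n) (%_. D)" by (rule prob_space_PiM_const[OF prob_D])
 note sp = shortage_prob[OF _ et]
 show "shortages et n \<in> sets (PiM (labels n) (%_. D))"
  unfolding shortages_def using finI sp(1) by (intro sets.finite_UN sets.Un) auto
 let ?e = "exp (- (real n * a * pi * eps^2 * et^2 / 32))"
 have "P.prob (shortages et n) <= (\<Sum>k\<in>I. P.prob (shortage et n Inl k \<union> shortage et n Inr k))"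
  unfolding shortages_def using finI sp(1) by (intro P.finite_measure_subadditive_finite) (auto intro!: sets.Un)
 also have "... <= (\<Sum>k\<in>I. 2 * ?e)"
 proof (rule sum_mono)
  fix k assume k: "k \<in> I"
  have "P.prob (shortage et n Inl k \<union> shortage et n Inr k) <= P.prob (shortage et n Inl k) + P.prob (shortage et n Inr k)"
   using sp(1)[OF _ k] by (intro measure_Un_le) auto
  then show "P.prob (shortage et n Inl k \<union> shortage et n Inr k) <= 2 * ?e"
   using sp(2)[of Inl k n, OF _ k] sp(2)[of Inr k n, OF _ k] by simp
 qed
 also have "... = real (card I) * (2 * ?e)" by simp
 also have "... <= 4 / (a * pi * eps^2) * (2 * ?e)" using card_I_le by (intro mult_right_mono) auto
 finally show "P.prob (shortages et n) <= 8 / (a * pi * eps^2) * ?e" by simp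
qed

text \<open>Expectation of \<open>match_cost_good\<close>, with the trivial bound by the diameter on
  the event of a shortage. The four summands are the displacement into the discs, the local fields
  of both samples, the global field and the shortages.\<close>

lemma expected_match_cells:
 assumes n: "1 <= n" and \<theta>: "0 < \<theta>" "\<theta> < 1 / 4" and N: "0 < N" and et: "0 < et" "et < 1" and s: "0 < s" "s <= eps / 2"
  and F: "\<And>i. i \<in> I ==> flow (density_integral (q i)) W (F i)"
   "\<And>i z. norm (F i z) <= Bd" "\<And>i z. z \<notin> Om ==> F i z = 0" "\<And>i. F i \<in> borel_measurable borel"
  and G: "(\<Sum>i\<in>I. ennreal (2 / real n * mass i) * (\<integral>\<^sup>+z. ennreal ((norm (F i z))^2 / r z) \<partial>lborel)) <= ennreal G" "0 <= G"
  and R: "\<And>z. z \<in> Om ==> norm z <= R"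
 shows "(LINT om|PiM (labels n) (%_. D). match_cost n (%i. om (Inl i)) (%i. om (Inr i)))
  <= real n * (2 * (K * s)^2 / \<theta> + 4 / \<theta> * ((CL s / real n + (b * K^3 * s)^2 * measure lborel Om) / a) / (1 - et)
   + (1 / (4 * \<theta> * real N) + 1 / (1 - 4 * \<theta>)) / (1 - et) * G
   + (2 * R)^2 * (8 / (a * pi * eps^2) * exp (- (real n * a * pi * eps^2 * et^2 / 32))))"
proof -
 let ?P = "PiM (labels n) (%_. D)"
 interpret P: prob_space ?P by (rule prob_space_PiM_const[OF prob_D])
 define m where "m om = match_cost n (%i. om (Inl i)) (%i. om (Inr i))" for om :: "nat + nat => real^2"
 define eX where "eX om = energy r (%z. \<Sum>i\<in>{1..n}. (1 / real n) *\<^sub>R Vloc s (om (Inl i)) z)" for om :: "nat + nat => real^2"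
 define eY where "eY om = energy r (%z. \<Sum>i\<in>{1..n}. (1 / real n) *\<^sub>R Vloc s (om (Inr i)) z)" for om :: "nat + nat => real^2"
 define eS where "eS om = energy r (global_field F n (%i. om (Inl i)) (%i. om (Inr i)))" for om :: "nat + nat => real^2"
 define c1 where "c1 = 2 / \<theta> / (1 - et)"
 define c2 where "c2 = (1 / (4 * \<theta> * real N) + 1 / (1 - 4 * \<theta>)) / (1 - et)"
 define c0 where "c0 = 2 * (K * s)^2 / \<theta>"
 define d where "d = (2 * R)^2"
 define L where "L = (CL s / real n + (b * K^3 * s)^2 * measure lborel Om) / a"
 have c: "0 <= c0" "0 <= c1" "0 <= c2" "0 <= d" unfolding c0_def c1_def c2_def d_def using \<theta> et N by auto
 have L0: "0 <= L" unfolding L_def using CL_nonneg[OF s] a by (intro divide_nonneg_nonneg add_nonneg_nonneg mult_nonneg_nonneg) auto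
 have enn: "0 <= energy r f" for f unfolding energy_def using r0 by (intro Bochner_Integration.integral_nonneg) auto
 have mX: "eX \<in> borel_measurable ?P" "(\<integral>\<^sup>+om. ennreal (eX om) \<partial>?P) <= ennreal L"
  using local_energy_expectation[OF n s, of Inl] unfolding eX_def[abs_def] L_def by auto
 have mY: "eY \<in> borel_measurable ?P" "(\<integral>\<^sup>+om. ennreal (eY om) \<partial>?P) <= ennreal L"
  using local_energy_expectation[OF n s, of Inr] unfolding eY_def[abs_def] L_def by auto
 have mS: "eS \<in> borel_measurable ?P"
  unfolding eS_def[abs_def] by (rule global_energy_expectation(2)[OF n F(2-4)])
 have eS: "(\<integral>\<^sup>+om. ennreal (eS om) \<partial>?P) <= ennreal G"
  unfolding eS_def by (rule order_trans[OF global_energy_expectation(1)[OF n F(2-4)] G(1)])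
 note [measurable] = mX(1) mY(1) mS shortages_prob(1)[OF et, of n]
 have pw: "AE om in ?P. ennreal (m om / real n) <= ennreal c0 + ennreal c1 * ennreal (eX om) + ennreal c1 * ennreal (eY om)
   + ennreal c2 * ennreal (eS om) + ennreal d * indicator (shortages et n) om"
  using AE_sample[of n] AE_space
 proof eventually_elim
  case (elim om)
  have x: "om (Inl i) \<in> Om" "om (Inr i) \<in> Om" if "i \<in> {1..n}" for i using elim(1) that unfolding labels_def by auto
  have "m om / real n <= c0 + c1 * eX om + c1 * eY om + c2 * eS om + d * indicator (shortages et n) om"
  proof (cases "om \<in> shortages et n")
   case False
   have cnt: "(1 - et) * (real n * mass k) <= (\<Sum>i\<in>{1..n}. indicator {w. kap w = k} (om (emb i)))"
    if k: "k \<in> I" and emb: "emb = Inl \<or> emb = Inr" for k and emb :: "nat => nat + nat"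
   proof -
    have "om \<notin> shortage et n emb k" using False k emb unfolding shortages_def by auto
    moreover have "(\<Sum>i\<in>{1..n}. indicat_real {w. kap w = k} (om (emb i))) = (\<Sum>i\<in>{1..n}. indicat_real (cell k) (om (emb i)))"
     using x emb by (intro sum.cong) (auto simp: cell_def indicator_def)
    ultimately show ?thesis using elim(2) unfolding shortage_def by auto
   qed
   have "m om / real n <= 2 * (K * s)^2 / \<theta>
    + 2 / \<theta> * (energy r (local_field s n (%i. om (Inl i))) + energy r (local_field s n (%i. om (Inr i)))) / (1 - et)
    + (1 / (4 * \<theta> * real N) + 1 / (1 - 4 * \<theta>)) * energy r (global_field F n (%i. om (Inl i)) (%i. om (Inr i))) / (1 - et)"
    unfolding m_def using x cnt by (intro match_cost_good[OF n \<theta> N et _ _ s F]) auto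
   also have "local_field s n (%i. om (Inl i)) = (%z. \<Sum>i\<in>{1..n}. (1 / real n) *\<^sub>R Vloc s (om (Inl i)) z)"
    using x by (intro local_field_eq) auto
   also have "local_field s n (%i. om (Inr i)) = (%z. \<Sum>i\<in>{1..n}. (1 / real n) *\<^sub>R Vloc s (om (Inr i)) z)"
    using x by (intro local_field_eq) auto
   also have "2 * (K * s)^2 / \<theta> + 2 / \<theta> * (energy r (%z. \<Sum>i\<in>{1..n}. (1 / real n) *\<^sub>R Vloc s (om (Inl i)) z)
     + energy r (%z. \<Sum>i\<in>{1..n}. (1 / real n) *\<^sub>R Vloc s (om (Inr i)) z)) / (1 - et)
    + (1 / (4 * \<theta> * real N) + 1 / (1 - 4 * \<theta>)) * energy r (global_field F n (%i. om (Inl i)) (%i. om (Inr i))) / (1 - et)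
    = c0 + c1 * eX om + c1 * eY om + c2 * eS om"
   proof -
    have "u + v * (X + Y) / h + k * S / h = u + v / h * X + v / h * Y + k / h * S" for u v X Y h k S :: real
     by (simp add: add_divide_distrib distrib_left)
    then show ?thesis unfolding c0_def c1_def c2_def eX_def eY_def eS_def .
   qed
   finally show ?thesis using False by simp
  next
   case True
   have "m om <= real n * d" unfolding m_def d_def using R x by (intro match_cost_le_diameter) auto
   then have "m om / real n <= d" using n by (simp add: divide_le_eq mult.commute)
   moreover have "0 <= c0 + c1 * eX om + c1 * eY om + c2 * eS om"
    unfolding eX_def eY_def eS_def using c enn by (intro add_nonneg_nonneg mult_nonneg_nonneg) auto
   ultimately show ?thesis using True by simp
  qed
  then have "ennreal (m om / real n) <= ennreal (c0 + c1 * eX om + c1 * eY om + c2 * eS om + d * indicator (shortages et n) om)"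
   by (rule ennreal_leI)
  also have "... = ennreal c0 + ennreal c1 * ennreal (eX om) + ennreal c1 * ennreal (eY om)
   + ennreal c2 * ennreal (eS om) + ennreal d * indicator (shortages et n) om"
   unfolding eX_def eY_def eS_def using c enn
   by (simp add: ennreal_plus ennreal_mult' indicator_def add_nonneg_nonneg mult_nonneg_nonneg)
  finally show ?case .
 qed
 have "(\<integral>\<^sup>+om. ennreal (m om / real n) \<partial>?P) <= (\<integral>\<^sup>+om. ennreal c0 + ennreal c1 * ennreal (eX om) + ennreal c1 * ennreal (eY om)
   + ennreal c2 * ennreal (eS om) + ennreal d * indicator (shortages et n) om \<partial>?P)"
  by (rule nn_integral_mono_AE[OF pw])
 also have "... = ennreal c0 + ennreal c1 * (\<integral>\<^sup>+om. ennreal (eX om) \<partial>?P) + ennreal c1 * (\<integral>\<^sup>+om. ennreal (eY om) \<partial>?P)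
   + ennreal c2 * (\<integral>\<^sup>+om. ennreal (eS om) \<partial>?P) + ennreal d * emeasure ?P (shortages et n)"
  by (simp add: nn_integral_add nn_integral_cmult nn_integral_cmult_indicator P.emeasure_space_1)
 also have "... <= ennreal c0 + ennreal c1 * ennreal L + ennreal c1 * ennreal L + ennreal c2 * ennreal G
   + ennreal d * ennreal (8 / (a * pi * eps^2) * exp (- (real n * a * pi * eps^2 * et^2 / 32)))"
 proof (intro add_mono mult_left_mono mX(2) mY(2) eS order_refl)
  show "emeasure ?P (shortages et n) <= ennreal (8 / (a * pi * eps^2) * exp (- (real n * a * pi * eps^2 * et^2 / 32)))"
   unfolding P.emeasure_eq_measure by (rule ennreal_leI, rule shortages_prob(2)[OF et])
 qed auto
 also have "... = ennreal (c0 + c1 * L + c1 * L + c2 * G + d * (8 / (a * pi * eps^2) * exp (- (real n * a * pi * eps^2 * et^2 / 32))))"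
 proof -
  have "ennreal c0 + ennreal c1 * ennreal L + ennreal c1 * ennreal L + ennreal c2 * ennreal G + ennreal d * ennreal p
    = ennreal (c0 + c1 * L + c1 * L + c2 * G + d * p)" if "0 <= p" for p
   using that by (simp only: ennreal_mult ennreal_plus add_nonneg_nonneg mult_nonneg_nonneg c L0 G(2))
  then show ?thesis using a by simp
 qed
 finally have nn: "(\<integral>\<^sup>+om. ennreal (m om / real n) \<partial>?P) <= ennreal (c0 + c1 * L + c1 * L + c2 * G + d * (8 / (a * pi * eps^2) * exp (- (real n * a * pi * eps^2 * et^2 / 32))))" .
 define X where "X = c0 + c1 * L + c1 * L + c2 * G + d * (8 / (a * pi * eps^2) * exp (- (real n * a * pi * eps^2 * et^2 / 32)))"
 have X0: "0 <= X" unfolding X_def using c L0 G(2) a by (intro add_nonneg_nonneg mult_nonneg_nonneg) auto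
 have "ennreal (norm (LINT om|?P. m om / real n)) <= (\<integral>\<^sup>+om. ennreal (norm (m om / real n)) \<partial>?P)"
  by (rule norm_integral_le_nn_integral)
 also have "... = (\<integral>\<^sup>+om. ennreal (m om / real n) \<partial>?P)" unfolding m_def using match_cost_nonneg by simp
 also have "... <= ennreal X" using nn unfolding X_def .
 finally have "norm (LINT om|?P. m om / real n) <= X" using X0 by (subst (asm) ennreal_le_iff) auto
 then have "(LINT om|?P. m om / real n) <= X" unfolding real_norm_def by (rule abs_le_D1)
 then have "(LINT om|?P. m om) / real n <= X" by simp
 then have "(LINT om|?P. m om) <= real n * X" using n by (simp add: divide_le_eq mult.commute)
 also have "X = 2 * (K * s)^2 / \<theta> + 4 / \<theta> * ((CL s / real n + (b * K^3 * s)^2 * measure lborel Om) / a) / (1 - et)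
   + (1 / (4 * \<theta> * real N) + 1 / (1 - 4 * \<theta>)) / (1 - et) * G
   + (2 * R)^2 * (8 / (a * pi * eps^2) * exp (- (real n * a * pi * eps^2 * et^2 / 32)))"
 proof -
  have "c1 * L + c1 * L = 4 / \<theta> * L / (1 - et)" unfolding c1_def by (simp add: field_simps)
  then show ?thesis unfolding X_def c0_def c2_def d_def L_def by simp
 qed
 finally show ?thesis unfolding m_def .
qed

end

section \<open>Energy of the fields of the cells\<close>

context planar_cells
begin

text \<open>Where \<open>A\<close> is not 0, the ratio \<open>mass i / r z\<close> is at most
  \<open>w\<close> times the area of the cell. For small cells away from the boundary
  \<open>w\<close> can be taken close to 1, so the density cancels and the area remains. The bounded
  remainder \<open>F - A\<close> is separated by a weighted square inequality.\<close>

lemma cell_energy: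
 fixes F A :: "real^2 => real^2"
 assumes i: "i \<in> I" and m[measurable]: "F \<in> borel_measurable borel" "A \<in> borel_measurable borel"
  and out: "\<And>z. z \<notin> Om ==> F z = 0"
  and w: "\<And>z. z \<in> Om ==> A z \<noteq> 0 ==> mass i <= w * measure lborel (cell i) * r z" "0 <= w"
  and SA: "(\<integral>\<^sup>+z. ennreal ((norm (A z))^2) \<partial>lborel) <= ennreal SA" "0 <= SA"
  and SE: "(\<integral>\<^sup>+z. ennreal ((norm (F z - A z))^2) \<partial>lborel) <= ennreal SE" "0 <= SE"
  and et: "0 < et"
 shows "ennreal (mass i) * (\<integral>\<^sup>+z. ennreal ((norm (F z))^2 / r z) \<partial>lborel)
  <= ennreal (measure lborel (cell i) * ((1 + et) * w * SA + (1 + 1 / et) * (b / a) * SE))"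
proof -
 define v where "v = measure lborel (cell i)"
 have v0: "0 <= v" unfolding v_def by simp
 define k1 where "k1 = v * ((1 + et) * w)"
 define k2 where "k2 = v * ((1 + 1 / et) * (b / a))"
 have k: "0 <= k1" "0 <= k2" unfolding k1_def k2_def using v0 w(2) et a b0 by auto
 have arith1: "m * (e * x + k * y) = e * (m * x) + k * y * m" for m e x k y :: real by (simp add: algebra_simps)
 have "ennreal (mass i) * (\<integral>\<^sup>+z. ennreal ((norm (F z))^2 / r z) \<partial>lborel)
   = (\<integral>\<^sup>+z. ennreal (mass i) * ennreal ((norm (F z))^2 / r z) \<partial>lborel)"
  by (rule nn_integral_cmult[symmetric]) measurable
 also have "... <= (\<integral>\<^sup>+z. ennreal k1 * ennreal ((norm (A z))^2) + ennreal k2 * ennreal ((norm (F z - A z))^2) \<partial>lborel)"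
 proof (intro nn_integral_mono)
  fix z
  have "mass i * ((norm (F z))^2 / r z) <= k1 * (norm (A z))^2 + k2 * (norm (F z - A z))^2"
  proof (cases "z \<in> Om")
   case True
   have rz: "0 < r z" "a <= r z" using ra[OF True] a by auto
   have ab: "mass i / r z <= b / a * v"
   proof -
    have "mass i <= b * v" unfolding v_def using rb by (intro mass_le) auto
    then have "mass i / r z <= (b * v) / a" using rz a b0 v0 by (intro frac_le) auto
    then show ?thesis by simp
   qed
   have aw: "mass i / r z * (norm (A z))^2 <= w * v * (norm (A z))^2"
   proof (cases "A z = 0")
    case False
    then have "mass i / r z <= w * v" using w(1)[OF True] rz unfolding v_def by (simp add: divide_le_eq)
    then show ?thesis by (intro mult_right_mono) auto
   qed simp
   have "(norm (F z))^2 <= (norm (A z) + norm (F z - A z))^2"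
    using norm_triangle_ineq[of "A z" "F z - A z"] by (intro power_mono) auto
   also have "... <= (1 + et) * (norm (A z))^2 + (1 + 1 / et) * (norm (F z - A z))^2" by (rule power2_sum_le_weighted[OF et])
   finally have "mass i / r z * (norm (F z))^2 <= mass i / r z * ((1 + et) * (norm (A z))^2 + (1 + 1 / et) * (norm (F z - A z))^2)"
    using mass_pos[OF i] rz by (intro mult_left_mono) auto
   also have "... = (1 + et) * (mass i / r z * (norm (A z))^2) + (1 + 1 / et) * (norm (F z - A z))^2 * (mass i / r z)"
    using arith1[of "mass i / r z"] .
   also have "... <= (1 + et) * (w * v * (norm (A z))^2) + (1 + 1 / et) * (norm (F z - A z))^2 * (b / a * v)"
    using aw ab et by (intro add_mono mult_left_mono) auto
   also have "... = k1 * (norm (A z))^2 + k2 * (norm (F z - A z))^2" unfolding k1_def k2_def by (simp add: algebra_simps)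
   finally show ?thesis by simp
  qed (use out k in auto)
  then have "ennreal (mass i * ((norm (F z))^2 / r z)) <= ennreal (k1 * (norm (A z))^2 + k2 * (norm (F z - A z))^2)"
   by (rule ennreal_leI)
  then show "ennreal (mass i) * ennreal ((norm (F z))^2 / r z) <= ennreal k1 * ennreal ((norm (A z))^2) + ennreal k2 * ennreal ((norm (F z - A z))^2)"
   using k mass_nonneg[of i] r0[of z] by (simp only: ennreal_mult ennreal_plus mult_nonneg_nonneg zero_le_power2 divide_nonneg_nonneg)
 qed
 also have "... = ennreal k1 * (\<integral>\<^sup>+z. ennreal ((norm (A z))^2) \<partial>lborel) + ennreal k2 * (\<integral>\<^sup>+z. ennreal ((norm (F z - A z))^2) \<partial>lborel)"
  by (subst nn_integral_add) (auto simp: nn_integral_cmult)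
 also have "... <= ennreal k1 * ennreal SA + ennreal k2 * ennreal SE"
  by (intro add_mono mult_left_mono SA(1) SE(1)) auto
 also have "... = ennreal (k1 * SA + k2 * SE)"
  using k SA(2) SE(2) by (simp only: ennreal_mult ennreal_plus mult_nonneg_nonneg)
 also have "k1 * SA + k2 * SE = v * ((1 + et) * w * SA + (1 + 1 / et) * (b / a) * SE)"
  unfolding k1_def k2_def by (simp add: algebra_simps)
 finally show ?thesis unfolding v_def .
qed

definition "field_family W F \<longleftrightarrow> (\<forall>i\<in>I. flow (density_integral (q i)) W (F i)) \<and> (\<exists>Bd. \<forall>i z. norm (F i z) <= Bd) \<and>
 (\<forall>i z. z \<notin> Om --> F i z = 0) \<and> (\<forall>i. F i \<in> borel_measurable borel)"

definition field_energy :: "(int \<times> int => real^2 => real^2) => ennreal" where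
 "field_energy F = (\<Sum>i\<in>I. ennreal (mass i) * (\<integral>\<^sup>+z. ennreal ((norm (F i z))^2 / r z) \<partial>lborel))"

end

context planar_density
begin

text \<open>All macroscopic choices precede \<open>eps\<close>, so that \<open>\<beta>\<close>
  absorbs everything but the logarithm. Interior cells contribute their area with the constant
  \<open>1 / (2 * pi)\<close>, boundary cells a larger constant on a set of measure at most
  \<open>l0\<close>.\<close>

lemma cell_fields_exist:
 assumes ucone: "uniform_cone Om h lam R0" and al: "measure lborel Om / (2 * pi) < al"
 shows "\<exists>W \<beta> eps1. 0 <= \<beta> \<and> 0 < eps1 \<and> eps1 < 1 \<and> (\<forall>eps kap ctr. 0 < eps \<and> eps < eps1 \<and> cell_structure Om (3 / lam + 3) eps kap ctr -->
  (\<exists>F. planar_cells.field_family Om r kap W F \<and> planar_cells.field_energy Om r kap F <= ennreal (al * ln (1 / eps) + \<beta>)))"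
proof -
 define C0 where "C0 = 3 / lam + 3"
 have lam: "0 < lam" "lam <= 1" "0 < h" "0 < R0" using ucone unfolding uniform_cone_def by auto
 have C0: "1 <= C0" unfolding C0_def using lam by simp
 define A0 where "A0 = measure lborel Om"
 have A0: "0 <= A0" unfolding A0_def by simp
 define k where "k = (1 + 1 / lam)^2 / (2 * pi)"
 define g where "g = al - A0 / (2 * pi)"
 have g: "0 < g" unfolding g_def A0_def using al by simp
 have "0 < 1 + 1 / lam" using lam by (intro add_pos_pos) auto
 then have k0: "0 < k" unfolding k_def by (intro divide_pos_pos zero_less_power) auto
 \<comment> \<open>The slack \<open>g\<close> between \<open>al\<close> and its lower bound is
   distributed: at most a quarter each for the boundary layer through \<open>l0\<close>, for the
   oscillation of the density through \<open>\<tau>\<close> and for the weighted inequality through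
   \<open>et\<close>.\<close>
 define l0 where "l0 = g / 4 / (b / a * k^2 * (2 * pi))"
 define \<tau> where "\<tau> = g / 4 * a * (2 * pi) / (A0 + 1)"
 define et where "et = g / 4 / (A0 / (2 * pi) + g / 2)"
 have l0: "0 < l0" unfolding l0_def using g b0 a k0 by (intro divide_pos_pos mult_pos_pos) auto
 have \<tau>: "0 < \<tau>" unfolding \<tau>_def using g a A0 by (intro divide_pos_pos mult_pos_pos) auto
 have s0: "0 < A0 / (2 * pi) + g / 2" using g A0 by (intro add_nonneg_pos) auto
 have et: "0 < et" unfolding et_def using g s0 by (intro divide_pos_pos) auto
 have coef: "(1 + et) * ((1 + \<tau> / a) * A0 / (2 * pi) + l0 * (b / a) * k^2 * (2 * pi)) <= al"
 proof -
  have "l0 * (b / a) * k^2 * (2 * pi) = g / 4" unfolding l0_def using b0 a k0 by simp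
  moreover have "\<tau> / a * A0 / (2 * pi) <= g / 4"
  proof -
   have "\<tau> / a * A0 / (2 * pi) = g / 4 * (A0 / (A0 + 1))" unfolding \<tau>_def using a by simp
   also have "... <= g / 4 * 1" using g A0 by (intro mult_left_mono) auto
   finally show ?thesis by simp
  qed
  ultimately have "(1 + \<tau> / a) * A0 / (2 * pi) + l0 * (b / a) * k^2 * (2 * pi) <= A0 / (2 * pi) + g / 2"
  proof -
   have four: "p = s + t ==> u = g / 4 ==> t <= g / 4 ==> p + u <= s + g / 2" for p s t u :: real by simp
   have "(1 + \<tau> / a) * A0 / (2 * pi) = A0 / (2 * pi) + \<tau> / a * A0 / (2 * pi)"
    by (simp only: distrib_right add_divide_distrib mult_1_left)
   then show "l0 * (b / a) * k^2 * (2 * pi) = g / 4 ==> \<tau> / a * A0 / (2 * pi) <= g / 4 ==> ?thesis"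
    using four by blast
  qed
  then have "(1 + et) * ((1 + \<tau> / a) * A0 / (2 * pi) + l0 * (b / a) * k^2 * (2 * pi)) <= (1 + et) * (A0 / (2 * pi) + g / 2)"
   using et by (intro mult_left_mono) auto
  also have "... = A0 / (2 * pi) + g / 2 + g / 4" 
  proof -
   have "0 < S ==> (1 + x / 4 / S) * S = S + x / 4" for S x :: real by (simp add: distrib_right)
   from this[OF s0] show ?thesis unfolding et_def .
  qed
  also have "... <= A0 / (2 * pi) + g" using g by simp
  also have "... = al" unfolding g_def by simp
  finally show ?thesis .
 qed
 obtain R1 where R1: "0 < R1" "{z \<in> Om. \<not> ball z R1 \<subseteq> Om} \<in> sets borel" "measure lborel {z \<in> Om. \<not> ball z R1 \<subseteq> Om} < l0"
  using boundary_layer_small[OF op bd l0] by blast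
 obtain d where d: "0 < d" "\<And>x y. x \<in> Om ==> y \<in> Om ==> dist x y < d ==> \<bar>r x - r y\<bar> < \<tau>" using uc[OF \<tau>] by blast
 \<comment> \<open>Cells will lie within \<open>R\<close> of their centres. Then
   \<open>2 * R <= R1\<close> places every cell whose disc of radius \<open>R\<close> leaves the
   domain in the boundary layer, and \<open>2 * R <= d\<close> controls the oscillation of
   \<open>r\<close> between a cell and the support of its field.\<close>
 define R where "R = min R1 d / 2"
 have R: "0 < R" "2 * R <= R1" "2 * R <= d" unfolding R_def using R1(1) d(1) by auto
 obtain cw rw where w: "0 < rw" "ball cw rw \<subseteq> Om" using Om_ne op open_contains_ball by (metis all_not_in_conv)
 define W where "W = disc_avg cw rw"
 have lh: "0 < lam * h" using lam by simp
 obtain M1 where M1: "\<And>c. ball c R \<subseteq> Om ==> \<exists>b. flow (disc_avg c R) W b \<and> (\<forall>x. norm (b x) <= M1) \<and> (\<forall>x. x \<notin> Om --> b x = 0)"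
  using macro_flow[OF op con bd w R(1)] unfolding W_def by blast
 obtain M2 where M2: "\<And>c. ball c (lam * h) \<subseteq> Om ==> \<exists>b. flow (disc_avg c (lam * h)) W b \<and> (\<forall>x. norm (b x) <= M2) \<and> (\<forall>x. x \<notin> Om --> b x = 0)"
  using macro_flow[OF op con bd w lh] unfolding W_def by blast
 define K where "K = 1 + 2 * C0"
 define CB where "CB = 2 * b * K^3 / (a * pi)"
 define SE where "SE = 2 * (CB^2 * (pi * (C0 + K)^2)) + 2 * ((max \<bar>M1\<bar> \<bar>M2\<bar>)^2 * A0)"
 have SE0: "0 <= SE" unfolding SE_def using A0 by auto
 define k' where "k' = (1 + 1 / lam) * (lam * h)"
 have k': "lam * h <= k'"
 proof -
  have "1 * (lam * h) <= (1 + 1 / lam) * (lam * h)" using lam by (intro mult_right_mono) auto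
  then show ?thesis unfolding k'_def by simp
 qed
 define eps1 where "eps1 = Min {1 / 2, R / C0, R, lam * h, R0}"
 have eps1: "0 < eps1" "eps1 < 1" "eps1 <= R / C0" "eps1 <= R" "eps1 <= lam * h" "eps1 <= R0"
  unfolding eps1_def using R C0 lh lam by auto
 define SA where "SA eps = (1 / (2 * pi))^2 * (pi + 2 * pi * ln (R / (eps / 2)))" for eps :: real
 define SB where "SB eps = k^2 * (pi + 2 * pi * ln (k' / (eps / 2)))" for eps :: real
 define \<beta>' where "\<beta>' = (1 + et) * (1 + \<tau> / a) * A0 * ((1 / (2 * pi))^2 * (pi + 2 * pi * ln (2 * R)))
   + (1 + 1 / et) * (b / a) * SE * A0 + (1 + et) * (b / a) * l0 * (k^2 * (pi + 2 * pi * ln (2 * k')))"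
 have main: "\<exists>F. planar_cells.field_family Om r kap W F \<and> planar_cells.field_energy Om r kap F <= ennreal (al * ln (1 / eps) + \<bar>\<beta>'\<bar>)"
  if eps: "0 < eps" "eps < eps1" and cs: "cell_structure Om C0 eps kap ctr" for eps kap ctr
 proof -
  interpret pc: planar_cells Om r a b C0 eps kap ctr
   by unfold_locales (use cs eps C0 in auto)
  have KC: "pc.K = K" "pc.CB = CB" unfolding pc.K_def K_def pc.CB_def CB_def by simp_all
  have e2: "eps <= 2 * R" "eps / 2 <= lam * h" "eps / 2 <= R0" "C0 * eps <= R"
  proof -
   show "eps <= 2 * R" "eps / 2 <= lam * h" "eps / 2 <= R0" using eps eps1 by linarith+
   have "eps <= R / C0" using eps eps1 by linarith
   then show "C0 * eps <= R" using C0 by (simp add: le_divide_eq mult.commute)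
  qed
  have lnA: "0 <= ln (R / (eps / 2))" "0 <= ln (k' / (eps / 2))" using e2 k' eps by (auto intro!: ln_ge_zero)
  have SA0: "0 <= SA eps" "0 <= SB eps" unfolding SA_def SB_def using lnA by (auto intro!: mult_nonneg_nonneg add_nonneg_nonneg)
  define bdry where "bdry i \<longleftrightarrow> \<not> ball (ctr i) R \<subseteq> Om" for i
  have bnd: "\<exists>f. flow A B f \<and> (\<forall>x. norm (f x) <= max \<bar>M1\<bar> \<bar>M2\<bar>) \<and> (\<forall>x. x \<notin> Om --> f x = 0)"
   if "\<exists>f. flow A B f \<and> (\<forall>x. norm (f x) <= M) \<and> (\<forall>x. x \<notin> Om --> f x = 0)" "M <= max \<bar>M1\<bar> \<bar>M2\<bar>" for A B M
   using that by (meson order_trans)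
  have M1': "\<exists>f. flow (disc_avg c R) W f \<and> (\<forall>x. norm (f x) <= max \<bar>M1\<bar> \<bar>M2\<bar>) \<and> (\<forall>x. x \<notin> Om --> f x = 0)"
   if "ball c R \<subseteq> Om" for c by (rule bnd[OF M1[OF that]]) linarith
  have M2': "\<exists>f. flow (disc_avg c (lam * h)) W f \<and> (\<forall>x. norm (f x) <= max \<bar>M1\<bar> \<bar>M2\<bar>) \<and> (\<forall>x. x \<notin> Om --> f x = 0)"
   if "ball c (lam * h) \<subseteq> Om" for c by (rule bnd[OF M2[OF that]]) linarith
  define X where "X = (1 + et) * (1 + \<tau> / a) * SA eps + (1 + 1 / et) * (b / a) * SE"
  define Y where "Y = (1 + et) * (b / a) * SB eps"
  have XY: "0 <= X" "0 <= Y" unfolding X_def Y_def using et \<tau> a b0 SA0 SE0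
   by (intro add_nonneg_nonneg mult_nonneg_nonneg; simp)+
  define ok where "ok i F \<longleftrightarrow> flow (density_integral (pc.q i)) W F \<and> (\<forall>z. z \<notin> Om --> F z = 0) \<and> (\<exists>Bd. \<forall>z. norm (F z) <= Bd) \<and>
   ennreal (pc.mass i) * (\<integral>\<^sup>+z. ennreal ((norm (F z))^2 / r z) \<partial>lborel) <= ennreal (measure lborel (pc.cell i) * (X + (if bdry i then Y else 0)))" for i F
  have ex: "\<exists>F. ok i F"
   if i: "i \<in> pc.I" for i
  proof (cases "bdry i")
   case False
   then have bi: "ball (ctr i) R \<subseteq> Om" unfolding bdry_def by simp
   obtain F A where FA: "flow (density_integral (pc.q i)) W F" "\<forall>x. x \<notin> Om --> F x = 0" "\<exists>Bd. \<forall>x. norm (F x) <= Bd"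
    "(\<integral>\<^sup>+x. ennreal ((norm (F x - A x))^2) \<partial>lborel) <= ennreal SE"
    "A \<in> borel_measurable borel" "\<And>x. norm (A x) <= 1 / (2 * pi * max (eps / 2) (norm (x - ctr i)))" "\<And>x. R <= norm (x - ctr i) ==> A x = 0"
    using pc.interior_flow[OF i e2(1) bi M1'] unfolding KC SE_def A0_def by blast
   have Fm: "F \<in> borel_measurable borel" using FA(1) unfolding flow_def by simp
   have "ennreal (pc.mass i) * (\<integral>\<^sup>+z. ennreal ((norm (F z))^2 / r z) \<partial>lborel)
    <= ennreal (measure lborel (pc.cell i) * ((1 + et) * (1 + \<tau> / a) * SA eps + (1 + 1 / et) * (b / a) * SE))"
   proof (rule pc.cell_energy[OF i Fm FA(5) _ _ _ _ SA0(1) FA(4) SE0 et])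
    show "F z = 0" if "z \<notin> Om" for z using FA(2) that by blast
    show "(\<integral>\<^sup>+z. ennreal ((norm (A z))^2) \<partial>lborel) <= ennreal (SA eps)"
     unfolding SA_def using FA(6,7) e2(1) eps by (intro nn_integral_inverse_bound[where c = "ctr i"]) auto
    show "pc.mass i <= (1 + \<tau> / a) * measure lborel (pc.cell i) * r z" if z: "z \<in> Om" "A z \<noteq> 0" for z
    proof -
     have nz: "norm (z - ctr i) < R" using FA(7)[of z] z(2) by force
     have "pc.mass i <= ((1 + \<tau> / a) * r z) * measure lborel (pc.cell i)"
     proof (rule pc.mass_le)
      fix x assume x: "x \<in> pc.cell i"
      then have xx: "x \<in> Om" "dist (ctr i) x <= C0 * eps" using pc.cell_subset[of i] by (auto simp: subset_iff)
      have "dist x z <= dist (ctr i) x + dist z (ctr i)" by metric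
      then have "dist x z < d" using nz xx(2) e2(4) R(3) by (simp add: dist_norm)
      then have "r x <= r z + \<tau>" using d(2)[OF xx(1) z(1)] by simp
      also have "\<tau> <= \<tau> / a * r z" using ra[OF z(1)] \<tau> a by (simp add: le_divide_eq)
      finally show "r x <= (1 + \<tau> / a) * r z" by (simp add: algebra_simps)
     qed
     then show ?thesis by (simp add: mult.commute mult.left_commute)
    qed
   qed (use \<tau> a in auto)
   then show ?thesis unfolding ok_def X_def using FA(1-3) False by auto
  next
   case True
   obtain F A where FA: "flow (density_integral (pc.q i)) W F" "\<forall>x. x \<notin> Om --> F x = 0" "\<exists>Bd. \<forall>x. norm (F x) <= Bd"
    "(\<integral>\<^sup>+x. ennreal ((norm (F x - A x))^2) \<partial>lborel) <= ennreal SE"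
    "A \<in> borel_measurable borel" "(\<integral>\<^sup>+x. ennreal ((norm (A x))^2) \<partial>lborel) <= ennreal (SB eps)"
    using pc.boundary_flow[OF i ucone e2(2,3) M2'] unfolding KC SE_def A0_def SB_def k_def k'_def by blast
   have Fm: "F \<in> borel_measurable borel" using FA(1) unfolding flow_def by simp
   have "ennreal (pc.mass i) * (\<integral>\<^sup>+z. ennreal ((norm (F z))^2 / r z) \<partial>lborel)
    <= ennreal (measure lborel (pc.cell i) * ((1 + et) * (b / a) * SB eps + (1 + 1 / et) * (b / a) * SE))"
   proof (rule pc.cell_energy[OF i Fm FA(5) _ _ _ FA(6) SA0(2) FA(4) SE0 et])
    show "F z = 0" if "z \<notin> Om" for z using FA(2) that by blast
    show "pc.mass i <= b / a * measure lborel (pc.cell i) * r z" if z: "z \<in> Om" for z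
    proof -
     have "pc.mass i <= b * measure lborel (pc.cell i)" using rb by (intro pc.mass_le)
     also have "... = b / a * measure lborel (pc.cell i) * a" using a by simp
     also have "... <= b / a * measure lborel (pc.cell i) * r z" using ra[OF z] a b0 by (intro mult_left_mono) auto
     finally show ?thesis .
    qed
   qed (use a b0 in auto)
   also have "... <= ennreal (measure lborel (pc.cell i) * ((1 + et) * (1 + \<tau> / a) * SA eps + (1 + 1 / et) * (b / a) * SE + (1 + et) * (b / a) * SB eps))"
   proof (intro ennreal_leI mult_left_mono)
    have "0 <= (1 + et) * (1 + \<tau> / a) * SA eps" using et \<tau> a SA0 by (intro mult_nonneg_nonneg add_nonneg_nonneg) auto
    then show "(1 + et) * (b / a) * SB eps + (1 + 1 / et) * (b / a) * SE <= (1 + et) * (1 + \<tau> / a) * SA eps + (1 + 1 / et) * (b / a) * SE + (1 + et) * (b / a) * SB eps"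
     by linarith
   qed simp
   finally show ?thesis unfolding ok_def X_def Y_def using FA(1-3) True by auto
  qed
  from bchoice[OF ballI[OF ex]] obtain F0 where F0: "\<forall>i\<in>pc.I. ok i (F0 i)" ..
  then have "\<forall>i\<in>pc.I. \<exists>Bd. \<forall>z. norm (F0 i z) <= Bd" unfolding ok_def by blast
  from bchoice[OF this] obtain Bd0 where Bd0: "\<forall>i\<in>pc.I. \<forall>z. norm (F0 i z) <= Bd0 i" ..
  define F where "F i = (if i \<in> pc.I then F0 i else (%z. 0))" for i
  define Bd where "Bd = (\<Sum>i\<in>pc.I. \<bar>Bd0 i\<bar>)"
  have FB: "norm (F i z) <= Bd" for i z
  proof (cases "i \<in> pc.I")
   case True
   have "norm (F0 i z) <= \<bar>Bd0 i\<bar>" using Bd0 True by (meson abs_ge_self order_trans)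
   also have "... <= Bd" unfolding Bd_def using True pc.finI by (intro member_le_sum) auto
   finally show ?thesis using True unfolding F_def by simp
  qed (simp add: F_def Bd_def sum_nonneg)
  have layer: "(\<Sum>i\<in>pc.I. measure lborel (pc.cell i) * (if bdry i then 1 else 0)) <= l0"
  proof -
   define Z where "Z = {z \<in> Om. \<not> ball z R1 \<subseteq> Om}"
   have Zf: "emeasure lborel Z < \<infinity>"
    using bounded_subset[OF bd, of Z] unfolding Z_def by (intro emeasure_bounded_finite) auto
   have iZ: "integrable lborel (indicat_real Z)" using Zf R1(2) unfolding Z_def by (intro integrable_real_indicator) auto
   have "(\<Sum>i\<in>pc.I. measure lborel (pc.cell i) * (if bdry i then 1 else 0)) = (LINT x|lborel. indicator Om x * (if bdry (kap x) then 1 else 0))"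
    by (rule pc.cell_area_sum)
   also have "... <= (LINT x|lborel. indicator Z x)"
   proof (rule integral_mono'[OF iZ])
    show "indicator Om x * (if bdry (kap x) then 1 else 0) <= indicat_real Z x" for x
    proof (cases "x \<in> Om \<and> bdry (kap x)")
     case True
     then have "dist x (ctr (kap x)) <= R" using pc.cell_props(2)[of x] e2(4) by linarith
     then have "ball (ctr (kap x)) R \<subseteq> ball x R1"
      using R by (intro ball_subset_ball_iff[THEN iffD2] disjI1) (simp add: dist_commute)
     then have "x \<in> Z" using True unfolding bdry_def Z_def by auto
     then show ?thesis using True by simp
    qed auto
   qed simp
   also have "... = measure lborel Z" using R1(2) unfolding Z_def by simp
   also have "... <= l0" using R1(3) unfolding Z_def by simp
   finally show ?thesis .
  qed
  have tot: "A0 * X + l0 * Y <= al * ln (1 / eps) + \<bar>\<beta>'\<bar>"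
  proof -
   have l1: "ln (R / (eps / 2)) = ln (2 * R) + ln (1 / eps)" "ln (k' / (eps / 2)) = ln (2 * k') + ln (1 / eps)"
    using R eps k' lh by (simp_all add: ln_div ln_mult)
   have "A0 * X + l0 * Y = \<beta>' + ((1 + et) * ((1 + \<tau> / a) * A0 / (2 * pi) + l0 * (b / a) * k^2 * (2 * pi))) * ln (1 / eps)"
   proof -
    have p: "(1 / (2 * pi))^2 * (2 * pi) = 1 / (2 * pi)" by (simp add: power2_eq_square)
    have arith: "A0 * ((1 + et) * t * (u * (P + 2 * pi * (x + y))) + c) + l0 * ((1 + et) * ba * (kk * (P + 2 * pi * (x' + y))))
     = ((1 + et) * t * A0 * (u * (P + 2 * pi * x)) + c * A0 + (1 + et) * ba * l0 * (kk * (P + 2 * pi * x')))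
      + (1 + et) * (t * A0 * (u * (2 * pi)) + l0 * ba * kk * (2 * pi)) * y" for t u P x y c ba kk x'
     by (simp add: algebra_simps)
    show ?thesis unfolding X_def Y_def SA_def SB_def l1 \<beta>'_def using arith[of "1 + \<tau> / a" "(1 / (2 * pi))^2" pi "ln (2 * R)" "ln (1 / eps)"
       "(1 + 1 / et) * (b / a) * SE" "b / a" "k^2" "ln (2 * k')", unfolded p] by simp
   qed
   also have "... <= \<bar>\<beta>'\<bar> + al * ln (1 / eps)"
    using coef eps eps1 by (intro add_mono mult_right_mono) (auto intro!: ln_ge_zero)
   finally show ?thesis by simp
  qed
  have "pc.field_energy F <= (\<Sum>i\<in>pc.I. ennreal (measure lborel (pc.cell i) * (X + (if bdry i then Y else 0))))"
   unfolding pc.field_energy_def F_def using F0 by (intro sum_mono) (simp add: ok_def)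
  also have "... = ennreal (\<Sum>i\<in>pc.I. measure lborel (pc.cell i) * (X + (if bdry i then Y else 0)))"
   using XY by (intro sum_ennreal) auto
  also have "(\<Sum>i\<in>pc.I. measure lborel (pc.cell i) * (X + (if bdry i then Y else 0)))
   = (\<Sum>i\<in>pc.I. measure lborel (pc.cell i)) * X + (\<Sum>i\<in>pc.I. measure lborel (pc.cell i) * (if bdry i then 1 else 0)) * Y"
   unfolding sum_distrib_right sum.distrib[symmetric] by (intro sum.cong refl) (simp add: distrib_left)
  also have "... <= A0 * X + l0 * Y"
   using layer XY unfolding pc.sum_area A0_def by (intro add_mono mult_right_mono) auto
  also note tot
  finally have "pc.field_energy F <= ennreal (al * ln (1 / eps) + \<bar>\<beta>'\<bar>)" by (simp add: ennreal_leI)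
  moreover have "pc.field_family W F"
   unfolding pc.field_family_def
  proof (intro conjI ballI allI impI)
   show "flow (density_integral (pc.q i)) W (F i)" if "i \<in> pc.I" for i using F0 that unfolding F_def ok_def by simp
   show "F i \<in> borel_measurable borel" for i using F0 unfolding F_def flow_def ok_def by (cases "i \<in> pc.I") auto
   show "F i z = 0" if "z \<notin> Om" for i z using F0 that unfolding F_def ok_def by simp
  qed (use FB in blast)
  ultimately show ?thesis by blast
 qed
 show ?thesis unfolding C0_def[symmetric]
  by (rule exI[of _ W], rule exI[of _ "\<bar>\<beta>'\<bar>"], rule exI[of _ eps1]) (intro conjI allI impI abs_ge_zero eps1(1,2) main; elim conjE; assumption)
qed

end

section \<open>Choice of the scales in the upper bound\<close>

lemma powr_exp_decay:
 fixes \<delta> c :: real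
 assumes "0 < \<delta>" "0 < c"
 shows "(%n. real n powr p * exp (- (c * real n powr \<delta>))) \<longlonglongrightarrow> 0"
 using assms by real_asymp

text \<open>First \<open>\<theta>\<close> and \<open>et\<close> are taken small compared with
  \<open>t\<close>; only then is \<open>N\<close> chosen so large that the error
  \<open>1 / (4 * \<theta> * N)\<close> is small as well.\<close>

lemma near_one_factor:
 fixes t :: real
 assumes "0 < t"
 shows "\<exists>\<theta> et N. 0 < \<theta> \<and> \<theta> < 1 / 4 \<and> 0 < et \<and> et < 1 \<and> 0 < (N::nat) \<and> (1 / (4 * \<theta> * real N) + 1 / (1 - 4 * \<theta>)) / (1 - et) <= 1 + t"
proof -
 define x where "x = min t 1 / 8"
 have x: "0 < x" "x <= 1 / 8" "8 * x <= t" unfolding x_def using assms by auto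
 obtain N :: nat where N: "1 / x^2 < real N" using reals_Archimedean2 by blast
 have N0: "0 < real N" using N x by (smt (verit) zero_less_divide_iff zero_less_power)
 have i: "1 / (1 - x) <= 1 + 2 * x"
 proof -
  have "1 <= (1 + 2 * x) * (1 - x)" using x by (simp add: algebra_simps)
  then show ?thesis using x by (simp add: divide_le_eq)
 qed
 have j: "1 / (x * real N) <= x"
 proof -
  have "1 < real N * x^2" using N x by (simp add: divide_less_eq)
  then show ?thesis using x N0 by (simp add: divide_le_eq power2_eq_square mult_ac)
 qed
 have "(1 / (4 * (x / 4) * real N) + 1 / (1 - 4 * (x / 4))) / (1 - x) <= (x + (1 + 2 * x)) * (1 + 2 * x)"
 proof -
  have "(1 / (x * real N) + 1 / (1 - x)) * (1 / (1 - x)) <= (x + (1 + 2 * x)) * (1 + 2 * x)"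
   using i j x by (intro mult_mono add_mono) auto
  then show ?thesis by simp
 qed
 also have "... <= 1 + 8 * x"
 proof -
  have "x * x <= 1 / 8 * x" using x by (intro mult_right_mono) auto
  then show ?thesis using x by (simp add: algebra_simps)
 qed
 also have "... <= 1 + t" using x by simp
 finally show ?thesis
  using x N0 by (intro exI[of _ "x / 4"] exI[of _ x] exI[of _ N]) auto
qed

context planar_density
begin

text \<open>The global field gives \<open>2 * p * al * ln n\<close> with
  \<open>2 * p = 1 - \<delta>\<close>, that is, at most \<open>al * ln n\<close>. Since
  \<open>eps / s\<close> is \<open>n powr (\<delta> / 2)\<close>, the local fields give a multiple
  of \<open>\<delta> * ln n\<close>. A cell holds of the order of \<open>n powr \<delta>\<close>
  points, so a shortage has a probability smaller than any power of \<open>n\<close>.\<close>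

lemma expected_match_upper:
 assumes e: "0 < e"
 shows "\<forall>\<^sub>F n in sequentially. (LINT om|PiM (labels n) (%_. D). match_cost n (%i. om (Inl i)) (%i. om (Inr i)))
  <= (measure lborel Om / (2 * pi) + e) * ln (real n)"
proof -
 define A0 where "A0 = measure lborel Om"
 have A0: "0 <= A0" unfolding A0_def by simp
 define al where "al = A0 / (2 * pi) + e / 4"
 have al: "measure lborel Om / (2 * pi) < al" "0 < al" unfolding al_def A0_def[symmetric] using e A0 by (auto intro!: add_nonneg_pos)
 obtain h lam R0 where uniform: "uniform_cone Om h lam R0" using uniform_cone_exists[OF lip op bd] by blast
 have lam: "0 < lam" "0 < h" "0 < R0" using uniform unfolding uniform_cone_def by auto
 obtain R where R: "\<And>z. z \<in> Om ==> norm z <= R" using bd bounded_iff by blast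
 obtain W \<beta> eps1 where \<beta>: "0 <= \<beta>" and eps1: "0 < eps1" "eps1 < 1" and fam: "\<forall>eps kap ctr. 0 < eps \<and> eps < eps1 \<and> cell_structure Om (3 / lam + 3) eps kap ctr -->
  (\<exists>F. planar_cells.field_family Om r kap W F \<and> planar_cells.field_energy Om r kap F <= ennreal (al * ln (1 / eps) + \<beta>))"
  using cell_fields_exist[OF uniform al(1)] by blast
 \<comment> \<open>Chosen so that \<open>(1 + t) * al = al + e / 4\<close>.\<close>
 define t where "t = e / 4 / al"
 have t: "0 < t" unfolding t_def using e al by simp
 obtain \<theta> et :: real and N :: nat where par: "0 < \<theta>" "\<theta> < 1 / 4" "0 < et" "et < 1" "0 < N"
  "(1 / (4 * \<theta> * real N) + 1 / (1 - 4 * \<theta>)) / (1 - et) <= 1 + t" using near_one_factor[OF t] by blast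
 define C0 where "C0 = 3 / lam + 3"
 have C0: "1 <= C0" unfolding C0_def using lam by simp
 define k where "k = 1 + 2 * C0"
 have k: "3 <= k" unfolding k_def using C0 by simp
 define CB where "CB = 2 * b * k^3 / (a * pi)"
 define E0 where "E0 = 2 * (CB^2 * (pi * (C0 + k)^2)) + (b * k^3)^2 * A0"
 define E1 where "E1 = 2 * (k^2 / (2 * pi))^2"
 define c where "c = 4 / \<theta> / a / (1 - et)"
 have c: "0 < c" unfolding c_def using par a by simp
 have E1: "0 <= E1" unfolding E1_def by simp
 \<comment> \<open>The local fields enter with \<open>c * E1 * pi * \<delta>\<close> as coefficient
   of \<open>ln n\<close>, which becomes at most \<open>e / 8\<close>; the 1 in the denominator
   keeps it positive.\<close>
 define \<delta> where "\<delta> = min (1 / 2) (e / 8 / (c * E1 * pi + 1))"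
 have den: "0 < c * E1 * pi + 1" using c E1 by (intro add_nonneg_pos mult_nonneg_nonneg) auto
 have \<delta>: "0 < \<delta>" "\<delta> < 1" "c * E1 * pi * \<delta> <= e / 8"
 proof -
  show p: "0 < \<delta>" "\<delta> < 1" unfolding \<delta>_def using e den by auto
  have "\<delta> <= e / 8 / (c * E1 * pi + 1)" unfolding \<delta>_def by simp
  then have "(c * E1 * pi + 1) * \<delta> <= e / 8" using den by (simp only: pos_le_divide_eq mult.commute)
  then show "c * E1 * pi * \<delta> <= e / 8" using p by (simp add: distrib_right)
 qed
 define H where "H = 2 * k^2 / \<theta> + c * (E0 + E1 * (pi + 2 * pi * ln (k / 2))) + (1 + t) * (2 * \<beta>)"
 define p where "p = (1 - \<delta>) / 2"
 define T where "T n = (2 * R)^2 * (8 / (a * pi)) * (real n powr (2 - \<delta>) * exp (- (a * pi * et^2 / 32 * real n powr \<delta>)))" for n :: nat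
 have "T \<longlonglongrightarrow> (2 * R)^2 * (8 / (a * pi)) * 0"
  unfolding T_def using a par \<delta> by (intro tendsto_mult_left powr_exp_decay) auto
 then have evT: "\<forall>\<^sub>F n in sequentially. T n < 1" by (intro order_tendstoD(2)[where a = 1]) auto
 have evln: "\<forall>\<^sub>F n in sequentially. H + 1 <= e / 8 * ln (real n)"
 proof -
  have "filterlim (%n. e / 8 * ln (real n)) at_top sequentially"
   using e by real_asymp
  then show ?thesis unfolding filterlim_at_top by blast
 qed
 have eveps: "\<forall>\<^sub>F n in sequentially. real n powr (- p) < eps1" "\<forall>\<^sub>F n in sequentially. real n powr (- p) < lam * h / 3"
  "\<forall>\<^sub>F n in sequentially. real n powr (- p) < R0 * 2 / 3"
 proof -
  have "(%n. real n powr (- p)) \<longlonglongrightarrow> 0" using \<delta> unfolding p_def by real_asymp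
  note l = order_tendstoD(2)[OF this]
  show "\<forall>\<^sub>F n in sequentially. real n powr (- p) < eps1" "\<forall>\<^sub>F n in sequentially. real n powr (- p) < lam * h / 3"
   "\<forall>\<^sub>F n in sequentially. real n powr (- p) < R0 * 2 / 3" by (rule l; use eps1 lam in simp)+
 qed
 have evs: "\<forall>\<^sub>F n in sequentially. 2 <= real n powr (\<delta> / 2)"
 proof -
  have "filterlim (%n. real n powr (\<delta> / 2)) at_top sequentially" using \<delta> by real_asymp
  then show ?thesis unfolding filterlim_at_top by blast
 qed
 show ?thesis
  using evT evln eveps evs eventually_gt_at_top[of 1]
 proof eventually_elim
  case (elim n)
  define eps where "eps = real n powr (- p)"
  have n: "1 <= n" "0 < real n" "0 < ln (real n)" using elim(7) by auto
  have eps: "0 < eps" "eps < eps1" "3 / lam * eps <= h" "3 / 2 * eps < R0"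
   unfolding eps_def using elim lam n by (auto simp: field_simps)
  obtain kap where kap: "cell_structure Om C0 eps kap (grid_center eps)"
   unfolding C0_def using cell_structure_exists[OF uniform bd eps(1,3,4)] by blast
  interpret pc: planar_cells Om r a b C0 eps kap "grid_center eps"
   by unfold_locales (use kap eps C0 in auto)
  have "0 < eps \<and> eps < eps1 \<and> cell_structure Om (3 / lam + 3) eps kap (grid_center eps)"
   using eps(1,2) kap unfolding C0_def by simp
  from fam[rule_format, OF this] obtain F where F0: "pc.field_family W F" "pc.field_energy F <= ennreal (al * ln (1 / eps) + \<beta>)" by blast
  then obtain Bd where F: "\<And>i. i \<in> pc.I ==> flow (density_integral (pc.q i)) W (F i)"
   "\<And>i z. norm (F i z) <= Bd" "\<And>i z. z \<notin> Om ==> F i z = 0" "\<And>i. F i \<in> borel_measurable borel"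
   unfolding pc.field_family_def by metis
  have G: "(\<Sum>i\<in>pc.I. ennreal (2 / real n * pc.mass i) * (\<integral>\<^sup>+z. ennreal ((norm (F i z))^2 / r z) \<partial>lborel))
    <= ennreal (2 / real n * (al * ln (1 / eps) + \<beta>))"
  proof -
   have "(\<Sum>i\<in>pc.I. ennreal (2 / real n * pc.mass i) * (\<integral>\<^sup>+z. ennreal ((norm (F i z))^2 / r z) \<partial>lborel)) = ennreal (2 / real n) * pc.field_energy F"
    unfolding pc.field_energy_def sum_distrib_left by (intro sum.cong refl) (simp add: ennreal_mult' mult.assoc del: times_divide_eq_left)
   also have "... <= ennreal (2 / real n) * ennreal (al * ln (1 / eps) + \<beta>)" by (intro mult_left_mono F0(2)) simp
   also have "... = ennreal (2 / real n * (al * ln (1 / eps) + \<beta>))" by (rule ennreal_mult'[symmetric]) simp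
   finally show ?thesis .
  qed
  \<comment> \<open>At this radius \<open>n * s^2 = 1\<close>, so the displacement into the discs
    and the squared mean of the local fields contribute bounded amounts.\<close>
  define s where "s = real n powr (- (1 / 2))"
  have s0: "0 < s" unfolding s_def using n by simp
  have epss: "eps = s * real n powr (\<delta> / 2)" 
  proof -
   have "- p = - (1 / 2) + \<delta> / 2" unfolding p_def by (simp add: field_simps)
   then show ?thesis unfolding eps_def s_def powr_add[symmetric] by simp
  qed
  have s1: "s <= eps / 2" using elim(6) s0 unfolding epss by (simp add: mult_left_mono)
  have ns: "real n * s^2 = 1"
  proof -
   have "s^2 = real n powr (- 1)" unfolding s_def using n by (simp add: powr_power)
   then show ?thesis using n by (simp add: powr_minus)
  qed
  have ln1: "ln (1 / eps) = p * ln (real n)" unfolding eps_def using n by (simp add: ln_div ln_powr)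
  have ln0: "0 <= ln (1 / eps)" unfolding ln1 p_def using \<delta> n by simp
  have G0: "0 <= 2 / real n * (al * ln (1 / eps) + \<beta>)"
   using ln0 al \<beta> by (intro mult_nonneg_nonneg add_nonneg_nonneg) auto
  have KC: "pc.K = k" "pc.CB = CB" unfolding pc.K_def k_def pc.CB_def CB_def by simp_all
  have "(LINT om|PiM (labels n) (%_. D). match_cost n (%i. om (Inl i)) (%i. om (Inr i)))
   <= real n * (2 * (k * s)^2 / \<theta> + 4 / \<theta> * ((pc.CL s / real n + (b * k^3 * s)^2 * A0) / a) / (1 - et)
   + (1 / (4 * \<theta> * real N) + 1 / (1 - 4 * \<theta>)) / (1 - et) * (2 / real n * (al * ln (1 / eps) + \<beta>))
   + (2 * R)^2 * (8 / (a * pi * eps^2) * exp (- (real n * a * pi * eps^2 * et^2 / 32))))"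
   unfolding A0_def KC[symmetric]
   by (rule pc.expected_match_cells[OF n(1) par(1,2,5,3,4) s0 s1 F G G0 R])
  also have "... = 2 * k^2 / \<theta> + c * (pc.CL s + (b * k^3)^2 * A0)
   + (1 / (4 * \<theta> * real N) + 1 / (1 - 4 * \<theta>)) / (1 - et) * (2 * (al * ln (1 / eps) + \<beta>)) + T n"
  proof -
   have t1: "real n * (2 * (k * s)^2 / \<theta>) = 2 * k^2 / \<theta>"
   proof -
    have "real n * (2 * (k * s)^2 / \<theta>) = (real n * s^2) * (2 * k^2 / \<theta>)" by (simp add: power_mult_distrib)
    then show ?thesis by (simp only: ns mult_1_left)
   qed
   have t2: "real n * (4 / \<theta> * ((pc.CL s / real n + (b * k^3 * s)^2 * A0) / a) / (1 - et)) = c * (pc.CL s + (b * k^3)^2 * A0)"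
   proof -
    have "real n * (pc.CL s / real n + (b * k^3 * s)^2 * A0) = pc.CL s + (real n * s^2) * ((b * k^3)^2 * A0)"
     using n by (simp add: distrib_left power_mult_distrib)
    also have "... = pc.CL s + (b * k^3)^2 * A0" by (simp only: ns mult_1_left)
    finally have q: "real n * (pc.CL s / real n + (b * k^3 * s)^2 * A0) = pc.CL s + (b * k^3)^2 * A0" .
    have "m * (u * (v / w) / z) = u / w / z * (m * v)" for m u v w z :: real by simp
    then show ?thesis unfolding c_def q[symmetric] by blast
   qed
   have t3: "real n * (Z * (2 / real n * Y)) = Z * (2 * Y)" for Z Y using n by simp
   have t4: "real n * ((2 * R)^2 * (8 / (a * pi * eps^2) * exp (- (real n * a * pi * eps^2 * et^2 / 32)))) = T n"
   proof -
    have e2: "eps^2 = real n powr (\<delta> - 1)" 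
    proof -
     have "- p * real 2 = \<delta> - 1" unfolding p_def by (simp add: field_simps)
     then show ?thesis unfolding eps_def using n by (subst powr_power) (simp_all add: mult.commute)
    qed
    have "real n * eps^2 = real n powr 1 * real n powr (\<delta> - 1)" using n e2 by simp
    also have "... = real n powr \<delta>" unfolding powr_add[symmetric] by simp
    finally have ne: "real n * eps^2 = real n powr \<delta>" .
    have "real n / eps^2 = real n powr 1 / real n powr (\<delta> - 1)" using n e2 by simp
    also have "... = real n powr (2 - \<delta>)" unfolding powr_diff[symmetric] by simp
    finally have nd: "real n / eps^2 = real n powr (2 - \<delta>)" .
    have "real n * ((2 * R)^2 * (8 / (a * pi * eps^2) * X)) = (2 * R)^2 * (8 / (a * pi)) * (real n / eps^2 * X)" for X by simp
    moreover have "real n * a * pi * eps^2 * et^2 / 32 = a * pi * et^2 / 32 * (real n * eps^2)" by simp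
    ultimately show ?thesis unfolding T_def ne nd by simp
   qed
   show ?thesis by (simp only: distrib_left t1 t2 t3 t4)
  qed
  also have "... <= 2 * k^2 / \<theta> + c * (E0 + E1 * (pi + 2 * pi * ln (k / 2)) + E1 * pi * \<delta> * ln (real n))
   + ((al + e / 4) * ln (real n) + (1 + t) * (2 * \<beta>)) + 1"
  proof (intro add_mono order_refl)
   have ks: "k * eps / 2 / s = k / 2 * real n powr (\<delta> / 2)" unfolding epss using s0 by simp
   have "ln (k * eps / 2 / s) = ln (k / 2) + \<delta> / 2 * ln (real n)" unfolding ks using n k by (subst ln_mult) (simp_all add: ln_powr del: times_divide_eq_left)
   then have "pc.CL s + (b * k^3)^2 * A0 = E0 + E1 * (pi + 2 * pi * (ln (k / 2) + \<delta> / 2 * ln (real n)))"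
    unfolding pc.CL_def KC E0_def E1_def by simp
   also have "... = E0 + E1 * (pi + 2 * pi * ln (k / 2)) + E1 * pi * \<delta> * ln (real n)" by (simp add: algebra_simps)
   finally show "c * (pc.CL s + (b * k^3)^2 * A0) <= c * (E0 + E1 * (pi + 2 * pi * ln (k / 2)) + E1 * pi * \<delta> * ln (real n))" by simp
   have "(1 / (4 * \<theta> * real N) + 1 / (1 - 4 * \<theta>)) / (1 - et) * (2 * (al * ln (1 / eps) + \<beta>)) <= (1 + t) * (2 * (al * ln (1 / eps) + \<beta>))"
    using par(6) ln0 al \<beta> by (intro mult_right_mono mult_nonneg_nonneg add_nonneg_nonneg) auto
   also have "... <= (1 + t) * (al * ln (real n) + 2 * \<beta>)"
   proof -
    have "2 * p * ln (real n) <= 1 * ln (real n)" unfolding p_def using \<delta> n by (intro mult_right_mono) auto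
    then have "al * (2 * p * ln (real n)) <= al * ln (real n)" using al by (intro mult_left_mono) auto
    then show ?thesis unfolding ln1 using t by (intro mult_left_mono) auto
   qed
   also have "... = (al + e / 4) * ln (real n) + (1 + t) * (2 * \<beta>)"
   proof -
    have "t * al = e / 4" unfolding t_def using al by simp
    moreover have "(1 + t) * (al * l + 2 * \<beta>) = (al + t * al) * l + (1 + t) * (2 * \<beta>)" for l by (simp add: algebra_simps)
    ultimately show ?thesis by metis
   qed
   finally show "(1 / (4 * \<theta> * real N) + 1 / (1 - 4 * \<theta>)) / (1 - et) * (2 * (al * ln (1 / eps) + \<beta>)) <= (al + e / 4) * ln (real n) + (1 + t) * (2 * \<beta>)" .
  qed (use elim(1) in simp)
  also have "... = (H + 1) + (c * E1 * pi * \<delta>) * ln (real n) + (al + e / 4) * ln (real n)" unfolding H_def by (simp add: algebra_simps)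
  also have "... <= e / 8 * ln (real n) + e / 8 * ln (real n) + (al + e / 4) * ln (real n)"
   using elim(2) \<delta>(3) n by (intro add_mono mult_right_mono) auto
  also have "... <= (A0 / (2 * pi) + e) * ln (real n)"
  proof -
   have "e / 8 * L + e / 8 * L + (m + e / 4 + e / 4) * L <= (m + e) * L" if "0 <= e * L" for m L
    using that by (simp add: algebra_simps)
   from this[of "ln (real n)"] show ?thesis unfolding al_def using e n by simp
  qed
  finally show ?case unfolding A0_def .
 qed
qed

end

section \<open>Lower bound for the matching cost\<close>

text \<open>The fundamental solution of the negative Laplacian in the plane, smoothed at scale
  \<open>e\<close>.\<close>

definition log_pot :: "real => real^2 => real" where
 "log_pot e x = - ln ((norm x)^2 + e^2) / (4 * pi)"

definition log_pot_grad :: "real => real^2 => real^2" where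
 "log_pot_grad e x = (- 1 / (2 * pi * ((norm x)^2 + e^2))) *\<^sub>R x"

lemma log_pot_measurable[measurable]: "log_pot e \<in> borel_measurable borel"
 unfolding log_pot_def[abs_def] by measurable

lemma log_pot_grad_measurable[measurable]: "log_pot_grad e \<in> borel_measurable borel"
 unfolding log_pot_grad_def[abs_def] by measurable

text \<open>Taylor's theorem along the segment from \<open>x\<close> to \<open>x + d\<close>. The
  second derivative of one kernel is at most \<open>(norm d)^2 / (2 * pi)\<close> divided by the
  regularised squared distance, in absolute value. Cancellation between charges is not exploited
  here; it is already contained in the smallness of the net charges \<open>al\<close>.\<close>

lemma log_pot_sum_second_order:
 assumes e: "0 < e" and I: "finite I"
  and H: "\<And>t. 0 <= t ==> t <= 1 ==> (\<Sum>i\<in>I. \<bar>al i\<bar> / ((norm (x + t *\<^sub>R d - c i))^2 + e^2)) <= 2 * pi * k"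
 shows "(\<Sum>i\<in>I. al i * log_pot e (x + d - c i)) <= (\<Sum>i\<in>I. al i * log_pot e (x - c i))
  + (\<Sum>i\<in>I. al i *\<^sub>R log_pot_grad e (x - c i)) \<bullet> d + k / 2 * (norm d)^2"
proof -
 define Q where "Q i t = (norm (x + t *\<^sub>R d - c i))^2 + e^2" for i t
 define w where "w i t = (x - c i) \<bullet> d + t * (norm d)^2" for i t
 have Q_eq: "Q i t = (norm (x - c i))^2 + 2 * t * ((x - c i) \<bullet> d) + t^2 * (norm d)^2 + e^2" for i t
 proof -
  have "x + t *\<^sub>R d - c i = (x - c i) + t *\<^sub>R d" by simp
  then show ?thesis unfolding Q_def
   by (simp only: power2_norm_eq_inner inner_add_left inner_add_right inner_scaleR_left inner_scaleR_right inner_commute)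
     (simp add: algebra_simps power2_eq_square inner_commute)
 qed
 have Q0: "0 < Q i t" for i t unfolding Q_def using e by (intro add_nonneg_pos) auto
 have dQ: "(Q i has_real_derivative 2 * w i t) (at t)" for i t
  unfolding Q_eq[abs_def] w_def by (auto intro!: derivative_eq_intros simp: algebra_simps)
 have dw: "(w i has_real_derivative (norm d)^2) (at t)" for i t
  unfolding w_def[abs_def] by (auto intro!: derivative_eq_intros)
 \<comment> \<open>\<open>F 0\<close>, \<open>F 1\<close> and \<open>F 2\<close> are the potential
   on the segment and its first two derivatives, in the form required by Maclaurin's
   theorem.\<close>
 define F where "F m t = (if m = 0 then \<Sum>i\<in>I. al i * (- ln (Q i t) / (4 * pi))
  else if m = 1 then \<Sum>i\<in>I. al i * (- w i t / (2 * pi * Q i t))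
  else \<Sum>i\<in>I. al i * (- ((norm d)^2 * Q i t - 2 * (w i t)^2) / (2 * pi * (Q i t)^2)))" for m :: nat and t
 have F0: "(F 0 has_real_derivative F 1 t) (at t)" for t
  unfolding F_def[abs_def] using Q0[THEN less_imp_neq]
  by (auto intro!: DERIV_sum DERIV_cmult derivative_eq_intros dQ simp: Q0 field_simps)
 have F1: "(F 1 has_real_derivative F 2 t) (at t)" for t
 proof -
  have "((%t. - w i t / (2 * pi * Q i t)) has_real_derivative - ((norm d)^2 * Q i t - 2 * (w i t)^2) / (2 * pi * (Q i t)^2)) (at t)" for i
  proof -
   have ne: "2 * pi * Q i t \<noteq> 0" using Q0[of i t] by simp
   have "((%t. - w i t / (2 * pi * Q i t)) has_real_derivative
    ((- ((norm d)^2)) * (2 * pi * Q i t) - (- w i t) * (2 * pi * (2 * w i t))) / ((2 * pi * Q i t) * (2 * pi * Q i t))) (at t)"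
    by (intro DERIV_divide DERIV_minus DERIV_cmult dQ dw ne)
   also have "((- ((norm d)^2)) * (2 * pi * Q i t) - (- w i t) * (2 * pi * (2 * w i t))) / ((2 * pi * Q i t) * (2 * pi * Q i t))
    = - ((norm d)^2 * Q i t - 2 * (w i t)^2) / (2 * pi * (Q i t)^2)"
   proof -
    have "(- D * (p * q) - (- v) * (p * (2 * v))) / ((p * q) * (p * q)) = - (D * q - 2 * v^2) / (p * q^2)"
     if "p \<noteq> 0" "q \<noteq> 0" for D p q v :: real
     using that by (simp add: field_simps power2_eq_square)
    from this[of "2 * pi" "Q i t" "(norm d)^2" "w i t"] show ?thesis using Q0[of i t] by simp
   qed
   finally show ?thesis .
  qed
  then have "((%t. \<Sum>i\<in>I. al i * (- w i t / (2 * pi * Q i t))) has_real_derivative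
   (\<Sum>i\<in>I. al i * (- ((norm d)^2 * Q i t - 2 * (w i t)^2) / (2 * pi * (Q i t)^2)))) (at t)" by (intro DERIV_sum DERIV_cmult)
  moreover have "F 1 = (%t. \<Sum>i\<in>I. al i * (- w i t / (2 * pi * Q i t)))" by (rule ext) (simp add: F_def)
  moreover have "F 2 t = (\<Sum>i\<in>I. al i * (- ((norm d)^2 * Q i t - 2 * (w i t)^2) / (2 * pi * (Q i t)^2)))" by (simp add: F_def)
  ultimately show ?thesis by (simp only:)
 qed
 have "\<exists>t. 0 < t \<and> t < 1 \<and> F 0 1 = (\<Sum>m<2. F m 0 / fact m * 1 ^ m) + F 2 t / fact 2 * 1 ^ 2"
 proof (rule Maclaurin)
  have "(F m has_real_derivative F (Suc m) t) (at t)" if "m < 2" for m t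
   using that F0[of t] F1[of t] by (cases "m = 0") (auto simp: numeral_2_eq_2 less_Suc_eq)
  then show "\<forall>m t. m < 2 \<and> 0 <= t \<and> t <= 1 --> (F m has_real_derivative F (Suc m) t) (at t)" by blast
 qed auto
 then obtain t where t: "0 < t" "t < 1" "F 0 1 = (\<Sum>m<2. F m 0 / fact m * 1 ^ m) + F 2 t / fact 2 * 1 ^ 2" by blast
 have F2_eq: "F 2 t = (\<Sum>i\<in>I. al i * (- ((norm d)^2 * Q i t - 2 * (w i t)^2) / (2 * pi * (Q i t)^2)))"
  by (simp add: F_def)
 have "F 2 t <= (\<Sum>i\<in>I. (norm d)^2 / (2 * pi) * (\<bar>al i\<bar> / Q i t))"
  unfolding F2_eq
 proof (intro sum_mono)
  fix i assume "i \<in> I"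
  have "w i t = (x + t *\<^sub>R d - c i) \<bullet> d" unfolding w_def by (simp add: inner_diff_left inner_add_left power2_norm_eq_inner)
  then have "\<bar>w i t\<bar> <= norm (x + t *\<^sub>R d - c i) * norm d" by (simp add: Cauchy_Schwarz_ineq2)
  then have "(w i t)^2 <= (norm (x + t *\<^sub>R d - c i) * norm d)^2" by (rule power2_le_iff_abs_le[THEN iffD2, rotated]) simp
  also have "... <= (norm d)^2 * Q i t" unfolding Q_def by (simp add: power_mult_distrib algebra_simps)
  finally have "\<bar>- ((norm d)^2 * Q i t - 2 * (w i t)^2)\<bar> <= (norm d)^2 * Q i t"
   using zero_le_power2[of "w i t"] unfolding abs_le_iff by linarith
  then have "\<bar>al i\<bar> * (\<bar>- ((norm d)^2 * Q i t - 2 * (w i t)^2)\<bar> / (2 * pi * (Q i t)^2)) <= \<bar>al i\<bar> * ((norm d)^2 * Q i t / (2 * pi * (Q i t)^2))"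
   by (intro mult_left_mono divide_right_mono) auto
  also have "... = (norm d)^2 / (2 * pi) * (\<bar>al i\<bar> / Q i t)" using Q0[of i t] by (simp add: power2_eq_square mult_ac)
  finally show "al i * (- ((norm d)^2 * Q i t - 2 * (w i t)^2) / (2 * pi * (Q i t)^2)) <= (norm d)^2 / (2 * pi) * (\<bar>al i\<bar> / Q i t)"
   using abs_ge_self[of "al i * (- ((norm d)^2 * Q i t - 2 * (w i t)^2) / (2 * pi * (Q i t)^2))"] by (simp add: abs_mult)
 qed
 also have "... = (norm d)^2 / (2 * pi) * (\<Sum>i\<in>I. \<bar>al i\<bar> / Q i t)" by (simp add: sum_distrib_left)
 also have "... <= (norm d)^2 / (2 * pi) * (2 * pi * k)"
  using H[of t] t unfolding Q_def by (intro mult_left_mono) auto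
 also have "... = k * (norm d)^2" by simp
 finally have F2: "F 2 t <= k * (norm d)^2" .
 have "F 0 1 = (\<Sum>i\<in>I. al i * log_pot e (x + d - c i))" unfolding F_def Q_def log_pot_def by simp
 moreover have "F 0 0 = (\<Sum>i\<in>I. al i * log_pot e (x - c i))" unfolding F_def Q_def log_pot_def by simp
 moreover have "F 1 0 = (\<Sum>i\<in>I. al i *\<^sub>R log_pot_grad e (x - c i)) \<bullet> d"
  unfolding F_def Q_def w_def log_pot_grad_def by (simp add: inner_sum_left)
 moreover have "F 0 1 = F 0 0 + F 1 0 + F 2 t / 2" using t(3) by (simp add: numeral_2_eq_2)
 ultimately show ?thesis using F2 by simp
qed

text \<open>Weak duality for a potential that is admissible only up to second order: completing the
  square turns the gradient term into the squared gradient plus the cost of the pair, and the second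
  order term enlarges the cost by the factor \<open>1 + k\<close>. All pairs are assumed because the
  optimal matching is not known.\<close>

lemma match_cost_lower:
 assumes "\<And>i j. i \<in> {1..n} ==> j \<in> {1..n} ==> f (y j) <= f (x i) + g (x i) \<bullet> (y j - x i) + k / 2 * (norm (y j - x i))^2"
 shows "2 * (\<Sum>i\<in>{1..n}. f (y i) - f (x i)) - (\<Sum>i\<in>{1..n}. (norm (g (x i)))^2) <= (1 + k) * match_cost n x y"
proof -
 obtain \<sigma> where \<sigma>: "\<sigma> permutes {1..n}" "match_cost n x y = (\<Sum>i\<in>{1..n}. (norm (x i - y (\<sigma> i)))^2)" using match_cost_attained .
 have "2 * (\<Sum>i\<in>{1..n}. f (y i) - f (x i)) - (\<Sum>i\<in>{1..n}. (norm (g (x i)))^2)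
  = (\<Sum>i\<in>{1..n}. 2 * (f (y (\<sigma> i)) - f (x i)) - (norm (g (x i)))^2)"
  using sum.permute[OF \<sigma>(1), of "%i. f (y i)"] by (simp add: sum_subtractf sum_distrib_left comp_def)
 also have "... <= (\<Sum>i\<in>{1..n}. (1 + k) * (norm (x i - y (\<sigma> i)))^2)"
 proof (rule sum_mono)
  fix i assume i: "i \<in> {1..n}"
  have "2 * (g (x i) \<bullet> (y (\<sigma> i) - x i)) <= (norm (g (x i)))^2 + (norm (y (\<sigma> i) - x i))^2"
  proof -
   have "0 <= (norm (g (x i) - (y (\<sigma> i) - x i)))^2" by simp
   also have "... = (norm (g (x i)))^2 + (norm (y (\<sigma> i) - x i))^2 - 2 * (g (x i) \<bullet> (y (\<sigma> i) - x i))"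
    unfolding power2_norm_eq_inner[of "g (x i) - (y (\<sigma> i) - x i)"] power2_norm_eq_inner[of "g (x i)"] power2_norm_eq_inner[of "y (\<sigma> i) - x i"]
    by (simp only: inner_diff_left[of "g (x i)"] inner_diff_right[of _ "g (x i)"] inner_commute[of "y (\<sigma> i) - x i" "g (x i)"])
   finally show ?thesis by simp
  qed
  moreover have "f (y (\<sigma> i)) <= f (x i) + g (x i) \<bullet> (y (\<sigma> i) - x i) + k / 2 * (norm (y (\<sigma> i) - x i))^2"
   using assms[OF i] permutes_in_image[OF \<sigma>(1)] i by blast
  ultimately show "2 * (f (y (\<sigma> i)) - f (x i)) - (norm (g (x i)))^2 <= (1 + k) * (norm (x i - y (\<sigma> i)))^2"
   unfolding norm_minus_commute[of "x i"] by (simp add: distrib_right)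
 qed
 also have "... = (1 + k) * match_cost n x y" unfolding \<sigma>(2) by (simp add: sum_distrib_left)
 finally show ?thesis .
qed

lemma match_cost_measurable[measurable]:
 assumes "\<And>i. i \<in> {1..n} ==> (%om. x om i) \<in> borel_measurable N" "\<And>i. i \<in> {1..n} ==> (%om. y om i) \<in> borel_measurable N"
 shows "(%om. match_cost n (x om) (y om)) \<in> borel_measurable N"
proof -
 have "(%om. Min ((%\<sigma>. \<Sum>i\<in>{1..n}. (norm (x om i - y om (\<sigma> i)))^2) ` {\<sigma>. \<sigma> permutes {1..n}})) \<in> borel_measurable N"
 proof (intro borel_measurable_Min borel_measurable_sum)
  show "finite {\<sigma>. \<sigma> permutes {1..n}}" by (rule finite_permutations) simp
 next
  fix \<sigma> i assume "\<sigma> \<in> {\<sigma>. \<sigma> permutes {1..n}}" and i: "i \<in> {1..n}"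
  then have p: "\<sigma> permutes {1..n}" by simp
  have "\<sigma> i \<in> {1..n}" using permutes_in_image[OF p, of i] i by (rule iffD2)
  note [measurable] = assms(2)[OF this] assms(1)[OF i]
  show "(%om. (norm (x om i - y om (\<sigma> i)))^2) \<in> borel_measurable N" by measurable
 qed
 then show ?thesis unfolding match_cost_def .
qed

context planar_cells
begin

text \<open>A sum over cells is compared with an integral: for \<open>w\<close> in a cell,
  \<open>max eps (norm (w - z))\<close> is at most a constant times the regularised distance from
  \<open>z\<close> to the centre. The point \<open>z\<close> ranges over a ball and not over the
  domain, since it will lie on a segment between two sample points.\<close>

lemma lattice_sum_bound:
 assumes R: "\<And>x. x \<in> Om ==> norm x <= R" "norm z <= R" and epsR: "eps <= 2 * R"
 shows "(\<Sum>i\<in>I. measure lborel (cell i) / ((norm (z - ctr i))^2 + eps^2)) <= 2 * C0^2 * (pi + 2 * pi * ln (2 * R / eps))"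
proof -
 have [measurable]: "cball z (2 * R) \<in> sets borel" by simp
 define q where "q i = (norm (z - ctr i))^2 + eps^2" for i
 have q0: "0 < q i" for i unfolding q_def using eps by (intro add_nonneg_pos) auto
 have "ennreal (\<Sum>i\<in>I. measure lborel (cell i) / ((norm (z - ctr i))^2 + eps^2)) = ennreal (norm (LINT w|lborel. indicator Om w * (1 / q (kap w))))"
  unfolding cell_area_sum[of "%i. 1 / q i", symmetric] q_def[symmetric] using q0 by (simp add: sum_nonneg less_imp_le)
 also have "... <= (\<integral>\<^sup>+w. ennreal (norm (indicator Om w * (1 / q (kap w)))) \<partial>lborel)" by (rule norm_integral_le_nn_integral)
 also have "... <= (\<integral>\<^sup>+w. ennreal (2 * C0^2) * (ennreal (1 / (max eps (norm (w - z)))^2) * indicator (cball z (2 * R)) w) \<partial>lborel)"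
 proof (rule nn_integral_mono)
  fix w
  show "ennreal (norm (indicator Om w * (1 / q (kap w)))) <= ennreal (2 * C0^2) * (ennreal (1 / (max eps (norm (w - z)))^2) * indicator (cball z (2 * R)) w)"
  proof (cases "w \<in> Om")
   case True
   define i where "i = kap w"
   have "ennreal (norm (indicator Om w * (1 / q (kap w)))) = ennreal (1 / q i)"
    using True q0[of i] unfolding i_def by simp
   also have "... <= ennreal (2 * C0^2 * (1 / (max eps (norm (w - z)))^2))"
    unfolding q_def
   proof (rule ennreal_leI)
    have C02: "1 <= C0^2" using C0 by simp
    have "norm (w - z) <= norm (z - ctr i) + C0 * eps"
     using cell_props(2)[OF True] norm_triangle_ineq[of "w - ctr i" "ctr i - z"] unfolding i_def
     by (simp add: dist_norm norm_minus_commute)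
    then have "(norm (w - z))^2 <= (norm (z - ctr i) + C0 * eps)^2" by (intro power_mono) auto
    also have "... <= 2 * (norm (z - ctr i))^2 + 2 * (C0 * eps)^2"
     using sum_squares_bound[of "norm (z - ctr i)" "C0 * eps"] by (simp add: power2_sum)
    also have "... <= 2 * (C0^2 * (norm (z - ctr i))^2) + 2 * (C0 * eps)^2"
     using mult_right_mono[OF C02, of "(norm (z - ctr i))^2"] by simp
    finally have 1: "(norm (w - z))^2 <= 2 * C0^2 * ((norm (z - ctr i))^2 + eps^2)" by (simp add: power_mult_distrib algebra_simps)
    have "1 * eps^2 <= (2 * C0^2) * ((norm (z - ctr i))^2 + eps^2)" using C02 by (intro mult_mono) auto
    then have 2: "(max eps (norm (w - z)))^2 <= 2 * C0^2 * ((norm (z - ctr i))^2 + eps^2)" using 1 by (simp add: max_def)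
    have "0 < (norm (z - ctr i))^2 + eps^2" using eps by (intro add_nonneg_pos) auto
    moreover have "0 < (max eps (norm (w - z)))^2" using eps by (intro zero_less_power) (simp add: less_max_iff_disj)
    moreover have "1 / q <= 2 * C0^2 * (1 / m)" if "m <= 2 * C0^2 * q" "0 < q" "0 < m" for q m
     using that by (simp add: field_simps)
    ultimately show "1 / ((norm (z - ctr i))^2 + eps^2) <= 2 * C0^2 * (1 / (max eps (norm (w - z)))^2)" using 2 by blast
   qed
   also have "... = ennreal (2 * C0^2) * ennreal (1 / (max eps (norm (w - z)))^2)" by (rule ennreal_mult') simp
   finally show ?thesis
    using R(1)[OF True] R(2) norm_triangle_ineq4[of z w] by (simp add: dist_norm)
  qed simp
 qed
 also have "... = ennreal (2 * C0^2) * (\<integral>\<^sup>+w\<in>cball z (2 * R). ennreal (1 / (max eps (norm (w - z)))^2) \<partial>lborel)"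
  by (rule nn_integral_cmult) measurable
 also have "... <= ennreal (2 * C0^2) * ennreal (pi + 2 * pi * ln (2 * R / eps))"
  by (intro mult_left_mono nn_integral_inverse_square_plane eps epsR) auto
 also have "... = ennreal (2 * C0^2 * (pi + 2 * pi * ln (2 * R / eps)))" by (rule ennreal_mult'[symmetric]) simp
 finally show ?thesis
  by (subst (asm) ennreal_le_iff) (use eps epsR in \<open>auto intro!: mult_nonneg_nonneg add_nonneg_nonneg ln_ge_zero\<close>)
qed

end

text \<open>The points \<open>X i\<close> (labels \<open>Inl\<close>) carry charge \<open>-1\<close>, the points \<open>Y i\<close> (labels \<open>Inr\<close>) charge \<open>1\<close>.\<close>

definition label_sign :: "nat + nat => real" where "label_sign = case_sum (%_. - 1) (%_. 1)"

lemma label_sign_simps[simp]: "label_sign (Inl i) = - 1" "label_sign (Inr i) = 1" "(label_sign k)^2 = 1" "\<bar>label_sign k\<bar> = 1"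
 unfolding label_sign_def by (auto split: sum.splits)

lemma sum_label_sign: "(\<Sum>k\<in>labels n. label_sign k) = 0"
 unfolding sum_labels by simp

lemma card_labels: "card (labels n) = 2 * n"
 unfolding labels_def by (simp add: card_Plus)

text \<open>The logarithm is bounded crudely by an inverse first power, which is integrable in the
  plane uniformly in \<open>e\<close>.\<close>

lemma log_pot_le: 
 assumes "0 < e"
 shows "log_pot e u <= 1 / (2 * pi * max e (norm u))"
proof -
 define m where "m = max e (norm u)"
 have m: "0 < m" unfolding m_def using assms by (simp add: less_max_iff_disj)
 have "m^2 <= (norm u)^2 + e^2" unfolding m_def max_def by auto
 then have "ln (m^2) <= ln ((norm u)^2 + e^2)" using m by (subst ln_le_cancel_iff) (auto intro: order_less_le_trans[rotated])
 moreover have "ln (m^2) = - 2 * ln (1 / m)" using m by (simp add: ln_div ln_realpow)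
 moreover have "ln (1 / m) <= 1 / m" using ln_le_minus_one[of "1 / m"] m by simp
 ultimately have "- ln ((norm u)^2 + e^2) <= 2 * (1 / m)" by linarith
 then have "- ln ((norm u)^2 + e^2) / (4 * pi) <= 2 * (1 / m) / (4 * pi)" by (rule divide_right_mono) simp
 then show ?thesis unfolding log_pot_def m_def by simp
qed

lemma abs_log_pot_le:
 assumes "0 < e" "e <= 1" "norm u <= S"
 shows "\<bar>log_pot e u\<bar> <= (2 * ln (1 / e) + ln (S^2 + 1)) / (4 * pi)"
proof -
 have S0: "0 <= S" using assms(3) norm_ge_zero order_trans by blast
 have 1: "e^2 <= (norm u)^2 + e^2" by simp
 have "e^2 <= 1" using assms by (simp add: power_le_one)
 moreover have "(norm u)^2 <= S^2" using assms by (intro power_mono) auto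
 ultimately have 2: "(norm u)^2 + e^2 <= S^2 + 1" by linarith
 have q: "0 < (norm u)^2 + e^2" using assms by (intro add_nonneg_pos) auto
 have "ln (e^2) <= ln ((norm u)^2 + e^2)" using 1 q assms by (subst ln_le_cancel_iff) auto
 moreover have "ln (e^2) = - 2 * ln (1 / e)" using assms by (simp add: ln_div ln_realpow)
 moreover have "ln ((norm u)^2 + e^2) <= ln (S^2 + 1)" using 2 q by (subst ln_le_cancel_iff) (auto intro: add_nonneg_pos)
 moreover have "0 <= ln (1 / e)" "0 <= ln (S^2 + 1)" using assms by (auto intro!: ln_ge_zero)
 ultimately have "\<bar>- ln ((norm u)^2 + e^2)\<bar> <= 2 * ln (1 / e) + ln (S^2 + 1)" by linarith
 then have "\<bar>- ln ((norm u)^2 + e^2)\<bar> / (4 * pi) <= (2 * ln (1 / e) + ln (S^2 + 1)) / (4 * pi)" by (rule divide_right_mono) simp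
 then show ?thesis unfolding log_pot_def by (simp add: abs_divide)
qed

section \<open>The potential of the charges of the cells\<close>

context planar_cells
begin

text \<open>The reciprocal of the mean density on a cell. With this weight the potential of the charges solves
 the linearised Monge-Ampere equation up to lower order terms.\<close>

definition wt :: "int \<times> int => real" where "wt i = measure lborel (cell i) / mass i"

lemma area_le_mass:
 assumes "\<And>x. x \<in> cell i ==> k <= l * r x"
 shows "k * measure lborel (cell i) <= l * mass i"
proof -
 have "(LINT x|lborel. k * indicator (cell i) x) <= (LINT x|lborel. l * (indicator (cell i) x * r x))"
 proof (rule integral_mono)
  show "integrable lborel (%x. k * indicat_real (cell i) x)"
   using cell_finite[of i] by (intro integrable_mult_right integrable_real_indicator) auto
  show "integrable lborel (%x. l * (indicat_real (cell i) x * r x))"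
   using ri integrable_mult_indicator[of "cell i" lborel r] by (intro integrable_mult_right) simp
  show "k * indicat_real (cell i) x <= l * (indicat_real (cell i) x * r x)" for x
   using assms[of x] by (auto simp: indicator_def)
 qed
 then show ?thesis unfolding mass_def by simp
qed

lemma mass_ge_area: "a * measure lborel (cell i) <= mass i"
 using area_le_mass[of i a 1] ra cell_subset(1)[of i] by (auto simp: subset_iff)

lemma wt_nonneg: "0 <= wt i" unfolding wt_def using mass_nonneg by simp

lemma wt_le: "wt i <= 1 / a"
proof (cases "mass i = 0")
 case False
 then have "0 < mass i" using mass_nonneg[of i] by simp
 then show ?thesis unfolding wt_def using mass_ge_area[of i] a by (simp add: field_simps)
qed (use a in \<open>simp add: wt_def\<close>)

lemma wt_integral: "(LINT z|D. wt (kap z)) = measure lborel Om"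
proof -
 have "mass i * wt i = measure lborel (cell i)" if "i \<in> I" for i
  unfolding wt_def using mass_pos[OF that] by simp
 then show ?thesis unfolding cell_integral sum_area[symmetric] by (rule sum.cong[OF refl])
qed

text \<open>The charge at \<open>z\<close> is moved to the centre of its cell, so the potential of a sample only depends on the
 numbers of points in the cells.\<close>

definition pot :: "real^2 => real^2 => real" where
 "pot x z = indicator Om x * indicator Om z * (wt (kap z) * log_pot eps (x - ctr (kap z)))"

definition pot_grad :: "real^2 => real^2 => real^2" where
 "pot_grad x z = (indicator Om x * indicator Om z * wt (kap z)) *\<^sub>R log_pot_grad eps (x - ctr (kap z))"

lemma kap_compose[measurable]: "(%z. h (kap z)) \<in> borel_measurable borel"
 by measurable

lemma sample_measurable: "k \<in> labels n ==> (%om. om k) \<in> borel_measurable (PiM (labels n) (%_. D))"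
 using measurable_component_singleton[of k "labels n" "%_. D"] by (simp cong: measurable_cong_sets)

lemma pot_compose[measurable]:
 assumes [measurable]: "f \<in> borel_measurable N" "g \<in> borel_measurable N"
 shows "(%w. pot (f w) (g w)) \<in> borel_measurable N" "(%w. pot_grad (f w) (g w)) \<in> borel_measurable N"
 unfolding pot_def pot_grad_def by measurable

lemma pot_measurable: "case_prod pot \<in> borel_measurable (borel \<Otimes>\<^sub>M borel)"
 unfolding pot_def[abs_def] case_prod_beta' by measurable

lemma pot_grad_measurable: "case_prod pot_grad \<in> borel_measurable (borel \<Otimes>\<^sub>M borel)"
 unfolding pot_grad_def[abs_def] case_prod_beta' by measurable

lemma abs_pot_le:
 assumes "eps <= 1" and R: "\<And>x. x \<in> Om ==> norm x <= R"
 shows "\<bar>pot x z\<bar> <= 1 / a * ((2 * ln (1 / eps) + ln ((2 * R)^2 + 1)) / (4 * pi))"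
proof -
 have l0: "0 <= (2 * ln (1 / eps) + ln ((2 * R)^2 + 1)) / (4 * pi)"
  using assms eps by (auto intro!: divide_nonneg_nonneg add_nonneg_nonneg ln_ge_zero)
 show ?thesis
 proof (cases "x \<in> Om \<and> z \<in> Om")
  case True
  then have "ctr (kap z) \<in> Om" by (intro ctr_in kap_in) auto
  then have "norm (x - ctr (kap z)) <= 2 * R" using R[of x] R[of "ctr (kap z)"] True norm_triangle_ineq4[of x "ctr (kap z)"] by auto
  then have "\<bar>wt (kap z) * log_pot eps (x - ctr (kap z))\<bar> <= 1 / a * ((2 * ln (1 / eps) + ln ((2 * R)^2 + 1)) / (4 * pi))"
   unfolding abs_mult using wt_nonneg wt_le a assms eps by (intro mult_mono abs_log_pot_le) auto
  then show ?thesis unfolding pot_def using True by simp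
 next
  case False
  then have "pot x z = 0" unfolding pot_def by auto
  moreover have "0 <= 1 / a * ((2 * ln (1 / eps) + ln ((2 * R)^2 + 1)) / (4 * pi))"
   using l0 a by (intro mult_nonneg_nonneg) auto
  ultimately show ?thesis by (simp only: abs_zero)
 qed
qed

text \<open>A point is within \<open>C0 * eps\<close> of the centre that carries its charge, so its
  interaction with itself is \<open>wt\<close> times \<open>ln (1 / eps) / (2 * pi)\<close> up to a
  constant, and the mean of \<open>wt\<close> is the area of the domain.\<close>

lemma pot_diagonal:
 assumes R: "eps <= 1" "\<And>x. x \<in> Om ==> norm x <= R"
 shows "measure lborel Om * ((2 * ln (1 / eps) - ln (C0^2 + 1)) / (4 * pi)) <= (LINT x|D. pot x x)"
proof -
 interpret D: prob_space D by (rule prob_D)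
 define g where "g = (2 * ln (1 / eps) - ln (C0^2 + 1)) / (4 * pi)"
 have m[measurable]: "(%x. pot x x) \<in> borel_measurable borel" unfolding pot_def by measurable
 have "measure lborel Om * g = (LINT x|D. wt (kap x) * g)" by (simp add: wt_integral)
 also have "... <= (LINT x|D. pot x x)"
 proof (rule integral_mono_AE)
  show "integrable D (%x. wt (kap x) * g)"
   using wt_nonneg wt_le by (intro integrable_mult_left D.integrable_const_bound[where B = "1 / a"]) auto
  show "integrable D (%x. pot x x)"
   using abs_pot_le[OF R] by (intro D.integrable_const_bound[OF AE_I2]) auto
  show "AE x in D. wt (kap x) * g <= pot x x"
   using AE_D
  proof eventually_elim
   case (elim x)
   have "norm (x - ctr (kap x)) <= C0 * eps" using cell_props(2)[OF elim] by (simp add: dist_norm)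
   then have "(norm (x - ctr (kap x)))^2 <= (C0 * eps)^2" by (intro power_mono) auto
   then have "(norm (x - ctr (kap x)))^2 + eps^2 <= (C0^2 + 1) * eps^2" by (simp add: power_mult_distrib distrib_right)
   moreover have "0 < (norm (x - ctr (kap x)))^2 + eps^2" using eps by (intro add_nonneg_pos) auto
   ultimately have "ln ((norm (x - ctr (kap x)))^2 + eps^2) <= ln ((C0^2 + 1) * eps^2)"
    by (subst ln_le_cancel_iff) auto
   also have "... = ln (C0^2 + 1) - 2 * ln (1 / eps)"
   proof -
    have "0 < C0^2 + 1" by (intro add_nonneg_pos) auto
    then show ?thesis using eps by (subst ln_mult) (auto simp: ln_realpow ln_div)
   qed
   finally have "g <= log_pot eps (x - ctr (kap x))" unfolding g_def log_pot_def by (intro divide_right_mono) auto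
   then show ?case unfolding pot_def using elim wt_nonneg by (simp add: mult_left_mono)
  qed
 qed
 finally show ?thesis unfolding g_def .
qed

text \<open>The interaction of independent points is subtracted in \<open>expected_pair_pot\<close>,
  so what matters is an upper bound free of \<open>eps\<close>.\<close>

lemma pot_off_diagonal:
 assumes R: "eps <= 1" "\<And>x. x \<in> Om ==> norm x <= R"
 shows "(LINT z|D. LINT y|D. pot y z) <= 2 * b * R / a"
proof -
 interpret D: prob_space D by (rule prob_D)
 have R0: "0 <= R" using R(2) Om_ne norm_ge_zero order_trans by blast
 define h where "h z = (LINT y|D. pot y z)" for z
 have pm[measurable]: "(%y. pot y z) \<in> borel_measurable borel" for z unfolding pot_def by measurable
 have hle: "h z <= 2 * b * R / a" for z
 proof (cases "z \<in> Om")
  case True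
  define c where "c = ctr (kap z)"
  have c: "c \<in> Om" unfolding c_def using True by (intro ctr_in kap_in)
  have [measurable]: "cball c (2 * R) \<in> sets borel" by simp
  define k where "k y = indicator Om y * (1 / a * (1 / (2 * pi * max eps (norm (y - c)))))" for y
  have km[measurable]: "k \<in> borel_measurable borel" unfolding k_def[abs_def] by measurable
  have mx: "0 < max eps (norm (y - c))" for y using eps by (simp add: less_max_iff_disj)
  have k0: "0 <= k y" for y unfolding k_def using a mx[of y] by auto
  have kB: "k y <= 1 / a * (1 / (2 * pi * eps))" for y
  proof -
   have "1 / (2 * pi * max eps (norm (y - c))) <= 1 / (2 * pi * eps)" using eps by (intro divide_left_mono) auto
   then have "1 / a * (1 / (2 * pi * max eps (norm (y - c)))) <= 1 / a * (1 / (2 * pi * eps))" using a by (intro mult_left_mono) auto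
   then show ?thesis unfolding k_def using a eps by (auto simp: indicator_def)
  qed
  have ki: "integrable D k" using k0 kB by (intro D.integrable_const_bound[OF AE_I2]) auto
  have hk: "h z <= (LINT y|D. k y)"
   unfolding h_def
  proof (rule integral_mono[OF _ ki])
   show "integrable D (%y. pot y z)" using abs_pot_le[OF R] by (intro D.integrable_const_bound[OF AE_I2]) auto
   fix y
   have "wt (kap z) * log_pot eps (y - c) <= wt (kap z) * (1 / (2 * pi * max eps (norm (y - c))))"
    by (intro mult_left_mono log_pot_le eps wt_nonneg)
   also have "... <= 1 / a * (1 / (2 * pi * max eps (norm (y - c))))"
    using wt_le mx[of y] by (intro mult_right_mono) auto
   finally show "pot y z <= k y" unfolding pot_def k_def c_def[symmetric] using True by (auto simp: indicator_def)
  qed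
  have "ennreal (LINT y|D. k y) = (\<integral>\<^sup>+y. ennreal (k y) \<partial>D)"
   using ki k0 by (intro nn_integral_eq_integral[symmetric]) auto
  also have "... = (\<integral>\<^sup>+y. ennreal (r y) * ennreal (k y) \<partial>lborel)" by (rule nn_integral_D) measurable
  also have "... <= (\<integral>\<^sup>+y. ennreal (b / (2 * pi * a)) * (ennreal (1 / norm (y - c)) * indicator (cball c (2 * R)) y) \<partial>lborel)"
  proof (rule nn_integral_mono_AE)
   have "AE y in lborel. y \<noteq> c" by (rule AE_lborel_singleton)
   then show "AE y in lborel. ennreal (r y) * ennreal (k y) <= ennreal (b / (2 * pi * a)) * (ennreal (1 / norm (y - c)) * indicator (cball c (2 * R)) y)"
   proof eventually_elim
    case (elim y)
    show ?case
    proof (cases "y \<in> Om")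
     case True
     have "y \<in> cball c (2 * R)" using R(2)[OF True] R(2)[OF c] norm_triangle_ineq4[of c y] by (simp add: dist_norm)
     moreover have "ennreal (r y) * ennreal (k y) <= ennreal (b / (2 * pi * a)) * ennreal (1 / norm (y - c))"
     proof -
      have "r y * k y <= b * (1 / a * (1 / (2 * pi * norm (y - c))))"
      proof (intro mult_mono rb)
       have "1 / (2 * pi * max eps (norm (y - c))) <= 1 / (2 * pi * norm (y - c))" using elim mx[of y] by (intro divide_left_mono mult_pos_pos) auto
       then have "1 / a * (1 / (2 * pi * max eps (norm (y - c)))) <= 1 / a * (1 / (2 * pi * norm (y - c)))"
        using a by (intro mult_left_mono) auto
       moreover have "indicat_real Om y = 1" using True by simp
       ultimately show "k y <= 1 / a * (1 / (2 * pi * norm (y - c)))" unfolding k_def by (simp only: mult_1_left)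
      qed (use b0 k0 in auto)
      also have "... = b / (2 * pi * a) * (1 / norm (y - c))" by simp
      finally have "ennreal (r y * k y) <= ennreal (b / (2 * pi * a) * (1 / norm (y - c)))" by (rule ennreal_leI)
      then show ?thesis using r0[of y] k0[of y] a b0 by (simp only: ennreal_mult' divide_nonneg_pos mult_pos_pos less_imp_le pi_gt_zero zero_less_numeral)
     qed
     ultimately show ?thesis by simp
    qed (simp add: r_out)
   qed
  qed
  also have "... = ennreal (b / (2 * pi * a)) * (\<integral>\<^sup>+y\<in>cball c (2 * R). ennreal (1 / norm (y - c)) \<partial>lborel)"
   by (rule nn_integral_cmult) measurable
  also have "... <= ennreal (b / (2 * pi * a)) * ennreal (2 * pi * (2 * R))"
   using R0 by (intro mult_left_mono nn_integral_inverse_norm_plane) auto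
  also have "... = ennreal (b / (2 * pi * a) * (2 * pi * (2 * R)))" using a b0 by (intro ennreal_mult'[symmetric]) simp
  also have "b / (2 * pi * a) * (2 * pi * (2 * R)) = 2 * b * R / a" by simp
  finally have "(LINT y|D. k y) <= 2 * b * R / a"
   by (subst (asm) ennreal_le_iff) (use a b0 R0 in auto)
  then show ?thesis using hk by simp
 next
  case False
  then have "h z = 0" unfolding h_def pot_def by simp
  then show ?thesis using a b0 R0 by simp
 qed
 have "(LINT z|D. h z) <= (LINT z|D. 2 * b * R / a)"
 proof (rule integral_mono)
  have "(%(z, y). pot y z) \<in> borel_measurable (D \<Otimes>\<^sub>M D)"
   using measurable_compose[OF measurable_pair_swap' pot_measurable] 
   by (simp add: case_prod_beta' cong: measurable_cong_sets)
  then have "h \<in> borel_measurable D" unfolding h_def[abs_def] by (rule D.borel_measurable_lebesgue_integral)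
  moreover have "norm (h z) <= 1 / a * ((2 * ln (1 / eps) + ln ((2 * R)^2 + 1)) / (4 * pi))" for z
  proof -
   have "norm (h z) <= (LINT y|D. norm (pot y z))" unfolding h_def by (rule integral_norm_bound)
   also have "... <= 1 / a * ((2 * ln (1 / eps) + ln ((2 * R)^2 + 1)) / (4 * pi))"
    using abs_pot_le[OF R] by (intro D.integral_le_const integrable_norm D.integrable_const_bound[OF AE_I2]) auto
   finally show ?thesis .
  qed
  ultimately show "integrable D h" by (intro D.integrable_const_bound[OF AE_I2]) auto
 qed (use hle in auto)
 then show ?thesis unfolding h_def using D.prob_space by simp
qed

lemma expected_pair_pot:
 assumes R: "eps <= 1" "\<And>x. x \<in> Om ==> norm x <= R"
 shows "2 * real n * (measure lborel Om * ((2 * ln (1 / eps) - ln (C0^2 + 1)) / (4 * pi)) - 2 * b * R / a)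
  <= (LINT om|PiM (labels n) (%_. D). (\<Sum>k\<in>labels n. \<Sum>l\<in>labels n. label_sign k * label_sign l * pot (om k) (om l)))"
proof -
 have m: "case_prod pot \<in> borel_measurable (D \<Otimes>\<^sub>M D)" using pot_measurable by (simp cong: measurable_cong_sets)
 have "(LINT om|PiM (labels n) (%_. D). (\<Sum>k\<in>labels n. \<Sum>l\<in>labels n. label_sign k * label_sign l * pot (om k) (om l)))
  = 2 * real n * (LINT x|D. pot x x) - 2 * real n * (LINT z|D. LINT y|D. pot y z)"
  using signed_pair_sum_integral[OF prob_D finite_labels m abs_pot_le[OF R], of n label_sign]
  by (simp add: sum_label_sign card_labels)
 moreover have "2 * real n * (measure lborel Om * ((2 * ln (1 / eps) - ln (C0^2 + 1)) / (4 * pi))) <= 2 * real n * (LINT x|D. pot x x)"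
  using pot_diagonal[OF R] by (intro mult_left_mono) auto
 moreover have "2 * real n * (LINT z|D. LINT y|D. pot y z) <= 2 * real n * (2 * b * R / a)"
  using pot_off_diagonal[OF R] by (intro mult_left_mono) auto
 ultimately show ?thesis by (simp only: right_diff_distrib)
qed

end

lemma norm_log_pot_grad_le:
 assumes "0 < e"
 shows "norm (log_pot_grad e u) <= 1 / (2 * pi * max e (norm u))"
proof -
 define m where "m = max e (norm u)"
 have m: "0 < m" "norm u <= m" unfolding m_def using assms by (auto simp: less_max_iff_disj)
 have q: "m * m <= (norm u)^2 + e^2" unfolding m_def max_def by (auto simp: power2_eq_square)
 have "norm u * m <= m * m" using m by (intro mult_right_mono) auto
 then have "norm u * m <= (norm u)^2 + e^2" using q by linarith
 moreover have q0: "0 < (norm u)^2 + e^2" using assms by (intro add_nonneg_pos) auto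
 ultimately have "norm u / ((norm u)^2 + e^2) <= 1 / m" using m by (simp add: divide_le_eq pos_le_divide_eq mult.commute)
 then have "norm u / ((norm u)^2 + e^2) / (2 * pi) <= 1 / m / (2 * pi)" by (rule divide_right_mono) simp
 moreover have "norm (log_pot_grad e u) = norm u / ((norm u)^2 + e^2) / (2 * pi)"
  unfolding log_pot_grad_def using q0 by (simp add: abs_mult)
 ultimately show ?thesis unfolding m_def by (simp add: mult.commute)
qed

context planar_cells
begin

lemma norm_pot_grad_le: "norm (pot_grad x z) <= 1 / a * (1 / (2 * pi * eps))"
proof -
 have "norm (log_pot_grad eps (x - ctr (kap z))) <= 1 / (2 * pi * max eps (norm (x - ctr (kap z))))"
  by (rule norm_log_pot_grad_le[OF eps])
 also have "... <= 1 / (2 * pi * eps)" using eps by (intro divide_left_mono) auto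
 finally have 1: "norm (log_pot_grad eps (x - ctr (kap z))) <= 1 / (2 * pi * eps)" .
 have "\<bar>indicator Om x * indicator Om z * wt (kap z)\<bar> <= 1 / a"
  using wt_nonneg[of "kap z"] wt_le[of "kap z"] a by (auto simp: indicator_def)
 then show ?thesis unfolding pot_grad_def norm_scaleR using 1 a by (intro mult_mono) auto
qed

text \<open>Energy of the gradient per unit area: the logarithm comes from distances up to
  \<open>\<rho>\<close>, where \<open>1 + \<tau> / a\<close> accounts for the oscillation of the
  density, and the last summand from larger distances.\<close>

definition grad_const :: "real => real => real" where
 "grad_const \<tau> \<rho> = ((1 + \<tau> / a) * (pi + 2 * pi * ln (\<rho> / eps)) + 1 / (a * \<rho>^2)) / (4 * pi^2)"

lemma grad_const_nonneg: "0 < \<tau> ==> eps <= \<rho> ==> 0 <= grad_const \<tau> \<rho>"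
 unfolding grad_const_def using a eps
 by (intro divide_nonneg_nonneg add_nonneg_nonneg mult_nonneg_nonneg ln_ge_zero) auto

text \<open>Close to the centre of the cell \<open>r x * wt (kap z)\<close> is at most
  \<open>1 + \<tau> / a\<close>: one of the two factors \<open>wt\<close> cancels the density, and
  the mean of the other one is the area. Far away the kernel is bounded and the total mass 1
  suffices.\<close>

lemma pot_grad_energy:
 assumes \<tau>: "0 < \<tau>" "\<And>x y. x \<in> Om ==> y \<in> Om ==> dist x y < d ==> \<bar>r x - r y\<bar> < \<tau>"
  and \<rho>: "eps <= \<rho>" "\<rho> + C0 * eps < d"
 shows "(\<integral>\<^sup>+x. \<integral>\<^sup>+z. ennreal ((norm (pot_grad x z))^2) \<partial>D \<partial>D) <= ennreal (measure lborel Om * grad_const \<tau> \<rho>)"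
proof -
 interpret D: prob_space D by (rule prob_D)
 interpret DD: pair_sigma_finite D D by unfold_locales
 have [measurable]: "case_prod pot_grad \<in> borel_measurable (D \<Otimes>\<^sub>M D)" using pot_grad_measurable by (simp cong: measurable_cong_sets)
 have \<rho>0: "0 < \<rho>" using \<rho> eps by simp
 have inner: "(\<integral>\<^sup>+x. ennreal ((norm (pot_grad x z))^2) \<partial>D) <= ennreal (wt (kap z) * grad_const \<tau> \<rho>)" for z
 proof (cases "z \<in> Om")
  case False
  then have "pot_grad x z = 0" for x unfolding pot_grad_def by simp
  then show ?thesis by (simp only: norm_zero) simp
 next
  case True
  define i where "i = kap z"
  define c where "c = ctr i"
  define w where "w = wt i"
  have i: "i \<in> I" unfolding i_def using True by (rule kap_in)
  have w: "0 <= w" "w <= 1 / a" unfolding w_def by (rule wt_nonneg, rule wt_le)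
  define k1 where "k1 = (1 + \<tau> / a) * w / (4 * pi^2)"
  define k2 where "k2 = w / (a * (4 * pi^2) * \<rho>^2)"
  have k: "0 <= k1" "0 <= k2" unfolding k1_def k2_def using w a \<tau> by auto
  have [measurable]: "cball c \<rho> \<in> sets borel" by simp
  have "(\<integral>\<^sup>+x. ennreal ((norm (pot_grad x z))^2) \<partial>D) = (\<integral>\<^sup>+x. ennreal (r x) * ennreal ((norm (pot_grad x z))^2) \<partial>lborel)"
   by (rule nn_integral_D) measurable
  also have "... <= (\<integral>\<^sup>+x. ennreal k1 * (ennreal (1 / (max eps (norm (x - c)))^2) * indicator (cball c \<rho>) x) + ennreal k2 * ennreal (r x) \<partial>lborel)"
  proof (rule nn_integral_mono)
   fix x
   define m where "m = max eps (norm (x - c))"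
   have m: "0 < m" unfolding m_def using eps by (simp add: less_max_iff_disj)
   have pg: "(norm (pot_grad x z))^2 <= w^2 * (1 / (4 * pi^2 * m^2))"
   proof -
    have "norm (pot_grad x z) <= w * (1 / (2 * pi * m))"
     unfolding pot_grad_def norm_scaleR
    proof (rule mult_mono)
     show "\<bar>indicator Om x * indicator Om z * wt (kap z)\<bar> <= w" using w(1) unfolding w_def i_def by (auto simp: indicator_def)
     show "norm (log_pot_grad eps (x - ctr (kap z))) <= 1 / (2 * pi * m)"
      using norm_log_pot_grad_le[OF eps] unfolding m_def c_def i_def .
    qed (use w in auto)
    then have "(norm (pot_grad x z))^2 <= (w * (1 / (2 * pi * m)))^2" by (intro power_mono) auto
    then show ?thesis by (simp add: power_mult_distrib power_divide)
   qed
   show "ennreal (r x) * ennreal ((norm (pot_grad x z))^2)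
    <= ennreal k1 * (ennreal (1 / (max eps (norm (x - c)))^2) * indicator (cball c \<rho>) x) + ennreal k2 * ennreal (r x)"
   proof (cases "x \<in> Om \<and> norm (x - c) <= \<rho>")
    case near: True
    have "r x * measure lborel (cell i) <= (1 + \<tau> / a) * mass i"
    proof (rule area_le_mass)
     fix y assume y: "y \<in> cell i"
     then have yy: "y \<in> Om" "dist c y <= C0 * eps" using cell_subset[of i] unfolding c_def by (auto simp: subset_iff)
     have "dist x y <= dist x c + dist c y" by (rule dist_triangle)
     then have "dist x y < d" using near yy \<rho> by (simp add: dist_norm)
     then have "r x <= r y + \<tau>" using \<tau>(2)[of x y] near yy by force
     moreover have "\<tau> * a <= \<tau> * r y" using ra[OF yy(1)] \<tau> by (intro mult_left_mono) auto
     then have "\<tau> <= \<tau> / a * r y" using a by (simp add: le_divide_eq)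
     ultimately show "r x <= (1 + \<tau> / a) * r y" by (simp add: distrib_right)
    qed
    then have rw: "r x * w <= 1 + \<tau> / a" unfolding w_def wt_def using mass_pos[OF i] by (simp add: divide_le_eq)
    have "r x * (norm (pot_grad x z))^2 <= r x * (w^2 * (1 / (4 * pi^2 * m^2)))" using pg r0[of x] by (rule mult_left_mono)
    also have "... = (r x * w) * (w * (1 / (4 * pi^2 * m^2)))" by (simp add: power2_eq_square)
    also have "... <= (1 + \<tau> / a) * (w * (1 / (4 * pi^2 * m^2)))" using rw w by (intro mult_right_mono) auto
    also have "... = k1 * (1 / m^2)" unfolding k1_def by simp
    finally have "ennreal (r x * (norm (pot_grad x z))^2) <= ennreal (k1 * (1 / m^2))" by (rule ennreal_leI)
    then have "ennreal (r x) * ennreal ((norm (pot_grad x z))^2) <= ennreal k1 * ennreal (1 / m^2)"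
     using r0[of x] k by (simp only: ennreal_mult')
    moreover have "x \<in> cball c \<rho>" using near by (simp add: dist_norm norm_minus_commute)
    ultimately show ?thesis unfolding m_def by (simp add: add_increasing2)
   next
    case far: False
    have "r x * (norm (pot_grad x z))^2 <= k2 * r x"
    proof (cases "x \<in> Om")
     case x: True
     then have "\<rho> <= m" using far unfolding m_def by auto
     then have "\<rho>^2 <= m^2" using \<rho>0 by (intro power_mono) auto
     then have "1 / (4 * pi^2 * m^2) <= 1 / (4 * pi^2 * \<rho>^2)" using \<rho>0 m by (intro divide_left_mono mult_pos_pos) auto
     moreover have "w^2 <= w * (1 / a)" unfolding power2_eq_square using w by (intro mult_left_mono) auto
     ultimately have "w^2 * (1 / (4 * pi^2 * m^2)) <= w * (1 / a) * (1 / (4 * pi^2 * \<rho>^2))" using w a by (intro mult_mono) auto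
     also have "... = k2" unfolding k2_def by simp
     finally have "(norm (pot_grad x z))^2 <= k2" using pg by simp
     then have "r x * (norm (pot_grad x z))^2 <= r x * k2" using r0[of x] by (rule mult_left_mono)
     then show ?thesis by (simp add: mult.commute)
    qed (simp add: r_out)
    then have "ennreal (r x * (norm (pot_grad x z))^2) <= ennreal (k2 * r x)" by (rule ennreal_leI)
    then have "ennreal (r x) * ennreal ((norm (pot_grad x z))^2) <= ennreal k2 * ennreal (r x)"
     using r0[of x] k by (simp only: ennreal_mult')
    then show ?thesis by (rule order_trans) simp
   qed
  qed
  also have "... = ennreal k1 * (\<integral>\<^sup>+x\<in>cball c \<rho>. ennreal (1 / (max eps (norm (x - c)))^2) \<partial>lborel) + ennreal k2 * (\<integral>\<^sup>+x. ennreal (r x) \<partial>lborel)"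
   by (subst nn_integral_add) (auto simp: nn_integral_cmult)
  also have "(\<integral>\<^sup>+x. ennreal (r x) \<partial>lborel) = ennreal 1" unfolding r1[symmetric] using ri r0 by (intro nn_integral_eq_integral) auto
  also have "ennreal k1 * (\<integral>\<^sup>+x\<in>cball c \<rho>. ennreal (1 / (max eps (norm (x - c)))^2) \<partial>lborel) + ennreal k2 * ennreal 1
   <= ennreal k1 * ennreal (pi + 2 * pi * ln (\<rho> / eps)) + ennreal k2 * ennreal 1"
   using \<rho> by (intro add_mono mult_left_mono nn_integral_inverse_square_plane eps order_refl) auto
  also have "... = ennreal (k1 * (pi + 2 * pi * ln (\<rho> / eps)) + k2 * 1)"
  proof -
   have "0 <= pi + 2 * pi * ln (\<rho> / eps)" using \<rho> eps by (intro add_nonneg_nonneg mult_nonneg_nonneg ln_ge_zero) auto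
   then show ?thesis using k by (simp only: ennreal_mult ennreal_plus mult_nonneg_nonneg zero_le_one)
  qed
  also have "k1 * (pi + 2 * pi * ln (\<rho> / eps)) + k2 * 1 = w * grad_const \<tau> \<rho>"
  proof -
   have "t * w / f * L + w / (a * f * s) * 1 = w * ((t * L + 1 / (a * s)) / f)" for t f L s
    by (simp add: add_divide_distrib distrib_left mult_ac)
   then show ?thesis unfolding k1_def k2_def grad_const_def by blast
  qed
  finally show ?thesis unfolding w_def i_def .
 qed
 have "(\<integral>\<^sup>+x. \<integral>\<^sup>+z. ennreal ((norm (pot_grad x z))^2) \<partial>D \<partial>D) = (\<integral>\<^sup>+z. \<integral>\<^sup>+x. ennreal ((norm (pot_grad x z))^2) \<partial>D \<partial>D)"
  by (rule DD.Fubini'[symmetric]) measurable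
 also have "... <= (\<integral>\<^sup>+z. ennreal (wt (kap z) * grad_const \<tau> \<rho>) \<partial>D)" by (rule nn_integral_mono[OF inner])
 also have "... = ennreal (LINT z|D. wt (kap z) * grad_const \<tau> \<rho>)"
 proof (rule nn_integral_eq_integral)
  show "integrable D (%z. wt (kap z) * grad_const \<tau> \<rho>)"
   using wt_nonneg wt_le by (intro integrable_mult_left D.integrable_const_bound[where B = "1 / a"]) auto
 qed (use wt_nonneg grad_const_nonneg[OF \<tau>(1) \<rho>(1)] in auto)
 also have "(LINT z|D. wt (kap z) * grad_const \<tau> \<rho>) = measure lborel Om * grad_const \<tau> \<rho>" by (simp add: wt_integral)
 finally show ?thesis .
qed

text \<open>The point at which the gradient is taken is itself one of the charges. Its own term is
  at most of order \<open>1 / eps\<close> and is split off; the other charges are independent of it.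
  After division by \<open>n\<close> the split term is of order
  \<open>1 / (n * eps^2)\<close>.\<close>

lemma expected_grad_square:
 assumes \<tau>: "0 < \<tau>" "\<And>x y. x \<in> Om ==> y \<in> Om ==> dist x y < d ==> \<bar>r x - r y\<bar> < \<tau>"
  and \<rho>: "eps <= \<rho>" "\<rho> + C0 * eps < d" and i: "i \<in> {1..n}" and et: "0 < et"
 shows "(LINT om|PiM (labels n) (%_. D). (norm (\<Sum>k\<in>labels n. label_sign k *\<^sub>R pot_grad (om (Inl i)) (om k)))^2)
  <= (1 + et) * (2 * real n * (measure lborel Om * grad_const \<tau> \<rho>)) + (1 + 1 / et) * (1 / a * (1 / (2 * pi * eps)))^2"
proof -
 let ?P = "PiM (labels n) (%_. D)"
 interpret P: prob_space ?P by (rule prob_space_PiM_const[OF prob_D])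
 define g where "g = 1 / a * (1 / (2 * pi * eps))"
 define i0 :: "nat + nat" where "i0 = Inl i"
 have i0: "i0 \<in> labels n" unfolding i0_def labels_def using i by auto
 define L where "L om = (\<Sum>k\<in>labels n - {i0}. label_sign k *\<^sub>R pot_grad (om i0) (om k))" for om
 define V where "V om = (\<Sum>k\<in>labels n. label_sign k *\<^sub>R pot_grad (om i0) (om k))" for om
 have VL: "V om = L om + label_sign i0 *\<^sub>R pot_grad (om i0) (om i0)" for om
  unfolding V_def L_def using i0 finite_labels by (subst sum.remove[of _ i0]) (auto simp: add.commute)
 have "(%om. pot_grad (om i0) (om k)) \<in> borel_measurable ?P" if "k \<in> labels n" for k
  using sample_measurable[OF i0] sample_measurable[OF that] by (rule pot_compose(2))
 then have [measurable]: "L \<in> borel_measurable ?P" unfolding L_def[abs_def] by measurable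
 \<comment> \<open>Without \<open>i0\<close> the signs sum to 1 and their squares to
   \<open>2 * n - 1\<close>.\<close>
 have s2: "(\<Sum>k\<in>labels n - {i0}. (label_sign k)^2) + (\<Sum>k\<in>labels n - {i0}. label_sign k)^2 = 2 * real n"
  using i0 i finite_labels sum.remove[OF finite_labels i0, of label_sign] sum_label_sign[of n]
  by (simp add: card_Diff_singleton card_labels of_nat_diff i0_def)
 have m: "case_prod pot_grad \<in> borel_measurable (D \<Otimes>\<^sub>M D)" using pot_grad_measurable by (simp cong: measurable_cong_sets)
 have "(\<integral>\<^sup>+om. ennreal ((norm (L om))^2) \<partial>?P) <= ennreal (2 * real n) * (\<integral>\<^sup>+x. \<integral>\<^sup>+z. ennreal ((norm (pot_grad x z))^2) \<partial>D \<partial>D)"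
  unfolding L_def s2[symmetric] by (rule leave_one_out_second_moment[OF prob_D finite_labels i0 m norm_pot_grad_le])
 also have "... <= ennreal (2 * real n) * ennreal (measure lborel Om * grad_const \<tau> \<rho>)"
  by (intro mult_left_mono pot_grad_energy[OF \<tau> \<rho>]) auto
 also have "... = ennreal (2 * real n * (measure lborel Om * grad_const \<tau> \<rho>))" by (rule ennreal_mult'[symmetric]) simp
 finally have EL: "(\<integral>\<^sup>+om. ennreal ((norm (L om))^2) \<partial>?P) <= ennreal (2 * real n * (measure lborel Om * grad_const \<tau> \<rho>))" .
 have le: "(norm (V om))^2 <= (1 + et) * (norm (L om))^2 + (1 + 1 / et) * g^2" for om
 proof -
  have "norm (V om) <= norm (L om) + g"
   unfolding VL using norm_triangle_ineq[of "L om" "label_sign i0 *\<^sub>R pot_grad (om i0) (om i0)"] norm_pot_grad_le[of "om i0" "om i0"]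
   unfolding g_def by simp
  then show ?thesis using power_mono[of "norm (V om)" "norm (L om) + g" 2] power2_sum_le_weighted[OF et, of "norm (L om)" g] by simp
 qed
 have "ennreal (LINT om|?P. (norm (V om))^2) <= (\<integral>\<^sup>+om. ennreal ((norm (V om))^2) \<partial>?P)"
  using norm_integral_le_nn_integral[of ?P "%om. (norm (V om))^2"] by simp
 also have "... <= (\<integral>\<^sup>+om. ennreal (1 + et) * ennreal ((norm (L om))^2) + ennreal ((1 + 1 / et) * g^2) \<partial>?P)"
  using le et by (intro nn_integral_mono) (simp add: ennreal_mult'[symmetric] ennreal_plus[symmetric] del: ennreal_plus)
 also have "... = ennreal (1 + et) * (\<integral>\<^sup>+om. ennreal ((norm (L om))^2) \<partial>?P) + ennreal ((1 + 1 / et) * g^2)"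
  by (simp add: nn_integral_add nn_integral_cmult P.emeasure_space_1)
 also have "... <= ennreal (1 + et) * ennreal (2 * real n * (measure lborel Om * grad_const \<tau> \<rho>)) + ennreal ((1 + 1 / et) * g^2)"
  by (intro add_right_mono mult_left_mono EL) auto
 also have "... = ennreal ((1 + et) * (2 * real n * (measure lborel Om * grad_const \<tau> \<rho>)) + (1 + 1 / et) * g^2)"
  using et grad_const_nonneg[OF \<tau>(1) \<rho>(1)] by (simp add: ennreal_mult'[symmetric] ennreal_plus[symmetric] del: ennreal_plus)
 finally show ?thesis unfolding V_def i0_def g_def
  by (subst (asm) ennreal_le_iff) (use et grad_const_nonneg[OF \<tau>(1) \<rho>(1)] in auto)
qed

end

section \<open>Samples whose cells are nearly neutral\<close>

context planar_cells
begin

definition imbalance :: "nat => (nat + nat => real^2) => int \<times> int => real" where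
 "imbalance n om i = (\<Sum>k\<in>labels n. label_sign k * indicator (cell i) (om k))"

text \<open>Regrouping by cells replaces unit charges by net charges. This is where the two samples
  cancel each other, and what makes estimates by absolute values affordable.\<close>

lemma sum_sample:
 fixes h :: "int \<times> int => 'v::real_vector"
 assumes "\<And>k. k \<in> labels n ==> om k \<in> Om"
 shows "(\<Sum>k\<in>labels n. label_sign k *\<^sub>R h (kap (om k))) = (\<Sum>i\<in>I. imbalance n om i *\<^sub>R h i)"
proof -
 have "(\<Sum>k\<in>labels n. label_sign k *\<^sub>R h (kap (om k))) = (\<Sum>k\<in>labels n. \<Sum>i\<in>I. (label_sign k * indicator (cell i) (om k)) *\<^sub>R h i)"
  using assms by (intro sum.cong refl) (simp add: cell_sum[symmetric] scaleR_sum_right)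
 also have "... = (\<Sum>i\<in>I. \<Sum>k\<in>labels n. (label_sign k * indicator (cell i) (om k)) *\<^sub>R h i)" by (rule sum.swap)
 finally show ?thesis unfolding imbalance_def by (simp add: scaleR_sum_left)
qed

definition unbalanced :: "real => nat => (nat + nat => real^2) set" where
 "unbalanced T n = (\<Union>i\<in>I. {om \<in> space (PiM (labels n) (%_. D)). T <= \<bar>imbalance n om i\<bar>})"

text \<open>A union bound over cells and both signs; \<open>t\<close> remains free and is tuned
  together with \<open>T\<close> once \<open>eps\<close> is chosen.\<close>

lemma unbalanced_prob:
 assumes t: "0 <= t" "t <= 1"
 shows "unbalanced T n \<in> sets (PiM (labels n) (%_. D))"
  "measure (PiM (labels n) (%_. D)) (unbalanced T n)
   <= 8 / (a * pi * eps^2) * exp (t^2 * (2 * real n) * (b * (pi * (C0 * eps)^2)) - t * T)"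
proof -
 let ?P = "PiM (labels n) (%_. D)"
 interpret P: prob_space ?P by (rule prob_space_PiM_const[OF prob_D])
 define E where "E = exp (t^2 * (2 * real n) * (b * (pi * (C0 * eps)^2)) - t * T)"
 have im[measurable]: "(%om. imbalance n om i) \<in> borel_measurable ?P" for i
  unfolding imbalance_def
 proof (intro borel_measurable_sum borel_measurable_times borel_measurable_const)
  show "(%om. indicat_real (cell i) (om k)) \<in> borel_measurable ?P" if "k \<in> labels n" for k
   by (rule measurable_compose[OF sample_measurable[OF that]]) simp
 qed
 have one: "measure ?P {om \<in> space ?P. T <= e * imbalance n om i} <= E" if i: "i \<in> I" and e: "e = 1 \<or> e = - 1" for i and e :: real
 proof -
  have eq: "(\<Sum>k\<in>labels n. (e * label_sign k) * (indicator (cell i) (om k) - measure D (cell i))) = e * imbalance n om i" for om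
  proof -
   have "(\<Sum>k\<in>labels n. (e * label_sign k) * (indicator (cell i) (om k) - measure D (cell i)))
    = e * imbalance n om i - (\<Sum>k\<in>labels n. label_sign k) * (e * measure D (cell i))"
    unfolding imbalance_def sum_distrib_left sum_distrib_right sum_subtractf[symmetric]
    by (intro sum.cong refl) (simp add: algebra_simps)
   then show ?thesis by (simp add: sum_label_sign)
  qed
  have "measure ?P {om \<in> space ?P. T <= e * imbalance n om i}
   <= exp (t^2 * real (card (labels n)) * measure D (cell i) - t * T)"
   unfolding eq[symmetric] using e t
   by (intro chernoff_counts prob_D finite_labels) (auto simp: label_sign_def split: sum.splits)
  also have "... <= E"
  proof -
   have "mass i <= b * measure lborel (cell i)" using rb by (intro mass_le)
   also have "... <= b * (pi * (C0 * eps)^2)" using area_le b0 by (intro mult_left_mono) auto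
   finally have "t^2 * (2 * real n) * mass i <= t^2 * (2 * real n) * (b * (pi * (C0 * eps)^2))" by (intro mult_left_mono) auto
   then show ?thesis unfolding E_def mass_measure card_labels by simp
  qed
  finally show ?thesis .
 qed
 have m: "{om \<in> space ?P. T <= \<bar>imbalance n om i\<bar>} \<in> sets ?P" for i by measurable
 then show "unbalanced T n \<in> sets ?P" unfolding unbalanced_def using finI by (intro sets.finite_UN) auto
 have two: "measure ?P {om \<in> space ?P. T <= \<bar>imbalance n om i\<bar>} <= 2 * E" if i: "i \<in> I" for i
 proof -
  have "measure ?P {om \<in> space ?P. T <= \<bar>imbalance n om i\<bar>}
   <= measure ?P ({om \<in> space ?P. T <= 1 * imbalance n om i} \<union> {om \<in> space ?P. T <= (- 1) * imbalance n om i})"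
   by (rule P.finite_measure_mono) auto
  also have "... <= measure ?P {om \<in> space ?P. T <= 1 * imbalance n om i} + measure ?P {om \<in> space ?P. T <= (- 1) * imbalance n om i}"
   by (rule measure_Un_le) measurable
  also have "... <= E + E" by (intro add_mono one i) auto
  finally show ?thesis by simp
 qed
 have "measure ?P (unbalanced T n) <= (\<Sum>i\<in>I. measure ?P {om \<in> space ?P. T <= \<bar>imbalance n om i\<bar>})"
  unfolding unbalanced_def using m finI by (intro P.finite_measure_subadditive_finite) auto
 also have "... <= (\<Sum>i\<in>I. 2 * E)" by (rule sum_mono[OF two])
 also have "... = real (card I) * (2 * E)" by simp
 also have "... <= 4 / (a * pi * eps^2) * (2 * E)" using card_I_le unfolding E_def by (intro mult_right_mono) auto
 finally show "measure ?P (unbalanced T n) <= 8 / (a * pi * eps^2) * exp (t^2 * (2 * real n) * (b * (pi * (C0 * eps)^2)) - t * T)"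
  unfolding E_def by simp
qed

text \<open>The Hessian bound of the potential, where \<open>T\<close> stands for the largest net
  charge of a cell divided by \<open>n\<close>. The factor \<open>4 / (a * pi * eps^2)\<close>
  bounds the inverse mass of a cell, and the rest is the lattice sum.\<close>

definition hess :: "real => real => real" where
 "hess R T = T * (4 / (a * pi * eps^2)) * (C0^2 * (1 + 2 * ln (2 * R / eps)))"

lemma match_cost_balanced:
 assumes n: "1 <= n" and R: "\<And>x. x \<in> Om ==> norm x <= R" "eps <= 2 * R"
  and om: "\<And>k. k \<in> labels n ==> om k \<in> Om" and T: "\<And>i. i \<in> I ==> \<bar>imbalance n om i\<bar> <= T"
 shows "2 / real n * (\<Sum>k\<in>labels n. \<Sum>l\<in>labels n. label_sign k * label_sign l * pot (om k) (om l))
   - 1 / (real n)^2 * (\<Sum>i\<in>{1..n}. (norm (\<Sum>k\<in>labels n. label_sign k *\<^sub>R pot_grad (om (Inl i)) (om k)))^2)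
  <= (1 + hess R (T / real n)) * match_cost n (%i. om (Inl i)) (%i. om (Inr i))"
proof -
 define al where "al i = imbalance n om i / real n * wt i" for i
 define f where "f x = (\<Sum>i\<in>I. al i * log_pot eps (x - ctr i))" for x
 define g where "g x = (\<Sum>i\<in>I. al i *\<^sub>R log_pot_grad eps (x - ctr i))" for x
 define S where "S = (\<Sum>k\<in>labels n. label_sign k * f (om k))"
 have inl: "Inl i \<in> labels n" "Inr i \<in> labels n" if "i \<in> {1..n}" for i using that unfolding labels_def by auto
 have lab: "om (Inl i) \<in> Om" "om (Inr i) \<in> Om" if "i \<in> {1..n}" for i
  by (rule om[OF inl(1)[OF that]], rule om[OF inl(2)[OF that]])
 have f_eq: "f x = 1 / real n * (\<Sum>k\<in>labels n. label_sign k * pot x (om k))" if "x \<in> Om" for x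
 proof -
  have "(\<Sum>k\<in>labels n. label_sign k * pot x (om k)) = (\<Sum>k\<in>labels n. label_sign k *\<^sub>R (wt (kap (om k)) * log_pot eps (x - ctr (kap (om k)))))"
   unfolding pot_def using that om by (intro sum.cong) auto
  also have "... = (\<Sum>i\<in>I. imbalance n om i *\<^sub>R (wt i * log_pot eps (x - ctr i)))"
   by (rule sum_sample[where h = "%i. wt i * log_pot eps (x - ctr i)"]) (rule om)
  finally show ?thesis unfolding f_def al_def by (simp add: sum_distrib_left mult.assoc)
 qed
 have g_eq: "g x = (1 / real n) *\<^sub>R (\<Sum>k\<in>labels n. label_sign k *\<^sub>R pot_grad x (om k))" if "x \<in> Om" for x
 proof -
  have "(\<Sum>k\<in>labels n. label_sign k *\<^sub>R pot_grad x (om k)) = (\<Sum>k\<in>labels n. label_sign k *\<^sub>R (wt (kap (om k)) *\<^sub>R log_pot_grad eps (x - ctr (kap (om k)))))"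
   unfolding pot_grad_def using that om by (intro sum.cong) auto
  also have "... = (\<Sum>i\<in>I. imbalance n om i *\<^sub>R (wt i *\<^sub>R log_pot_grad eps (x - ctr i)))"
   by (rule sum_sample[where h = "%i. wt i *\<^sub>R log_pot_grad eps (x - ctr i)"]) (rule om)
  finally show ?thesis unfolding g_def al_def by (simp add: scaleR_sum_right)
 qed
 have T0: "0 <= T" using T Om_ne unfolding I_def by (metis abs_ge_zero all_not_in_conv image_eqI order_trans)
 have "f (om (Inr j)) <= f (om (Inl i)) + g (om (Inl i)) \<bullet> (om (Inr j) - om (Inl i)) + hess R (T / real n) / 2 * (norm (om (Inr j) - om (Inl i)))^2"
  if ij: "i \<in> {1..n}" "j \<in> {1..n}" for i j
 proof -
  define x where "x = om (Inl i)"
  define d where "d = om (Inr j) - x"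
  have xd: "x + d = om (Inr j)" unfolding d_def by simp
  have "f (x + d) <= f x + g x \<bullet> d + hess R (T / real n) / 2 * (norm d)^2"
   unfolding f_def g_def
  proof (rule log_pot_sum_second_order[OF eps finI])
   fix t :: real assume t: "0 <= t" "t <= 1"
   \<comment> \<open>The segment can leave the domain, but by convexity it stays in the ball of
     radius \<open>R\<close>.\<close>
   define z where "z = x + t *\<^sub>R d"
   have "z = (1 - t) *\<^sub>R x + t *\<^sub>R (x + d)" unfolding z_def by (simp add: algebra_simps)
   then have "norm z <= norm ((1 - t) *\<^sub>R x) + norm (t *\<^sub>R (x + d))" using norm_triangle_ineq by metis
   also have "... <= (1 - t) * R + t * R"
    unfolding norm_scaleR xd unfolding x_def using t R(1)[OF lab(1)[OF ij(1)]] R(1)[OF lab(2)[OF ij(2)]]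
    by (intro add_mono mult_mono) auto
   finally have z: "norm z <= R" by (simp add: algebra_simps)
   have "(\<Sum>i\<in>I. \<bar>al i\<bar> / ((norm (z - ctr i))^2 + eps^2))
    <= (\<Sum>i\<in>I. T / real n * (4 / (a * pi * eps^2)) * (measure lborel (cell i) / ((norm (z - ctr i))^2 + eps^2)))"
   proof (rule sum_mono)
    fix i assume i: "i \<in> I"
    have q: "0 < (norm (z - ctr i))^2 + eps^2" using eps by (intro add_nonneg_pos) auto
    have mp: "0 < a * (pi * (eps / 2)^2)" using a eps by simp
    have "wt i <= measure lborel (cell i) / (a * (pi * (eps / 2)^2))"
     unfolding wt_def using mass_ge[OF i] mult_pos_pos[OF mass_pos[OF i] mp] by (intro divide_left_mono) auto
    then have "\<bar>al i\<bar> <= T / real n * (measure lborel (cell i) / (a * (pi * (eps / 2)^2)))"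
     unfolding al_def abs_mult using T[OF i] wt_nonneg[of i] T0
     by (intro mult_mono) (auto simp: abs_divide divide_right_mono)
    also have "... = T / real n * (4 / (a * pi * eps^2)) * measure lborel (cell i)" by (simp add: power2_eq_square mult_ac)
    finally have "\<bar>al i\<bar> / ((norm (z - ctr i))^2 + eps^2) <= T / real n * (4 / (a * pi * eps^2)) * measure lborel (cell i) / ((norm (z - ctr i))^2 + eps^2)"
     using q by (intro divide_right_mono) auto
    then show "\<bar>al i\<bar> / ((norm (z - ctr i))^2 + eps^2) <= T / real n * (4 / (a * pi * eps^2)) * (measure lborel (cell i) / ((norm (z - ctr i))^2 + eps^2))"
     by simp
   qed
   also have "... = T / real n * (4 / (a * pi * eps^2)) * (\<Sum>i\<in>I. measure lborel (cell i) / ((norm (z - ctr i))^2 + eps^2))"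
    by (simp only: sum_distrib_left)
   also have "... <= T / real n * (4 / (a * pi * eps^2)) * (2 * C0^2 * (pi + 2 * pi * ln (2 * R / eps)))"
    using T0 a by (intro mult_left_mono lattice_sum_bound R z) auto
   also have "... = 2 * pi * hess R (T / real n)"
   proof -
    have "u * (2 * c * (pi + 2 * pi * l)) = 2 * pi * (u * (c * (1 + 2 * l)))" for u c l by (simp add: algebra_simps)
    then show ?thesis unfolding hess_def by blast
   qed
   finally show "(\<Sum>i\<in>I. \<bar>al i\<bar> / ((norm (x + t *\<^sub>R d - ctr i))^2 + eps^2)) <= 2 * pi * hess R (T / real n)" unfolding z_def .
  qed
  then show ?thesis unfolding xd unfolding x_def d_def .
 qed
 from match_cost_lower[of n f "%i. om (Inr i)" "%i. om (Inl i)" g, OF this]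
 have "2 * (\<Sum>i\<in>{1..n}. f (om (Inr i)) - f (om (Inl i))) - (\<Sum>i\<in>{1..n}. (norm (g (om (Inl i))))^2)
  <= (1 + hess R (T / real n)) * match_cost n (%i. om (Inl i)) (%i. om (Inr i))" by blast
 moreover have "(\<Sum>i\<in>{1..n}. f (om (Inr i)) - f (om (Inl i))) = 1 / real n * (\<Sum>k\<in>labels n. \<Sum>l\<in>labels n. label_sign k * label_sign l * pot (om k) (om l))"
 proof -
  have "(\<Sum>i\<in>{1..n}. f (om (Inr i)) - f (om (Inl i))) = (\<Sum>k\<in>labels n. label_sign k * f (om k))"
   unfolding sum_labels by (simp add: sum_subtractf sum_negf)
  also have "... = (\<Sum>k\<in>labels n. 1 / real n * (\<Sum>l\<in>labels n. label_sign k * label_sign l * pot (om k) (om l)))"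
   using f_eq[OF om] by (intro sum.cong refl) (simp add: sum_distrib_left mult_ac)
  finally show ?thesis by (simp only: sum_distrib_left)
 qed
 moreover have "(\<Sum>i\<in>{1..n}. (norm (g (om (Inl i))))^2)
  = 1 / (real n)^2 * (\<Sum>i\<in>{1..n}. (norm (\<Sum>k\<in>labels n. label_sign k *\<^sub>R pot_grad (om (Inl i)) (om k)))^2)"
  unfolding sum_distrib_left using g_eq[OF lab(1)] by (intro sum.cong refl) (simp add: power_mult_distrib power_divide)
 ultimately show ?thesis by (simp add: mult.assoc)
qed

text \<open>On unbalanced samples the quadratic expression is not controlled by the cost. There it
  is bounded by a polynomial in \<open>n\<close> times a logarithm, which is multiplied by the
  probability of that event.\<close>

lemma expected_match_lower_cells:
 assumes n: "1 <= n" and R: "eps <= 1" "eps <= 2 * R" "\<And>x. x \<in> Om ==> norm x <= R"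
  and \<tau>: "0 < \<tau>" "\<And>x y. x \<in> Om ==> y \<in> Om ==> dist x y < d ==> \<bar>r x - r y\<bar> < \<tau>"
  and \<rho>: "eps <= \<rho>" "\<rho> + C0 * eps < d" and et: "0 < et" and T: "0 <= T" and t: "0 <= t" "t <= 1"
 shows "4 * (measure lborel Om * ((2 * ln (1 / eps) - ln (C0^2 + 1)) / (4 * pi)) - 2 * b * R / a)
   - (2 * (1 + et) * (measure lborel Om * grad_const \<tau> \<rho>) + (1 + 1 / et) * (1 / a * (1 / (2 * pi * eps)))^2 / real n)
  <= (1 + hess R (T / real n)) * (LINT om|PiM (labels n) (%_. D). match_cost n (%i. om (Inl i)) (%i. om (Inr i)))
   + 8 * real n * (1 / a * ((2 * ln (1 / eps) + ln ((2 * R)^2 + 1)) / (4 * pi)))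
    * (8 / (a * pi * eps^2) * exp (t^2 * (2 * real n) * (b * (pi * (C0 * eps)^2)) - t * T))"
proof -
 let ?P = "PiM (labels n) (%_. D)"
 interpret P: prob_space ?P by (rule prob_space_PiM_const[OF prob_D])
 define k where "k = hess R (T / real n)"
 define GB where "GB = 1 / a * ((2 * ln (1 / eps) + ln ((2 * R)^2 + 1)) / (4 * pi))"
 define g where "g = 1 / a * (1 / (2 * pi * eps))"
 define m where "m om = match_cost n (%i. om (Inl i)) (%i. om (Inr i))" for om :: "nat + nat => real^2"
 define A where "A om = (\<Sum>k\<in>labels n. \<Sum>l\<in>labels n. label_sign k * label_sign l * pot (om k) (om l))" for om
 define V where "V i om = (norm (\<Sum>k\<in>labels n. label_sign k *\<^sub>R pot_grad (om (Inl i)) (om k)))^2" for i :: nat and om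
 define U where "U = unbalanced T n"
 note um = unbalanced_prob[OF t, where T = T and n = n]
 have inl: "Inl i \<in> labels n" "Inr i \<in> labels n" if "i \<in> {1..n}" for i using that unfolding labels_def by auto
 have GB0: "0 <= GB" using abs_pot_le[OF R(1,3)] abs_ge_zero order_trans unfolding GB_def by blast
 have k0: "0 <= k" unfolding k_def hess_def using T a R(2) eps by (intro mult_nonneg_nonneg add_nonneg_nonneg ln_ge_zero) auto
 have R0: "0 <= R" using R(2) eps by simp
 have mi: "integrable ?P m"
 proof (rule P.integrable_const_bound)
  show "m \<in> borel_measurable ?P"
   unfolding m_def by (rule match_cost_measurable) (rule sample_measurable, erule inl)+
  show "AE om in ?P. norm (m om) <= real n * (2 * R)^2"
   using AE_sample[of n]
  proof eventually_elim
   case (elim om)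
   have "m om <= real n * (2 * R)^2" unfolding m_def using R(3) elim inl by (intro match_cost_le_diameter) auto
   then show ?case using match_cost_nonneg[of n "%i. om (Inl i)" "%i. om (Inr i)"] unfolding m_def by simp
  qed
 qed
 have Ab: "\<bar>A om\<bar> <= 4 * (real n)^2 * GB" for om
 proof -
  have "\<bar>A om\<bar> <= (\<Sum>k\<in>labels n. \<Sum>l\<in>labels n. GB)"
   unfolding A_def
  proof (rule order_trans[OF sum_abs], rule sum_mono, rule order_trans[OF sum_abs], rule sum_mono)
   show "\<bar>label_sign k * label_sign l * pot (om k) (om l)\<bar> <= GB" for k l
    using abs_pot_le[OF R(1,3)] unfolding GB_def abs_mult by simp
  qed
  then show ?thesis by (simp add: card_labels power2_eq_square)
 qed
 have Ai: "integrable ?P A"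
 proof (rule P.integrable_const_bound[OF AE_I2])
  show "A \<in> borel_measurable ?P" unfolding A_def[abs_def]
   by (intro borel_measurable_sum borel_measurable_times borel_measurable_const pot_compose(1) sample_measurable)
 qed (use Ab in auto)
 have Vi: "integrable ?P (V i)" if i: "i \<in> {1..n}" for i
 proof (rule P.integrable_const_bound[OF AE_I2])
  have "(%om. \<Sum>k\<in>labels n. label_sign k *\<^sub>R pot_grad (om (Inl i)) (om k)) \<in> borel_measurable ?P"
   by (intro borel_measurable_sum borel_measurable_scaleR borel_measurable_const pot_compose(2) sample_measurable inl[OF i])
  then show "V i \<in> borel_measurable ?P" unfolding V_def[abs_def] by measurable
  fix om
  have "norm (\<Sum>k\<in>labels n. label_sign k *\<^sub>R pot_grad (om (Inl i)) (om k)) <= (\<Sum>k\<in>labels n. g)"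
   by (rule sum_norm_le) (use norm_pot_grad_le in \<open>simp add: g_def\<close>)
  then show "norm (V i om) <= (\<Sum>k\<in>labels n. g)^2" unfolding V_def by (simp add: power_mono)
 qed
 have Ui: "integrable ?P (indicat_real U)" unfolding U_def using um(1) by (intro integrable_real_indicator) (auto simp: P.emeasure_eq_measure)
 have "(LINT om|?P. 2 / real n * A om - 1 / (real n)^2 * (\<Sum>i\<in>{1..n}. V i om)) <= (LINT om|?P. (1 + k) * m om + 8 * real n * GB * indicator U om)"
 proof (rule integral_mono_AE)
  show "integrable ?P (%om. 2 / real n * A om - 1 / (real n)^2 * (\<Sum>i\<in>{1..n}. V i om))"
   using Ai Vi by (intro Bochner_Integration.integrable_diff integrable_mult_right Bochner_Integration.integrable_sum)
  show "integrable ?P (%om. (1 + k) * m om + 8 * real n * GB * indicator U om)"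
   using mi Ui by (intro Bochner_Integration.integrable_add integrable_mult_right)
  show "AE om in ?P. 2 / real n * A om - 1 / (real n)^2 * (\<Sum>i\<in>{1..n}. V i om) <= (1 + k) * m om + 8 * real n * GB * indicator U om"
   using AE_sample[of n] AE_space
  proof eventually_elim
   case (elim om)
   have V0: "0 <= 1 / (real n)^2 * (\<Sum>i\<in>{1..n}. V i om)" unfolding V_def by (intro mult_nonneg_nonneg sum_nonneg) auto
   have m0: "0 <= (1 + k) * m om" unfolding m_def using k0 match_cost_nonneg by (intro mult_nonneg_nonneg) auto
   show ?case
   proof (cases "om \<in> U")
    case True
    have "2 / real n * A om <= 2 / real n * (4 * (real n)^2 * GB)" using Ab[of om] by (intro mult_left_mono) auto
    also have "... = 8 * real n * GB" using n by (simp add: power2_eq_square)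
    finally show ?thesis using True V0 m0 by simp
   next
    case False
    have "\<bar>imbalance n om i\<bar> <= T" if "i \<in> I" for i
     using False elim(2) that unfolding U_def unbalanced_def by force
    then have "2 / real n * A om - 1 / (real n)^2 * (\<Sum>i\<in>{1..n}. V i om) <= (1 + k) * m om"
     unfolding A_def V_def k_def m_def using elim(1) by (intro match_cost_balanced n R) auto
    then show ?thesis using False by simp
   qed
  qed
 qed
 also have "... = (1 + k) * (LINT om|?P. m om) + 8 * real n * GB * measure ?P U"
  using mi Ui um(1) unfolding U_def by (subst Bochner_Integration.integral_add) (auto simp: sets.Int_space_eq2)
 also have "... <= (1 + k) * (LINT om|?P. m om) + 8 * real n * GB * (8 / (a * pi * eps^2) * exp (t^2 * (2 * real n) * (b * (pi * (C0 * eps)^2)) - t * T))"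
  unfolding U_def using um(2) GB0 by (intro add_left_mono mult_left_mono) auto
 finally have up: "(LINT om|?P. 2 / real n * A om - 1 / (real n)^2 * (\<Sum>i\<in>{1..n}. V i om))
  <= (1 + k) * (LINT om|?P. m om) + 8 * real n * GB * (8 / (a * pi * eps^2) * exp (t^2 * (2 * real n) * (b * (pi * (C0 * eps)^2)) - t * T))" .
 have "(LINT om|?P. 2 / real n * A om - 1 / (real n)^2 * (\<Sum>i\<in>{1..n}. V i om))
  = 2 / real n * (LINT om|?P. A om) - 1 / (real n)^2 * (\<Sum>i\<in>{1..n}. LINT om|?P. V i om)"
 proof -
  have "(LINT om|?P. 2 / real n * A om - 1 / (real n)^2 * (\<Sum>i\<in>{1..n}. V i om))
   = (LINT om|?P. 2 / real n * A om) - (LINT om|?P. 1 / (real n)^2 * (\<Sum>i\<in>{1..n}. V i om))"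
   using Ai Vi by (intro Bochner_Integration.integral_diff integrable_mult_right Bochner_Integration.integrable_sum)
  moreover have "(LINT om|?P. (\<Sum>i\<in>{1..n}. V i om)) = (\<Sum>i\<in>{1..n}. LINT om|?P. V i om)"
   using Vi by (rule Bochner_Integration.integral_sum)
  then have "(LINT om|?P. 1 / (real n)^2 * (\<Sum>i\<in>{1..n}. V i om)) = 1 / (real n)^2 * (\<Sum>i\<in>{1..n}. LINT om|?P. V i om)"
   by (simp only: integral_mult_right_zero)
  ultimately show ?thesis by (simp only: integral_mult_right_zero)
 qed
 moreover have "4 * (measure lborel Om * ((2 * ln (1 / eps) - ln (C0^2 + 1)) / (4 * pi)) - 2 * b * R / a) <= 2 / real n * (LINT om|?P. A om)"
 proof -
  define J where "J = measure lborel Om * ((2 * ln (1 / eps) - ln (C0^2 + 1)) / (4 * pi)) - 2 * b * R / a"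
  have "2 / real n * (2 * real n * J) <= 2 / real n * (LINT om|?P. A om)"
   unfolding J_def A_def by (intro mult_left_mono expected_pair_pot R divide_nonneg_nonneg) auto
  moreover have "2 / real n * (2 * real n * J) = 4 * J" using n by simp
  ultimately show ?thesis unfolding J_def by simp
 qed
 moreover have "1 / (real n)^2 * (\<Sum>i\<in>{1..n}. LINT om|?P. V i om)
  <= 2 * (1 + et) * (measure lborel Om * grad_const \<tau> \<rho>) + (1 + 1 / et) * g^2 / real n"
 proof -
  define J where "J = measure lborel Om * grad_const \<tau> \<rho>"
  have "(\<Sum>i\<in>{1..n}. LINT om|?P. V i om) <= (\<Sum>i\<in>{1..n}. (1 + et) * (2 * real n * J) + (1 + 1 / et) * g^2)"
   unfolding V_def J_def g_def by (rule sum_mono) (rule expected_grad_square[OF \<tau> \<rho> _ et])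
  then have "1 / (real n)^2 * (\<Sum>i\<in>{1..n}. LINT om|?P. V i om) <= 1 / (real n)^2 * (real n * ((1 + et) * (2 * real n * J) + (1 + 1 / et) * g^2))"
   by (intro mult_left_mono) auto
  also have "... = 2 * (1 + et) * J + (1 + 1 / et) * g^2 / real n"
  proof -
   have "1 / N^2 * (N * (e * (2 * N * J) + x)) = 2 * e * J + x / N" if "N \<noteq> 0" for N e x :: real
    using that by (simp add: field_simps power2_eq_square)
   then show ?thesis using n by simp
  qed
  finally show ?thesis unfolding J_def .
 qed
 ultimately show ?thesis using up unfolding k_def m_def GB_def g_def by linarith
qed

end

section \<open>Choice of the scales in the lower bound\<close>

lemma powr_ln_exp_decay:
 fixes d q u c :: real
 assumes "0 < d"
 shows "(%n. real n powr q * (u * ln (real n) + c) * exp (- (real n powr d))) \<longlonglongrightarrow> 0"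
proof -
 have "(%n. real n powr q * ln (real n) * exp (- (real n powr d))) \<longlonglongrightarrow> 0" using assms by real_asymp
 then have "(%n. u * (real n powr q * ln (real n) * exp (- (real n powr d))) + c * (real n powr q * exp (- (1 * real n powr d)))) \<longlonglongrightarrow> u * 0 + c * 0"
  using assms by (intro tendsto_add tendsto_mult_left powr_exp_decay) auto
 then show ?thesis by (simp add: algebra_simps)
qed

lemma powr_ln_decay:
 fixes d u c :: real
 assumes "0 < d"
 shows "(%n. real n powr (- d) * (u * ln (real n) + c)) \<longlonglongrightarrow> 0"
proof -
 have "(%n. real n powr (- d) * ln (real n)) \<longlonglongrightarrow> 0" "(%n. real n powr (- d)) \<longlonglongrightarrow> 0" using assms by real_asymp+
 then have "(%n. u * (real n powr (- d) * ln (real n)) + c * real n powr (- d)) \<longlonglongrightarrow> u * 0 + c * 0"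
  by (intro tendsto_add tendsto_mult_left)
 then show ?thesis by (simp add: algebra_simps)
qed

context planar_density
begin

text \<open>A cell holds of the order of \<open>n powr et\<close> points, with fluctuations of the
  order of \<open>n powr (et / 2)\<close>. The threshold \<open>T = n powr (3 * et / 4)\<close> lies
  strictly between: exceeding it is less likely than any inverse power of \<open>n\<close>, and
  \<open>hess\<close> still tends to 0. Per unit of \<open>ln (1 / eps)\<close> the pair sum gives
  \<open>4 * A\<close>, the gradients take away about \<open>2 * A\<close>, and
  \<open>ln (1 / eps)\<close> is nearly half of \<open>ln n\<close>.\<close>

lemma expected_match_lower:
 assumes e: "0 < e"
 shows "\<forall>\<^sub>F n in sequentially. (measure lborel Om / (2 * pi) - e) * ln (real n)
  <= (LINT om|PiM (labels n) (%_. D). match_cost n (%i. om (Inl i)) (%i. om (Inr i)))"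
proof -
 define A0 where "A0 = measure lborel Om"
 define A where "A = A0 / (2 * pi)"
 have A: "0 <= A" "A0 = 2 * pi * A" unfolding A_def A0_def by auto
 obtain h lam R0 where uniform: "uniform_cone Om h lam R0" using uniform_cone_exists[OF lip op bd] by blast
 have lam: "0 < lam" "0 < h" "0 < R0" using uniform unfolding uniform_cone_def by auto
 obtain R1 where R1: "\<And>z. z \<in> Om ==> norm z <= R1" using bd bounded_iff by blast
 define R where "R = max R1 1"
 have R: "\<And>z. z \<in> Om ==> norm z <= R" "1 <= R" unfolding R_def using R1 by (auto simp: le_max_iff_disj)
 define C0 where "C0 = 3 / lam + 3"
 have C0: "1 <= C0" unfolding C0_def using lam by simp
 define et where "et = min (1 / 2) (e / (16 * A + 16))"
 have et: "0 < et" "et <= 1 / 2" "A * (4 * et) <= e / 4"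
 proof -
  show p: "0 < et" "et <= 1 / 2" unfolding et_def using e A by (simp_all only: min.cobounded1) auto
  have "et <= e / (16 * A + 16)" unfolding et_def by simp
  then have "et * (16 * A + 16) <= e" using A by (simp add: pos_le_divide_eq)
  then show "A * (4 * et) <= e / 4" using p by (simp add: algebra_simps)
 qed
 define p where "p = (1 - et) / 2"
 define \<tau> where "\<tau> = a * et"
 have \<tau>: "0 < \<tau>" "\<tau> / a = et" unfolding \<tau>_def using a et by auto
 obtain d where d: "0 < d" "\<And>x y. x \<in> Om ==> y \<in> Om ==> dist x y < d ==> \<bar>r x - r y\<bar> < \<tau>" using uc[OF \<tau>(1)] by blast
 define \<rho> where "\<rho> = d / 2"
 have \<rho>0: "0 < \<rho>" unfolding \<rho>_def using d by simp
 define c1 where "c1 = ln (C0^2 + 1)"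
 define c2 where "c2 = ln ((2 * R)^2 + 1)"
 define k1 where "k1 = 8 * (1 / a * (1 / (4 * pi))) * (8 / (a * pi)) * exp (2 * b * pi * C0^2)"
 define er where "er n = k1 * (real n powr (2 - et) * (2 * p * ln (real n) + c2) * exp (- (real n powr (et / 4))))" for n :: nat
 define hs where "hs n = 4 / (a * pi) * C0^2 * (real n powr (- (et / 4)) * (2 * p * ln (real n) + (1 + 2 * ln (2 * R))))" for n :: nat
 define sm where "sm n = (1 + 1 / et) * (1 / a * (1 / (2 * pi)))^2 * real n powr (- et)" for n :: nat
 define Z where "Z = 4 * (A0 * (c1 / (4 * pi)) + 2 * b * R / a) + 2 * (1 + et) * (A0 * (((1 + et) * (pi + 2 * pi * ln \<rho>) + 1 / (a * \<rho>^2)) / (4 * pi^2)))"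
 \<comment> \<open>Small enough that a relative error of \<open>k0 / 2\<close> costs at most
   \<open>e / 4\<close> in the coefficient of \<open>ln n\<close>.\<close>
 define k0 where "k0 = e / (2 * A + 1)"
 have k0: "0 < k0" unfolding k0_def using A e by simp
 have er0: "\<forall>\<^sub>F n in sequentially. er n < 1"
 proof -
  have "er \<longlonglongrightarrow> k1 * 0" unfolding er_def[abs_def] using et by (intro tendsto_mult_left powr_ln_exp_decay) auto
  then show ?thesis by (intro order_tendstoD(2)[where a = 1]) auto
 qed
 have hs0: "\<forall>\<^sub>F n in sequentially. hs n < k0 / 2"
 proof -
  have "hs \<longlonglongrightarrow> 4 / (a * pi) * C0^2 * 0" unfolding hs_def[abs_def] using et by (intro tendsto_mult_left powr_ln_decay) auto
  then show ?thesis using k0 by (intro order_tendstoD(2)) auto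
 qed
 have sm0: "\<forall>\<^sub>F n in sequentially. sm n < 1"
 proof -
  have "(%n. real n powr (- et)) \<longlonglongrightarrow> 0" using et by real_asymp
  then have "sm \<longlonglongrightarrow> (1 + 1 / et) * (1 / a * (1 / (2 * pi)))^2 * 0" unfolding sm_def[abs_def] by (intro tendsto_mult_left)
  then show ?thesis by (intro order_tendstoD(2)[where a = 1]) auto
 qed
 have evln: "\<forall>\<^sub>F n in sequentially. Z + 2 <= e / 4 * ln (real n)"
 proof -
  have "filterlim (%n. e / 4 * ln (real n)) at_top sequentially" using e by real_asymp
  then show ?thesis unfolding filterlim_at_top by blast
 qed
 define eps1 where "eps1 = Min {1, lam * h / 3, R0 * 2 / 3, \<rho> / C0, \<rho>}"
 have eps1: "0 < eps1" "eps1 <= 1" "eps1 <= lam * h / 3" "eps1 <= R0 * 2 / 3" "eps1 <= \<rho> / C0" "eps1 <= \<rho>"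
 proof -
  show "0 < eps1" unfolding eps1_def using lam \<rho>0 C0 by auto
  show "eps1 <= 1" "eps1 <= lam * h / 3" "eps1 <= R0 * 2 / 3" "eps1 <= \<rho> / C0" "eps1 <= \<rho>"
   unfolding eps1_def by (rule Min_le; simp only: finite.intros insert_iff simp_thms)+
 qed
 have eveps: "\<forall>\<^sub>F n in sequentially. real n powr (- p) < eps1"
 proof -
  have "(%n. real n powr (- p)) \<longlonglongrightarrow> 0" using et unfolding p_def by real_asymp
  then show ?thesis using eps1 by (intro order_tendstoD(2))
 qed
 show ?thesis
  using er0 hs0 sm0 evln eveps eventually_gt_at_top[of 1]
 proof eventually_elim
  case (elim n)
  define eps where "eps = real n powr (- p)"
  define E where "E = (LINT om|PiM (labels n) (%_. D). match_cost n (%i. om (Inl i)) (%i. om (Inr i)))"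
  have E0: "0 <= E" unfolding E_def by (intro Bochner_Integration.integral_nonneg match_cost_nonneg)
  have n: "1 <= n" "0 < real n" "0 < ln (real n)" "1 < real n" using elim(6) by auto
  have eps: "0 < eps" "eps < eps1" unfolding eps_def using elim n by auto
  have eps': "3 / lam * eps <= h" "3 / 2 * eps < R0" "eps <= 1" "eps <= 2 * R" "eps <= \<rho>" "\<rho> + C0 * eps < d"
  proof -
   have "eps <= lam * h / 3" using eps eps1 by linarith
   then show "3 / lam * eps <= h" using lam by (simp add: field_simps)
   show "3 / 2 * eps < R0" "eps <= 1" "eps <= 2 * R" "eps <= \<rho>" using eps eps1 R by linarith+
   have "eps < \<rho> / C0" using eps eps1 by linarith
   then have "C0 * eps < \<rho>" using C0 by (simp add: pos_less_divide_eq mult.commute)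
   then show "\<rho> + C0 * eps < d" unfolding \<rho>_def by simp
  qed
  obtain kap where kap: "cell_structure Om C0 eps kap (grid_center eps)"
   unfolding C0_def using cell_structure_exists[OF uniform bd eps(1) eps'(1,2)] by blast
  interpret pc: planar_cells Om r a b C0 eps kap "grid_center eps"
   by unfold_locales (use kap eps C0 in auto)
  have ln1: "ln (1 / eps) = p * ln (real n)" unfolding eps_def using n by (simp add: ln_div ln_powr)
  \<comment> \<open>This makes \<open>t^2 * n * eps^2 = 1\<close>, so the quadratic term of the
    Chernoff exponent is constant, while \<open>t * T\<close> is
    \<open>n powr (et / 4)\<close>.\<close>
  define t where "t = real n powr (- (et / 2))"
  define T where "T = real n powr (et / 4) / t"
  have t: "0 < t" "t <= 1"
  proof -
   show "0 < t" unfolding t_def using n by simp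
   have "real n powr (- (et / 2)) <= real n powr 0" using et n by (intro powr_mono) auto
   then show "t <= 1" unfolding t_def using n by simp
  qed
  have T0: "0 <= T" unfolding T_def using t by simp
  have e2: "eps^2 = real n powr (et - 1)"
  proof -
   have "eps^2 = real n powr (- p) * real n powr (- p)" unfolding eps_def by (simp add: power2_eq_square)
   also have "... = real n powr (- p + - p)" by (rule powr_add[symmetric])
   also have "- p + - p = et - 1" unfolding p_def by simp
   finally show ?thesis .
  qed
  have nn: "real n = real n powr 1" using n by simp
  have tne: "t^2 * real n * eps^2 = 1"
  proof -
   have "t^2 = real n powr (- (et / 2) + - (et / 2))" unfolding t_def powr_add by (simp add: power2_eq_square)
   then have "t^2 * real n * eps^2 = real n powr (- (et / 2) + - (et / 2)) * real n powr 1 * real n powr (et - 1)" using e2 nn by simp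
   also have "... = real n powr (- (et / 2) + - (et / 2) + 1 + (et - 1))" by (simp only: powr_add)
   also have "... = 1" using n by simp
   finally show ?thesis .
  qed
  have x1: "pc.hess R (T / real n) = hs n"
  proof -
   have "T / real n / eps^2 = real n powr (et / 4) / real n powr (- (et / 2)) / real n powr 1 / real n powr (et - 1)"
    unfolding T_def t_def e2 using nn by simp
   also have "... = real n powr (et / 4 - - (et / 2) - 1 - (et - 1))" by (simp only: powr_diff)
   also have "et / 4 - - (et / 2) - 1 - (et - 1) = - (et / 4)" by simp
   finally have w: "T / real n / eps^2 = real n powr (- (et / 4))" .
   have "ln (2 * R / eps) = ln (2 * R) + p * ln (real n)"
    using R eps ln1 by (simp add: ln_div)
   then have "pc.hess R (T / real n) = 4 / (a * pi) * C0^2 * (T / real n / eps^2 * (2 * p * ln (real n) + (1 + 2 * ln (2 * R))))"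
    unfolding pc.hess_def by (simp add: algebra_simps)
   then show ?thesis unfolding w hs_def .
  qed
  have x2: "8 * real n * (1 / a * ((2 * ln (1 / eps) + c2) / (4 * pi)))
    * (8 / (a * pi * eps^2) * exp (t^2 * (2 * real n) * (b * (pi * (C0 * eps)^2)) - t * T)) = er n"
  proof -
   have "t * T = real n powr (et / 4)" unfolding T_def using t by simp
   moreover have "t^2 * (2 * real n) * (b * (pi * (C0 * eps)^2)) = 2 * b * pi * C0^2"
   proof -
    have "t^2 * (2 * real n) * (b * (pi * (C0 * eps)^2)) = (t^2 * real n * eps^2) * (2 * b * pi * C0^2)" by (simp add: power_mult_distrib mult_ac)
    then show ?thesis by (simp only: tne mult_1_left)
   qed
   ultimately have ex: "exp (t^2 * (2 * real n) * (b * (pi * (C0 * eps)^2)) - t * T) = exp (2 * b * pi * C0^2) * exp (- (real n powr (et / 4)))"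
    by (simp add: exp_diff exp_minus field_simps)
   have "real n / eps^2 = real n powr 1 / real n powr (et - 1)" using e2 nn by simp
   also have "... = real n powr (2 - et)" unfolding powr_diff[symmetric] by simp
   finally have nd: "real n / eps^2 = real n powr (2 - et)" .
   have "8 * N * (x * (y / z)) * (8 / (w * s) * (u * v)) = 8 * (x * (1 / z)) * (8 / w) * u * (N / s * y * v)" for N x y z w s u v :: real
    by (simp add: mult_ac)
   from this[of "real n" "1 / a" "2 * (p * ln (real n)) + c2" "4 * pi" "a * pi" "eps^2" "exp (2 * b * pi * C0^2)" "exp (- (real n powr (et / 4)))"]
   show ?thesis unfolding ex er_def k1_def nd[symmetric] ln1 by (simp only: mult.assoc)
  qed
  have x3: "(1 + 1 / et) * (1 / a * (1 / (2 * pi * eps)))^2 / real n = sm n"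
  proof -
   have "1 / (eps^2 * real n) = 1 / (real n powr (et - 1) * real n powr 1)" using e2 nn by simp
   also have "... = real n powr (- et)" unfolding powr_add[symmetric] by (simp add: powr_minus divide_inverse)
   finally have w: "1 / (eps^2 * real n) = real n powr (- et)" .
   have "(1 / a * (1 / (2 * pi * eps)))^2 = (1 / a * (1 / (2 * pi)))^2 * (1 / eps^2)" by (simp add: power_mult_distrib power_divide)
   then show ?thesis unfolding sm_def w[symmetric] by simp
  qed
  have x4: "4 * (A0 * ((2 * ln (1 / eps) - c1) / (4 * pi)) - 2 * b * R / a) - 2 * (1 + et) * (A0 * pc.grad_const \<tau> \<rho>)
   = A * (4 - 2 * (1 + et)^2) * (p * ln (real n)) - Z"
  proof -
   have lr: "ln (\<rho> / eps) = ln \<rho> + p * ln (real n)" using \<rho>0 eps ln1 by (simp add: ln_div)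
   have ar: "4 * (A0 * ((2 * L - c1) / (4 * pi)) - Y) - 2 * H * (A0 * ((H * (pi + 2 * pi * (l + L)) + q) / (4 * pi^2)))
    = A * (4 - 2 * H^2) * L - (4 * (A0 * (c1 / (4 * pi)) + Y) + 2 * H * (A0 * ((H * (pi + 2 * pi * l) + q) / (4 * pi^2))))" for L Y H l q
    unfolding A(2) by (simp add: field_simps power2_eq_square)
   show ?thesis unfolding pc.grad_const_def \<tau>(2) lr ln1 Z_def by (rule ar)
  qed
  have main: "A * (4 - 2 * (1 + et)^2) * (p * ln (real n)) - Z - sm n <= (1 + hs n) * E + er n"
  proof -
   have "4 * (A0 * ((2 * ln (1 / eps) - c1) / (4 * pi)) - 2 * b * R / a)
    - (2 * (1 + et) * (A0 * pc.grad_const \<tau> \<rho>) + (1 + 1 / et) * (1 / a * (1 / (2 * pi * eps)))^2 / real n)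
    <= (1 + pc.hess R (T / real n)) * E
    + 8 * real n * (1 / a * ((2 * ln (1 / eps) + c2) / (4 * pi)))
    * (8 / (a * pi * eps^2) * exp (t^2 * (2 * real n) * (b * (pi * (C0 * eps)^2)) - t * T))"
    unfolding A0_def E_def c1_def c2_def
    by (rule pc.expected_match_lower_cells[OF n(1) eps'(3,4) R(1) \<tau>(1) d(2) eps'(5,6) et(1) T0]) (use t in auto)
   then show ?thesis unfolding x1 x2 x3 using x4 by linarith
  qed
  have co: "(A - e / 4) * ln (real n) <= A * (4 - 2 * (1 + et)^2) * (p * ln (real n))"
  proof -
   have "1 - 4 * et <= (4 - 2 * (1 + et)^2) * p"
   proof -
    have "et * et <= 1 / 2 * et" using et by (intro mult_right_mono) auto
    then have "(1 + et)^2 <= 1 + 3 * et" using et by (simp add: power2_eq_square algebra_simps)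
    then have "(4 - 2 * (1 + 3 * et)) * p <= (4 - 2 * (1 + et)^2) * p" unfolding p_def using et by (intro mult_right_mono) auto
    moreover have "(4 - 2 * (1 + 3 * et)) * p = 1 - 4 * et + 3 * (et * et)" unfolding p_def by (simp add: field_simps)
    ultimately show ?thesis using mult_nonneg_nonneg[of et et] et by linarith
   qed
   then have "A * (1 - 4 * et) <= A * ((4 - 2 * (1 + et)^2) * p)" using A by (intro mult_left_mono)
   then have "A - e / 4 <= A * (4 - 2 * (1 + et)^2) * p" using et(3) by (simp add: algebra_simps)
   then have "(A - e / 4) * ln (real n) <= A * (4 - 2 * (1 + et)^2) * p * ln (real n)" using n by (intro mult_right_mono) auto
   then show ?thesis by (simp only: mult.assoc)
  qed
  have low: "(A - e / 2) * ln (real n) <= (1 + hs n) * E"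
  proof -
   have "(A - e / 2) * ln (real n) = (A - e / 4) * ln (real n) - e / 4 * ln (real n)" by (simp add: algebra_simps)
   then show ?thesis using main co elim(1,3,4) by linarith
  qed
  have "(1 + hs n) * E <= (1 + k0 / 2) * E" using elim(2) E0 by (intro mult_right_mono) auto
  then have low2: "(A - e / 2) * ln (real n) <= (1 + k0 / 2) * E" using low by linarith
  have "(A - e) * ln (real n) <= E"
  proof (rule ccontr)
   assume "\<not> (A - e) * ln (real n) <= E"
   then have lt: "E < (A - e) * ln (real n)" by simp
   then have pos: "0 < (A - e) * ln (real n)" using E0 by linarith
   then have Ae: "0 < A - e" using n by (simp add: zero_less_mult_iff)
   have "(1 + k0 / 2) * E < (1 + k0 / 2) * ((A - e) * ln (real n))" using lt k0 by (intro mult_strict_left_mono) auto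
   also have "... = ((1 + k0 / 2) * (A - e)) * ln (real n)" by simp
   also have "... <= (A - e / 2) * ln (real n)"
   proof (intro mult_right_mono)
    have "k0 / 2 * (A - e) <= k0 / 2 * (A + 1 / 2)" using k0 e by (intro mult_left_mono) auto
    also have "k0 / 2 * (A + 1 / 2) = e / 4 * ((2 * A + 1) / (2 * A + 1))" unfolding k0_def by (simp add: field_simps)
    also have "... = e / 4" using A by simp
    finally show "(1 + k0 / 2) * (A - e) <= A - e / 2" using e by (simp add: distrib_right)
   qed (use n in simp)
   finally show False using low2 by simp
  qed
  then show ?case unfolding A_def A0_def E_def .
 qed
qed

end

section \<open>Matchings and bipartite tours\<close>

lemma match_cost_le_pair:
 assumes "\<sigma> permutes {1..n}" "\<tau> permutes {1..n}"
 shows "match_cost n x y <= (\<Sum>i\<in>{1..n}. (norm (x (\<sigma> i) - y (\<tau> i)))^2)"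
proof -
 have "match_cost n x y <= (\<Sum>i\<in>{1..n}. (norm (x i - y ((\<tau> \<circ> inv \<sigma>) i)))^2)"
  by (intro match_cost_le permutes_compose permutes_inv assms)
 also have "... = (\<Sum>i\<in>{1..n}. (norm (x (\<sigma> i) - y (\<tau> i)))^2)"
  using sum.permute[OF assms(1), of "%i. (norm (x i - y ((\<tau> \<circ> inv \<sigma>) i)))^2"] permutes_inverses[OF assms(1)]
  by (simp add: comp_def)
 finally show ?thesis .
qed

lemma cyclic_shift_permutes:
 fixes n :: nat
 assumes "1 <= n"
 shows "(%i. if i \<in> {1..n} then if i = n then 1 else i + 1 else i) permutes {1..n}"
proof (rule bij_imp_permutes)
 let ?s = "%i. if i \<in> {1..n} then if i = n then 1 else i + 1 else i"
 have inj: "inj_on ?s {1..n}" by (auto simp: inj_on_def split: if_splits)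
 moreover have "?s ` {1..n} \<subseteq> {1..n}" using assms by (auto split: if_splits)
 ultimately show "bij_betw ?s {1..n} {1..n}"
  unfolding bij_betw_def using endo_inj_surj[of "{1..n}" ?s] by blast
qed auto

lemma bipartite_tsp_image:
 "bipartite_tsp n x y = Min ((%p. bipartite_tour_cost n x y (fst p) (snd p)) ` ({\<sigma>. \<sigma> permutes {1..n}} \<times> {\<tau>. \<tau> permutes {1..n}}))"
 unfolding bipartite_tsp_def by (rule arg_cong[where f = Min]) force

lemma bipartite_tsp_ge:
 assumes n: "1 <= n"
 shows "2 * match_cost n x y <= bipartite_tsp n x y"
 unfolding bipartite_tsp_image
proof (rule Min.boundedI)
 show "finite ((%p. bipartite_tour_cost n x y (fst p) (snd p)) ` ({\<sigma>. \<sigma> permutes {1..n}} \<times> {\<tau>. \<tau> permutes {1..n}}))"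
  by (intro finite_imageI finite_cartesian_product finite_permutations) auto
 show "(%p. bipartite_tour_cost n x y (fst p) (snd p)) ` ({\<sigma>. \<sigma> permutes {1..n}} \<times> {\<tau>. \<tau> permutes {1..n}}) \<noteq> {}"
  using permutes_id by blast
 fix c assume "c \<in> (%p. bipartite_tour_cost n x y (fst p) (snd p)) ` ({\<sigma>. \<sigma> permutes {1..n}} \<times> {\<tau>. \<tau> permutes {1..n}})"
 then obtain \<sigma> \<tau> where st: "\<sigma> permutes {1..n}" "\<tau> permutes {1..n}" "c = bipartite_tour_cost n x y \<sigma> \<tau>" by auto
 \<comment> \<open>Composing \<open>\<sigma>\<close> with the cyclic shift turns the second legs of
   the tour into a sum of the same form as the first legs.\<close>
 define s where "s i = (if i \<in> {1..n} then if i = n then 1 else i + 1 else i)" for i :: nat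
 have s: "s permutes {1..n}" unfolding s_def[abs_def] by (rule cyclic_shift_permutes[OF n])
 have "match_cost n x y <= (\<Sum>i\<in>{1..n}. (norm (x ((\<sigma> \<circ> s) i) - y (\<tau> i)))^2)"
  by (intro match_cost_le_pair permutes_compose s st)
 also have "... = (\<Sum>i\<in>{1..n}. (norm (y (\<tau> i) - x (\<sigma> (if i = n then 1 else i + 1))))^2)"
  by (intro sum.cong refl) (auto simp: s_def norm_minus_commute)
 finally show "2 * match_cost n x y <= c"
  using match_cost_le_pair[OF st(1,2), of x y] unfolding st(3) bipartite_tour_cost_def sum.distrib by linarith
qed

lemma bipartite_tsp_le:
 assumes n: "1 <= n" and R: "0 < R" "\<And>i. i \<in> {1..n} ==> norm (x i) <= R" and et: "0 < et"
 shows "bipartite_tsp n x y <= (2 + et) * match_cost n x y + (1 + 1 / et) * (36 * R^2)"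
proof -
 obtain \<sigma> where \<sigma>: "\<sigma> permutes {1..n}"
  "(\<Sum>i\<in>{1..n}. (norm (x (\<sigma> i) - x (\<sigma> (if i = n then 1 else i + 1))))^2) <= 36 * R^2"
  using short_closed_tour[OF n R(1), of x] R(2) by blast
 obtain \<pi> where \<pi>: "\<pi> permutes {1..n}" "match_cost n x y = (\<Sum>i\<in>{1..n}. (norm (x i - y (\<pi> i)))^2)" using match_cost_attained .
 have m: "(\<Sum>i\<in>{1..n}. (norm (x (\<sigma> i) - y ((\<pi> \<circ> \<sigma>) i)))^2) = match_cost n x y"
  using sum.permute[OF \<sigma>(1), of "%i. (norm (x i - y (\<pi> i)))^2"] unfolding \<pi>(2) by (simp add: comp_def)
 \<comment> \<open>The second family of points is visited in the order of its partners. The leg to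
   the next first-family point is compared with a return to the current one followed by a step of
   the short tour.\<close>
 have "bipartite_tsp n x y <= bipartite_tour_cost n x y \<sigma> (\<pi> \<circ> \<sigma>)"
  unfolding bipartite_tsp_image
 proof (rule Min_le)
  show "bipartite_tour_cost n x y \<sigma> (\<pi> \<circ> \<sigma>) \<in> (%p. bipartite_tour_cost n x y (fst p) (snd p)) ` ({\<sigma>. \<sigma> permutes {1..n}} \<times> {\<tau>. \<tau> permutes {1..n}})"
   using \<sigma>(1) permutes_compose[OF \<sigma>(1) \<pi>(1)] by (intro image_eqI[of _ _ "(\<sigma>, \<pi> \<circ> \<sigma>)"]) auto
 qed (intro finite_imageI finite_cartesian_product finite_permutations, auto)
 also have "... = match_cost n x y + (\<Sum>i\<in>{1..n}. (norm (y ((\<pi> \<circ> \<sigma>) i) - x (\<sigma> (if i = n then 1 else i + 1))))^2)"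
  unfolding bipartite_tour_cost_def sum.distrib m ..
 also have "... <= match_cost n x y + (\<Sum>i\<in>{1..n}. (1 + et) * (norm (x (\<sigma> i) - y ((\<pi> \<circ> \<sigma>) i)))^2
   + (1 + 1 / et) * (norm (x (\<sigma> i) - x (\<sigma> (if i = n then 1 else i + 1))))^2)"
 proof (intro add_left_mono sum_mono)
  fix i
  define u where "u = norm (x (\<sigma> i) - y ((\<pi> \<circ> \<sigma>) i))"
  define v where "v = norm (x (\<sigma> i) - x (\<sigma> (if i = n then 1 else i + 1)))"
  have "norm (y ((\<pi> \<circ> \<sigma>) i) - x (\<sigma> (if i = n then 1 else i + 1))) <= u + v"
   unfolding u_def v_def norm_minus_commute[of "x (\<sigma> i)" "y ((\<pi> \<circ> \<sigma>) i)"]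
   using norm_triangle_ineq[of "y ((\<pi> \<circ> \<sigma>) i) - x (\<sigma> i)" "x (\<sigma> i) - x (\<sigma> (if i = n then 1 else i + 1))"] by simp
  then have "(norm (y ((\<pi> \<circ> \<sigma>) i) - x (\<sigma> (if i = n then 1 else i + 1))))^2 <= (u + v)^2" by (intro power_mono) auto
  also have "... <= (1 + et) * u^2 + (1 + 1 / et) * v^2" by (rule power2_sum_le_weighted[OF et])
  finally show "(norm (y ((\<pi> \<circ> \<sigma>) i) - x (\<sigma> (if i = n then 1 else i + 1))))^2 <= (1 + et) * (norm (x (\<sigma> i) - y ((\<pi> \<circ> \<sigma>) i)))^2
   + (1 + 1 / et) * (norm (x (\<sigma> i) - x (\<sigma> (if i = n then 1 else i + 1))))^2" unfolding u_def v_def .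
 qed
 also have "... = match_cost n x y + ((1 + et) * match_cost n x y
   + (1 + 1 / et) * (\<Sum>i\<in>{1..n}. (norm (x (\<sigma> i) - x (\<sigma> (if i = n then 1 else i + 1))))^2))"
  unfolding sum.distrib sum_distrib_left[symmetric] m ..
 also have "... <= match_cost n x y + ((1 + et) * match_cost n x y + (1 + 1 / et) * (36 * R^2))"
  using \<sigma>(2) et by (intro add_left_mono mult_left_mono) auto
 also have "... = (2 + et) * match_cost n x y + (1 + 1 / et) * (36 * R^2)" by (simp add: algebra_simps)
 finally show ?thesis .
qed

lemma bipartite_tsp_measurable:
 assumes n: "1 <= n" and x: "\<And>i. i \<in> {1..n} ==> (%om. x om i) \<in> borel_measurable N" "\<And>i. i \<in> {1..n} ==> (%om. y om i) \<in> borel_measurable N"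
 shows "(%om. bipartite_tsp n (x om) (y om)) \<in> borel_measurable N"
 unfolding bipartite_tsp_image
proof (rule borel_measurable_Min)
 fix p :: "(nat => nat) \<times> (nat => nat)" assume p: "p \<in> {\<sigma>. \<sigma> permutes {1..n}} \<times> {\<tau>. \<tau> permutes {1..n}}"
 then have st: "fst p permutes {1..n}" "snd p permutes {1..n}" by auto
 show "(%om. bipartite_tour_cost n (x om) (y om) (fst p) (snd p)) \<in> borel_measurable N"
  unfolding bipartite_tour_cost_def
 proof (rule borel_measurable_sum)
  fix i assume i: "i \<in> {1..n}"
  then have j: "(if i = n then 1 else i + 1) \<in> {1..n}" by auto
  note [measurable] = x(1)[OF permutes_in_image[OF st(1), THEN iffD2, OF i]] x(2)[OF permutes_in_image[OF st(2), THEN iffD2, OF i]]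
   x(1)[OF permutes_in_image[OF st(1), THEN iffD2, OF j]]
  show "(%om. (norm (x om (fst p i) - y om (snd p i)))^2 + (norm (y om (snd p i) - x om (fst p (if i = n then 1 else i + 1))))^2) \<in> borel_measurable N"
   by measurable
 qed
qed (intro finite_cartesian_product finite_permutations, auto)

lemma match_cost_cong:
 assumes "\<And>i. i \<in> {1..n} ==> x i = x' i" "\<And>i. i \<in> {1..n} ==> y i = y' i"
 shows "match_cost n x y = match_cost n x' y'"
 unfolding match_cost_def
proof (intro arg_cong[where f = Min] image_cong refl sum.cong)
 fix \<sigma> i assume "\<sigma> \<in> {\<sigma>. \<sigma> permutes {1..n}}" and i: "i \<in> {1..n}"
 then have "\<sigma> i \<in> {1..n}" using permutes_in_image[of \<sigma> "{1..n}" i] by simp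
 then show "(norm (x i - y (\<sigma> i)))^2 = (norm (x' i - y' (\<sigma> i)))^2" using assms i by simp
qed

lemma hoelder_uniform:
 fixes f :: "'a::metric_space => real"
 assumes "hoelder_continuous_on S f" "0 < e"
 shows "\<exists>d>0. \<forall>x\<in>S. \<forall>y\<in>S. dist x y < d --> \<bar>f x - f y\<bar> < e"
proof -
 obtain al C where ac: "0 < al" "0 <= C" "\<And>x y. x \<in> S ==> y \<in> S ==> dist (f x) (f y) <= C * dist x y powr al"
  using assms(1) unfolding hoelder_continuous_on_def by blast
 \<comment> \<open>The denominator \<open>C + 1\<close> is positive even for \<open>C = 0\<close>
   and makes the final inequality strict.\<close>
 define d where "d = (e / (C + 1)) powr (1 / al)"
 have d: "0 < d" unfolding d_def using assms ac by simp
 have "\<bar>f x - f y\<bar> < e" if "x \<in> S" "y \<in> S" "dist x y < d" for x y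
 proof -
  have "dist x y powr al <= d powr al" using that ac by (intro powr_mono2) auto
  also have "d powr al = e / (C + 1)" unfolding d_def using ac assms by (simp add: powr_powr)
  finally have "C * dist x y powr al <= C * (e / (C + 1))" using ac by (intro mult_left_mono)
  also have "... < e" using ac assms by (simp add: field_simps)
  finally show ?thesis using ac(3)[OF that(1,2)] by (simp add: dist_real_def)
 qed
 then show ?thesis using d by blast
qed

section \<open>Transfer to the given random variables\<close>

locale planar_sample = planar_density + prob_space M for M :: "'w measure" +
 fixes X Y :: "nat => 'w => real^2"
 assumes indep: "indep_vars (%_. borel) (case_sum X Y) ({1..} <+> {1..})"
  and lawX: "\<And>i. 1 <= i ==> distributed M lborel (X i) (%x. ennreal (r x))"
  and lawY: "\<And>i. 1 <= i ==> distributed M lborel (Y i) (%x. ennreal (r x))"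
begin

lemma distr_eq_D:
 assumes "distributed M lborel Z (%x. ennreal (r x))"
 shows "Z \<in> borel_measurable M" "distr M borel Z = D"
proof -
 show "Z \<in> borel_measurable M" using distributed_measurable[OF assms] by simp
 have "distr M borel Z = distr M lborel Z" by (rule distr_cong) auto
 then show "distr M borel Z = D" using distributed_distr_eq_density[OF assms] unfolding D_def by simp
qed

lemma law:
 assumes "k \<in> labels n"
 shows "case_sum X Y k \<in> borel_measurable M" "distr M borel (case_sum X Y k) = D"
proof -
 have "distributed M lborel (case_sum X Y k) (%x. ennreal (r x))"
  using assms lawX lawY unfolding labels_def by auto
 from distr_eq_D[OF this] show "case_sum X Y k \<in> borel_measurable M" "distr M borel (case_sum X Y k) = D" .
qed

lemma AE_in_domain: "AE om in M. \<forall>k\<in>labels n. case_sum X Y k om \<in> Om"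
proof (rule AE_finite_allI[OF finite_labels])
 fix k assume k: "k \<in> labels n"
 have "AE x in distr M borel (case_sum X Y k). x \<in> Om" unfolding law(2)[OF k] by (rule AE_D)
 then show "AE om in M. case_sum X Y k om \<in> Om" by (rule AE_distrD[OF law(1)[OF k]])
qed

text \<open>By independence the joint law of the \<open>2 * n\<close> points is the product measure
  on which the expected costs were estimated.\<close>

lemma expected_match_transfer:
 assumes n: "1 <= n"
 shows "expectation (%om. match_cost n (%i. X i om) (%i. Y i om))
  = (LINT om|PiM (labels n) (%_. D). match_cost n (%i. om (Inl i)) (%i. om (Inr i)))"
proof -
 let ?K = "labels n"
 define W where "W om = (\<lambda>k\<in>?K. case_sum X Y k om)" for om
 have ne: "?K \<noteq> {}" unfolding labels_def using n by (auto simp: Plus_def)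
 have inl: "Inl i \<in> ?K" "Inr i \<in> ?K" if "i \<in> {1..n}" for i using that unfolding labels_def by auto
 have "indep_vars (%_. borel) (case_sum X Y) ?K"
  by (rule indep_vars_subset[OF indep]) (auto simp: labels_def)
 then have "distr M (PiM ?K (%_. borel)) W = PiM ?K (%k. distr M borel (case_sum X Y k))"
  using indep_vars_iff_distr_eq_PiM'[OF ne, where M' = "%_. borel" and X = "case_sum X Y"] law(1) unfolding W_def by blast
 also have "... = PiM ?K (%_. D)" by (rule PiM_cong[OF refl law(2)])
 finally have d: "distr M (PiM ?K (%_. borel)) W = PiM ?K (%_. D)" .
 have Wm: "W \<in> measurable M (PiM ?K (%_. borel))" unfolding W_def[abs_def] by (intro measurable_restrict law(1))
 have hm: "(%om. match_cost n (%i. om (Inl i)) (%i. om (Inr i))) \<in> borel_measurable (PiM ?K (%_. borel))"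
  by (rule match_cost_measurable) (rule measurable_component_singleton, erule inl)+
 have "(LINT om|PiM ?K (%_. D). match_cost n (%i. om (Inl i)) (%i. om (Inr i)))
  = expectation (%om. match_cost n (%i. W om (Inl i)) (%i. W om (Inr i)))"
  unfolding d[symmetric] by (rule integral_distr[OF Wm hm])
 also have "... = expectation (%om. match_cost n (%i. X i om) (%i. Y i om))"
  unfolding W_def using inl by (intro Bochner_Integration.integral_cong refl match_cost_cong) auto
 finally show ?thesis by simp
qed

text \<open>The pathwise comparison of tour and matching is integrated; the upper comparison holds
  almost surely and also provides the integrability of the tour cost.\<close>

lemma expected_tsp_bounds:
 assumes n: "1 <= n" and R: "0 < R" "\<And>z. z \<in> Om ==> norm z <= R" and et: "0 < et"
 defines "m \<equiv> LINT om|PiM (labels n) (%_. D). match_cost n (%i. om (Inl i)) (%i. om (Inr i))"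
 shows "2 * m <= expectation (%om. bipartite_tsp n (%i. X i om) (%i. Y i om))"
  "expectation (%om. bipartite_tsp n (%i. X i om) (%i. Y i om)) <= (2 + et) * m + (1 + 1 / et) * (36 * R^2)"
proof -
 define mc where "mc om = match_cost n (%i. X i om) (%i. Y i om)" for om
 define ts where "ts om = bipartite_tsp n (%i. X i om) (%i. Y i om)" for om
 have inl: "Inl i \<in> labels n" "Inr i \<in> labels n" if "i \<in> {1..n}" for i using that unfolding labels_def by auto
 have Xm: "(%om. X i om) \<in> borel_measurable M" "(%om. Y i om) \<in> borel_measurable M" if "i \<in> {1..n}" for i
  using law(1)[OF inl(1)[OF that]] law(1)[OF inl(2)[OF that]] by simp_all
 have dom: "AE om in M. \<forall>i\<in>{1..n}. norm (X i om) <= R \<and> norm (Y i om) <= R"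
  using AE_in_domain[of n]
 proof eventually_elim
  case (elim om)
  show ?case
  proof
   fix i assume i: "i \<in> {1..n}"
   have "case_sum X Y (Inl i) om \<in> Om" "case_sum X Y (Inr i) om \<in> Om" using elim inl[OF i] by blast+
   then show "norm (X i om) <= R \<and> norm (Y i om) <= R" using R(2) by simp
  qed
 qed
 have mci: "integrable M mc"
 proof (rule integrable_const_bound)
  show "mc \<in> borel_measurable M" unfolding mc_def[abs_def] by (rule match_cost_measurable) (rule Xm, assumption)+
  show "AE om in M. norm (mc om) <= real n * (2 * R)^2"
   using dom
  proof eventually_elim
   case (elim om)
   then have "mc om <= real n * (2 * R)^2" unfolding mc_def by (intro match_cost_le_diameter) auto
   then show ?case using match_cost_nonneg[of n "%i. X i om" "%i. Y i om"] unfolding mc_def by simp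
  qed
 qed
 have up: "AE om in M. ts om <= (2 + et) * mc om + (1 + 1 / et) * (36 * R^2)"
  using dom
 proof eventually_elim
  case (elim om)
  then show ?case unfolding ts_def mc_def by (intro bipartite_tsp_le[OF n R(1) _ et]) auto
 qed
 have lo: "2 * mc om <= ts om" for om unfolding ts_def mc_def by (rule bipartite_tsp_ge[OF n])
 have Ui: "integrable M (%om. (2 + et) * mc om + (1 + 1 / et) * (36 * R^2))"
  using mci by (intro Bochner_Integration.integrable_add integrable_mult_right integrable_const)
 have tsi: "integrable M ts"
 proof (rule Bochner_Integration.integrable_bound[OF Ui])
  show "ts \<in> borel_measurable M" unfolding ts_def[abs_def] by (rule bipartite_tsp_measurable[OF n]) (rule Xm, assumption)+
  show "AE om in M. norm (ts om) <= norm ((2 + et) * mc om + (1 + 1 / et) * (36 * R^2))"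
   using up
  proof eventually_elim
   case (elim om)
   have "0 <= ts om" using lo[of om] match_cost_nonneg[of n "%i. X i om" "%i. Y i om"] unfolding mc_def by linarith
   then show ?case using elim by simp
  qed
 qed
 have m: "expectation mc = m" unfolding m_def mc_def by (rule expected_match_transfer[OF n])
 have "expectation (%om. 2 * mc om) <= expectation ts"
  using mci tsi lo by (intro integral_mono) auto
 then show "2 * m <= expectation (%om. bipartite_tsp n (%i. X i om) (%i. Y i om))"
  unfolding m[symmetric] ts_def[symmetric] by simp
 have "expectation ts <= expectation (%om. (2 + et) * mc om + (1 + 1 / et) * (36 * R^2))"
  using tsi Ui up by (rule integral_mono_AE)
 also have "... = (2 + et) * expectation mc + (1 + 1 / et) * (36 * R^2)"
  using mci prob_space by (subst Bochner_Integration.integral_add) auto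
 finally show "expectation (%om. bipartite_tsp n (%i. X i om) (%i. Y i om)) <= (2 + et) * m + (1 + 1 / et) * (36 * R^2)"
  unfolding m ts_def .
qed

lemma tsp_limit:
 "(%n. 1 / ln (real n) * expectation (%om. bipartite_tsp n (%i. X i om) (%i. Y i om))) \<longlonglongrightarrow> measure lborel Om / pi"
proof (rule tendstoI)
 fix e :: real assume e: "0 < e"
 define A where "A = measure lborel Om / (2 * pi)"
 have A: "0 <= A" "measure lborel Om / pi = 2 * A" unfolding A_def by auto
 obtain R1 where R1: "\<And>z. z \<in> Om ==> norm z <= R1" using bd bounded_iff by blast
 define R where "R = max R1 1"
 have R: "0 < R" "\<And>z. z \<in> Om ==> norm z <= R" unfolding R_def using R1 by (auto simp: le_max_iff_disj)
 \<comment> \<open>This gives \<open>et * (A + e / 8) = e / 4\<close>. With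
   \<open>2 * (e / 8)\<close> from the matching and \<open>e / 4\<close> for the constant
   \<open>C\<close>, the total error is \<open>3 / 4 * e\<close>.\<close>
 define et where "et = e / 4 / (A + e / 8)"
 have s0: "0 < A + e / 8" using A e by simp
 have "x / S * S = x" if "0 < S" for x S :: real using that by simp
 from this[OF s0, of "e / 4"] have et: "0 < et" "et * (A + e / 8) = e / 4" unfolding et_def using s0 e by auto
 define C where "C = (1 + 1 / et) * (36 * R^2)"
 have e8: "0 < e / 8" using e by simp
 have evln: "\<forall>\<^sub>F n in sequentially. C <= e / 4 * ln (real n)"
 proof -
  have "filterlim (%n. e / 4 * ln (real n)) at_top sequentially" using e by real_asymp
  then show ?thesis unfolding filterlim_at_top by blast
 qed
 show "\<forall>\<^sub>F n in sequentially. dist (1 / ln (real n) * expectation (%om. bipartite_tsp n (%i. X i om) (%i. Y i om))) (measure lborel Om / pi) < e"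
  using expected_match_upper[OF e8] expected_match_lower[OF e8] evln eventually_gt_at_top[of 1]
 proof eventually_elim
  case (elim n)
  define m where "m = (LINT om|PiM (labels n) (%_. D). match_cost n (%i. om (Inl i)) (%i. om (Inr i)))"
  define T where "T = expectation (%om. bipartite_tsp n (%i. X i om) (%i. Y i om))"
  define L where "L = ln (real n)"
  have n: "1 <= n" and L: "0 < L" unfolding L_def using elim(4) by auto
  have T: "2 * m <= T" "T <= (2 + et) * m + C"
   unfolding m_def T_def C_def
   by (rule expected_tsp_bounds(1)[OF n R et(1)], assumption, rule expected_tsp_bounds(2)[OF n R et(1)], assumption)
  have ml: "m <= (A + e / 8) * L" "(A - e / 8) * L <= m" using elim(1,2) unfolding m_def A_def L_def by auto
  have "T <= (2 + et) * ((A + e / 8) * L) + e / 4 * L"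
   using T(2) elim(3) mult_left_mono[OF ml(1), of "2 + et"] et(1) unfolding L_def by linarith
  also have "... = (2 * A + 2 * (e / 8) + et * (A + e / 8) + e / 4) * L"
  proof -
   have "(2 + et) * ((A + x) * L) + y * L = (2 * A + 2 * x + et * (A + x) + y) * L" for x y by (simp add: algebra_simps)
   then show ?thesis .
  qed
  also have "... = (2 * A + 3 / 4 * e) * L" unfolding et(2) by simp
  finally have "T / L <= 2 * A + 3 / 4 * e" using L by (simp add: pos_divide_le_eq)
  moreover have "(2 * A - e / 4) * L <= T" using T(1) ml(2) by (simp add: algebra_simps)
  then have "2 * A - e / 4 <= T / L" using L by (simp add: pos_le_divide_eq)
  ultimately have "\<bar>T / L - 2 * A\<bar> < e" using e by (simp add: abs_less_iff)
  then show ?case unfolding A(2) dist_real_def T_def L_def by simp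
 qed
qed

end

theorem corollary1p4:
  fixes \<Omega> :: "(real^2) set" and \<rho> :: "real^2 \<Rightarrow> real"
    and M :: "'w measure" and X Y :: "nat \<Rightarrow> 'w \<Rightarrow> real^2"
  assumes "bounded \<Omega>" and "connected \<Omega>" and "open \<Omega>" and "lipschitz_boundary \<Omega>"
    and "probability_density_on \<Omega> \<rho>" and "hoelder_continuous_on \<Omega> \<rho>"
    and "\<exists>a>0. \<forall>x\<in>\<Omega>. a \<le> \<rho> x" and "\<exists>b. \<forall>x\<in>\<Omega>. \<rho> x \<le> b"
    and "prob_space M"
    and "prob_space.indep_vars M (\<lambda>_. borel) (case_sum X Y) ({1..} <+> {1..})"
    and "\<And>i. i \<ge> 1 \<Longrightarrow> has_law_on M (X i) \<Omega> \<rho>"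
    and "\<And>i. i \<ge> 1 \<Longrightarrow> has_law_on M (Y i) \<Omega> \<rho>"
  shows "(\<lambda>n. 1 / ln (real n) *
            prob_space.expectation M (\<lambda>\<omega>. bipartite_tsp n (\<lambda>i. X i \<omega>) (\<lambda>i. Y i \<omega>)))
          \<longlonglongrightarrow> measure lebesgue \<Omega> / pi"
proof -
 obtain a b where a: "0 < a" "\<And>x. x \<in> \<Omega> ==> a <= \<rho> x" and b: "\<And>x. x \<in> \<Omega> ==> \<rho> x <= b" using assms(7,8) by blast
 define r where "r x = indicator \<Omega> x * \<rho> x" for x
 have pd: "integrable lborel r" "(LINT x|lborel. r x) = 1"
  using assms(5) unfolding probability_density_on_def set_integrable_def set_lebesgue_integral_def r_def by auto
 interpret prob_space M by fact
 \<comment> \<open>The absolute value makes the bound valid also outside the domain, where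
   \<open>r\<close> is 0.\<close>
 interpret planar_sample \<Omega> r a "\<bar>b\<bar>" M X Y
 proof unfold_locales
  show "r \<in> borel_measurable borel" using borel_measurable_integrable[OF pd(1)] by simp
  show "r x <= \<bar>b\<bar>" for x using b[of x] unfolding r_def by (auto simp: indicator_def)
  show "\<exists>d>0. \<forall>x\<in>\<Omega>. \<forall>y\<in>\<Omega>. dist x y < d --> \<bar>r x - r y\<bar> < e" if "0 < e" for e
   using hoelder_uniform[OF assms(6) that] unfolding r_def by simp
  show "distributed M lborel (X i) (%x. ennreal (r x))" "distributed M lborel (Y i) (%x. ennreal (r x))" if "1 <= i" for i
   using assms(11,12)[OF that] unfolding has_law_on_def r_def by auto
  show "indep_vars (%_. borel) (case_sum X Y) ({1..} <+> {1..})" by fact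
 qed (use assms(1-4) a pd in \<open>auto simp: r_def\<close>)
 \<comment> \<open>An open set is Borel, and the completion does not change the measure of a Borel
   set.\<close>
 have "measure lebesgue \<Omega> = measure lborel \<Omega>" by (rule measure_completion) simp
 then show ?thesis using tsp_limit by simp
qed

end
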